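(* Let $(X_t)_{t\in\Delta_{[\gamma]}}$ be the local universal family of essential deformations of the Iwasawa manifold $X=X_0$. There exist canonical isomorphisms $$H^3_{DR}(X,\mathbb C)\simeq H^{3,0}_{\bar\partial}(X_t,\mathbb C)\oplus H^{2,1}_{[\gamma]}(X_t,\mathbb C)\oplus H^{1,2}_{[\gamma]}(X_t,\mathbb C)\oplus H^{0,3}_{\bar\partial}(X_t,\mathbb C),\qquad t\in\Delta_{[\gamma]},$$ and $$H^{3,0}_{\bar\partial}(X_t,\mathbb C)\simeq\overline{H^{0,3}_{\bar\partial}(X_t,\mathbb C)},\qquad H^{2,1}_{[\gamma]}(X_t,\mathbb C)\simeq\overline{H^{1,2}_{[\gamma]}(X_t,\mathbb C)},\qquad t\in\Delta_{[\gamma]}.$$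
   Context: Iwasawa manifold: $X=X_0=G/\Gamma$, $G$ the Heisenberg group of upper unitriangular complex $3\times3$ matrices $\begin{pmatrix}1&z_1&z_3\\0&1&z_2\\0&0&1\end{pmatrix}$, $\Gamma\subset G$ the subgroup with entries in $\mathbb Z[i]$. $\alpha,\beta,\gamma$ are the holomorphic $1$-forms on $X$ induced by $dz_1,dz_2,dz_3-z_1dz_2$; $d\alpha=d\beta=0$, $d\gamma=-\alpha\wedge\beta$. $\xi_\alpha,\xi_\beta,\xi_\gamma$ is the dual frame of holomorphic vector fields. Deformations: $H^{0,1}(X,T^{1,0}X)$ has basis $\bar\alpha_\lambda\otimes\xi_i$ ($\alpha_1=\alpha,\alpha_2=\beta$, $\xi_1=\xi_\alpha,\xi_2=\xi_\beta,\xi_3=\xi_\gamma$; $\lambda=1,2$, $i=1,2,3$), with coordinates $t_{i\lambda}$. The Kuranishi family $(X_t)_{t\in\Delta}$ of $X$ is unobstructed and $\Delta$ is a small open ball about $0$ in this space. All $X_t$ have the same underlying $C^\infty$ manifold $X$; with $D(t)=t_{11}t_{22}-t_{12}t_{21}$, the complex structure of $X_t$ has the $(1,0)$-coframe $\alpha_t=\alpha+t_{11}\bar\alpha+t_{12}\bar\beta$, $\beta_t=\beta+t_{21}\bar\alpha+t_{22}\bar\beta$, $\gamma_t=\gamma+t_{31}\bar\alpha+t_{32}\bar\beta-D(t)\bar\gamma$. $\Delta_{[\gamma]}:=\{t\in\Delta: t_{31}=t_{32}=0\}$. $H^{2,1}_{[\gamma]}(X_t,\mathbb C)$, $t\in\Delta_{[\gamma]}$: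 write $\bar\partial_t\gamma_t=\sigma_{1\bar1}\alpha_t\wedge\bar\alpha_t+\sigma_{1\bar2}\alpha_t\wedge\bar\beta_t+\sigma_{2\bar1}\beta_t\wedge\bar\alpha_t+\sigma_{2\bar2}\beta_t\wedge\bar\beta_t$ and $\partial_t\gamma_t=\sigma_{12}\alpha_t\wedge\beta_t$, the $\sigma$'s being constants depending smoothly on $t$, $\sigma_{12}(0)=-1$, $\sigma_{i\bar j}(0)=0$. Put $\Gamma_1(t)=\alpha_t\wedge\gamma_t\wedge\bar\alpha_t-\frac{\sigma_{2\bar2}}{\bar\sigma_{12}}\alpha_t\wedge\beta_t\wedge\bar\gamma_t$, $\Gamma_2(t)=\alpha_t\wedge\gamma_t\wedge\bar\beta_t+\frac{\sigma_{2\bar1}}{\bar\sigma_{12}}\alpha_t\wedge\beta_t\wedge\bar\gamma_t$, $\Gamma_3(t)=\beta_t\wedge\gamma_t\wedge\bar\alpha_t+\frac{\sigma_{1\bar2}}{\bar\sigma_{12}}\alpha_t\wedge\beta_t\wedge\bar\gamma_t$, $\Gamma_4(t)=\beta_t\wedge\gamma_t\wedge\bar\beta_t-\frac{\sigma_{1\bar1}}{\bar\sigma_{12}}\alpha_t\wedge\beta_t\wedge\bar\gamma_t$. Then $H^{2,1}_{[\gamma]}(X_t,\mathbb C):=\langle[\Gamma_1(t)]_{\bar\partial},\dots,[\Gamma_4(t)]_{\bar\partial}\rangle\subset H^{2,1}_{\bar\partial}(X_t,\mathbb C)$ and $H^{1,2}_{[\gamma]}(X_t,\mathbb C):=\langle[\star_t\overline{\Gamma_1(t)}]_{\bar\partial},\dots,[\star_t\overline{\Gamma_4(t)}]_{\bar\partial}\rangle\subset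 H^{1,2}_{\bar\partial}(X_t,\mathbb C)$, where $\star_t$ is the Hodge star operator ($u\wedge\star\bar v=\langle u,v\rangle dV$) of the Hermitian metric $\omega_t=i\alpha_t\wedge\bar\alpha_t+i\beta_t\wedge\bar\beta_t+i\gamma_t\wedge\bar\gamma_t$ on $X_t$. An isomorphism is called canonical if it is defined, without arbitrary choices, by the forms $\alpha,\beta,\gamma$ (respectively $\alpha_t,\beta_t,\gamma_t$). *)

theory Defs
  imports "HOL-Analysis.Analysis" "HOL-Algebra.Module" "HOL-Library.Function_Algebras"
begin

section \<open>Complex vector spaces with explicit carriers\<close>

text \<open>
  The cohomology spaces are quotients, hence complex vector spaces with a carrier: modules in
  the sense of HOL-Algebra over the field of complex numbers.  The record fields \<open>mult\<close> and \<open>one\<close>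
  of a module play no role.
\<close>

definition complex_field :: "complex ring" where
  "complex_field = \<lparr>carrier = UNIV, mult = (*), one = 1, zero = 0, add = (+)\<rparr>"

definition linear_iso ::
  "(complex, 'a) module \<Rightarrow> (complex, 'b) module \<Rightarrow> ('a \<Rightarrow> 'b) \<Rightarrow> bool" where
  "linear_iso V W f \<longleftrightarrow>
     Module.module complex_field V \<and> Module.module complex_field W \<and>
     bij_betw f (carrier V) (carrier W) \<and>
     (\<forall>x\<in>carrier V. \<forall>y\<in>carrier V. f (x \<oplus>\<^bsub>V\<^esub> y) = f x \<oplus>\<^bsub>W\<^esub> f y) \<and>
     (\<forall>c. \<forall>x\<in>carrier V. f (c \<odot>\<^bsub>V\<^esub> x) = c \<odot>\<^bsub>W\<^esub> f x)"

definition direct_sum ::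
  "(complex, 'a) module \<Rightarrow> (complex, 'b) module \<Rightarrow> (complex, 'a \<times> 'b) module"
  (infixr \<open>\<boxplus>\<close> 65) where
  "V \<boxplus> W = \<lparr>carrier = carrier V \<times> carrier W, mult = undefined, one = undefined,
             zero = (\<zero>\<^bsub>V\<^esub>, \<zero>\<^bsub>W\<^esub>),
             add = (\<lambda>(a, b) (a', b'). (a \<oplus>\<^bsub>V\<^esub> a', b \<oplus>\<^bsub>W\<^esub> b')),
             smult = (\<lambda>c (a, b). (c \<odot>\<^bsub>V\<^esub> a, c \<odot>\<^bsub>W\<^esub> b))\<rparr>"

text \<open>The complex conjugate vector space: same additive group, \<open>c\<close> acts as \<open>cnj c\<close>.\<close>

definition conj_space :: "(complex, 'a) module \<Rightarrow> (complex, 'a) module" where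
  "conj_space V = V\<lparr>smult := (\<lambda>c v. cnj c \<odot>\<^bsub>V\<^esub> v)\<rparr>"

definition lin_span :: "(complex, 'a) module \<Rightarrow> 'a set \<Rightarrow> 'a set" where
  "lin_span V S = \<Inter> {H. submodule H complex_field V \<and> S \<subseteq> H}"


section \<open>The exterior algebra\<close>

text \<open>
  \<open>ext\<close> is the complexified exterior algebra of the cotangent space of \<open>\<complex>\<^sup>3\<close>.  Its six generators,
  indexed by the type \<open>6\<close> in the order \<open>0 < 1 < \<dots> < 5\<close>, are
  \<open>dz\<^sub>1, dz\<^sub>2, dz\<^sub>3, d\<bar>z\<^sub>1, d\<bar>z\<^sub>2, d\<bar>z\<^sub>3\<close>.  The component of an element at \<open>I\<close>
  is its coefficient at the increasing monomial in the generators from \<open>I\<close>.  Arithmetic in the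
  type \<open>6\<close> is modulo 6, so adding 3 exchanges conjugate generators.
\<close>

type_synonym ext = "complex ^ (6 set)"

definition hol :: "6 set" where "hol = {0, 1, 2}"
definition antihol :: "6 set" where "antihol = {3, 4, 5}"

definition gen :: "6 \<Rightarrow> ext" where "gen i = axis {i} 1"

definition shuffle_sign :: "6 set \<Rightarrow> 6 set \<Rightarrow> complex" where
  "shuffle_sign I J = (-1) ^ card {(i, j). i \<in> I \<and> j \<in> J \<and> j < i}"

definition wedge :: "ext \<Rightarrow> ext \<Rightarrow> ext" where
  "wedge a b = (\<chi> K. \<Sum>I\<in>Pow K. shuffle_sign I (K - I) * a $ I * b $ (K - I))"

text \<open>The product of the \<open>\<theta> i\<close>, \<open>i \<in> I\<close>, in increasing order of \<open>i\<close>.\<close>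

definition monomial :: "(6 \<Rightarrow> ext) \<Rightarrow> 6 set \<Rightarrow> ext" where
  "monomial \<theta> I = foldr wedge (map \<theta> (sorted_list_of_set I)) (axis {} 1)"

definition cnj_ext :: "ext \<Rightarrow> ext" where
  "cnj_ext u = (\<Sum>I\<in>UNIV. cnj (u $ I) *s monomial (\<lambda>i. gen (i + 3)) I)"

definition has_degree :: "nat \<Rightarrow> ext \<Rightarrow> bool" where
  "has_degree k u \<longleftrightarrow> (\<forall>I. u $ I \<noteq> 0 \<longrightarrow> card I = k)"


section \<open>Differential forms on \<open>\<complex>\<^sup>3\<close>\<close>

type_synonym form = "complex ^ 3 \<Rightarrow> ext"

primrec Ck :: "nat \<Rightarrow> ('a::real_normed_vector \<Rightarrow> 'b::real_normed_vector) \<Rightarrow> bool" where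
  "Ck 0 f \<longleftrightarrow> continuous_on UNIV f"
| "Ck (Suc n) f \<longleftrightarrow>
     f differentiable_on UNIV \<and> (\<forall>v. Ck n (\<lambda>x. frechet_derivative f (at x) v))"

definition smooth :: "('a::real_normed_vector \<Rightarrow> 'b::real_normed_vector) \<Rightarrow> bool" where
  "smooth f \<longleftrightarrow> (\<forall>n. Ck n f)"

definition fscale :: "complex \<Rightarrow> form \<Rightarrow> form" (infixr \<open>\<cdot>\<close> 75) where
  "c \<cdot> u = (\<lambda>x. c *s u x)"

definition fwedge :: "form \<Rightarrow> form \<Rightarrow> form" (infixr \<open>\<and>\<^sub>f\<close> 80) where
  "u \<and>\<^sub>f v = (\<lambda>x. wedge (u x) (v x))"

definition fcnj :: "form \<Rightarrow> form" where
  "fcnj u = (\<lambda>x. cnj_ext (u x))"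

definition form_space :: "(complex, form) module" where
  "form_space = \<lparr>carrier = UNIV, mult = undefined, one = undefined, zero = 0, add = (+),
                 smult = fscale\<rparr>"

definition coord_index :: "6 \<Rightarrow> 3" where
  "coord_index i = (if i \<in> {0, 3} then 1 else if i \<in> {1, 4} then 2 else 3)"

definition coord :: "6 \<Rightarrow> complex ^ 3 \<Rightarrow> complex" where
  "coord i z = (if i \<in> hol then z $ coord_index i else cnj (z $ coord_index i))"

text \<open>The Wirtinger derivatives \<open>\<partial>/\<partial>z\<^sub>j\<close> (for \<open>i \<in> hol\<close>) and \<open>\<partial>/\<partial>\<bar>z\<^sub>j\<close>.\<close>

definition wirtinger :: "6 \<Rightarrow> form \<Rightarrow> form" where
  "wirtinger i u x =
     (let j = coord_index i;
          ux = frechet_derivative u (at x) (axis j 1);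
          uy = frechet_derivative u (at x) (axis j \<i>)
      in (1/2) *s (if i \<in> hol then ux - \<i> *s uy else ux + \<i> *s uy))"

definition ext_d :: "form \<Rightarrow> form" where
  "ext_d u x = (\<Sum>i\<in>UNIV. wedge (gen i) (wirtinger i u x))"

definition pullback :: "(complex ^ 3 \<Rightarrow> complex ^ 3) \<Rightarrow> form \<Rightarrow> form" where
  "pullback F u x =
     (\<Sum>I\<in>UNIV. u (F x) $ I *s monomial (\<lambda>i. ext_d (\<lambda>y. axis {} (coord i (F y))) x) I)"


section \<open>The Iwasawa manifold\<close>

text \<open>
  The Heisenberg group is \<open>\<complex>\<^sup>3\<close> through the coordinates \<open>z\<^sub>1, z\<^sub>2, z\<^sub>3\<close>.  The forms
  \<open>dz\<^sub>1, dz\<^sub>2, dz\<^sub>3 - z\<^sub>1 dz\<^sub>2\<close> are left invariant, so the lattice acts by left translations.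
  This action is free and properly discontinuous, and the smooth forms on the quotient are
  identified, through the covering map, with the smooth forms on \<open>\<complex>\<^sup>3\<close> invariant under the lattice.
\<close>

definition heis_matrix :: "complex ^ 3 \<Rightarrow> complex ^ 3 ^ 3" where
  "heis_matrix z = vector [vector [1, z $ 1, z $ 3], vector [0, 1, z $ 2], vector [0, 0, 1]]"

definition heis_mult :: "complex ^ 3 \<Rightarrow> complex ^ 3 \<Rightarrow> complex ^ 3" where
  "heis_mult g z = vector [g $ 1 + z $ 1, g $ 2 + z $ 2, g $ 3 + z $ 3 + g $ 1 * z $ 2]"

lemma heis_matrix_mult: "heis_matrix (heis_mult g z) = heis_matrix g ** heis_matrix z"
  by (simp add: vec_eq_iff forall_3 heis_matrix_def heis_mult_def matrix_matrix_mult_def sum_3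
      algebra_simps)

definition lattice :: "(complex ^ 3) set" where
  "lattice = {g. \<forall>i. Re (g $ i) \<in> \<int> \<and> Im (g $ i) \<in> \<int>}"

definition forms_X :: "form set" where
  "forms_X = {u. smooth u \<and> (\<forall>g\<in>lattice. pullback (heis_mult g) u = u)}"

definition kforms :: "nat \<Rightarrow> form set" where
  "kforms k = {u \<in> forms_X. \<forall>x. has_degree k (u x)}"


section \<open>Cohomology spaces\<close>

definition cohom_class :: "form set \<Rightarrow> form \<Rightarrow> form set" where
  "cohom_class B u = {u + b | b. b \<in> B}"

definition quotient_space :: "form set \<Rightarrow> form set \<Rightarrow> (complex, form set) module" where
  "quotient_space Z B =
     \<lparr>carrier = cohom_class B ` Z, mult = undefined, one = undefined, zero = B,
      add = (\<lambda>A A'. {a + a' | a a'. a \<in> A \<and> a' \<in> A'}),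
      smult = (\<lambda>c A. {c \<cdot> a + b | a b. a \<in> A \<and> b \<in> B})\<rparr>"

definition dR_boundaries :: "nat \<Rightarrow> form set" where
  "dR_boundaries k = (if k = 0 then {0} else ext_d ` kforms (k - 1))"

definition H_dR :: "nat \<Rightarrow> (complex, form set) module" where
  "H_dR k = quotient_space {u \<in> kforms k. ext_d u = 0} (dR_boundaries k)"

definition dR_class :: "nat \<Rightarrow> form \<Rightarrow> form set" where
  "dR_class k = cohom_class (dR_boundaries k)"


section \<open>The complex structures \<open>X\<^sub>t\<close>\<close>

text \<open>The parameter \<open>t\<^sub>i\<^sub>\<lambda>\<close> is \<open>t $ i $ \<lambda>\<close>.\<close>

type_synonym param = "complex ^ 2 ^ 3"

definition alpha :: form where "alpha = (\<lambda>x. gen 0)"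
definition beta :: form where "beta = (\<lambda>x. gen 1)"
definition gamma :: form where "gamma = (\<lambda>x. gen 2 - x $ 1 *s gen 1)"

definition D_param :: "param \<Rightarrow> complex" where
  "D_param t = t $ 1 $ 1 * t $ 2 $ 2 - t $ 1 $ 2 * t $ 2 $ 1"

definition alpha_t :: "param \<Rightarrow> form" where
  "alpha_t t = alpha + t $ 1 $ 1 \<cdot> fcnj alpha + t $ 1 $ 2 \<cdot> fcnj beta"
definition beta_t :: "param \<Rightarrow> form" where
  "beta_t t = beta + t $ 2 $ 1 \<cdot> fcnj alpha + t $ 2 $ 2 \<cdot> fcnj beta"
definition gamma_t :: "param \<Rightarrow> form" where
  "gamma_t t = gamma + t $ 3 $ 1 \<cdot> fcnj alpha + t $ 3 $ 2 \<cdot> fcnj beta - D_param t \<cdot> fcnj gamma"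

definition Delta_gamma :: "real \<Rightarrow> param set" where
  "Delta_gamma \<epsilon> = {t \<in> ball 0 \<epsilon>. t $ 3 $ 1 = 0 \<and> t $ 3 $ 2 = 0}"

text \<open>The frame \<open>\<alpha>\<^sub>t, \<beta>\<^sub>t, \<gamma>\<^sub>t, \<bar>\<alpha>\<^sub>t, \<bar>\<beta>\<^sub>t, \<bar>\<gamma>\<^sub>t\<close>, in this order.\<close>

definition coframe :: "param \<Rightarrow> 6 \<Rightarrow> form" where
  "coframe t i =
     (if i = 0 then alpha_t t else if i = 1 then beta_t t else if i = 2 then gamma_t t
      else if i = 3 then fcnj (alpha_t t) else if i = 4 then fcnj (beta_t t)
      else fcnj (gamma_t t))"

definition coframe_monomial :: "param \<Rightarrow> 6 set \<Rightarrow> form" where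
  "coframe_monomial t I x = monomial (\<lambda>i. coframe t i x) I"

text \<open>For \<open>t\<close> near 0 the 64 monomials in the coframe form a basis at each point.\<close>

definition coframe_coeffs :: "param \<Rightarrow> complex ^ 3 \<Rightarrow> ext \<Rightarrow> complex ^ (6 set)" where
  "coframe_coeffs t x u = (THE c. u = (\<Sum>I\<in>UNIV. c $ I *s coframe_monomial t I x))"

definition bidegree :: "nat \<Rightarrow> nat \<Rightarrow> 6 set set" where
  "bidegree p q = {I. card (I \<inter> hol) = p \<and> card (I \<inter> antihol) = q}"

definition pq_part :: "param \<Rightarrow> nat \<Rightarrow> nat \<Rightarrow> form \<Rightarrow> form" where
  "pq_part t p q u x =
     (\<Sum>I\<in>bidegree p q. coframe_coeffs t x (u x) $ I *s coframe_monomial t I x)"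

definition pq_forms :: "param \<Rightarrow> nat \<Rightarrow> nat \<Rightarrow> form set" where
  "pq_forms t p q =
     {u \<in> forms_X. \<forall>x. u x \<in> vec.span ((\<lambda>I. coframe_monomial t I x) ` bidegree p q)}"

text \<open>The operators \<open>\<partial>\<^sub>t\<close> and \<open>\<bar>\<partial>\<^sub>t\<close> on forms of type \<open>(p, q)\<close>.\<close>

definition del :: "param \<Rightarrow> nat \<Rightarrow> nat \<Rightarrow> form \<Rightarrow> form" where
  "del t p q u = pq_part t (p + 1) q (ext_d u)"

definition delbar :: "param \<Rightarrow> nat \<Rightarrow> nat \<Rightarrow> form \<Rightarrow> form" where
  "delbar t p q u = pq_part t p (q + 1) (ext_d u)"

definition delbar_boundaries :: "param \<Rightarrow> nat \<Rightarrow> nat \<Rightarrow> form set" where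
  "delbar_boundaries t p q = (if q = 0 then {0} else delbar t p (q - 1) ` pq_forms t p (q - 1))"

definition H_Dolb :: "param \<Rightarrow> nat \<Rightarrow> nat \<Rightarrow> (complex, form set) module" where
  "H_Dolb t p q =
     quotient_space {u \<in> pq_forms t p q. delbar t p q u = 0} (delbar_boundaries t p q)"

definition Dolb_class :: "param \<Rightarrow> nat \<Rightarrow> nat \<Rightarrow> form \<Rightarrow> form set" where
  "Dolb_class t p q = cohom_class (delbar_boundaries t p q)"


section \<open>The Hodge star operator of \<open>\<omega>\<^sub>t\<close>\<close>

definition omega :: "param \<Rightarrow> form" where
  "omega t = \<i> \<cdot> alpha_t t \<and>\<^sub>f fcnj (alpha_t t) + \<i> \<cdot> beta_t t \<and>\<^sub>f fcnj (beta_t t)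
             + \<i> \<cdot> gamma_t t \<and>\<^sub>f fcnj (gamma_t t)"

definition volume :: "param \<Rightarrow> form" where
  "volume t = (1/6) \<cdot> omega t \<and>\<^sub>f omega t \<and>\<^sub>f omega t"

text \<open>The Hermitian metric induced by \<open>\<omega>\<^sub>t\<close> on forms: the coframe monomials are orthonormal.\<close>

definition herm :: "param \<Rightarrow> complex ^ 3 \<Rightarrow> ext \<Rightarrow> ext \<Rightarrow> complex" where
  "herm t x u v = (\<Sum>I\<in>UNIV. coframe_coeffs t x u $ I * cnj (coframe_coeffs t x v $ I))"

text \<open>The star operator on \<open>k\<close>-forms, \<open>u \<and> \<star>\<bar>v = \<langle>u, v\<rangle> dV\<close>, with \<open>w = \<bar>v\<close>.\<close>

definition hodge_star :: "param \<Rightarrow> nat \<Rightarrow> form \<Rightarrow> form" where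
  "hodge_star t k w x =
     (THE s. has_degree (6 - k) s \<and>
        (\<forall>u. has_degree k u \<longrightarrow> wedge u s = herm t x u (cnj_ext (w x)) *s volume t x))"


section \<open>The spaces \<open>H\<^sup>2\<^sup>,\<^sup>1\<close> and \<open>H\<^sup>1\<^sup>,\<^sup>2\<close> attached to \<open>\<gamma>\<close>\<close>

definition sigma12 :: "param \<Rightarrow> complex" where
  "sigma12 t = (THE s. del t 1 0 (gamma_t t) = s \<cdot> alpha_t t \<and>\<^sub>f beta_t t)"

text \<open>\<open>sigma_bar t $ i $ j\<close> is the coefficient with indices \<open>i\<close> and \<open>\<bar>j\<close>.\<close>

definition sigma_bar :: "param \<Rightarrow> complex ^ 2 ^ 2" where
  "sigma_bar t = (THE s. delbar t 1 0 (gamma_t t) =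
       s $ 1 $ 1 \<cdot> alpha_t t \<and>\<^sub>f fcnj (alpha_t t) + s $ 1 $ 2 \<cdot> alpha_t t \<and>\<^sub>f fcnj (beta_t t)
     + s $ 2 $ 1 \<cdot> beta_t t \<and>\<^sub>f fcnj (alpha_t t) + s $ 2 $ 2 \<cdot> beta_t t \<and>\<^sub>f fcnj (beta_t t))"

definition Gamma1 :: "param \<Rightarrow> form" where
  "Gamma1 t = alpha_t t \<and>\<^sub>f gamma_t t \<and>\<^sub>f fcnj (alpha_t t)
     - (sigma_bar t $ 2 $ 2 / cnj (sigma12 t)) \<cdot> alpha_t t \<and>\<^sub>f beta_t t \<and>\<^sub>f fcnj (gamma_t t)"
definition Gamma2 :: "param \<Rightarrow> form" where
  "Gamma2 t = alpha_t t \<and>\<^sub>f gamma_t t \<and>\<^sub>f fcnj (beta_t t)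
     + (sigma_bar t $ 2 $ 1 / cnj (sigma12 t)) \<cdot> alpha_t t \<and>\<^sub>f beta_t t \<and>\<^sub>f fcnj (gamma_t t)"
definition Gamma3 :: "param \<Rightarrow> form" where
  "Gamma3 t = beta_t t \<and>\<^sub>f gamma_t t \<and>\<^sub>f fcnj (alpha_t t)
     + (sigma_bar t $ 1 $ 2 / cnj (sigma12 t)) \<cdot> alpha_t t \<and>\<^sub>f beta_t t \<and>\<^sub>f fcnj (gamma_t t)"
definition Gamma4 :: "param \<Rightarrow> form" where
  "Gamma4 t = beta_t t \<and>\<^sub>f gamma_t t \<and>\<^sub>f fcnj (beta_t t)
     - (sigma_bar t $ 1 $ 1 / cnj (sigma12 t)) \<cdot> alpha_t t \<and>\<^sub>f beta_t t \<and>\<^sub>f fcnj (gamma_t t)"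

definition Gammas :: "param \<Rightarrow> form set" where
  "Gammas t = {Gamma1 t, Gamma2 t, Gamma3 t, Gamma4 t}"

definition H21_gamma :: "param \<Rightarrow> (complex, form set) module" where
  "H21_gamma t =
     (H_Dolb t 2 1)\<lparr>carrier := lin_span (H_Dolb t 2 1) (Dolb_class t 2 1 ` Gammas t)\<rparr>"

definition H12_gamma :: "param \<Rightarrow> (complex, form set) module" where
  "H12_gamma t =
     (H_Dolb t 1 2)\<lparr>carrier := lin_span (H_Dolb t 1 2)
        ((\<lambda>u. Dolb_class t 1 2 (hodge_star t 3 (fcnj u))) ` Gammas t)\<rparr>"


section \<open>Canonical isomorphisms\<close>

text \<open>
  The forms in \<open>span30 t\<close> and \<open>span21 t\<close>, and their conjugates, are combinations with constant
  coefficients of products of \<open>\<alpha>\<^sub>t, \<beta>\<^sub>t, \<gamma>\<^sub>t\<close> and their conjugates, and they are \<open>d\<close>-closed.  The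
  canonical isomorphisms are the ones given by these representatives: a Dolbeault class is sent
  to the de Rham class of its representative, and the Hodge symmetries send the class of a
  representative to the class of its conjugate.  (The forms \<open>\<star>\<^sub>t\<bar>\<Gamma>\<^sub>j(t)\<close> spanning
  \<open>H12_gamma t\<close> are \<open>\<bar>\<partial>\<^sub>t\<close>-closed, but for \<open>t \<noteq> 0\<close> in general not \<open>d\<close>-closed; the forms
  \<open>\<bar>\<Gamma>\<^sub>j(t)\<close> represent classes in the same space.)
\<close>

definition span30 :: "param \<Rightarrow> form set" where
  "span30 t = lin_span form_space {alpha_t t \<and>\<^sub>f beta_t t \<and>\<^sub>f gamma_t t}"

definition span21 :: "param \<Rightarrow> form set" where
  "span21 t = lin_span form_space (Gammas t)"

text \<open>The graph of a function on the carrier, used to say which isomorphism is meant.\<close>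

definition graph_on :: "(complex, 'a) module \<Rightarrow> ('a \<Rightarrow> 'b) \<Rightarrow> ('a \<times> 'b) set" where
  "graph_on V f = (\<lambda>x. (x, f x)) ` carrier V"

definition canonical_Hodge_decomposition ::
  "param \<Rightarrow> (form set \<Rightarrow> form set \<times> form set \<times> form set \<times> form set) \<Rightarrow> bool" where
  "canonical_Hodge_decomposition t \<Phi> \<longleftrightarrow>
     graph_on (H_dR 3) \<Phi> =
       {(dR_class 3 (u + v + fcnj w + fcnj s),
         (Dolb_class t 3 0 u, Dolb_class t 2 1 v, Dolb_class t 1 2 (fcnj w),
          Dolb_class t 0 3 (fcnj s))) | u v w s.
          u \<in> span30 t \<and> v \<in> span21 t \<and> w \<in> span21 t \<and> s \<in> span30 t}"

definition canonical_symmetry_30 :: "param \<Rightarrow> (form set \<Rightarrow> form set) \<Rightarrow> bool" where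
  "canonical_symmetry_30 t \<Psi> \<longleftrightarrow>
     graph_on (H_Dolb t 3 0) \<Psi> =
       {(Dolb_class t 3 0 u, Dolb_class t 0 3 (fcnj u)) | u. u \<in> span30 t}"

definition canonical_symmetry_21 :: "param \<Rightarrow> (form set \<Rightarrow> form set) \<Rightarrow> bool" where
  "canonical_symmetry_21 t \<Psi> \<longleftrightarrow>
     graph_on (H21_gamma t) \<Psi> =
       {(Dolb_class t 2 1 v, Dolb_class t 1 2 (fcnj v)) | v. v \<in> span21 t}"

end

theory Submission
  imports Defs
begin

text \<open>
  In the frame \<open>\<alpha>\<^sub>t, \<beta>\<^sub>t, \<gamma>\<^sub>t\<close> and its conjugates a form is a function into the exterior algebra which
  is invariant under the lattice, and \<open>d\<close> is the sum of a first order operator built from left invariant vector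
  fields and a constant endomorphism \<open>c\<^sub>2 \<and> \<iota>\<^sub>2 + c\<^sub>5 \<and> \<iota>\<^sub>5\<close>, where \<open>c\<^sub>2 = d\<gamma>\<^sub>t\<close>.  Fourier series along the
  centre and along the base torus invert the relevant combination of vector fields on functions of mean zero, by
  operators commuting with all left invariant fields.  Contracting with these inverses gives homotopies that
  reduce every class in question to one with constant coefficients.  Conversely, averaging shows that a constant
  form which is exact is the image of a constant form.  What remains is linear algebra: the constant endomorphism
  lowers the degree in \<open>\<gamma>\<^sub>t, \<gamma>\<^sub>t\<close>-bar by one, so the only constant 2-form that can hit the ten
  representatives is the one of degree two, and the smallness of \<open>\<sigma>\<^sub>i\<^sub>j\<close>-bar against \<open>\<sigma>\<^sub>1\<^sub>2\<close> excludes it.  The same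
  smallness shows that the classes of the \<open>\<star>\<close>-images and of the conjugates of the \<open>\<Gamma>\<^sub>j\<close> span the same
  space, since both differ from four words by a rank one perturbation.
\<close>

text \<open>The obstacle is that the left invariant fields do not commute and that functions on X
  are not periodic in z1 and z2, so there is no global Fourier series. Central translations do
  commute with everything; the zero mode of their Fourier series descends to a torus, where ordinary
  series apply. The symbols of the antiholomorphic fields are, up to a small perturbation, pi times
  Gaussian integers, hence bounded below off zero. As de Rham cohomology does not depend on t, its
  homotopy is built at t = 0 only; noncommutativity leaves an error term in Cartan's formula, and
  this term has square zero. Only types (3,0) and (0,3) need a full Dolbeault computation: the other
  two spaces are spans by definition, so independence of the generators suffices. The condition t31
  = t32 = 0 makes the change of frame preserve the degree in gamma and its conjugate. Closeness
  1/100 of the frames becomes 1/50 for the inverse and 1/25 for the coefficients of d gamma_t; the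
  decisive inequality is 4 (1/25)^2 < (24/25)^2.\<close>

section \<open>Smooth maps and directional derivatives\<close>

definition dd :: "'a::real_normed_vector \<Rightarrow> ('a \<Rightarrow> 'b::real_normed_vector) \<Rightarrow> 'a \<Rightarrow> 'b" where
  "dd v f x = frechet_derivative f (at x) v"

lemma Ck_Suc_dd: "Ck (Suc n) f \<longleftrightarrow> f differentiable_on UNIV \<and> (\<forall>v. Ck n (dd v f))"
  by (simp add: dd_def[abs_def])

lemma Ck_Suc_imp_Ck: "Ck (Suc n) f \<Longrightarrow> Ck n f"
proof (induction n arbitrary: f)
  case 0 then show ?case by (simp add: differentiable_imp_continuous_on)
next
  case (Suc n) then show ?case unfolding Ck_Suc_dd[of n] using Ck_Suc_dd by blast
qed

lemma smooth_imp_differentiable: "smooth f \<Longrightarrow> f differentiable (at x)"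
  unfolding smooth_def using Ck_Suc_dd[of 0 f] by (metis UNIV_I differentiable_on_def)

lemma smooth_dd: "smooth f \<Longrightarrow> smooth (dd v f)"
  unfolding smooth_def using Ck_Suc_dd by blast

lemma smooth_imp_continuous_on: "smooth f \<Longrightarrow> continuous_on S f"
  unfolding smooth_def using Ck.simps(1) continuous_on_subset by blast

lemma smooth_has_derivative: "smooth f \<Longrightarrow> (f has_derivative (\<lambda>v. dd v f x)) (at x)"
  using smooth_imp_differentiable[of f x]
  by (simp add: dd_def frechet_derivative_works)

text \<open>Meant for operators on smooth functions: with \<open>P\<close> the range of the
  operator, smoothness of its values reduces to differentiability and to a formula that moves
  \<open>dd\<close> inside the operator.\<close>

lemma smooth_coinduct:
  assumes "P f" and "\<And>f x. P f \<Longrightarrow> f differentiable (at x)" and "\<And>f v. P f \<Longrightarrow> P (dd v f)"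
  shows "smooth f"
proof -
  have "Ck n f" if "P f" for n f using that
  proof (induction n arbitrary: f)
    case 0 then show ?case
      by (auto intro!: differentiable_imp_continuous_on simp: differentiable_on_def assms(2))
  next
    case (Suc n) then show ?case unfolding Ck_Suc_dd using assms(2,3) 
      by (auto simp: differentiable_on_def)
  qed
  then show ?thesis using assms(1) by (auto simp: smooth_def)
qed

lemma dd_eqI: "(f has_derivative f') (at x) \<Longrightarrow> dd v f x = f' v"
  using frechet_derivative_at[of f f' x] by (simp add: dd_def)

lemma dd_const [simp]: "dd v (\<lambda>x. c) = (\<lambda>x. 0)"
  by (rule ext, rule dd_eqI) (rule has_derivative_const)

lemma smooth_const [simp]: "smooth (\<lambda>x. c)"
  by (rule smooth_coinduct[where P="\<lambda>f. \<exists>c. f = (\<lambda>x. c)"]) auto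

lemma dd_bounded_linear: "bounded_linear f \<Longrightarrow> dd v f = (\<lambda>x. f v)"
  by (rule ext, rule dd_eqI) (rule bounded_linear_imp_has_derivative)

lemma smooth_bounded_linear: "bounded_linear f \<Longrightarrow> smooth f"
proof (rule smooth_coinduct[where P="\<lambda>f. bounded_linear f \<or> (\<exists>c. f = (\<lambda>x. c))"], goal_cases)
  case (2 h x) then show ?case using bounded_linear_imp_differentiable by fastforce
next
  case (3 h v) then show ?case using dd_bounded_linear dd_const by metis
qed blast

lemma dd_add: "smooth f \<Longrightarrow> smooth g \<Longrightarrow> dd v (\<lambda>x. f x + g x) = (\<lambda>x. dd v f x + dd v g x)"
  using dd_eqI[OF has_derivative_add[OF smooth_has_derivative smooth_has_derivative]] by blast

lemma smooth_add: "smooth f \<Longrightarrow> smooth g \<Longrightarrow> smooth (\<lambda>x. f x + g x)"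
proof (rule smooth_coinduct[where P="\<lambda>h. \<exists>f g. smooth f \<and> smooth g \<and> h = (\<lambda>x. f x + g x)"], goal_cases)
  case (2 h x) then show ?case using differentiable_add smooth_imp_differentiable by blast
next
  case (3 h v) then show ?case using dd_add smooth_dd by metis
qed blast

lemma dd_linear_comp: "bounded_linear L \<Longrightarrow> smooth f \<Longrightarrow> dd v (\<lambda>x. L (f x)) = (\<lambda>x. L (dd v f x))"
  using dd_eqI[OF bounded_linear.has_derivative[OF _ smooth_has_derivative]] by blast

lemma smooth_linear_comp:
  assumes L: "bounded_linear L" and f: "smooth f"
  shows "smooth (\<lambda>x. L (f x))"
proof (rule smooth_coinduct[where P="\<lambda>h. \<exists>f. smooth f \<and> h = (\<lambda>x. L (f x))"], goal_cases)
  case 1 show ?case using f by (intro exI[of _ f]) simp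
next
  case (2 h x)
  then obtain f where f: "smooth f" "h = (\<lambda>x. L (f x))" by auto
  show ?case unfolding f(2)
    by (rule differentiableI, rule bounded_linear.has_derivative[OF L], rule smooth_has_derivative[OF f(1)])
next
  case (3 h v)
  then obtain f where f: "smooth f" "h = (\<lambda>x. L (f x))" by auto
  show ?case unfolding f(2) dd_linear_comp[OF L f(1)] using smooth_dd[OF f(1)] by blast
qed

lemma dd_mult: fixes f g :: "'a::real_normed_vector \<Rightarrow> 'b::real_normed_algebra"
  shows "smooth f \<Longrightarrow> smooth g \<Longrightarrow> dd v (\<lambda>x. f x * g x) = (\<lambda>x. f x * dd v g x + dd v f x * g x)"
  using dd_eqI[OF has_derivative_mult[OF smooth_has_derivative smooth_has_derivative]] by blast

text \<open>Products are not closed under \<open>dd\<close>, since the Leibniz rule yields a sum of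
  two products; hence an induction on the order instead of \<open>smooth_coinduct\<close>, with
  additivity of \<open>Ck n\<close> supplied at each order.\<close>

lemma smooth_mult: fixes f g :: "'a::real_normed_vector \<Rightarrow> 'b::real_normed_algebra"
  assumes "smooth f" "smooth g" shows "smooth (\<lambda>x. f x * g x)"
proof -
  have "Ck n (\<lambda>x. f x * g x)" if "smooth f" "smooth g" for n and f g :: "'a \<Rightarrow> 'b" using that
  proof (induction n arbitrary: f g)
    case 0 then show ?case
      using continuous_on_mult smooth_imp_continuous_on by fastforce
  next
    case (Suc n)
    have add: "Ck n (\<lambda>x. p x + q x)" if "Ck n p" "Ck n q" for p q :: "'a \<Rightarrow> 'b" using that
    proof (induction n arbitrary: p q)
      case 0 then show ?case by (auto intro: continuous_on_add)
    next
      case (Suc n)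
      have h: "p differentiable at x" "q differentiable at x" for x
        using Suc.prems by (auto simp: differentiable_on_def)
      then have "dd v (\<lambda>x. p x + q x) = (\<lambda>x. dd v p x + dd v q x)" for v
        by (intro ext dd_eqI) (auto simp: dd_def frechet_derivative_works intro!: has_derivative_add)
      then show ?case unfolding Ck_Suc_dd using Suc.prems[unfolded Ck_Suc_dd] h
        by (auto simp: differentiable_on_def simp del: Ck.simps intro!: Suc.IH)
    qed
    have "(\<lambda>x. f x * g x) differentiable at x" for x
      using Suc.prems by (intro differentiable_mult smooth_imp_differentiable)
    moreover have "Ck n (dd v (\<lambda>x. f x * g x))" for v
      unfolding dd_mult[OF Suc.prems] by (intro add Suc smooth_dd)
    ultimately show ?case unfolding Ck_Suc_dd by (auto simp: differentiable_on_def)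
  qed
  then show ?thesis using assms smooth_def by blast
qed

lemma bounded_linear_euclidean: "linear f \<Longrightarrow> bounded_linear (f :: 'a::euclidean_space \<Rightarrow> 'b::real_normed_vector)"
  by (rule linear_conv_bounded_linear[THEN iffD1])

lemma dd_sum: "(\<And>i. i \<in> I \<Longrightarrow> smooth (f i)) \<Longrightarrow> dd v (\<lambda>x. \<Sum>i\<in>I. f i x) = (\<lambda>x. \<Sum>i\<in>I. dd v (f i) x)"
  using dd_eqI[OF has_derivative_sum[OF smooth_has_derivative]] by blast

lemma smooth_sum: "(\<And>i. i \<in> I \<Longrightarrow> smooth (f i)) \<Longrightarrow> smooth (\<lambda>x. \<Sum>i\<in>I. f i x)"
  by (induction I rule: infinite_finite_induct) (auto intro: smooth_add)

lemma dd_linear_arg: "smooth f \<Longrightarrow> linear (\<lambda>v. dd v f x)"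
  using smooth_has_derivative has_derivative_linear by blast

lemma dd_affine:
  assumes "bounded_linear A" "smooth f"
  shows "dd v (\<lambda>x. f (A x + a)) = (\<lambda>x. dd (A v) f (A x + a))"
proof (rule ext, rule dd_eqI)
  fix x
  have "((\<lambda>x. A x + a) has_derivative A) (at x)"
    using bounded_linear_imp_has_derivative[OF assms(1)] by (auto intro!: derivative_eq_intros)
  from has_derivative_compose[OF this smooth_has_derivative[OF assms(2)]]
  show "((\<lambda>x. f (A x + a)) has_derivative (\<lambda>v. dd (A v) f (A x + a))) (at x)" .
qed

lemma smooth_affine:
  assumes "bounded_linear A" "smooth f" shows "smooth (\<lambda>x. f (A x + a))"
proof (rule smooth_coinduct[where P="\<lambda>h. \<exists>f. smooth f \<and> h = (\<lambda>x. f (A x + a))"], goal_cases)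
  case (2 h x)
  then obtain f where f: "smooth f" "h = (\<lambda>x. f (A x + a))" by auto
  have "((\<lambda>x. A x + a) has_derivative A) (at x)"
    using bounded_linear_imp_has_derivative[OF assms(1)] by (auto intro!: derivative_eq_intros)
  from has_derivative_compose[OF this smooth_has_derivative[OF f(1)]] show ?case
    unfolding f differentiable_def by blast
next
  case (3 h v) then show ?case using dd_affine[OF assms(1)] smooth_dd by metis
qed (use assms(2) in blast)

lemma dd_translate: "smooth f \<Longrightarrow> dd v (\<lambda>x. f (x + a)) = (\<lambda>x. dd v f (x + a))"
  using dd_affine[OF bounded_linear_ident] by auto

lemma smooth_translate: "smooth f \<Longrightarrow> smooth (\<lambda>x. f (x + a))"
  using smooth_affine[OF bounded_linear_ident] by auto

lemma smooth_vec_iff: fixes f :: "'a::euclidean_space \<Rightarrow> complex ^ 'n"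
  shows "smooth f \<longleftrightarrow> (\<forall>i. smooth (\<lambda>x. f x $ i))"
proof
  assume *: "\<forall>i. smooth (\<lambda>x. f x $ i)"
  have "f = (\<lambda>x. \<Sum>i\<in>UNIV. axis i (f x $ i))"
    by (auto simp: vec_eq_iff axis_def if_distrib cong: if_cong)
  moreover have "smooth (\<lambda>x. \<Sum>i\<in>UNIV. axis i (f x $ i))"
  proof (rule smooth_sum)
    fix i
    have "bounded_linear (\<lambda>z::complex. axis i z :: complex^'n)"
      by (intro bounded_linear_euclidean linearI) (auto simp: vec_eq_iff axis_def)
    then show "smooth (\<lambda>x. axis i (f x $ i) :: complex^'n)" using smooth_linear_comp * by blast
  qed
  ultimately show "smooth f" by simp
next
  assume "smooth f" then show "\<forall>i. smooth (\<lambda>x. f x $ i)"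
    using smooth_linear_comp[OF bounded_linear_vec_nth] by blast
qed

lemma dd_vec_nth: "smooth f \<Longrightarrow> dd v f x $ i = dd v (\<lambda>x. f x $ i) x"
  using dd_linear_comp[OF bounded_linear_vec_nth] by metis

section \<open>Integrals along a direction\<close>

text \<open>The weight 1 turns a derivative along e into a difference, by the fundamental theorem of
  calculus; an exponential weight gives a Fourier coefficient along e. One differentiation lemma
  covers both.\<close>

definition dirint :: "(real \<Rightarrow> complex) \<Rightarrow> 'a::euclidean_space \<Rightarrow> ('a \<Rightarrow> complex) \<Rightarrow> 'a \<Rightarrow> complex" where
  "dirint \<phi> e f x = integral {0..1} (\<lambda>s. \<phi> s * f (x + s *\<^sub>R e))"

lemma dirint_integrable:
  fixes f :: "'a::euclidean_space \<Rightarrow> complex"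
  assumes "continuous_on UNIV \<phi>" "continuous_on UNIV f"
  shows "(\<lambda>s. \<phi> s * f (x + s *\<^sub>R e)) integrable_on {0..1::real}"
proof -
  have "continuous_on {0..1} \<phi>" using assms(1) continuous_on_subset by blast
  moreover have "continuous_on {0..1} (\<lambda>s. f (x + s *\<^sub>R e))"
    by (rule continuous_on_compose2[OF assms(2)]) (auto intro!: continuous_intros)
  ultimately have "continuous_on {0..1} (\<lambda>s. \<phi> s * f (x + s *\<^sub>R e))"
    by (rule continuous_on_mult)
  then show ?thesis by (rule integrable_continuous_real)
qed

lemma dirint_has_derivative:
  fixes f :: "'a::euclidean_space \<Rightarrow> complex"
  assumes "continuous_on UNIV \<phi>" "smooth f"
  shows "(dirint \<phi> e f has_derivative (\<lambda>v. dirint \<phi> e (dd v f) x)) (at x)"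
proof -
  define fx :: "'a \<Rightarrow> real \<Rightarrow> 'a \<Rightarrow>\<^sub>L complex" where
    "fx x s = Blinfun (\<lambda>v. \<phi> s * dd v f (x + s *\<^sub>R e))" for x s
  have cd: "continuous_on UNIV (dd v f)" for v
    using assms(2) smooth_dd smooth_imp_continuous_on by blast
  have bl: "bounded_linear (\<lambda>v. \<phi> s * dd v f (x + s *\<^sub>R e))" for x s
    using has_derivative_bounded_linear[OF smooth_has_derivative[OF assms(2)]]
    by (intro bounded_linear_const_mult)
  have ap: "blinfun_apply (fx x s) v = \<phi> s * dd v f (x + s *\<^sub>R e)" for x s v
    by (simp add: fx_def bounded_linear_Blinfun_apply[OF bl])
  \<comment> \<open>The Leibniz rule wants a continuous family of bounded linear maps. In finite
    dimension continuity can be tested on each direction separately, where it is continuity of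
    \<open>dd i f\<close>.\<close>
  have cont: "continuous_on (UNIV \<times> cbox 0 1) (\<lambda>(x,t). fx x t)"
  proof (rule continuous_on_blinfun_componentwise)
    fix i :: 'a
    have "continuous_on (UNIV \<times> cbox 0 1) (\<lambda>p::'a\<times>real. \<phi> (snd p))"
      by (rule continuous_on_compose2[OF assms(1)]) (auto intro: continuous_intros)
    moreover have "continuous_on (UNIV \<times> cbox 0 1) (\<lambda>p::'a\<times>real. dd i f (fst p + snd p *\<^sub>R e))"
      by (rule continuous_on_compose2[OF cd]) (auto intro!: continuous_intros)
    ultimately show "continuous_on (UNIV \<times> cbox 0 1) (\<lambda>p. blinfun_apply (case p of (x, t) \<Rightarrow> fx x t) i)"
      unfolding case_prod_unfold ap by (rule continuous_on_mult)
  qed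
  have "((\<lambda>x. integral (cbox 0 1) (\<lambda>s. \<phi> s * f (x + s *\<^sub>R e))) has_derivative integral (cbox 0 1) (fx x)) (at x within UNIV)"
  proof (rule leibniz_rule[OF _ _ cont])
    fix x t
    have "((\<lambda>x. f (x + t *\<^sub>R e)) has_derivative (\<lambda>v. dd v f (x + t *\<^sub>R e))) (at x)"
      using smooth_has_derivative[OF smooth_translate[OF assms(2)]] by (simp add: dd_translate[OF assms(2)])
    then show "((\<lambda>x. \<phi> t * f (x + t *\<^sub>R e)) has_derivative blinfun_apply (fx x t)) (at x within UNIV)"
      by (auto simp: ap[abs_def] intro!: derivative_eq_intros)
  next
    fix x show "(\<lambda>s. \<phi> s * f (x + s *\<^sub>R e)) integrable_on cbox 0 (1::real)"
      using dirint_integrable[OF assms(1) smooth_imp_continuous_on[OF assms(2)]] by simp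
  qed auto
  moreover have "blinfun_apply (integral (cbox 0 1) (fx x)) v = dirint \<phi> e (dd v f) x" for v
  proof -
    have "fx x integrable_on cbox 0 1"
    proof (rule integrable_continuous)
      have "continuous_on (cbox 0 1) (\<lambda>t. (x, t))" by (intro continuous_intros)
      from continuous_on_compose2[OF cont this] show "continuous_on (cbox 0 1) (fx x)" by auto
    qed
    then show ?thesis
      by (subst blinfun_apply_integral) (auto simp: ap dirint_def)
  qed
  moreover from this have "blinfun_apply (integral (cbox 0 1) (fx x)) = (\<lambda>v. dirint \<phi> e (dd v f) x)" by auto
  ultimately have "((\<lambda>x. integral (cbox 0 1) (\<lambda>s. \<phi> s * f (x + s *\<^sub>R e))) has_derivative (\<lambda>v. dirint \<phi> e (dd v f) x)) (at x)"
    by metis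
  then show ?thesis unfolding dirint_def[of \<phi> e f, abs_def] cbox_interval .
qed

lemma dd_dirint: "continuous_on UNIV \<phi> \<Longrightarrow> smooth f \<Longrightarrow> dd v (dirint \<phi> e f) = dirint \<phi> e (dd v f)"
  using dd_eqI[OF dirint_has_derivative] by blast

lemma smooth_dirint: "continuous_on UNIV \<phi> \<Longrightarrow> smooth f \<Longrightarrow> smooth (dirint \<phi> e f)"
proof (rule smooth_coinduct[where P="\<lambda>h. \<exists>f. smooth f \<and> h = dirint \<phi> e f"], goal_cases)
  case (2 h x) then show ?case using dirint_has_derivative differentiableI by blast
next
  case (3 h v) then show ?case using dd_dirint smooth_dd by metis
qed blast

lemma dd_along_line:
  assumes "smooth f"
  shows "((\<lambda>s. f (x + s *\<^sub>R e)) has_vector_derivative dd e f (x + s *\<^sub>R e)) (at s within S)"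
proof -
  have "((\<lambda>s. x + s *\<^sub>R e) has_derivative (\<lambda>h. h *\<^sub>R e)) (at s within S)" by (auto intro!: derivative_eq_intros)
  moreover have "linear (\<lambda>v. dd v f (x + s *\<^sub>R e))" using dd_linear_arg[OF assms] .
  ultimately show ?thesis unfolding has_vector_derivative_def
    using has_derivative_compose[OF _ smooth_has_derivative[OF assms], of "\<lambda>s. x + s *\<^sub>R e" "\<lambda>h. h *\<^sub>R e" s S]
    by (simp add: linear_scale[OF dd_linear_arg[OF assms]])
qed

lemma dirint_one_dd: fixes f :: "'a::euclidean_space \<Rightarrow> complex"
  assumes "smooth f" shows "dirint (\<lambda>s. 1) e (dd e f) x = f (x + e) - f x"
proof -
  have "((\<lambda>s. dd e f (x + s *\<^sub>R e)) has_integral (f (x + 1 *\<^sub>R e) - f (x + 0 *\<^sub>R e))) {0..1}"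
    by (intro fundamental_theorem_of_calculus dd_along_line assms) auto
  then show ?thesis by (simp add: dirint_def integral_unique)
qed

text \<open>The difference f(x + r w) - f(x) is an integral of a derivative along w. Differentiating
  it in direction v, directly and under the integral sign, shows that both iterated derivatives have
  the same average over the segment from x to x + r w. A continuous function whose averages over all
  short segments at x are zero vanishes at x.\<close>

lemma dd_commute: fixes f :: "'a::euclidean_space \<Rightarrow> complex"
  assumes f: "smooth f" shows "dd v (dd w f) = dd w (dd v f)"
proof
  fix x
  define h where "h = (\<lambda>x. dd v (dd w f) x - dd w (dd v f) x)"
  have sm: "smooth (dd v (dd w f))" "smooth (dd w (dd v f))" using f by (auto intro: smooth_dd)
  have ch: "continuous_on UNIV h" unfolding h_def
    by (intro continuous_on_diff smooth_imp_continuous_on sm)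
  have scale: "dd (r *\<^sub>R w) g y = r *\<^sub>R dd w g y" if "smooth g" for r y and g :: "'a \<Rightarrow> complex"
    by (rule linear_scale[OF dd_linear_arg[OF that]])
  have zero: "integral {0..1} (\<lambda>s. h (x + s *\<^sub>R (r *\<^sub>R w))) = 0" if "r \<noteq> 0" for r
  proof -
    let ?e = "r *\<^sub>R w"
    have "dd v (dirint (\<lambda>s. 1) ?e (dd ?e f)) x = dd v (\<lambda>x. f (x + ?e) - f x) x"
      using dirint_one_dd[OF f] by presburger
    also have "... = dd v f (x + ?e) - dd v f x"
      by (rule dd_eqI) (auto intro!: has_derivative_diff smooth_has_derivative f
        simp: smooth_has_derivative[OF smooth_translate[OF f], unfolded dd_translate[OF f]])
    also have "... = dirint (\<lambda>s. 1) ?e (dd ?e (dd v f)) x"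
      using dirint_one_dd[OF smooth_dd[OF f]] by metis
    finally have 1: "dirint (\<lambda>s. 1) ?e (dd v (dd ?e f)) x = dirint (\<lambda>s. 1) ?e (dd ?e (dd v f)) x"
      using dd_dirint[OF _ smooth_dd[OF f]] by (metis continuous_on_const)
    have 2: "dd v (dd ?e f) = (\<lambda>x. r *\<^sub>R dd v (dd w f) x)"
    proof -
      have "dd ?e f = (\<lambda>x. r *\<^sub>R dd w f x)" using scale[OF f] by auto
      then show ?thesis using dd_linear_comp[OF bounded_linear_scaleR_right smooth_dd[OF f]] by simp
    qed
    have 3: "dd ?e (dd v f) = (\<lambda>x. r *\<^sub>R dd w (dd v f) x)" using scale[OF smooth_dd[OF f]] by auto
    have int: "(\<lambda>s. g (x + s *\<^sub>R ?e)) integrable_on {0..1}" if "smooth g" for g :: "'a \<Rightarrow> complex"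
      by (intro integrable_continuous_real continuous_on_compose2[OF smooth_imp_continuous_on[OF that, of UNIV]] continuous_intros) auto
    show ?thesis using 1 that unfolding 2 3 dirint_def h_def
      using integral_diff[OF int[OF sm(1)] int[OF sm(2)]] by simp
  qed
  have "h x = 0"
  proof (rule ccontr)
    assume n: "h x \<noteq> 0"
    have "isCont h x" using ch by (simp add: continuous_on_eq_continuous_at)
    then obtain d where d: "d > 0" "\<And>y. dist y x < d \<Longrightarrow> dist (h y) (h x) < norm (h x) / 2"
      using n unfolding continuous_at_eps_delta by (metis half_gt_zero zero_less_norm_iff)
    \<comment> \<open>The segment must stay in the d-ball on which h varies by at most half of its
      value at x; adding 1 to the norm covers w = 0.\<close>
    define r where "r = d / (2 * (norm w + 1))"
    have nw: "0 < norm w + 1" by (smt (verit) norm_ge_zero)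
    have r: "r > 0" "norm (r *\<^sub>R w) < d"
    proof -
      show "r > 0" using d nw by (simp add: r_def)
      have "norm (r *\<^sub>R w) = d * (norm w / (2 * (norm w + 1)))" using d(1) nw by (simp add: r_def)
      also have "... < d * 1" using d(1) nw by (intro mult_strict_left_mono) (auto simp: field_simps add_nonneg_pos)
      finally show "norm (r *\<^sub>R w) < d" by simp
    qed
    have b: "norm (h (x + s *\<^sub>R (r *\<^sub>R w)) - h x) \<le> norm (h x) / 2" if "s \<in> {0..1}" for s
    proof -
      have "norm (s *\<^sub>R (r *\<^sub>R w)) \<le> norm (r *\<^sub>R w)" using that unfolding norm_scaleR[of s]
        by (intro mult_left_le_one_le) auto
      then have "dist (x + s *\<^sub>R (r *\<^sub>R w)) x < d" using r by (simp add: dist_norm)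
      from d(2)[OF this] show ?thesis by (simp add: dist_norm)
    qed
    have i: "((\<lambda>s. h (x + s *\<^sub>R (r *\<^sub>R w)) - h x) has_integral (0 - h x)) {0..1}"
    proof (rule has_integral_diff)
      have "(\<lambda>s. h (x + s *\<^sub>R (r *\<^sub>R w))) integrable_on {0..1}"
        by (intro integrable_continuous_real continuous_on_compose2[OF ch] continuous_intros) auto
      then show "((\<lambda>s. h (x + s *\<^sub>R (r *\<^sub>R w))) has_integral 0) {0..1}"
        using zero[of r] r by (simp add: has_integral_iff)
      show "((\<lambda>s. h x) has_integral h x) {0..1::real}" using has_integral_const_real[of "h x" 0 1] by simp
    qed
    have "norm (0 - h x) \<le> norm (h x) / 2 * measure lborel {0..1::real}"
      by (rule has_integral_bound_real[OF _ _ i]) (use b in auto)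
    then show False using n by simp
  qed
  then show "dd v (dd w f) x = dd w (dd v f) x" by (simp add: h_def)
qed

section \<open>Pointwise Fourier inversion in one variable\<close>

lemma cesaro_null:
  fixes a :: "nat \<Rightarrow> 'a::real_normed_vector"
  assumes "a \<longlonglongrightarrow> 0" shows "(\<lambda>n. (\<Sum>i<n. a i) /\<^sub>R real n) \<longlonglongrightarrow> 0"
proof (rule LIMSEQ_I)
  fix r :: real assume r: "r > 0"
  obtain M where M: "\<And>n. n \<ge> M \<Longrightarrow> norm (a n) < r / 2"
    using LIMSEQ_D[OF assms, of "r/2"] r by auto
  define C where "C = (\<Sum>i<M. norm (a i))"
  have C: "C \<ge> 0" by (simp add: C_def sum_nonneg)
  obtain N where N: "real N > 2 * C / r" using reals_Archimedean2 by blast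
  have "norm ((\<Sum>i<n. a i) /\<^sub>R real n - 0) < r" if n: "n \<ge> max (max M N) 1" for n
  proof -
    have "norm (\<Sum>i<n. a i) \<le> (\<Sum>i<n. norm (a i))" by (rule norm_sum)
    also have "... = C + (\<Sum>i\<in>{M..<n}. norm (a i))"
      unfolding C_def using n by (subst sum.union_disjoint[symmetric]) (auto simp: ivl_disj_un intro!: sum.cong)
    also have "(\<Sum>i\<in>{M..<n}. norm (a i)) \<le> (\<Sum>i\<in>{M..<n}. r/2)"
      using M by (intro sum_mono) (auto intro: less_imp_le)
    also have "... \<le> real n * (r/2)" using n r by (auto simp: of_nat_diff intro!: mult_right_mono)
    finally have "norm (\<Sum>i<n. a i) \<le> C + real n * (r/2)" by simp
    moreover have "C < real n * (r/2)"
    proof -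
      have "2 * C / r < real n" using N n by linarith
      then show ?thesis using r by (simp add: field_simps)
    qed
    ultimately have "norm (\<Sum>i<n. a i) < real n * r" by argo
    then show ?thesis using n by (simp add: field_simps)
  qed
  then show "\<exists>no. \<forall>n\<ge>no. norm ((\<Sum>i<n. a i) /\<^sub>R real n - 0) < r" by blast
qed

text \<open>The modulus is 2 sin(pi s), and concavity of the sine on [0, pi] puts its graph above
  the chord up to pi/2. Reflection s to 1 - s treats the other half. The bound measures the simple
  zeros at both ends of the interval.\<close>

lemma cis_minus_one_lower_bound:
  assumes "0 < s" "s < 1" shows "norm (cis (2 * pi * s) - 1) \<ge> 4 * min s (1 - s)"
proof -
  have conc: "concave_on {0..pi} sin"
    by (rule f''_le0_imp_concave[where f'=cos and f''="\<lambda>x. - sin x"])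
      (auto intro!: derivative_eq_intros sin_ge_zero)
  have half: "sin (pi * t) \<ge> 2 * t" if "0 \<le> t" "t \<le> 1/2" for t :: real
    using concave_onD[OF conc, of "2*t" 0 "pi/2"] that by (simp add: algebra_simps)
  have "norm (cis (2 * pi * s) - 1) = 2 * \<bar>sin (pi * s)\<bar>"
  proof -
    have "(norm (cis (2 * pi * s) - 1))\<^sup>2 = (cos (2*(pi * s)) - 1)\<^sup>2 + (sin (2*(pi * s)))\<^sup>2"
      by (simp add: cmod_power2 mult.assoc)
    also have "... = 2 - 2 * cos (2*(pi * s))" using sin_cos_squared_add[of "2*(pi * s)"] by (simp add: power2_eq_square algebra_simps)
    also have "... = (2 * \<bar>sin (pi * s)\<bar>)\<^sup>2" by (simp add: cos_double_sin power_mult_distrib)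
    finally show ?thesis by (rule power2_eq_imp_eq) auto
  qed
  moreover have "sin (pi * s) \<ge> 2 * min s (1 - s)"
  proof (cases "s \<le> 1/2")
    case True then show ?thesis using half[of s] assms by simp
  next
    case False
    have "sin (pi * s) = sin (pi * (1 - s))" using sin_pi_minus[of "pi * s"] by (simp add: algebra_simps)
    then show ?thesis using half[of "1-s"] False assms by simp
  qed
  ultimately show ?thesis by linarith
qed

lemma integral_cis:
  "integral {0..1} (\<lambda>s. cis (- (2 * pi * of_int k * s))) = (if k = 0 then 1 else 0)"
proof (cases "k = 0")
  case True then show ?thesis by (simp add: cis_zero)
next
  case False
  define c where "c = - (2 * pi * of_int k)"
  have c: "c \<noteq> 0" using False by (simp add: c_def)
  have d: "((\<lambda>s. cis (c * s) / (\<i> * c)) has_vector_derivative cis (c * s)) (at s within {0..1})" for s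
  proof -
    have "((\<lambda>s. cis (c * s)) has_vector_derivative (of_real c * (\<i> * cis (c * s)))) (at s within {0..1})"
      unfolding has_vector_derivative_def
      by (auto intro!: derivative_eq_intros simp: scaleR_conv_of_real algebra_simps)
    from has_vector_derivative_divide[OF this, of "\<i> * c"] show ?thesis using c by simp
  qed
  have "((\<lambda>s. cis (c * s)) has_integral (cis (c * 1) / (\<i> * c) - cis (c * 0) / (\<i> * c))) {0..1}"
    using d by (intro fundamental_theorem_of_calculus) auto
  moreover have "cis (c * 1) = 1"
    using cis_multiple_2pi[of "of_int (-k)"] by (simp add: c_def)
  ultimately show ?thesis using False by (simp add: c_def has_integral_iff mult.assoc)
qed

text \<open>Chernoff's argument: after subtracting the value at 0, the function is divisible by
  exp(2 pi i s) - 1 with a bounded quotient, so its coefficients are differences of the coefficients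
  of the quotient and their partial sums telescope. Convergence is assumed; only the value of the
  sum is identified, so Cesaro means with dominated convergence are enough.\<close>

lemma fourier_series_at_zero:
  fixes \<phi> \<phi>' :: "real \<Rightarrow> complex"
  assumes deriv: "\<And>s. (\<phi> has_vector_derivative \<phi>' s) (at s)" and cont: "continuous_on UNIV \<phi>'"
    and per: "\<phi> 1 = \<phi> 0"
    and sum: "((\<lambda>k::int. integral {0..1} (\<lambda>s. cis (- (2 * pi * of_int k * s)) * \<phi> s)) has_sum S) UNIV"
  shows "S = \<phi> 0"
proof -
  define g where "g s = \<phi> s - \<phi> 0" for s
  define E where "E k s = cis (- (2 * pi * of_int k * s))" for k :: int and s :: real
  define \<psi> where "\<psi> s = g s / (cis (2 * pi * s) - 1)" for s
  let ?U = "{0<..<1::real}"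
  have contphi: "continuous_on UNIV \<phi>"
    using deriv by (auto simp: continuous_on_eq_continuous_at intro: has_vector_derivative_continuous)
  have cg: "continuous_on A g" for A unfolding g_def
    by (intro continuous_intros continuous_on_subset[OF contphi]) auto
  have cE: "continuous_on A (E k)" for A k unfolding E_def[abs_def] by (intro continuous_intros)
  obtain C where C: "\<And>s. s \<in> {0..1} \<Longrightarrow> norm (\<phi>' s) \<le> C"
  proof -
    have "compact (\<phi>' ` {0..1})" by (intro compact_continuous_image continuous_on_subset[OF cont]) auto
    from compact_imp_bounded[OF this] obtain a where "\<forall>x\<in>\<phi>' ` {0..1}. norm x \<le> a" unfolding bounded_iff by blast
    then show ?thesis by (intro that[of a]) blast
  qed
  have C0: "C \<ge> 0" using order_trans[OF norm_ge_zero C[of 0]] by simp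
  have Lip: "norm (\<phi> s - \<phi> r) \<le> C * norm (s - r)" if "s \<in> {0..1}" "r \<in> {0..1}" for s r
  proof (rule differentiable_bound[where S="{0..1}" and f'="\<lambda>s h. h *\<^sub>R \<phi>' s"])
    fix t :: real assume t: "t \<in> {0..1}"
    show "(\<phi> has_derivative (\<lambda>h. h *\<^sub>R \<phi>' t)) (at t within {0..1})"
      using deriv[of t] unfolding has_vector_derivative_def by (rule has_derivative_at_withinI)
    show "onorm (\<lambda>h. h *\<^sub>R \<phi>' t) \<le> C"
      by (rule onorm_bound) (use C[OF t] C0 in \<open>auto simp: mult.commute[of C] intro!: mult_left_mono\<close>)
  qed (use that in auto)
  have ne: "cis (2 * pi * s) - 1 \<noteq> 0" if "s \<in> ?U" for s
    using cis_minus_one_lower_bound[of s] that by auto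
  \<comment> \<open>Both the numerator and the denominator vanish at the two ends. The Lipschitz
    bound is used from 0 and, by periodicity, from 1, against the lower bound of the
    denominator.\<close>
  have bpsi: "norm (\<psi> s) \<le> C" if s: "s \<in> ?U" for s
  proof -
    have "norm (g s) \<le> C * s" using Lip[of s 0] s by (simp add: g_def)
    moreover have "norm (g s) \<le> C * (1 - s)" using Lip[of s 1] s by (simp add: g_def per abs_if)
    ultimately have "norm (g s) \<le> C * min s (1 - s)" by (simp add: min_def)
    moreover have "min s (1 - s) \<le> norm (cis (2 * pi * s) - 1)"
      using cis_minus_one_lower_bound[of s] s by (auto simp: min_def split: if_splits)
    ultimately have "norm (g s) \<le> C * norm (cis (2 * pi * s) - 1)"
      using C0 mult_left_mono order_trans by blast
    then show ?thesis using ne[OF s] by (simp add: \<psi>_def norm_divide divide_le_eq)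
  qed
  have cpsi: "continuous_on ?U \<psi>" unfolding \<psi>_def[abs_def]
    using ne by (intro continuous_intros cg) auto
  have mb: "h integrable_on ?U" if "continuous_on ?U h" "\<And>s. s \<in> ?U \<Longrightarrow> norm (h s) \<le> K"
    for h :: "real \<Rightarrow> complex" and K
  proof (rule measurable_bounded_by_integrable_imp_integrable)
    show "h \<in> borel_measurable (lebesgue_on ?U)"
      by (intro continuous_imp_measurable_on_sets_lebesgue that) auto
    show "(\<lambda>s. K) integrable_on ?U" unfolding integrable_on_Icc_iff_Ioo[symmetric] by (rule integrable_const_ivl)
  qed (use that in auto)
  define p where "p k = integral ?U (\<lambda>s. E k s * \<psi> s)" for k
  have ip: "(\<lambda>s. E k s * \<psi> s) integrable_on ?U" for k
    by (rule mb[where K=C]) (use bpsi in \<open>auto intro!: continuous_intros cE cpsi simp: E_def norm_mult\<close>)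
  define b where "b k = integral {0..1} (\<lambda>s. E k s * g s)" for k
  have iE: "(\<lambda>s. E k s * h s) integrable_on {0..1}" if "continuous_on {0..1} h" for k h
    by (intro integrable_continuous_real continuous_intros cE that)
  \<comment> \<open>Multiplying by exp(2 pi i s) - 1 subtracts neighbouring coefficients of the
    quotient.\<close>
  have bp: "b k = p (k - 1) - p k" for k
  proof -
    have "b k = integral ?U (\<lambda>s. E k s * g s)" unfolding b_def by (rule integral_open_interval_real)
    also have "... = integral ?U (\<lambda>s. E (k-1) s * \<psi> s - E k s * \<psi> s)"
    proof (rule integral_cong)
      fix s assume s: "s \<in> ?U"
      have "E (k-1) s = E k s * cis (2 * pi * s)" by (simp add: E_def cis_mult algebra_simps)
      then have "E (k-1) s * \<psi> s - E k s * \<psi> s = E k s * ((cis (2 * pi * s) - 1) * \<psi> s)" by (simp add: algebra_simps)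
      then show "E k s * g s = E (k-1) s * \<psi> s - E k s * \<psi> s" using ne[OF s] by (simp add: \<psi>_def)
    qed
    also have "... = p (k-1) - p k" unfolding p_def by (rule integral_diff[OF ip ip])
    finally show ?thesis .
  qed
  have bhs: "(b has_sum (S - \<phi> 0)) UNIV"
  proof -
    have "((\<lambda>k. if k = 0 then \<phi> 0 else 0) has_sum \<phi> 0) (UNIV::int set)"
      using has_sum_finite_neutralI[of "{0::int}" UNIV "\<lambda>k. if k = 0 then \<phi> 0 else 0"] by simp
    from has_sum_add[OF sum has_sum_uminusI[OF this]] have "((\<lambda>k. integral {0..1} (\<lambda>s. E k s * \<phi> s) - (if k = 0 then \<phi> 0 else 0)) has_sum (S - \<phi> 0)) UNIV"
      by (simp add: E_def)
    moreover have "integral {0..1} (\<lambda>s. E k s * \<phi> s) - (if k = 0 then \<phi> 0 else 0) = b k" for k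
    proof -
      have "b k = integral {0..1} (\<lambda>s. E k s * \<phi> s - E k s * \<phi> 0)" by (simp add: b_def g_def right_diff_distrib)
      also have "... = integral {0..1} (\<lambda>s. E k s * \<phi> s) - integral {0..1} (\<lambda>s. E k s * \<phi> 0)"
        by (intro integral_diff iE continuous_on_subset[OF contphi]) auto
      finally show ?thesis using integral_cis[of k] by (simp add: E_def)
    qed
    ultimately show ?thesis by simp
  qed
  \<comment> \<open>The sum of \<open>b\<close> over [-n, n] telescopes to this boundary
    term.\<close>
  define q where "q n = p (- int n - 1) - p (int n)" for n
  have qlim: "q \<longlonglongrightarrow> S - \<phi> 0"
  proof -
    have "filterlim (\<lambda>n. {- int n..int n}) (finite_subsets_at_top UNIV) sequentially"
      unfolding filterlim_finite_subsets_at_top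
    proof safe
      fix X :: "int set" assume X: "finite X"
      define N where "N = nat (Max (insert 0 (abs ` X)))"
      have "X \<subseteq> {- int n..int n}" if "n \<ge> N" for n
      proof
        fix x assume "x \<in> X"
        then have "\<bar>x\<bar> \<le> Max (insert 0 (abs ` X))" using X by (intro Max_ge) auto
        then show "x \<in> {- int n..int n}" using that by (auto simp: N_def)
      qed
      then show "\<forall>\<^sub>F n in sequentially. finite {- int n..int n} \<and> X \<subseteq> {- int n..int n} \<and> {- int n..int n} \<subseteq> UNIV"
        by (auto simp: eventually_sequentially)
    qed
    from filterlim_compose[OF bhs[unfolded has_sum_def] this]
    have "(\<lambda>n. sum b {- int n..int n}) \<longlonglongrightarrow> S - \<phi> 0" .
    moreover have "sum b {- int n..int n} = q n" for n
    proof (induction n)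
      case 0 then show ?case by (simp add: q_def bp)
    next
      case (Suc n)
      have "{- int (Suc n)..int (Suc n)} = insert (- int (Suc n)) (insert (int (Suc n)) {- int n..int n})" by auto
      moreover have "p (- int n - 1) = p (- 1 - int n)" by (rule arg_cong) simp
      ultimately show ?case using Suc by (simp add: q_def bp algebra_simps)
    qed
    ultimately show ?thesis by simp
  qed
  have lim1: "(\<lambda>n. (\<Sum>i<n. q i) /\<^sub>R real n) \<longlonglongrightarrow> c" if qc: "q \<longlonglongrightarrow> c" for c
  proof -
    have "(\<lambda>n. (\<Sum>i<n. q i - c) /\<^sub>R real n) \<longlonglongrightarrow> 0"
      by (rule cesaro_null, rule LIM_zero, rule qc)
    then have "(\<lambda>n. (\<Sum>i<n. q i) /\<^sub>R real n - c) \<longlonglongrightarrow> 0"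
    proof (rule Lim_transform_eventually)
      show "\<forall>\<^sub>F n in sequentially. (\<Sum>i<n. q i - c) /\<^sub>R real n = (\<Sum>i<n. q i) /\<^sub>R real n - c"
        using eventually_gt_at_top[of 0]
        by eventually_elim (simp add: sum_subtractf scaleR_conv_of_real field_simps)
    qed
    then show ?thesis by (rule LIM_zero_cancel)
  qed
  \<comment> \<open>The kernel of the n-th Cesaro mean of \<open>q\<close>. It is bounded by 2
    everywhere and tends to 0 in the open interval, so its integrals against the bounded
    \<open>\<psi>\<close> tend to 0.\<close>
  define Q where "Q n s = (\<Sum>i<n. (E (- int i - 1) s - E (int i) s)) /\<^sub>R real n" for n s
  have Eb: "norm (E k s) = 1" for k s by (simp add: E_def)
  have Qeq: "(\<Sum>i<n. q i) /\<^sub>R real n = integral ?U (\<lambda>s. Q n s * \<psi> s)" for n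
  proof -
    have "integral ?U (\<lambda>s. Q n s * \<psi> s) = integral ?U (\<lambda>s. (\<Sum>i<n. E (- int i - 1) s * \<psi> s - E (int i) s * \<psi> s) /\<^sub>R real n)"
      by (simp add: Q_def sum_distrib_right left_diff_distrib)
    also have "... = (\<Sum>i<n. integral ?U (\<lambda>s. E (- int i - 1) s * \<psi> s - E (int i) s * \<psi> s)) /\<^sub>R real n"
      by (subst integral_cmul, subst integral_sum) (auto intro!: integrable_diff ip)
    also have "... = (\<Sum>i<n. q i) /\<^sub>R real n"
      by (simp add: q_def p_def integral_diff[OF ip ip])
    finally show ?thesis by simp
  qed
  have Qb: "norm (Q n s) \<le> 2" for n s
  proof (cases "n = 0")
    case False
    have "norm (\<Sum>i<n. (E (- int i - 1) s - E (int i) s)) \<le> (\<Sum>i<n. 2)"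
      by (rule sum_norm_le) (metis Eb norm_triangle_ineq4 one_add_one)
    then show ?thesis using False by (simp add: Q_def field_simps)
  qed (simp add: Q_def)
  have Qlim: "(\<lambda>n. Q n s * \<psi> s) \<longlonglongrightarrow> 0" if s: "s \<in> ?U" for s
  proof -
    define z where "z = cis (2 * pi * s)"
    have z: "z - 1 \<noteq> 0" using ne[OF s] by (simp add: z_def)
    have Ez: "(z - 1) * E k s = E (k-1) s - E k s" for k
      by (simp add: z_def E_def cis_mult algebra_simps)
    have t1: "(z - 1) * (\<Sum>i<n. E (int i) s) = E (-1) s - E (int n - 1) s" for n
      by (induction n) (simp_all add: Ez distrib_left)
    have t2: "(z - 1) * (\<Sum>i<n. E (- int i - 1) s) = E (- int n - 1) s - E (-1) s" for n
      by (induction n) (simp_all add: Ez distrib_left)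
    \<comment> \<open>Geometric sums: after multiplication by z - 1 only four unimodular terms are
      left.\<close>
    have bd: "norm (Q n s) \<le> (4 / norm (z - 1)) / real n" for n
    proof (cases "n = 0")
      case False
      have "(z - 1) * (\<Sum>i<n. (E (- int i - 1) s - E (int i) s))
        = (E (- int n - 1) s - E (-1) s) - (E (-1) s - E (int n - 1) s)"
        by (simp add: sum_subtractf right_diff_distrib t1 t2)
      also have "norm ... \<le> 4" using Eb norm_triangle_ineq4 by (smt (verit, best))
      finally have "norm (z - 1) * norm (\<Sum>i<n. (E (- int i - 1) s - E (int i) s)) \<le> 4"
        by (simp add: norm_mult)
      then show ?thesis using False z by (simp add: Q_def field_simps)
    qed (simp add: Q_def)
    have "(\<lambda>n. (4 / norm (z - 1)) / real n) \<longlonglongrightarrow> 0" by (rule lim_const_over_n)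
    then have "(\<lambda>n. Q n s) \<longlonglongrightarrow> 0"
      by (rule Lim_null_comparison[rotated]) (intro always_eventually allI bd)
    then show ?thesis by (rule tendsto_mult_left_zero)
  qed
  have "(\<lambda>n. integral ?U (\<lambda>s. Q n s * \<psi> s)) \<longlonglongrightarrow> integral ?U (\<lambda>s. 0)"
  proof (rule dominated_convergence(2)[where h="\<lambda>s. 2 * C"])
    show bq: "norm (Q n s * \<psi> s) \<le> 2 * C" if "s \<in> ?U" for n s
      unfolding norm_mult using Qb bpsi[OF that] by (intro mult_mono) auto
    show "(\<lambda>s. Q n s * \<psi> s) integrable_on ?U" for n
      by (rule mb[where K="2*C"]) (use bq in \<open>auto intro!: continuous_intros cE cpsi simp: Q_def\<close>)
    show "(\<lambda>s. 2 * C) integrable_on ?U" unfolding integrable_on_Icc_iff_Ioo[symmetric] by (rule integrable_const_ivl)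
  qed (use Qlim in auto)
  then have "(\<lambda>n. (\<Sum>i<n. q i) /\<^sub>R real n) \<longlonglongrightarrow> 0" by (simp add: Qeq)
  then have "S - \<phi> 0 = 0" using LIMSEQ_unique[OF lim1[OF qlim]] by blast
  then show ?thesis by simp
qed

section \<open>Termwise differentiation\<close>

text \<open>Dominating the derivatives direction by direction is enough, because finitely many basis
  directions give one majorant that is uniform over all directions. An enumeration of the index set
  reduces the sum to a sequence of partial sums with uniformly convergent derivatives.\<close>

lemma has_derivative_infsum:
  fixes f :: "'i::countable \<Rightarrow> 'a::euclidean_space \<Rightarrow> complex"
  assumes inf: "infinite (UNIV :: 'i set)"
    and sm: "\<And>i. smooth (f i)"
    and bd0: "\<And>R. \<exists>a. a summable_on UNIV \<and> (\<forall>i x. norm x \<le> R \<longrightarrow> norm (f i x) \<le> a i)"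
    and bd1: "\<And>v R. \<exists>a. a summable_on UNIV \<and> (\<forall>i x. norm x \<le> R \<longrightarrow> norm (dd v (f i) x) \<le> a i)"
  shows "((\<lambda>x. \<Sum>\<^sub>\<infinity>i. f i x) has_derivative (\<lambda>v. \<Sum>\<^sub>\<infinity>i. dd v (f i) x)) (at x)"
proof -
  define e where "e = from_nat_into (UNIV :: 'i set)"
  have e: "bij_betw e UNIV UNIV"
    unfolding e_def by (rule bij_betw_from_nat_into) (use inf in auto)
  define R where "R = norm x + 1"
  define S where "S = ball (0::'a) R"
  have xS: "x \<in> S" by (simp add: S_def R_def)
  have sums: "(\<lambda>n. g (e n)) sums (\<Sum>\<^sub>\<infinity>i. g i)" "summable (\<lambda>n. norm (g (e n)))"
    if "a summable_on UNIV" "\<And>i. norm (g i) \<le> a i" for g :: "'i \<Rightarrow> complex" and a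
  proof -
    have "(\<lambda>i. norm (g i)) summable_on UNIV"
      by (rule Infinite_Sum.abs_summable_on_comparison_test'[OF that(1)]) (rule that(2))
    then have "(\<lambda>i. norm (g i)) summable_on UNIV" "g summable_on UNIV"
      using abs_summable_summable by auto
    then have "(\<lambda>n. norm (g (e n))) summable_on UNIV" "(\<lambda>n. g (e n)) summable_on UNIV"
      using summable_on_reindex_bij_betw[OF e, of "\<lambda>i. norm (g i)"] summable_on_reindex_bij_betw[OF e, of g] by auto
    moreover have "(\<Sum>\<^sub>\<infinity>n. g (e n)) = (\<Sum>\<^sub>\<infinity>i. g i)" by (rule infsum_reindex_bij_betw[OF e])
    ultimately show "(\<lambda>n. g (e n)) sums (\<Sum>\<^sub>\<infinity>i. g i)" "summable (\<lambda>n. norm (g (e n)))"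
      using has_sum_imp_sums[OF has_sum_infsum[of "\<lambda>n. g (e n)"]]
        summable_on_UNIV_nonneg_real_iff[of "\<lambda>n. norm (g (e n))"] by auto
  qed
  obtain a0 where a0: "a0 summable_on UNIV" "\<And>i y. norm y \<le> R \<Longrightarrow> norm (f i y) \<le> a0 i"
    using bd0[of R] by blast
  obtain a1 where a1: "\<And>b. a1 b summable_on UNIV" "\<And>b i y. norm y \<le> R \<Longrightarrow> norm (dd b (f i) y) \<le> a1 b i"
    using bd1[of R] by metis
  \<comment> \<open>The common majorant: the derivative of the i-th term along h is at most
    \<open>norm h * A i\<close> on the ball.\<close>
  define A where "A i = (\<Sum>b\<in>Basis. a1 b i)" for i
  have A: "A summable_on UNIV" 
  proof -
    have "(\<lambda>i. \<Sum>b\<in>B. a1 b i) summable_on UNIV" if "finite B" for B :: "'a set"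
      using that by (induction B) (auto intro!: summable_on_add a1)
    then show ?thesis unfolding A_def[abs_def] by simp
  qed
  have dA: "norm (dd h (f i) y) \<le> norm h * A i" if "norm y \<le> R" for h i y
  proof -
    have "dd h (f i) y = dd (\<Sum>b\<in>Basis. (h \<bullet> b) *\<^sub>R b) (f i) y" by (simp add: euclidean_representation)
    also have "... = (\<Sum>b\<in>Basis. (h \<bullet> b) *\<^sub>R dd b (f i) y)"
      by (simp add: linear_sum[OF dd_linear_arg[OF sm]] linear_scale[OF dd_linear_arg[OF sm]])
    also have "norm ... \<le> (\<Sum>b\<in>Basis. norm h * a1 b i)"
      by (intro sum_norm_le) (auto simp: intro!: mult_mono a1 that Basis_le_norm)
    finally show ?thesis by (simp add: A_def sum_distrib_left)
  qed
  have hA: "(\<lambda>i. norm h * A i) summable_on UNIV" for h :: 'a by (intro summable_on_cmult_right A)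
  have sA: "summable (\<lambda>n. A (e n))"
  proof -
    have A0: "A i \<ge> 0" for i
    proof (cases "\<exists>b::'a. b \<in> Basis")
      case True
      have "a1 b i \<ge> 0" for b 
      proof -
        have "norm (0::'a) \<le> R" by (simp add: R_def add_nonneg_nonneg)
        from order_trans[OF norm_ge_zero a1(2)[OF this]] show ?thesis .
      qed
      then show ?thesis by (simp add: A_def sum_nonneg)
    qed (simp add: A_def)
    have "(\<lambda>n. A (e n)) summable_on UNIV" using summable_on_reindex_bij_betw[OF e, of A] A by auto
    then show ?thesis by (subst (asm) summable_on_UNIV_nonneg_real_iff) (rule A0)
  qed
  have "\<exists>g. \<forall>y\<in>S. (\<lambda>n. \<Sum>i<n. f (e i) y) \<longlonglongrightarrow> g y \<and>
     (g has_derivative (\<lambda>v. \<Sum>\<^sub>\<infinity>i. dd v (f i) y)) (at y within S)"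
  proof (rule has_derivative_sequence[where f'="\<lambda>n y h. \<Sum>i<n. dd h (f (e i)) y"])
    show "convex S" by (simp add: S_def)
    show "((\<lambda>y. \<Sum>i<n. f (e i) y) has_derivative (\<lambda>h. \<Sum>i<n. dd h (f (e i)) y)) (at y within S)" for n y
      by (rule has_derivative_sum, rule has_derivative_at_withinI, rule smooth_has_derivative, rule sm)
    show "x \<in> S" by fact
    show "(\<lambda>n. \<Sum>i<n. f (e i) x) \<longlonglongrightarrow> (\<Sum>\<^sub>\<infinity>i. f i x)"
      using sums(1)[OF a0(1), of "\<lambda>i. f i x"] a0(2) by (auto simp: R_def sums_def)
    fix r :: real assume r: "r > 0"
    obtain N where N: "\<And>n. n \<ge> N \<Longrightarrow> norm (\<Sum>i. A (e (i + n))) < r"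
      using suminf_exist_split[OF r sA] by blast
    have "norm ((\<Sum>i<n. dd h (f (e i)) y) - (\<Sum>\<^sub>\<infinity>i. dd h (f i) y)) \<le> r * norm h"
      if n: "n \<ge> N" and y: "y \<in> S" for n y h
    proof -
      have y': "norm y \<le> R" using y by (simp add: S_def)
      note s = sums[OF hA[of h], of "\<lambda>i. dd h (f i) y", OF dA[OF y']]
      have "(\<lambda>i. dd h (f (e (i + n))) y) sums ((\<Sum>\<^sub>\<infinity>i. dd h (f i) y) - (\<Sum>i<n. dd h (f (e i)) y))"
        using sums_split_initial_segment[OF s(1)] by simp
      then have eq: "(\<Sum>i. dd h (f (e (i + n))) y) = (\<Sum>\<^sub>\<infinity>i. dd h (f i) y) - (\<Sum>i<n. dd h (f (e i)) y)"
        by (rule sums_unique[symmetric])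
      have sA': "summable (\<lambda>i. A (e (i + n)))" using summable_ignore_initial_segment[OF sA] .
      have "norm (\<Sum>i. dd h (f (e (i + n))) y) \<le> (\<Sum>i. norm h * A (e (i + n)))"
        by (rule norm_suminf_le[OF dA[OF y'] summable_mult[OF sA']])
      also have "... = norm h * (\<Sum>i. A (e (i + n)))" by (rule suminf_mult[OF sA'])
      also have "... \<le> norm h * r" using N[OF n] by (intro mult_left_mono) auto
      finally show ?thesis unfolding eq by (simp add: norm_minus_commute mult.commute)
    qed
    then show "\<forall>\<^sub>F n in sequentially. \<forall>y\<in>S. \<forall>h. norm ((\<Sum>i<n. dd h (f (e i)) y) - (\<Sum>\<^sub>\<infinity>i. dd h (f i) y)) \<le> r * norm h"
      unfolding eventually_sequentially by blast
  qed
  then obtain g where g: "\<And>y. y \<in> S \<Longrightarrow> (\<lambda>n. \<Sum>i<n. f (e i) y) \<longlonglongrightarrow> g y"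
     "\<And>y. y \<in> S \<Longrightarrow> (g has_derivative (\<lambda>v. \<Sum>\<^sub>\<infinity>i. dd v (f i) y)) (at y within S)" by blast
  have gx: "g y = (\<Sum>\<^sub>\<infinity>i. f i y)" if "y \<in> S" for y
  proof -
    have "(\<lambda>n. \<Sum>i<n. f (e i) y) \<longlonglongrightarrow> (\<Sum>\<^sub>\<infinity>i. f i y)"
      using sums(1)[OF a0(1), of "\<lambda>i. f i y"] a0(2) that by (auto simp: S_def sums_def)
    then show ?thesis using g(1)[OF that] LIMSEQ_unique by blast
  qed
  have "(g has_derivative (\<lambda>v. \<Sum>\<^sub>\<infinity>i. dd v (f i) x)) (at x)"
    using g(2)[OF xS] at_within_open[OF xS] by (simp add: S_def)
  then show ?thesis
    by (rule has_derivative_transform_within_open[of _ _ _ _ S]) (use xS gx in \<open>auto simp: S_def\<close>)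
qed

section \<open>Fourier coefficients along a direction\<close>

text \<open>The coefficient of s \<mapsto> f(x + s d) is kept as a function of x. So taking
  coefficients is an operator that commutes with translations and derivatives and can be iterated in
  several directions.\<close>

definition fc :: "int \<Rightarrow> 'a::euclidean_space \<Rightarrow> ('a \<Rightarrow> complex) \<Rightarrow> 'a \<Rightarrow> complex" where
  "fc k = dirint (\<lambda>s. cis (- (2 * pi * of_int k * s)))"

lemma cont_cis: "continuous_on A (\<lambda>s. cis (- (2 * pi * of_int k * s)))"
  by (intro continuous_intros)

lemma smooth_fc: "smooth f \<Longrightarrow> smooth (fc k d f)"
  unfolding fc_def by (rule smooth_dirint[OF cont_cis])

lemma dd_fc: "smooth f \<Longrightarrow> dd v (fc k d f) = fc k d (dd v f)"
  unfolding fc_def by (rule dd_dirint[OF cont_cis])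

lemma fc_integrable: "smooth f \<Longrightarrow> (\<lambda>s. cis (- (2 * pi * of_int k * s)) * f (x + s *\<^sub>R d)) integrable_on {0..1::real}"
  for f :: "'a::euclidean_space \<Rightarrow> complex"
  by (rule dirint_integrable[OF cont_cis smooth_imp_continuous_on])

lemma fc_add: "smooth f \<Longrightarrow> smooth g \<Longrightarrow> fc k d (\<lambda>x. f x + g x) = (\<lambda>x. fc k d f x + fc k d g x)"
  unfolding fc_def dirint_def
  by (simp only: distrib_left integral_add fc_integrable)

lemma fc_cmult: "(\<And>x s. c (x + s *\<^sub>R d) = c x) \<Longrightarrow> fc k d (\<lambda>x. c x * f x) = (\<lambda>x. c x * fc k d f x)"
  unfolding fc_def dirint_def by (simp only: mult.left_commute[of "cis _"] integral_mult_right)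

lemma fc_comp: "(\<And>x s. h (x + s *\<^sub>R d) = h x + s *\<^sub>R d) \<Longrightarrow> fc k d (\<lambda>x. f (h x)) = (\<lambda>x. fc k d f (h x))"
  unfolding fc_def dirint_def by simp

lemma fc_translate: "fc k d (\<lambda>x. f (x + a)) = (\<lambda>x. fc k d f (x + a))"
  by (rule fc_comp) (simp add: algebra_simps)

lemma fc_bound:
  assumes "smooth f" "\<And>s. s \<in> {0..1} \<Longrightarrow> norm (f (x + s *\<^sub>R d)) \<le> B"
  shows "norm (fc k d f x) \<le> B"
proof -
  have B: "B \<ge> 0" using order_trans[OF norm_ge_zero assms(2)[of 0]] by simp
  have "norm (fc k d f x) \<le> B * (1 - 0)"
    unfolding fc_def dirint_def
  proof (rule integral_bound)
    have "continuous_on {0..1} (\<lambda>s. f (x + s *\<^sub>R d))"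
      by (rule continuous_on_compose2[OF smooth_imp_continuous_on[OF assms(1), of UNIV]])
        (auto intro!: continuous_intros)
    then show "continuous_on {0..1} (\<lambda>s. cis (- (2 * pi * of_int k * s)) * f (x + s *\<^sub>R d))"
      by (intro continuous_on_mult cont_cis)
  qed (auto simp: norm_mult assms(2))
  then show ?thesis by simp
qed

text \<open>Integration by parts; periodicity cancels the boundary terms because the exponential is
  1 at both ends.\<close>

lemma fc_dd:
  assumes f: "smooth f" and per: "\<And>x. f (x + d) = f x"
  shows "fc k d (dd d f) = (\<lambda>x. 2 * pi * \<i> * of_int k * fc k d f x)"
proof
  fix x
  let ?E = "\<lambda>s. cis (- (2 * pi * of_int k * s))"
  have dE: "(?E has_vector_derivative (- (2 * pi * \<i> * of_int k) * ?E s)) (at s within {0..1})" for s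
    unfolding has_vector_derivative_def
    by (auto intro!: derivative_eq_intros simp: scaleR_conv_of_real algebra_simps)
  have "((\<lambda>s. ?E s * dd d f (x + s *\<^sub>R d) + (- (2 * pi * \<i> * of_int k) * ?E s) * f (x + s *\<^sub>R d))
     has_integral (?E 1 * f (x + 1 *\<^sub>R d) - ?E 0 * f (x + 0 *\<^sub>R d))) {0..1}"
    using fundamental_theorem_of_calculus[of 0 1, OF _ has_vector_derivative_mult[OF dE dd_along_line[OF f]]]
    by simp
  moreover have "?E 1 = 1" using cis_multiple_2pi[of "of_int (-k)"] by simp
  moreover have "integral {0..1} (\<lambda>s. ?E s * dd d f (x + s *\<^sub>R d) + (- (2 * pi * \<i> * of_int k)) * (?E s * f (x + s *\<^sub>R d)))
    = fc k d (dd d f) x + (- (2 * pi * \<i> * of_int k)) * fc k d f x"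
    unfolding fc_def dirint_def
    by (simp only: integral_add[OF fc_integrable[OF smooth_dd[OF f]] integrable_on_mult_right[OF fc_integrable[OF f]]] integral_mult_right)
  ultimately show "fc k d (dd d f) x = 2 * pi * \<i> * of_int k * fc k d f x"
    by (simp add: per has_integral_iff mult.assoc cis_zero)
qed

lemma fc_has_sum:
  assumes f: "smooth f" and per: "\<And>x. f (x + d) = f x" and s: "(\<lambda>k. fc k d f x) summable_on UNIV"
  shows "((\<lambda>k. fc k d f x) has_sum f x) UNIV"
proof -
  define \<phi> where "\<phi> s = f (x + s *\<^sub>R d)" for s
  have "((\<lambda>k. fc k d f x) has_sum (\<Sum>\<^sub>\<infinity>k. fc k d f x)) UNIV" using s by (rule has_sum_infsum)
  moreover have "(\<Sum>\<^sub>\<infinity>k. fc k d f x) = \<phi> 0"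
  proof (rule fourier_series_at_zero[where \<phi>'="\<lambda>s. dd d f (x + s *\<^sub>R d)"])
    show "(\<phi> has_vector_derivative dd d f (x + s *\<^sub>R d)) (at s)" for s
      unfolding \<phi>_def[abs_def] by (rule dd_along_line[OF f])
    show "continuous_on UNIV (\<lambda>s. dd d f (x + s *\<^sub>R d))"
      by (rule continuous_on_compose2[OF smooth_imp_continuous_on[OF smooth_dd[OF f], of UNIV]])
        (auto intro!: continuous_intros)
    show "\<phi> 1 = \<phi> 0" by (simp add: \<phi>_def per)
    show "((\<lambda>k. integral {0..1} (\<lambda>s. cis (- (2 * pi * of_int k * s)) * \<phi> s)) has_sum (\<Sum>\<^sub>\<infinity>k. fc k d f x)) UNIV"
      using has_sum_infsum[OF s] unfolding fc_def dirint_def \<phi>_def .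
  qed
  ultimately show ?thesis by (simp add: \<phi>_def)
qed

lemma fc_diff: "smooth f \<Longrightarrow> smooth g \<Longrightarrow> fc k d (\<lambda>x. f x - g x) = (\<lambda>x. fc k d f x - fc k d g x)"
  unfolding fc_def dirint_def
  by (simp only: right_diff_distrib integral_diff fc_integrable)

text \<open>A zero direction carries only frequency zero. This allows zero vectors among four
  directions when a series in two directions is wanted.\<close>

lemma fc_zero_direction:
  assumes "k \<noteq> 0" shows "fc k 0 f x = 0"
  using assms by (simp add: fc_def dirint_def integral_cis)

lemma smooth_cmult: "smooth f \<Longrightarrow> smooth (\<lambda>x. c * f x)" for f :: "'a::real_normed_vector \<Rightarrow> complex"
  by (rule smooth_linear_comp[OF bounded_linear_mult_right])

lemma dd_cmult: "smooth f \<Longrightarrow> dd v (\<lambda>x. c * f x) = (\<lambda>x. c * dd v f x)" for f :: "'a::real_normed_vector \<Rightarrow> complex"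
  by (rule dd_linear_comp[OF bounded_linear_mult_right])

lemma smooth_diff: "smooth f \<Longrightarrow> smooth g \<Longrightarrow> smooth (\<lambda>x. f x - g x)" for f :: "'a::real_normed_vector \<Rightarrow> complex"
  using smooth_add[OF _ smooth_cmult[of g "-1"], of f] by simp

lemma dd_diff: "smooth f \<Longrightarrow> smooth g \<Longrightarrow> dd v (\<lambda>x. f x - g x) = (\<lambda>x. dd v f x - dd v g x)"
  using dd_eqI[OF has_derivative_diff[OF smooth_has_derivative smooth_has_derivative]] by blast

definition lap :: "'a::real_normed_vector \<Rightarrow> ('a \<Rightarrow> complex) \<Rightarrow> 'a \<Rightarrow> complex" where
  "lap d f x = f x - dd d (dd d f) x"

text \<open>The factor by which \<open>lap\<close> acts on the k-th coefficient. The summand 1 in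
  \<open>lap\<close> keeps it at least 1 at frequency zero, and the square makes the reciprocals
  summable.\<close>

definition wt :: "int \<Rightarrow> real" where "wt k = 1 + (2 * pi * of_int k)\<^sup>2"

lemma smooth_lap: "smooth f \<Longrightarrow> smooth (lap d f)"
  unfolding lap_def[abs_def] by (intro smooth_diff smooth_dd)

lemma lap_cmult: "smooth f \<Longrightarrow> lap d (\<lambda>x. c * f x) = (\<lambda>x. c * lap d f x)"
  unfolding lap_def[abs_def] by (simp add: dd_cmult smooth_dd right_diff_distrib)

lemma lap_fc: "smooth f \<Longrightarrow> lap e (fc k d f) = fc k d (lap e f)"
  unfolding lap_def[abs_def] by (simp add: dd_fc smooth_dd fc_diff)

lemma dd_periodic: "smooth f \<Longrightarrow> (\<And>x. f (x + d) = f x) \<Longrightarrow> dd v f (x + d) = dd v f x"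
  using fun_cong[OF dd_translate[of f v d], of x] by simp

lemma fc_periodic: "(\<And>x. f (x + e) = f x) \<Longrightarrow> fc k d f (x + e) = fc k d f x"
  using fun_cong[OF fc_translate[of k d f e], of x] by simp

lemma fc_lap:
  assumes "smooth f" "\<And>x. f (x + d) = f x"
  shows "fc k d (lap d f) = (\<lambda>x. of_real (wt k) * fc k d f x)"
proof -
  have "fc k d (dd d (dd d f)) = (\<lambda>x. (2 * pi * \<i> * of_int k) * ((2 * pi * \<i> * of_int k) * fc k d f x))"
    by (simp only: fc_dd[OF smooth_dd[OF assms(1)] dd_periodic[OF assms]] fc_dd[OF assms])
  then show ?thesis unfolding lap_def[abs_def]
    by (simp only: fc_diff[OF assms(1) smooth_dd[OF smooth_dd[OF assms(1)]]])
      (simp add: wt_def power2_eq_square algebra_simps fun_eq_iff)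
qed

lemma wt_pos: "wt k \<ge> 1" by (simp add: wt_def)

lemma summable_wt: "(\<lambda>k. 1 / wt k) summable_on UNIV"
proof -
  have s: "(\<lambda>n. 1 / wt (int n)) summable_on UNIV"
  proof (subst summable_on_UNIV_nonneg_real_iff)
    show "0 \<le> 1 / wt (int n)" for n using wt_pos[of "int n"] by simp
    show "summable (\<lambda>n. 1 / wt (int n))"
    proof (rule summable_comparison_test')
      show "summable (\<lambda>n. inverse ((real n)\<^sup>2))" by (rule inverse_power_summable) simp
      show "norm (1 / wt (int n)) \<le> inverse ((real n)\<^sup>2)" if "n \<ge> 1" for n
      proof -
        have "(1 * real n)\<^sup>2 \<le> (2 * pi * real n)\<^sup>2"
          using pi_ge_two by (intro power_mono mult_right_mono) auto
        then have "(real n)\<^sup>2 \<le> 1 + (2 * pi * real n)\<^sup>2" unfolding mult_1 by linarith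
        then have "(real n)\<^sup>2 \<le> wt (int n)" by (simp add: wt_def)
        then show ?thesis using that wt_pos[of "int n"] by (simp add: divide_inverse le_imp_inverse_le)
      qed
    qed
  qed
  have e: "wt (- k) = wt k" for k by (simp add: wt_def)
  have "(\<lambda>k. 1 / wt k) summable_on range int"
    by (subst summable_on_reindex) (use s in \<open>auto simp: o_def\<close>)
  moreover have "(\<lambda>k. 1 / wt k) summable_on range (\<lambda>n. - int n)"
    by (subst summable_on_reindex) (use s e in \<open>auto simp: o_def inj_on_def\<close>)
  moreover have "UNIV = range int \<union> range (\<lambda>n. - int n)"
    by (metis (no_types) UNIV_eq_I Un_iff int_cases2 rangeI)
  ultimately show ?thesis by (metis summable_on_union)
qed

section \<open>Fourier multipliers in four directions\<close>

type_synonym freq = "int \<times> int \<times> int \<times> int"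

definition wt4 :: "freq \<Rightarrow> real" where "wt4 = (\<lambda>(a, b, c, d). wt a * wt b * wt c * wt d)"

lemma wt4_pos: "wt4 k > 0"
proof -
  have "wt k > 0" for k using wt_pos[of k] by linarith
  then show ?thesis by (auto simp: wt4_def split: prod.splits)
qed

lemma summable_wt4: "(\<lambda>k. 1 / wt4 k) summable_on UNIV"
proof -
  have pr: "(\<lambda>(x, y). f x * g y) summable_on UNIV"
    if "f summable_on UNIV" "g summable_on UNIV" "\<And>x. f x \<ge> 0" "\<And>x. g x \<ge> 0"
    for f :: "'x \<Rightarrow> real" and g :: "'y \<Rightarrow> real"
  proof -
    have "(\<lambda>(x, y). f x * g y) summable_on (UNIV \<times> UNIV)"
    proof (rule summable_on_SigmaI)
      show "((\<lambda>y. case (x, y) of (x, y) \<Rightarrow> f x * g y) has_sum (f x * infsum g UNIV)) UNIV" for x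
        using has_sum_cmult_right[OF has_sum_infsum[OF that(2)]] by simp
      show "(\<lambda>x. f x * infsum g UNIV) summable_on UNIV" by (rule summable_on_cmult_left[OF that(1)])
    qed (use that in auto)
    then show ?thesis by simp
  qed
  have p: "1 / wt k \<ge> 0" for k using wt_pos[of k] by simp
  note 2 = pr[OF summable_wt summable_wt p p]
  note 3 = pr[OF summable_wt 2 p]
  note 4 = pr[OF summable_wt 3 p]
  have "(\<lambda>(x, y). 1 / wt x * (case y of (x, y) \<Rightarrow> 1 / wt x * (case y of (x, y) \<Rightarrow> 1 / wt x * (1 / wt y)))) summable_on UNIV"
    by (rule 4) (use order_trans[OF zero_le_one wt_pos] in \<open>auto intro!: mult_nonneg_nonneg divide_nonneg_nonneg split: prod.splits\<close>)
  moreover have "(\<lambda>(x, y). 1 / wt x * (case y of (x, y) \<Rightarrow> 1 / wt x * (case y of (x, y) \<Rightarrow> 1 / wt x * (1 / wt y)))) = (\<lambda>k. 1 / wt4 k)"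
    by (auto simp: wt4_def fun_eq_iff)
  ultimately show ?thesis by simp
qed

text \<open>The directions are arbitrary vectors, possibly zero or dependent. The locale is
  instantiated by the central directions, padded by zeros, and by the four base directions.\<close>

locale four_directions =
  fixes d1 d2 d3 d4 :: "'a::euclidean_space"
begin

definition per :: "('a \<Rightarrow> complex) \<Rightarrow> bool" where
  "per f \<longleftrightarrow> smooth f \<and> (\<forall>x. f (x + d1) = f x) \<and> (\<forall>x. f (x + d2) = f x)
     \<and> (\<forall>x. f (x + d3) = f x) \<and> (\<forall>x. f (x + d4) = f x)"

definition fc4 :: "freq \<Rightarrow> ('a \<Rightarrow> complex) \<Rightarrow> 'a \<Rightarrow> complex" where
  "fc4 = (\<lambda>(k1, k2, k3, k4) f. fc k1 d1 (fc k2 d2 (fc k3 d3 (fc k4 d4 f))))"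

definition mult :: "(freq \<Rightarrow> complex) \<Rightarrow> ('a \<Rightarrow> complex) \<Rightarrow> 'a \<Rightarrow> complex" where
  "mult m f x = (\<Sum>\<^sub>\<infinity>k. m k * fc4 k f x)"

lemma per_smooth: "per f \<Longrightarrow> smooth f" by (simp add: per_def)

lemma per_dd: "per f \<Longrightarrow> per (dd v f)"
  by (simp add: per_def smooth_dd dd_periodic)

lemma per_fc: "per f \<Longrightarrow> per (fc k e f)"
  by (simp add: per_def smooth_fc fc_periodic)

lemma per_lap: "per f \<Longrightarrow> per (lap e f)"
  using per_dd[OF per_dd, of f] by (simp add: per_def smooth_lap lap_def)

lemma per_fc4: "per f \<Longrightarrow> per (fc4 k f)"
  by (auto simp: fc4_def per_fc split: prod.splits)

lemma per_add: "per f \<Longrightarrow> per g \<Longrightarrow> per (\<lambda>x. f x + g x)"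
  by (simp add: per_def smooth_add)

lemma per_cmult: "per f \<Longrightarrow> per (\<lambda>x. c * f x)"
  by (simp add: per_def smooth_cmult)

lemma fc4_dd_comm: "smooth f \<Longrightarrow> fc4 k (dd v f) = dd v (fc4 k f)"
  by (auto simp: fc4_def dd_fc smooth_fc split: prod.splits)

lemma fc4_add: "smooth f \<Longrightarrow> smooth g \<Longrightarrow> fc4 k (\<lambda>x. f x + g x) = (\<lambda>x. fc4 k f x + fc4 k g x)"
  by (auto simp: fc4_def fc_add smooth_fc split: prod.splits)

lemma fc4_cmult:
  assumes "\<And>x s. c (x + s *\<^sub>R d1) = c x" "\<And>x s. c (x + s *\<^sub>R d2) = c x"
    "\<And>x s. c (x + s *\<^sub>R d3) = c x" "\<And>x s. c (x + s *\<^sub>R d4) = c x"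
  shows "fc4 k (\<lambda>x. c x * f x) = (\<lambda>x. c x * fc4 k f x)"
proof -
  obtain k1 k2 k3 k4 where k: "k = (k1, k2, k3, k4)" by (cases k)
  show ?thesis
    unfolding k fc4_def prod.case fc_cmult[of c d4 k4 f, OF assms(4)]
      fc_cmult[of c d3 k3 "fc k4 d4 f", OF assms(3)]
      fc_cmult[of c d2 k2 "fc k3 d3 (fc k4 d4 f)", OF assms(2)]
      fc_cmult[of c d1 k1 "fc k2 d2 (fc k3 d3 (fc k4 d4 f))", OF assms(1)] ..
qed

lemma fc4_comp:
  assumes "\<And>x s. h (x + s *\<^sub>R d1) = h x + s *\<^sub>R d1" "\<And>x s. h (x + s *\<^sub>R d2) = h x + s *\<^sub>R d2"
    "\<And>x s. h (x + s *\<^sub>R d3) = h x + s *\<^sub>R d3" "\<And>x s. h (x + s *\<^sub>R d4) = h x + s *\<^sub>R d4"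
  shows "fc4 k (\<lambda>x. f (h x)) = (\<lambda>x. fc4 k f (h x))"
proof -
  obtain k1 k2 k3 k4 where k: "k = (k1, k2, k3, k4)" by (cases k)
  show ?thesis
    unfolding k fc4_def prod.case fc_comp[of h d4 k4 f, OF assms(4)]
      fc_comp[of h d3 k3 "fc k4 d4 f", OF assms(3)]
      fc_comp[of h d2 k2 "fc k3 d3 (fc k4 d4 f)", OF assms(2)]
      fc_comp[of h d1 k1 "fc k2 d2 (fc k3 d3 (fc k4 d4 f))", OF assms(1)] ..
qed

lemma fc4_dd:
  assumes "per f"
  shows "fc4 (k1, k2, k3, k4) (dd d1 f) x = 2 * pi * \<i> * of_int k1 * fc4 (k1, k2, k3, k4) f x"
    "fc4 (k1, k2, k3, k4) (dd d2 f) x = 2 * pi * \<i> * of_int k2 * fc4 (k1, k2, k3, k4) f x"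
    "fc4 (k1, k2, k3, k4) (dd d3 f) x = 2 * pi * \<i> * of_int k3 * fc4 (k1, k2, k3, k4) f x"
    "fc4 (k1, k2, k3, k4) (dd d4 f) x = 2 * pi * \<i> * of_int k4 * fc4 (k1, k2, k3, k4) f x"
proof -
  have fd: "fc k d1 (dd d1 g) = (\<lambda>x. 2 * pi * \<i> * of_int k * fc k d1 g x)"
    "fc k d2 (dd d2 g) = (\<lambda>x. 2 * pi * \<i> * of_int k * fc k d2 g x)"
    "fc k d3 (dd d3 g) = (\<lambda>x. 2 * pi * \<i> * of_int k * fc k d3 g x)"
    "fc k d4 (dd d4 g) = (\<lambda>x. 2 * pi * \<i> * of_int k * fc k d4 g x)" if "per g" for k g
    using that by (intro fc_dd; simp add: per_def)+
  have sm: "smooth g" if "per g" for g using that by (rule per_smooth)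
  have com: "fc k e (dd v g) = dd v (fc k e g)" if "per g" for k e v g
    using dd_fc[OF sm[OF that]] by simp
  have cm: "fc k e (\<lambda>x. c * g x) = (\<lambda>x. c * fc k e g x)" for k e c and g :: "'a \<Rightarrow> complex"
    by (rule fc_cmult) simp
  note c1 = com[OF assms] and c2 = com[OF per_fc[OF assms, of k4 d4]]
    and c3 = com[OF per_fc[OF per_fc[OF assms, of k4 d4], of k3 d3]]
  show "fc4 (k1, k2, k3, k4) (dd d1 f) x = 2 * pi * \<i> * of_int k1 * fc4 (k1, k2, k3, k4) f x"
    unfolding fc4_def by (simp only: prod.case c1 c2 c3 fd per_fc assms)
  show "fc4 (k1, k2, k3, k4) (dd d2 f) x = 2 * pi * \<i> * of_int k2 * fc4 (k1, k2, k3, k4) f x"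
    unfolding fc4_def by (simp only: prod.case c1 c2 fd per_fc assms cm)
  show "fc4 (k1, k2, k3, k4) (dd d3 f) x = 2 * pi * \<i> * of_int k3 * fc4 (k1, k2, k3, k4) f x"
    unfolding fc4_def by (simp only: prod.case c1 fd per_fc assms cm)
  show "fc4 (k1, k2, k3, k4) (dd d4 f) x = 2 * pi * \<i> * of_int k4 * fc4 (k1, k2, k3, k4) f x"
    unfolding fc4_def by (simp only: prod.case fd assms cm)
qed

text \<open>The source of decay: one application of \<open>lap\<close> in each direction multiplies
  the coefficient by a weight with summable reciprocal.\<close>

lemma fc4_lap:
  assumes "per f"
  shows "fc4 k (lap d1 (lap d2 (lap d3 (lap d4 f)))) x = of_real (wt4 k) * fc4 k f x"
proof -
  obtain k1 k2 k3 k4 where k: "k = (k1, k2, k3, k4)" by (cases k)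
  have fl: "fc k d1 (lap d1 g) = (\<lambda>x. of_real (wt k) * fc k d1 g x)"
    "fc k d2 (lap d2 g) = (\<lambda>x. of_real (wt k) * fc k d2 g x)"
    "fc k d3 (lap d3 g) = (\<lambda>x. of_real (wt k) * fc k d3 g x)"
    "fc k d4 (lap d4 g) = (\<lambda>x. of_real (wt k) * fc k d4 g x)" if "per g" for k g
    using that by (intro fc_lap; simp add: per_def)+
  have com: "fc k e (lap v g) = lap v (fc k e g)" if "per g" for k e v g
    using lap_fc[OF per_smooth[OF that]] by simp
  have cm: "fc k e (\<lambda>x. c * g x) = (\<lambda>x. c * fc k e g x)" for k e c and g :: "'a \<Rightarrow> complex"
    by (rule fc_cmult) simp
  have lc: "lap e (\<lambda>x. c * g x) = (\<lambda>x. c * lap e g x)" if "per g" for e c g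
    using lap_cmult[OF per_smooth[OF that]] .
  let ?f4 = "fc k4 d4 f"
  let ?f3 = "fc k3 d3 ?f4"
  let ?f2 = "fc k2 d2 ?f3"
  have p4: "per ?f4" and p3: "per ?f3" and p2: "per ?f2" by (intro per_fc assms)+
  note l = com[OF assms] com[OF per_lap[OF assms]] com[OF per_lap[OF per_lap[OF assms]]]
    com[OF per_lap[OF per_lap[OF per_lap[OF assms]]]]
  note l4 = com[OF p4] com[OF per_lap[OF p4]] com[OF per_lap[OF per_lap[OF p4]]]
  note l3 = com[OF p3] com[OF per_lap[OF p3]]
  have e4: "lap d4 ?f4 = (\<lambda>x. of_real (wt k4) * ?f4 x)" using fl(4)[OF assms] unfolding l .
  have e3: "lap d3 ?f3 = (\<lambda>x. of_real (wt k3) * ?f3 x)" using fl(3)[OF p4] unfolding l4 .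
  have e2: "lap d2 ?f2 = (\<lambda>x. of_real (wt k2) * ?f2 x)" using fl(2)[OF p3] unfolding l3 .
  have 1: "fc k4 d4 (lap d1 (lap d2 (lap d3 (lap d4 f)))) = (\<lambda>x. of_real (wt k4) * lap d1 (lap d2 (lap d3 ?f4)) x)"
    unfolding l e4 lc[OF p4] lc[OF per_lap[OF p4]] lc[OF per_lap[OF per_lap[OF p4]]] ..
  have 2: "fc k3 d3 (lap d1 (lap d2 (lap d3 ?f4))) = (\<lambda>x. of_real (wt k3) * lap d1 (lap d2 ?f3) x)"
    unfolding l4 e3 lc[OF p3] lc[OF per_lap[OF p3]] ..
  have 3: "fc k2 d2 (lap d1 (lap d2 ?f3)) = (\<lambda>x. of_real (wt k2) * lap d1 ?f2 x)"
    unfolding l3 e2 lc[OF p2] ..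
  have 4: "fc k1 d1 (lap d1 ?f2) = (\<lambda>x. of_real (wt k1) * fc k1 d1 ?f2 x)"
    by (rule fl(1)[OF p2])
  have "fc4 k (lap d1 (lap d2 (lap d3 (lap d4 f)))) x
    = of_real (wt k4) * (of_real (wt k3) * (of_real (wt k2) * (of_real (wt k1) * fc k1 d1 ?f2 x)))"
    unfolding k fc4_def prod.case 1 cm 2 3 4 ..
  then show ?thesis by (simp add: k fc4_def wt4_def)
qed

text \<open>Each one-directional coefficient averages over a segment of length
  \<open>norm d\<close>, so four of them consume the enlargement of the radius by the four
  norms.\<close>

lemma fc4_sup:
  assumes "smooth f" and "\<And>y. norm y \<le> R + norm d1 + norm d2 + norm d3 + norm d4 \<Longrightarrow> norm (f y) \<le> B"
    and "norm x \<le> R"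
  shows "norm (fc4 k f x) \<le> B"
proof -
  obtain k1 k2 k3 k4 where k: "k = (k1, k2, k3, k4)" by (cases k)
  have step: "norm (fc k d g y) \<le> B"
    if "smooth g" "\<And>y. norm y \<le> r + norm d \<Longrightarrow> norm (g y) \<le> B" "norm y \<le> r"
    for g :: "'a \<Rightarrow> complex" and k d y r
  proof (rule fc_bound[OF that(1)])
    fix s :: real assume s: "s \<in> {0..1}"
    have "norm (y + s *\<^sub>R d) \<le> norm y + norm (s *\<^sub>R d)" by (rule norm_triangle_ineq)
    also have "... \<le> r + norm d" using that(3) s by (auto intro!: add_mono mult_left_le_one_le)
    finally show "norm (g (y + s *\<^sub>R d)) \<le> B" by (rule that(2))
  qed
  have "norm (fc k4 d4 f y) \<le> B" if "norm y \<le> R + norm d1 + norm d2 + norm d3" for y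
    by (rule step[OF assms(1) _ that]) (rule assms(2))
  then have "norm (fc k3 d3 (fc k4 d4 f) y) \<le> B" if "norm y \<le> R + norm d1 + norm d2" for y
    by (intro step[OF smooth_fc[OF assms(1)] _ that]) auto
  then have "norm (fc k2 d2 (fc k3 d3 (fc k4 d4 f)) y) \<le> B" if "norm y \<le> R + norm d1" for y
    by (intro step[OF smooth_fc[OF smooth_fc[OF assms(1)]] _ that]) auto
  then have "norm (fc k1 d1 (fc k2 d2 (fc k3 d3 (fc k4 d4 f))) x) \<le> B"
    by (intro step[OF smooth_fc[OF smooth_fc[OF smooth_fc[OF assms(1)]]] _ assms(3)]) auto
  then show ?thesis by (simp add: k fc4_def)
qed

text \<open>The coefficients of the smooth function obtained by four applications of
  \<open>lap\<close> are bounded on balls; dividing by the weight gives a majorant that is uniform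
  in x and summable in k.\<close>

lemma fc4_decay:
  assumes "per f"
  shows "\<exists>C\<ge>0. \<forall>k x. norm x \<le> R \<longrightarrow> norm (fc4 k f x) \<le> C * (1 / wt4 k)"
proof -
  define g where "g = lap d1 (lap d2 (lap d3 (lap d4 f)))"
  have g: "per g" unfolding g_def by (intro per_lap assms)
  let ?R = "R + norm d1 + norm d2 + norm d3 + norm d4"
  have "compact (g ` cball 0 ?R)"
    by (intro compact_continuous_image smooth_imp_continuous_on per_smooth[OF g]) auto
  from compact_imp_bounded[OF this] obtain B where "\<forall>y\<in>g ` cball 0 ?R. norm y \<le> B" unfolding bounded_iff by blast
  then have B: "norm (g y) \<le> B" if "norm y \<le> ?R" for y using that by auto
  show ?thesis
  proof (intro exI[of _ "max B 0"] conjI allI impI)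
    fix k and x :: 'a assume x: "norm x \<le> R"
    have "norm (fc4 k g x) \<le> B" by (rule fc4_sup[OF per_smooth[OF g] B x])
    then have "wt4 k * norm (fc4 k f x) \<le> max B 0"
      using fc4_lap[OF assms, of k x] wt4_pos[of k] by (simp add: g_def norm_mult)
    then show "norm (fc4 k f x) \<le> max B 0 * (1 / wt4 k)"
      using wt4_pos[of k] by (simp add: field_simps)
  qed simp
qed

lemma mult_term_bound:
  assumes "per f" "\<forall>k. norm (m k) \<le> K"
  shows "\<exists>a. a summable_on UNIV \<and> (\<forall>k x. norm x \<le> R \<longrightarrow> norm (m k * fc4 k f x) \<le> a k)"
proof -
  obtain C where C: "C \<ge> 0" "\<And>k x. norm x \<le> R \<Longrightarrow> norm (fc4 k f x) \<le> C * (1 / wt4 k)"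
    using fc4_decay[OF assms(1), of R] by blast
  have K: "K \<ge> 0" using order_trans[OF norm_ge_zero assms(2)[THEN spec]] .
  have "norm (m k * fc4 k f x) \<le> (K * C) * (1 / wt4 k)" if "norm x \<le> R" for k x
    using mult_mono[OF assms(2)[THEN spec, of k] C(2)[OF that, of k] K norm_ge_zero] by (simp add: norm_mult)
  moreover have "(\<lambda>k. (K * C) * (1 / wt4 k)) summable_on UNIV"
    by (rule summable_on_cmult_right[OF summable_wt4])
  ultimately show ?thesis by blast
qed

lemma mult_summable:
  assumes "per f" "\<forall>k. norm (m k) \<le> K"
  shows "(\<lambda>k. m k * fc4 k f x) summable_on UNIV"
proof -
  obtain a where a: "a summable_on UNIV" "\<And>k. norm (m k * fc4 k f x) \<le> a k"
    using mult_term_bound[OF assms, of "norm x"] by blast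
  have "(\<lambda>k. norm (m k * fc4 k f x)) summable_on UNIV"
    by (rule Infinite_Sum.abs_summable_on_comparison_test'[OF a(1)]) (rule a(2))
  then show ?thesis by (rule Infinite_Sum.abs_summable_summable)
qed

lemma dd_mult_op:
  assumes "per f" "\<forall>k. norm (m k) \<le> K"
  shows "mult m f differentiable (at x)" "dd v (mult m f) = mult m (dd v f)"
proof -
  have sm: "smooth (\<lambda>x. m k * fc4 k f x)" for k
    by (intro smooth_cmult per_smooth per_fc4 assms)
  have d: "dd v (\<lambda>x. m k * fc4 k f x) = (\<lambda>x. m k * fc4 k (dd v f) x)" for v k
    using dd_cmult[OF per_smooth[OF per_fc4[OF assms(1)]]] fc4_dd_comm[OF per_smooth[OF assms(1)]] by simp
  have inf: "infinite (UNIV :: freq set)" by (simp add: finite_prod)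
  have *: "(mult m f has_derivative (\<lambda>v. \<Sum>\<^sub>\<infinity>k. dd v (\<lambda>x. m k * fc4 k f x) x)) (at x)" for x
    unfolding mult_def[abs_def]
  proof (rule has_derivative_infsum[OF inf sm])
    show "\<exists>a. a summable_on UNIV \<and> (\<forall>k x. norm x \<le> R \<longrightarrow> norm (m k * fc4 k f x) \<le> a k)" for R
      by (rule mult_term_bound[OF assms])
    show "\<exists>a. a summable_on UNIV \<and> (\<forall>k x. norm x \<le> R \<longrightarrow> norm (dd v (\<lambda>x. m k * fc4 k f x) x) \<le> a k)" for v R
      unfolding d by (rule mult_term_bound[OF per_dd[OF assms(1)] assms(2)])
  qed
  show "mult m f differentiable (at x)" by (rule differentiableI[OF *])
  show "dd v (mult m f) = mult m (dd v f)"
    by (rule ext, rule trans[OF dd_eqI[OF *]]) (simp only: d mult_def)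
qed

lemma per_mult:
  assumes f: "per f" and m: "\<forall>k. norm (m k) \<le> K"
  shows "per (mult m f)"
proof -
  have "smooth (mult m f)"
  proof (rule smooth_coinduct[where P="\<lambda>h. \<exists>f. per f \<and> h = mult m f"], goal_cases)
    case 1 show ?case using f by (intro exI[of _ f]) simp
  next
    case (2 h x)
    then obtain g where g: "per g" "h = mult m g" by auto
    show ?case unfolding g(2) by (rule dd_mult_op(1)[OF g(1) m])
  next
    case (3 h v)
    then obtain g where g: "per g" "h = mult m g" by auto
    show ?case unfolding g(2) dd_mult_op(2)[OF g(1) m] by (intro exI[of _ "dd v g"] conjI refl per_dd g(1))
  qed
  then show ?thesis using per_fc4[OF f] by (simp add: per_def mult_def)
qed

lemma mult_add:
  assumes "per f" "per g" "\<forall>k. norm (m k) \<le> K"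
  shows "mult m (\<lambda>x. f x + g x) = (\<lambda>x. mult m f x + mult m g x)"
proof
  fix x
  show "mult m (\<lambda>x. f x + g x) x = mult m f x + mult m g x"
    unfolding mult_def fc4_add[OF per_smooth[OF assms(1)] per_smooth[OF assms(2)]] distrib_left
    by (rule infsum_add[OF mult_summable[OF assms(1,3)] mult_summable[OF assms(2,3)]])
qed

text \<open>The factor c need only be constant along the four directions. With x $ 1 as factor and
  central directions, this is why multipliers commute with the variable coefficient of the left
  invariant fields.\<close>

lemma mult_cmult:
  assumes "\<And>x s. c (x + s *\<^sub>R d1) = c x" "\<And>x s. c (x + s *\<^sub>R d2) = c x"
    "\<And>x s. c (x + s *\<^sub>R d3) = c x" "\<And>x s. c (x + s *\<^sub>R d4) = c x"
  shows "mult m (\<lambda>x. c x * f x) = (\<lambda>x. c x * mult m f x)"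
  unfolding mult_def fc4_cmult[of c _ f, OF assms] by (simp add: mult.left_commute infsum_cmult_right')

lemma mult_comp:
  assumes "\<And>x s. h (x + s *\<^sub>R d1) = h x + s *\<^sub>R d1" "\<And>x s. h (x + s *\<^sub>R d2) = h x + s *\<^sub>R d2"
    "\<And>x s. h (x + s *\<^sub>R d3) = h x + s *\<^sub>R d3" "\<And>x s. h (x + s *\<^sub>R d4) = h x + s *\<^sub>R d4"
  shows "mult m (\<lambda>x. f (h x)) = (\<lambda>x. mult m f (h x))"
  unfolding mult_def fc4_comp[of h _ f, OF assms] ..

text \<open>Absolute summability over all frequencies permits summing one frequency at a time; every
  single sum is an inversion in one variable and removes one coefficient operator.\<close>

lemma fc4_inversion:
  assumes f: "per f" shows "(\<Sum>\<^sub>\<infinity>k. fc4 k f x) = f x"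
proof -
  \<comment> \<open>One elimination: the sum over the outermost frequency is carried out inside, and
    summability of the remaining family is passed on. The inner evaluation may assume summability,
    since one-variable inversion only identifies the value of a convergent sum.\<close>
  have col: "infsum (\<lambda>(k, r). h k r) UNIV = infsum H UNIV \<and> H summable_on UNIV"
    if s: "(\<lambda>(k, r). h k r) summable_on UNIV"
      and H: "\<And>r. (\<lambda>k. h k r) summable_on UNIV \<Longrightarrow> (\<Sum>\<^sub>\<infinity>k. h k r) = H r"
    for h :: "int \<Rightarrow> 'r \<Rightarrow> complex" and H
  proof -
    have s': "(\<lambda>(k, r). h k r) summable_on UNIV \<times> UNIV" using s by simp
    then have s2: "(\<lambda>(r, k). h k r) summable_on UNIV \<times> UNIV"
      by (subst (asm) summable_on_swap) (simp add: case_prod_unfold)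
    have Hr: "(\<Sum>\<^sub>\<infinity>k. h k r) = H r" for r
    proof (rule H)
      have "(\<lambda>(k, r). h k r) summable_on (range (\<lambda>k. (k, r)))"
        by (rule summable_on_subset_banach[OF s]) simp
      then show "(\<lambda>k. h k r) summable_on UNIV"
        by (subst (asm) summable_on_reindex) (auto simp: inj_on_def o_def)
    qed
    have "infsum (\<lambda>(k, r). h k r) UNIV = (\<Sum>\<^sub>\<infinity>k. \<Sum>\<^sub>\<infinity>r. h k r)"
      using infsum_Sigma'_banach[OF s'] by simp
    also have "... = (\<Sum>\<^sub>\<infinity>r. \<Sum>\<^sub>\<infinity>k. h k r)" by (rule infsum_swap_banach[OF s'])
    finally show ?thesis using summable_on_Sigma_banach[OF s2] by (simp add: Hr)
  qed
  have inv: "(\<Sum>\<^sub>\<infinity>k. fc k d g x) = g x"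
    if "smooth g" "\<And>x. g (x + d) = g x" "(\<lambda>k. fc k d g x) summable_on UNIV" for d g and x :: 'a
    by (rule infsumI, rule fc_has_sum) (use that in auto)
  have P: "per (fc k4 d4 f)" "per (fc k3 d3 (fc k4 d4 f))" "per (fc k2 d2 (fc k3 d3 (fc k4 d4 f)))"
    for k2 k3 k4 by (intro per_fc f)+
  define h1 where "h1 k r = fc4 (k, r) f x" for k r
  define h2 where "h2 k r = (case r of (k3, k4) \<Rightarrow> fc k d2 (fc k3 d3 (fc k4 d4 f)) x)" for k r
  define h3 where "h3 k r = fc k d3 (fc r d4 f) x" for k r
  have s1: "(\<lambda>(k, r). h1 k r) summable_on UNIV"
    using mult_summable[OF f, of "\<lambda>_. 1" 1 x] by (simp add: h1_def case_prod_unfold)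
  have 1: "infsum (\<lambda>(k, r). h1 k r) UNIV = infsum (\<lambda>(k, r). h2 k r) UNIV \<and> (\<lambda>(k, r). h2 k r) summable_on UNIV"
  proof (rule col[OF s1])
    fix r :: "int \<times> int \<times> int"
    assume s: "(\<lambda>k. h1 k r) summable_on UNIV"
    obtain a b c where r: "r = (a, b, c)" by (cases r)
    show "(\<Sum>\<^sub>\<infinity>k. h1 k r) = (case r of (k, r) \<Rightarrow> h2 k r)"
      using s unfolding r h1_def h2_def fc4_def prod.case
      by (rule inv[rotated 2]) (use P(3)[of a b c] in \<open>auto simp: per_def\<close>)
  qed
  have 2: "infsum (\<lambda>(k, r). h2 k r) UNIV = infsum (\<lambda>(k, r). h3 k r) UNIV \<and> (\<lambda>(k, r). h3 k r) summable_on UNIV"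
  proof (rule col[OF conjunct2[OF 1]])
    fix r :: "int \<times> int"
    assume s: "(\<lambda>k. h2 k r) summable_on UNIV"
    obtain b c where r: "r = (b, c)" by (cases r)
    show "(\<Sum>\<^sub>\<infinity>k. h2 k r) = (case r of (k, r) \<Rightarrow> h3 k r)"
      using s unfolding r h2_def h3_def prod.case
      by (rule inv[rotated 2]) (use P(2)[of b c] in \<open>auto simp: per_def\<close>)
  qed
  have 3: "infsum (\<lambda>(k, r). h3 k r) UNIV = infsum (\<lambda>k. fc k d4 f x) UNIV \<and> (\<lambda>k. fc k d4 f x) summable_on UNIV"
  proof (rule col[OF conjunct2[OF 2]])
    fix r :: int
    assume s: "(\<lambda>k. h3 k r) summable_on UNIV"
    show "(\<Sum>\<^sub>\<infinity>k. h3 k r) = fc r d4 f x"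
      using s unfolding h3_def
      by (rule inv[rotated 2]) (use P(1)[of r] in \<open>auto simp: per_def\<close>)
  qed
  have "(\<Sum>\<^sub>\<infinity>k. fc k d4 f x) = f x"
    by (rule inv) (use f 3 in \<open>auto simp: per_def\<close>)
  moreover have "(\<Sum>\<^sub>\<infinity>k. fc4 k f x) = infsum (\<lambda>(k, r). h1 k r) UNIV"
    by (simp add: h1_def case_prod_unfold)
  ultimately show ?thesis using 1 2 3 by simp
qed

text \<open>The symbol is to be 1 at every nonzero frequency that actually occurs. Frequencies whose
  coefficient vanishes are exempt, which is what happens in zero directions.\<close>

lemma mult_eq_zero_freq:
  assumes f: "per f" and m: "\<forall>k. norm (m k) \<le> K"
    and one: "\<And>k x. k \<noteq> (0, 0, 0, 0) \<Longrightarrow> m k = 1 \<or> fc4 k f x = 0" and zero: "m (0, 0, 0, 0) = 0"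
  shows "f x = fc4 (0, 0, 0, 0) f x + mult m f x"
proof -
  have s1: "(\<lambda>k. fc4 k f x) summable_on UNIV"
    using mult_summable[OF f, of "\<lambda>_. 1" 1 x] by simp
  have s2: "(\<lambda>k. m k * fc4 k f x) summable_on UNIV" by (rule mult_summable[OF f m])
  have "f x = (\<Sum>\<^sub>\<infinity>k. fc4 k f x)" by (rule fc4_inversion[OF f, symmetric])
  also have "... = (\<Sum>\<^sub>\<infinity>k. (if k = (0, 0, 0, 0) then fc4 k f x else 0) + m k * fc4 k f x)"
    by (rule infsum_cong) (use one[of _ x] zero in auto)
  also have "... = (\<Sum>\<^sub>\<infinity>k. if k = (0, 0, 0, 0) then fc4 k f x else 0) + mult m f x"
    unfolding mult_def
  proof (rule infsum_add[OF _ s2])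
    show "(\<lambda>k. if k = (0, 0, 0, 0) then fc4 k f x else 0) summable_on UNIV"
      using has_sum_finite_neutralI[of "{(0,0,0,0)}" UNIV "\<lambda>k. if k = (0, 0, 0, 0) then fc4 k f x else 0"]
      by (auto simp: summable_on_def)
  qed
  also have "(\<Sum>\<^sub>\<infinity>k. if k = (0, 0, 0, 0) then fc4 k f x else 0) = fc4 (0, 0, 0, 0) f x"
    by (rule infsumI)
      (use has_sum_finite_neutralI[of "{(0,0,0,0)}" UNIV "\<lambda>k. if k = (0, 0, 0, 0) then fc4 k f x else 0"] in auto)
  finally show ?thesis .
qed

lemma mult_symbol:
  assumes f: "per f" and g: "per g" and m: "\<forall>k. norm (m k) \<le> K" and m': "\<forall>k. norm (m' k) \<le> K'"
    and eq: "\<And>k x. m k * fc4 k f x = m' k * fc4 k g x"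
  shows "mult m f = mult m' g"
  unfolding mult_def eq ..

lemma fc4_degenerate:
  shows "d1 = 0 \<Longrightarrow> a \<noteq> 0 \<Longrightarrow> fc4 (a, b, c, e) f x = 0"
    "d2 = 0 \<Longrightarrow> b \<noteq> 0 \<Longrightarrow> fc4 (a, b, c, e) f x = 0"
    "d3 = 0 \<Longrightarrow> c \<noteq> 0 \<Longrightarrow> fc4 (a, b, c, e) f x = 0"
    "d4 = 0 \<Longrightarrow> e \<noteq> 0 \<Longrightarrow> fc4 (a, b, c, e) f x = 0"
proof -
  have z: "fc k d (\<lambda>x. 0) = (\<lambda>x. 0)" for k and d :: 'a by (simp add: fc_def dirint_def fun_eq_iff)
  have z0: "fc k 0 f = (\<lambda>x. 0)" if "k \<noteq> 0" for k and f :: "'a \<Rightarrow> complex" using fc_zero_direction[OF that] by auto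
  show "d1 = 0 \<Longrightarrow> a \<noteq> 0 \<Longrightarrow> fc4 (a, b, c, e) f x = 0" unfolding fc4_def by (simp add: z0)
  show "d2 = 0 \<Longrightarrow> b \<noteq> 0 \<Longrightarrow> fc4 (a, b, c, e) f x = 0" unfolding fc4_def by (simp add: z z0)
  show "d3 = 0 \<Longrightarrow> c \<noteq> 0 \<Longrightarrow> fc4 (a, b, c, e) f x = 0" unfolding fc4_def by (simp add: z z0)
  show "d4 = 0 \<Longrightarrow> e \<noteq> 0 \<Longrightarrow> fc4 (a, b, c, e) f x = 0" unfolding fc4_def by (simp add: z z0)
qed

lemma fc4_zero_dd:
  assumes "per f"
  shows "dd d1 (fc4 (0, 0, 0, 0) f) x = 0" "dd d2 (fc4 (0, 0, 0, 0) f) x = 0"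
    "dd d3 (fc4 (0, 0, 0, 0) f) x = 0" "dd d4 (fc4 (0, 0, 0, 0) f) x = 0"
  using fc4_dd[OF assms, of 0 0 0 0 x] unfolding fc4_dd_comm[OF per_smooth[OF assms]] by simp_all

end

section \<open>Left invariant fields and functions on the quotient\<close>

definition wirt :: "6 \<Rightarrow> (complex ^ 3 \<Rightarrow> complex) \<Rightarrow> complex ^ 3 \<Rightarrow> complex" where
  "wirt i f x = (let j = coord_index i; ux = dd (axis j 1) f x; uy = dd (axis j \<i>) f x
     in 1/2 * (if i \<in> hol then ux - \<i> * uy else ux + \<i> * uy))"

text \<open>The frame dual to dz1, dz2, dz3 - z1 dz2 and their conjugates; only the fields dual to
  dz2 and its conjugate have a variable coefficient.\<close>

definition xi :: "6 \<Rightarrow> (complex ^ 3 \<Rightarrow> complex) \<Rightarrow> complex ^ 3 \<Rightarrow> complex" where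
  "xi i f x = wirt i f x + (if i = 1 then x $ 1 * wirt 2 f x else if i = 4 then cnj (x $ 1) * wirt 5 f x else 0)"

lemma type6_distinct: "(0::6) \<noteq> 1" "(0::6) \<noteq> 2" "(0::6) \<noteq> 3" "(0::6) \<noteq> 4" "(0::6) \<noteq> 5"
  "(1::6) \<noteq> 2" "(1::6) \<noteq> 3" "(1::6) \<noteq> 4" "(1::6) \<noteq> 5" "(2::6) \<noteq> 3" "(2::6) \<noteq> 4" "(2::6) \<noteq> 5"
  "(3::6) \<noteq> 4" "(3::6) \<noteq> 5" "(4::6) \<noteq> 5"
  by simp_all

lemma UNIV_6: "(UNIV :: 6 set) = {0, 1, 2, 3, 4, 5}"
proof -
  have "{0, 1, 2, 3, 4, 5} = (UNIV :: 6 set)"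
    by (rule card_subset_eq) simp_all
  then show ?thesis ..
qed

lemma forall_6: "(\<forall>i::6. P i) \<longleftrightarrow> P 0 \<and> P 1 \<and> P 2 \<and> P 3 \<and> P 4 \<and> P 5"
  using UNIV_6 by (metis UNIV_I empty_iff insert_iff)

lemma sum_6: "(\<Sum>i\<in>UNIV. f i) = f (0::6) + f 1 + f 2 + f 3 + f 4 + f 5"
  unfolding UNIV_6 by (simp add: add.assoc)

lemma type3_distinct: "(1::3) \<noteq> 2" "(1::3) \<noteq> 3" "(2::3) \<noteq> 3"
  by simp_all

lemma wirt_simps:
  "wirt 0 f x = 1/2 * (dd (axis 1 1) f x - \<i> * dd (axis 1 \<i>) f x)"
  "wirt 1 f x = 1/2 * (dd (axis 2 1) f x - \<i> * dd (axis 2 \<i>) f x)"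
  "wirt 2 f x = 1/2 * (dd (axis 3 1) f x - \<i> * dd (axis 3 \<i>) f x)"
  "wirt 3 f x = 1/2 * (dd (axis 1 1) f x + \<i> * dd (axis 1 \<i>) f x)"
  "wirt 4 f x = 1/2 * (dd (axis 2 1) f x + \<i> * dd (axis 2 \<i>) f x)"
  "wirt 5 f x = 1/2 * (dd (axis 3 1) f x + \<i> * dd (axis 3 \<i>) f x)"
  by (simp_all add: wirt_def hol_def coord_index_def Let_def)

lemma wirt_smooth: "smooth f \<Longrightarrow> smooth (wirt i f)"
  unfolding wirt_def[abs_def] Let_def
  by (cases "i \<in> hol") (simp_all add: smooth_cmult smooth_diff smooth_add smooth_dd del: times_divide_eq_left)

lemma bounded_linear_coord: "bounded_linear (\<lambda>x::complex^3. x $ j)" "bounded_linear (\<lambda>x::complex^3. cnj (x $ j))"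
  by (rule bounded_linear_vec_nth) (rule bounded_linear_compose[OF bounded_linear_cnj bounded_linear_vec_nth])

lemma smooth_coord: "smooth (\<lambda>x::complex^3. x $ j)" "smooth (\<lambda>x::complex^3. cnj (x $ j))"
  by (intro smooth_bounded_linear bounded_linear_coord)+

lemma xi_smooth: "smooth f \<Longrightarrow> smooth (xi i f)"
  unfolding xi_def[abs_def]
  by (cases "i = 1"; cases "i = 4") (simp_all add: wirt_smooth smooth_add smooth_mult smooth_coord)

definition inv_fun :: "(complex ^ 3 \<Rightarrow> complex) \<Rightarrow> bool" where
  "inv_fun f \<longleftrightarrow> smooth f \<and> (\<forall>g\<in>lattice. \<forall>x. f (heis_mult g x) = f x)"

lemma inv_smooth: "inv_fun f \<Longrightarrow> smooth f" by (simp add: inv_fun_def)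

lemma inv_add: "inv_fun f \<Longrightarrow> inv_fun g \<Longrightarrow> inv_fun (\<lambda>x. f x + g x)"
  by (simp add: inv_fun_def smooth_add)

lemma inv_cmult: "inv_fun f \<Longrightarrow> inv_fun (\<lambda>x. c * f x)"
  by (simp add: inv_fun_def smooth_cmult)

lemma inv_const: "inv_fun (\<lambda>x. c)"
  by (simp add: inv_fun_def)

lemma inv_sum: "(\<And>i. i \<in> I \<Longrightarrow> inv_fun (f i)) \<Longrightarrow> inv_fun (\<lambda>x. \<Sum>i\<in>I. f i x)"
  by (induction I rule: infinite_finite_induct) (auto intro: inv_add inv_const)

definition heis_lin :: "complex ^ 3 \<Rightarrow> complex ^ 3 \<Rightarrow> complex ^ 3" where
  "heis_lin g v = v + axis 3 (g $ 1 * v $ 2)"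

lemma heis_mult_affine: "heis_mult g x = heis_lin g x + g"
  by (simp add: heis_mult_def heis_lin_def vec_eq_iff forall_3 axis_def)

lemma bounded_linear_heis_lin: "bounded_linear (heis_lin g)"
  by (intro bounded_linear_euclidean linearI)
    (simp_all add: heis_lin_def vec_eq_iff forall_3 axis_def algebra_simps)

lemma axis_split: fixes f :: "complex^3 \<Rightarrow> complex"
  assumes "smooth f" shows "dd (axis j c) f x = Re c * dd (axis j 1) f x + Im c * dd (axis j \<i>) f x"
proof -
  have "axis j c = Re c *\<^sub>R axis j 1 + Im c *\<^sub>R (axis j \<i> :: complex^3)"
    by (auto simp: vec_eq_iff axis_def complex_eq_iff)
  then have "dd (axis j c) f x = dd (Re c *\<^sub>R axis j 1 + Im c *\<^sub>R axis j \<i>) f x" by simp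
  also have "... = Re c *\<^sub>R dd (axis j 1) f x + Im c *\<^sub>R dd (axis j \<i>) f x"
    using dd_linear_arg[OF assms, of x] by (simp only: linear_add[OF dd_linear_arg[OF assms]] linear_scale[OF dd_linear_arg[OF assms]])
  finally show ?thesis by (simp add: scaleR_conv_of_real)
qed

lemma dd_heis: fixes f :: "complex^3 \<Rightarrow> complex"
  assumes "smooth f"
  shows "dd v (\<lambda>x. f (heis_mult g x)) = (\<lambda>x. dd (heis_lin g v) f (heis_mult g x))"
  unfolding heis_mult_affine by (rule dd_affine[OF bounded_linear_heis_lin assms])

lemma dd_arg_add: "smooth f \<Longrightarrow> dd (v + w) f x = dd v f x + dd w f x"
  using linear_add[OF dd_linear_arg] by blast

lemma heis_lin_axis: "heis_lin g (axis 1 c) = axis 1 c" "heis_lin g (axis 3 c) = axis 3 c"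
  "heis_lin g (axis 2 c) = axis 2 c + axis 3 (g $ 1 * c)"
  by (simp_all add: heis_lin_def axis_def vec_eq_iff forall_3)

lemma wirt_heis: fixes f :: "complex^3 \<Rightarrow> complex"
  assumes f: "smooth f"
  shows "wirt i (\<lambda>x. f (heis_mult g x)) x = wirt i f (heis_mult g x) +
    (if i = 1 then g $ 1 * wirt 2 f (heis_mult g x) else if i = 4 then cnj (g $ 1) * wirt 5 f (heis_mult g x) else 0)"
proof -
  have "\<forall>i. wirt i (\<lambda>x. f (heis_mult g x)) x = wirt i f (heis_mult g x) +
    (if i = 1 then g $ 1 * wirt 2 f (heis_mult g x) else if i = 4 then cnj (g $ 1) * wirt 5 f (heis_mult g x) else 0)"
    unfolding forall_6 wirt_simps dd_heis[OF f] heis_lin_axis dd_arg_add[OF f]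
      axis_split[OF f, of 3 "g $ 1 * \<i>"] axis_split[OF f, of 3 "g $ 1 * 1"]
    by (simp add: complex_eq_iff algebra_simps add_divide_distrib diff_divide_distrib)
  then show ?thesis by blast
qed

text \<open>The chain rule adds g $ 1 times the central derivative, and the coefficient x $ 1 of the
  field absorbs it because the first coordinates add up under multiplication.\<close>

lemma xi_heis:
  assumes f: "smooth f"
  shows "xi i (\<lambda>x. f (heis_mult g x)) x = xi i f (heis_mult g x)"
proof -
  have 1: "heis_mult g x $ 1 = g $ 1 + x $ 1" by (simp add: heis_mult_def)
  show ?thesis unfolding xi_def wirt_heis[OF f] 1 by (auto simp: algebra_simps)
qed

lemma inv_xi: "inv_fun f \<Longrightarrow> inv_fun (xi i f)"
  unfolding inv_fun_def using xi_heis[of f i] xi_smooth[of f i]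
  by (metis (no_types, lifting) ext)

lemma wirt_eq: "wirt i f = (\<lambda>x. 1/2 * (dd (axis (coord_index i) 1) f x + (if i \<in> hol then - \<i> else \<i>) * dd (axis (coord_index i) \<i>) f x))"
  by (auto simp: wirt_def Let_def fun_eq_iff)

lemma wirt_add: "smooth f \<Longrightarrow> smooth g \<Longrightarrow> wirt i (\<lambda>x. f x + g x) = (\<lambda>x. wirt i f x + wirt i g x)"
  unfolding wirt_eq by (simp add: dd_add algebra_simps add_divide_distrib)

lemma wirt_cmult: "smooth f \<Longrightarrow> wirt i (\<lambda>x. c * f x) = (\<lambda>x. c * wirt i f x)"
  unfolding wirt_eq by (simp add: dd_cmult algebra_simps)

lemma wirt_const: "wirt i (\<lambda>x. c) = (\<lambda>x. 0)"
  unfolding wirt_eq by simp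

lemma xi_eq: "xi i f = (\<lambda>x. wirt i f x + (if i = 1 then x $ 1 * wirt 2 f x else if i = 4 then cnj (x $ 1) * wirt 5 f x else 0))"
  by (simp add: xi_def fun_eq_iff)

lemma xi_add: "smooth f \<Longrightarrow> smooth g \<Longrightarrow> xi i (\<lambda>x. f x + g x) = (\<lambda>x. xi i f x + xi i g x)"
  unfolding xi_eq by (simp add: wirt_add fun_eq_iff algebra_simps)

lemma xi_cmult: "smooth f \<Longrightarrow> xi i (\<lambda>x. c * f x) = (\<lambda>x. c * xi i f x)"
  unfolding xi_eq by (simp add: wirt_cmult fun_eq_iff algebra_simps)

lemma xi_const: "xi i (\<lambda>x. c) = (\<lambda>x. 0)"
  unfolding xi_eq by (simp add: wirt_const fun_eq_iff)

lemma axis3_1: "(axis 3 c :: complex ^ 3) $ 1 = 0"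
  by (simp add: axis_def)

lemma lattice_axis: "axis j 1 \<in> lattice" "axis j \<i> \<in> lattice"
  by (simp_all add: lattice_def axis_def)

text \<open>\<open>S1\<close> is the centre, padded by two zero directions; \<open>S2\<close> is the
  base torus. Functions on the quotient are periodic for \<open>S1\<close>, but for
  \<open>S2\<close> only once they are constant along the centre.\<close>

interpretation S1: four_directions "axis 3 1 :: complex^3" "axis 3 \<i>" 0 0 .
interpretation S2: four_directions "axis 1 1 :: complex^3" "axis 1 \<i>" "axis 2 1" "axis 2 \<i>" .

lemma S1_per: assumes f: "inv_fun f" shows "S1.per f"
proof -
  have "f (x + axis 3 c) = f x" if "axis 3 c \<in> lattice" for x c
  proof -
    have "heis_mult (axis 3 c) x = x + axis 3 c"
      by (simp add: heis_mult_def vec_eq_iff forall_3 axis_def)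
    then show ?thesis using f that by (metis inv_fun_def)
  qed
  then show ?thesis using f lattice_axis by (simp add: S1.per_def inv_fun_def)
qed

lemma heis_add_axis3: "heis_mult g (x + s *\<^sub>R axis 3 c) = heis_mult g x + s *\<^sub>R axis 3 c"
  by (simp add: heis_mult_def vec_eq_iff forall_3 axis_def algebra_simps)

text \<open>Central translations commute with all left translations, so multipliers along the centre
  preserve invariance under the lattice.\<close>

lemma S1_mult_inv:
  assumes f: "inv_fun f" and m: "\<forall>k. norm (m k) \<le> K" shows "inv_fun (S1.mult m f)"
proof -
  have "S1.mult m f (heis_mult g x) = S1.mult m f x" if "g \<in> lattice" for g x
  proof -
    have "S1.mult m (\<lambda>x. f (heis_mult g x)) = (\<lambda>x. S1.mult m f (heis_mult g x))"
      by (rule S1.mult_comp) (simp_all add: heis_add_axis3)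
    moreover have "(\<lambda>x. f (heis_mult g x)) = f" using f that by (auto simp: inv_fun_def)
    ultimately show ?thesis by metis
  qed
  then show ?thesis using S1.per_mult[OF S1_per[OF f] m] by (simp add: inv_fun_def S1.per_def)
qed

text \<open>The fields are built from constant derivatives, linear combinations and multiplication
  by x $ 1 or its conjugate. An operator respecting these on a suitable class \<open>C\<close>
  commutes with every field.\<close>

lemma xi_commute:
  assumes d: "\<And>v. dd v (T f) = T (dd v f)"
    and add: "\<And>g h. C g \<Longrightarrow> C h \<Longrightarrow> T (\<lambda>x. g x + h x) = (\<lambda>x. T g x + T h x)"
    and cm: "\<And>g c. C g \<Longrightarrow> T (\<lambda>x. c * g x) = (\<lambda>x. c * T g x)"
    and x1: "\<And>g. C g \<Longrightarrow> T (\<lambda>x. x $ 1 * g x) = (\<lambda>x. x $ 1 * T g x)"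
      "\<And>g. C g \<Longrightarrow> T (\<lambda>x. cnj (x $ 1) * g x) = (\<lambda>x. cnj (x $ 1) * T g x)"
    and C: "\<And>v. C (dd v f)" "\<And>g h. C g \<Longrightarrow> C h \<Longrightarrow> C (\<lambda>x. g x + h x)" "\<And>c g. C g \<Longrightarrow> C (\<lambda>x. c * g x)"
      "\<And>g. C g \<Longrightarrow> C (\<lambda>x. x $ 1 * g x)" "\<And>g. C g \<Longrightarrow> C (\<lambda>x. cnj (x $ 1) * g x)"
  shows "T (xi i f) = xi i (T f)"
proof -
  have neg: "(\<lambda>x. g x - \<i> * h x) = (\<lambda>x. g x + (- \<i>) * h x)" for g h :: "complex^3 \<Rightarrow> complex" by auto
  have w: "wirt i f = (\<lambda>x. 1/2 * (dd (axis (coord_index i) 1) f x + (if i \<in> hol then - \<i> else \<i>) * dd (axis (coord_index i) \<i>) f x))" for i f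
    by (auto simp: wirt_def Let_def fun_eq_iff)
  have Cw: "C (wirt i f)" for i unfolding w by (intro C)
  have Tw: "T (wirt i f) = wirt i (T f)" for i
    unfolding w[of i f] by (subst cm, intro C, subst add, intro C, intro C, subst cm, intro C) (simp add: w[of i "T f"] d)
  have "xi i f = (\<lambda>x. wirt i f x + (if i = 1 then x $ 1 * wirt 2 f x else if i = 4 then cnj (x $ 1) * wirt 5 f x else 0))" for f
    by (simp add: xi_def fun_eq_iff)
  moreover have "T (\<lambda>x. wirt i f x + (if i = 1 then x $ 1 * wirt 2 f x else if i = 4 then cnj (x $ 1) * wirt 5 f x else 0))
    = (\<lambda>x. wirt i (T f) x + (if i = 1 then x $ 1 * wirt 2 (T f) x else if i = 4 then cnj (x $ 1) * wirt 5 (T f) x else 0))"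
    by (auto simp: add C Cw x1 Tw)
  ultimately show ?thesis by simp
qed

lemma S1_mult_xi:
  assumes f: "inv_fun f" and m: "\<forall>k. norm (m k) \<le> K" shows "S1.mult m (xi i f) = xi i (S1.mult m f)"
proof (rule xi_commute[where C=S1.per])
  note p = S1_per[OF f]
  show "dd v (S1.mult m f) = S1.mult m (dd v f)" for v by (rule S1.dd_mult_op(2)[OF p m])
  show "S1.per (dd v f)" for v by (rule S1.per_dd[OF p])
  show "S1.per (\<lambda>x. x $ 1 * g x)" "S1.per (\<lambda>x. cnj (x $ 1) * g x)" if "S1.per g" for g
    using that by (simp_all add: S1.per_def smooth_mult smooth_coord axis3_1)
  show "S1.mult m (\<lambda>x. x $ 1 * g x) = (\<lambda>x. x $ 1 * S1.mult m g x)"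
    "S1.mult m (\<lambda>x. cnj (x $ 1) * g x) = (\<lambda>x. cnj (x $ 1) * S1.mult m g x)"
    "S1.mult m (\<lambda>x. c * g x) = (\<lambda>x. c * S1.mult m g x)" for g c
    by (rule S1.mult_cmult; simp add: axis3_1)+
  show "S1.mult m (\<lambda>x. g x + h x) = (\<lambda>x. S1.mult m g x + S1.mult m h x)" if "S1.per g" "S1.per h" for g h
    by (rule S1.mult_add[OF that m])
qed (simp_all add: S1.per_add S1.per_cmult)

text \<open>Averages are multipliers with the indicator of zero as symbol, so invariance and
  commutation with the fields follow from the general lemmas.\<close>

lemma S1_fc4_eq: "S1.fc4 (0, 0, 0, 0) f = S1.mult (\<lambda>k. if k = (0, 0, 0, 0) then 1 else 0) f"
  "S2.fc4 (0, 0, 0, 0) f = S2.mult (\<lambda>k. if k = (0, 0, 0, 0) then 1 else 0) f"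
proof -
  have *: "(\<Sum>\<^sub>\<infinity>k. (if k = (0::int, 0::int, 0::int, 0::int) then 1 else 0) * h k) = h (0, 0, 0, 0)" for h :: "_ \<Rightarrow> complex"
    by (rule infsumI)
      (use has_sum_finite_neutralI[of "{(0,0,0,0)}" UNIV "\<lambda>k. (if k = (0::int, 0::int, 0::int, 0::int) then 1 else 0) * h k"] in auto)
  show "S1.fc4 (0, 0, 0, 0) f = S1.mult (\<lambda>k. if k = (0, 0, 0, 0) then 1 else 0) f"
    "S2.fc4 (0, 0, 0, 0) f = S2.mult (\<lambda>k. if k = (0, 0, 0, 0) then 1 else 0) f"
    by (simp_all add: fun_eq_iff S1.mult_def S2.mult_def *)
qed

text \<open>Functions pulled back from the base torus.\<close>

definition base_fun :: "(complex ^ 3 \<Rightarrow> complex) \<Rightarrow> bool" where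
  "base_fun f \<longleftrightarrow> inv_fun f \<and> (\<forall>x c. dd (axis 3 c) f x = 0)"

lemma base_funI: "inv_fun f \<Longrightarrow> (\<And>x. dd (axis 3 1) f x = 0) \<Longrightarrow> (\<And>x. dd (axis 3 \<i>) f x = 0) \<Longrightarrow> base_fun f"
proof -
  assume f: "inv_fun f" and z: "\<And>x. dd (axis 3 1) f x = 0" "\<And>x. dd (axis 3 \<i>) f x = 0"
  have "dd (axis 3 c) f x = 0" for x c
    by (rule trans[OF axis_split[OF inv_smooth[OF f], of 3 c x]]) (simp only: z mult_zero_right add_0)
  then show ?thesis using f by (simp add: base_fun_def)
qed

lemma heis_mult_translate: "heis_mult g x = (x + g) + axis 3 (g $ 1 * x $ 2)"
  by (simp add: heis_mult_def vec_eq_iff forall_3 axis_def)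

lemma base_translate3: assumes "base_fun f" shows "f (x + axis 3 c) = f x"
  using dirint_one_dd[of f "axis 3 c" x] assms inv_smooth[of f]
  by (simp add: base_fun_def dirint_def)

text \<open>Left multiplication differs from the ordinary translation by a central vector, and base
  functions do not see it. Hence they are genuinely periodic.\<close>

lemma base_translate: assumes "base_fun f" "g \<in> lattice" shows "f (x + g) = f x"
proof -
  have "f (x + g) = f (heis_mult g x)" unfolding heis_mult_translate by (rule base_translate3[OF assms(1), symmetric])
  then show ?thesis using assms by (simp add: base_fun_def inv_fun_def)
qed

lemma S2_per: assumes f: "base_fun f" shows "S2.per f"
  using base_translate[OF f] lattice_axis f by (simp add: S2.per_def base_fun_def inv_smooth)

lemma S2_mult_zero: "S2.mult m (\<lambda>x. 0) = (\<lambda>x. 0)"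
  using S2.mult_cmult[of "\<lambda>x. 0" m "\<lambda>x. 0"] by simp

lemma S2_mult_base:
  assumes f: "base_fun f" and m: "\<forall>k. norm (m k) \<le> K" shows "base_fun (S2.mult m f)"
proof -
  have s: "smooth (S2.mult m f)" using S2.per_mult[OF S2_per[OF f] m] by (simp add: S2.per_def)
  have d: "dd (axis 3 c) (S2.mult m f) x = 0" for c x
  proof -
    have "dd (axis 3 c) (S2.mult m f) = S2.mult m (dd (axis 3 c) f)" by (rule S2.dd_mult_op(2)[OF S2_per[OF f] m])
    also have "dd (axis 3 c) f = (\<lambda>x. 0)" using f by (simp add: base_fun_def fun_eq_iff)
    finally show ?thesis by (simp add: S2_mult_zero)
  qed
  have t3: "S2.mult m f (x + axis 3 c) = S2.mult m f x" for x c
    using dirint_one_dd[OF s, of "axis 3 c" x] by (simp add: d dirint_def)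
  have "S2.mult m f (heis_mult g x) = S2.mult m f x" if "g \<in> lattice" for g x
  proof -
    have "S2.mult m (\<lambda>x. f (x + g)) = (\<lambda>x. S2.mult m f (x + g))"
      by (rule S2.mult_comp) (simp_all add: algebra_simps)
    moreover have "(\<lambda>x. f (x + g)) = f" using base_translate[OF f that] by auto
    ultimately have "S2.mult m f (x + g) = S2.mult m f x" by metis
    then show ?thesis unfolding heis_mult_translate t3 .
  qed
  then show ?thesis using s d by (simp add: base_fun_def inv_fun_def)
qed

lemma xi_base: "base_fun f \<Longrightarrow> xi i f x = (if i = 2 \<or> i = 5 then 0 else wirt i f x)"
proof -
  assume f: "base_fun f"
  have "dd (axis 3 1) f x = 0" "dd (axis 3 \<i>) f x = 0" using f by (auto simp: base_fun_def)
  then have "wirt 2 f x = 0" "wirt 5 f x = 0" unfolding wirt_simps by simp_all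
  then show ?thesis by (auto simp: xi_def)
qed

lemma S2_mult_xi:
  assumes f: "base_fun f" and m: "\<forall>k. norm (m k) \<le> K" shows "S2.mult m (xi i f) = xi i (S2.mult m f)"
proof -
  have b: "base_fun (S2.mult m f)" by (rule S2_mult_base[OF f m])
  have d: "dd v (S2.mult m f) = S2.mult m (dd v f)" for v by (rule S2.dd_mult_op(2)[OF S2_per[OF f] m])
  have cm: "S2.mult m (\<lambda>x. c * g x) = (\<lambda>x. c * S2.mult m g x)" for c g by (rule S2.mult_cmult) simp_all
  have w: "wirt i f = (\<lambda>x. 1/2 * (dd (axis (coord_index i) 1) f x + (if i \<in> hol then - \<i> else \<i>) * dd (axis (coord_index i) \<i>) f x))" for i f
    by (auto simp: wirt_def Let_def fun_eq_iff)
  have p: "S2.per (dd v f)" for v by (rule S2.per_dd[OF S2_per[OF f]])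
  have "S2.mult m (wirt i f) = wirt i (S2.mult m f)"
    unfolding w[of i f] cm
    by (subst S2.mult_add[OF p S2.per_cmult[OF p] m]) (simp add: cm w[of i "S2.mult m f"] d)
  moreover have "xi i f = (if i = 2 \<or> i = 5 then \<lambda>x. 0 else wirt i f)" "xi i (S2.mult m f) = (if i = 2 \<or> i = 5 then \<lambda>x. 0 else wirt i (S2.mult m f))"
    using xi_base[OF f] xi_base[OF b] by (auto simp: fun_eq_iff)
  ultimately show ?thesis by (simp add: S2_mult_zero)
qed


lemma const_if_dd_zero:
  fixes f :: "complex^3 \<Rightarrow> complex"
  assumes f: "smooth f" and z: "\<And>j x. dd (axis j 1) f x = 0" "\<And>j x. dd (axis j \<i>) f x = 0"
  shows "f x = f 0"
proof -
  have x: "x = axis 1 (x $ 1) + axis 2 (x $ 2) + axis 3 (x $ 3)"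
    by (simp add: vec_eq_iff forall_3 axis_def)
  have "dd x f y = 0" for y
  proof -
    have "dd x f y = dd (axis 1 (x $ 1) + axis 2 (x $ 2) + axis 3 (x $ 3)) f y" using x by simp
    also have "... = 0"
      unfolding dd_arg_add[OF f] axis_split[OF f, of _ "x $ 1"] axis_split[OF f, of _ "x $ 2"]
        axis_split[OF f, of _ "x $ 3"] z by simp
    finally show ?thesis .
  qed
  then show ?thesis using dirint_one_dd[OF f, of x 0] by (simp add: dirint_def)
qed

lemma S2_mean_const:
  assumes f: "base_fun f" shows "S2.fc4 (0, 0, 0, 0) f x = S2.fc4 (0, 0, 0, 0) f 0"
proof -
  let ?g = "S2.fc4 (0, 0, 0, 0) f"
  have b: "base_fun ?g" unfolding S1_fc4_eq by (rule S2_mult_base[OF f, where K=1]) simp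
  have d3: "dd (axis 3 c) ?g y = 0" for c y using b by (simp add: base_fun_def)
  note z = S2.fc4_zero_dd[OF S2_per[OF f]]
  show ?thesis
  proof (rule const_if_dd_zero)
    show "smooth ?g" using b by (simp add: base_fun_def inv_smooth)
    have "\<forall>j. dd (axis j 1) ?g y = 0" "\<forall>j. dd (axis j \<i>) ?g y = 0" for y
      unfolding forall_3 using z d3 by simp_all
    then show "dd (axis j 1) ?g y = 0" "dd (axis j \<i>) ?g y = 0" for j y by blast+
  qed
qed

definition vmean :: "(complex ^ 3 \<Rightarrow> complex) \<Rightarrow> complex ^ 3 \<Rightarrow> complex" where
  "vmean = S1.fc4 (0, 0, 0, 0)"

text \<open>The average over the central fibre, then over the base. The second average is a constant
  function, and 0 is merely the point at which it is read off.\<close>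

definition mean :: "(complex ^ 3 \<Rightarrow> complex) \<Rightarrow> complex" where
  "mean f = S2.fc4 (0, 0, 0, 0) (vmean f) 0"

lemma vmean_base: assumes f: "inv_fun f" shows "base_fun (vmean f)"
proof (rule base_funI)
  show "inv_fun (vmean f)" unfolding vmean_def S1_fc4_eq by (rule S1_mult_inv[OF f, where K=1]) simp
  show "dd (axis 3 1) (vmean f) x = 0" "dd (axis 3 \<i>) (vmean f) x = 0" for x
    unfolding vmean_def by (rule S1.fc4_zero_dd[OF S1_per[OF f]])+
qed

lemma vmean_xi: assumes f: "inv_fun f" shows "vmean (xi i f) = xi i (vmean f)"
  unfolding vmean_def S1_fc4_eq by (rule S1_mult_xi[OF f, where K=1]) simp

lemma vmean_add: "inv_fun f \<Longrightarrow> inv_fun g \<Longrightarrow> vmean (\<lambda>x. f x + g x) = (\<lambda>x. vmean f x + vmean g x)"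
  unfolding vmean_def by (intro S1.fc4_add inv_smooth)

lemma vmean_cmult: "vmean (\<lambda>x. c * f x) = (\<lambda>x. c * vmean f x)"
  unfolding vmean_def by (intro S1.fc4_cmult) simp_all

lemma mean_add: "inv_fun f \<Longrightarrow> inv_fun g \<Longrightarrow> mean (\<lambda>x. f x + g x) = mean f + mean g"
  using vmean_base[of f] vmean_base[of g] unfolding mean_def vmean_add base_fun_def
  by (simp add: S2.fc4_add inv_smooth vmean_add)

lemma mean_cmult: "mean (\<lambda>x. c * f x) = c * mean f"
  unfolding mean_def vmean_cmult by (subst S2.fc4_cmult) simp_all

lemma wirt_zero_of_dd: "(\<And>j. dd (axis j 1) f x = 0) \<Longrightarrow> (\<And>j. dd (axis j \<i>) f x = 0) \<Longrightarrow> wirt i f x = 0"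
  by (simp add: wirt_def)

text \<open>Both averages commute with the field, and the total average is constant, hence killed by
  it. No integration by parts on the quotient is required.\<close>

lemma mean_xi: assumes f: "inv_fun f" shows "mean (xi i f) = 0"
proof -
  let ?P = "vmean f"
  have b: "base_fun ?P" by (rule vmean_base[OF f])
  have b2: "base_fun (S2.mult (\<lambda>k. if k = (0, 0, 0, 0) then 1 else 0) ?P)" by (rule S2_mult_base[OF b, where K=1]) simp
  have "S2.fc4 (0, 0, 0, 0) (xi i ?P) = xi i (S2.fc4 (0, 0, 0, 0) ?P)"
    unfolding S1_fc4_eq by (rule S2_mult_xi[OF b, where K=1]) simp
  moreover have "S2.fc4 (0, 0, 0, 0) ?P = (\<lambda>x. S2.fc4 (0, 0, 0, 0) ?P 0)"
    by (rule ext) (rule S2_mean_const[OF b])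
  ultimately show ?thesis unfolding mean_def vmean_xi[OF f] using xi_const by metis
qed

section \<open>Symbols and right inverses of the antiholomorphic fields\<close>

lemma S1_symbol:
  assumes f: "inv_fun f"
  shows "S1.fc4 (a, b, c, e) (xi 2 f) x = pi * (\<i> * of_int a + of_int b) * S1.fc4 (a, b, c, e) f x"
    "S1.fc4 (a, b, c, e) (xi 5 f) x = pi * (\<i> * of_int a - of_int b) * S1.fc4 (a, b, c, e) f x"
proof -
  note p = S1_per[OF f]
  have x2: "xi 2 f = (\<lambda>x. 1/2 * (dd (axis 3 1) f x + (- \<i>) * dd (axis 3 \<i>) f x))"
    by (simp add: fun_eq_iff xi_def wirt_simps)
  have x5: "xi 5 f = (\<lambda>x. 1/2 * (dd (axis 3 1) f x + \<i> * dd (axis 3 \<i>) f x))"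
    by (simp add: fun_eq_iff xi_def wirt_simps)
  have cm: "S1.fc4 k (\<lambda>x. c * g x) = (\<lambda>x. c * S1.fc4 k g x)" for k c g by (rule S1.fc4_cmult) simp_all
  have s: "smooth (dd v f)" for v using inv_smooth[OF f] by (rule smooth_dd)
  show "S1.fc4 (a, b, c, e) (xi 2 f) x = pi * (\<i> * of_int a + of_int b) * S1.fc4 (a, b, c, e) f x"
    unfolding x2 cm S1.fc4_add[OF s smooth_cmult[OF s]] S1.fc4_dd[OF p] by (simp add: algebra_simps)
  show "S1.fc4 (a, b, c, e) (xi 5 f) x = pi * (\<i> * of_int a - of_int b) * S1.fc4 (a, b, c, e) f x"
    unfolding x5 cm S1.fc4_add[OF s smooth_cmult[OF s]] S1.fc4_dd[OF p] by (simp add: algebra_simps)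
qed

lemma S2_symbol:
  assumes f: "base_fun f"
  shows "S2.fc4 (a, b, c, e) (xi 0 f) x = pi * (\<i> * of_int a + of_int b) * S2.fc4 (a, b, c, e) f x"
    "S2.fc4 (a, b, c, e) (xi 3 f) x = pi * (\<i> * of_int a - of_int b) * S2.fc4 (a, b, c, e) f x"
    "S2.fc4 (a, b, c, e) (xi 1 f) x = pi * (\<i> * of_int c + of_int e) * S2.fc4 (a, b, c, e) f x"
    "S2.fc4 (a, b, c, e) (xi 4 f) x = pi * (\<i> * of_int c - of_int e) * S2.fc4 (a, b, c, e) f x"
proof -
  note p = S2_per[OF f]
  have x0: "xi 0 f = (\<lambda>x. 1/2 * (dd (axis 1 1) f x + (- \<i>) * dd (axis 1 \<i>) f x))"
    by (simp add: fun_eq_iff xi_base[OF f] wirt_simps)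
  have x1: "xi 1 f = (\<lambda>x. 1/2 * (dd (axis 2 1) f x + (- \<i>) * dd (axis 2 \<i>) f x))"
    by (simp add: fun_eq_iff xi_base[OF f] wirt_simps)
  have x3: "xi 3 f = (\<lambda>x. 1/2 * (dd (axis 1 1) f x + \<i> * dd (axis 1 \<i>) f x))"
    by (simp add: fun_eq_iff xi_base[OF f] wirt_simps)
  have x4: "xi 4 f = (\<lambda>x. 1/2 * (dd (axis 2 1) f x + \<i> * dd (axis 2 \<i>) f x))"
    by (simp add: fun_eq_iff xi_base[OF f] wirt_simps)
  have cm: "S2.fc4 k (\<lambda>x. c * g x) = (\<lambda>x. c * S2.fc4 k g x)" for k c g by (rule S2.fc4_cmult) simp_all
  have s: "smooth (dd v f)" for v using f unfolding base_fun_def by (intro smooth_dd inv_smooth) simp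
  note r = cm S2.fc4_add[OF s smooth_cmult[OF s]] S2.fc4_dd[OF p]
  show "S2.fc4 (a, b, c, e) (xi 0 f) x = pi * (\<i> * of_int a + of_int b) * S2.fc4 (a, b, c, e) f x"
    unfolding x0 r by (simp add: algebra_simps)
  show "S2.fc4 (a, b, c, e) (xi 3 f) x = pi * (\<i> * of_int a - of_int b) * S2.fc4 (a, b, c, e) f x"
    unfolding x3 r by (simp add: algebra_simps)
  show "S2.fc4 (a, b, c, e) (xi 1 f) x = pi * (\<i> * of_int c + of_int e) * S2.fc4 (a, b, c, e) f x"
    unfolding x1 r by (simp add: algebra_simps)
  show "S2.fc4 (a, b, c, e) (xi 4 f) x = pi * (\<i> * of_int c - of_int e) * S2.fc4 (a, b, c, e) f x"
    unfolding x4 r by (simp add: algebra_simps)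
qed

lemma norm_gauss: "norm (\<i> * of_int a + of_int b) = sqrt (of_int (a\<^sup>2 + b\<^sup>2))"
  "norm (\<i> * of_int a - of_int b) = sqrt (of_int (a\<^sup>2 + b\<^sup>2))"
  by (simp_all add: cmod_def add.commute)

text \<open>Nonzero Gaussian integers have modulus at least 1; this is the spectral gap behind all
  the bounded inverses.\<close>

lemma norm_gauss_ge_1: "(a, b) \<noteq> (0, 0) \<Longrightarrow> sqrt (of_int (a\<^sup>2 + b\<^sup>2)) \<ge> 1" for a b :: int
proof -
  assume "(a, b) \<noteq> (0, 0)"
  then have "a\<^sup>2 + b\<^sup>2 > 0" by (auto simp: sum_power2_gt_zero_iff)
  then have "of_int (a\<^sup>2 + b\<^sup>2) \<ge> (1::real)" by linarith
  then show ?thesis by simp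
qed

text \<open>The symbols of \<open>xi 2\<close> and \<open>xi 5\<close> have the same modulus at each
  frequency, so the dominance of N5 over N2 keeps the combined symbol away from zero. Its
  reciprocal, set to zero at vertical frequency zero, is the symbol of R.\<close>

lemma vertical_solution:
  assumes N: "norm (N2 :: complex) < norm N5"
  obtains R where
    "\<And>f. inv_fun f \<Longrightarrow> inv_fun (R f)"
    "\<And>f i. inv_fun f \<Longrightarrow> R (xi i f) = xi i (R f)"
    "\<And>f g. inv_fun f \<Longrightarrow> inv_fun g \<Longrightarrow> R (\<lambda>x. f x + g x) = (\<lambda>x. R f x + R g x)"
    "\<And>f c. R (\<lambda>x. c * f x) = (\<lambda>x. c * R f x)"
    "\<And>f x. inv_fun f \<Longrightarrow> f x = vmean f x + (N2 * xi 2 (R f) x + N5 * xi 5 (R f) x)"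
proof -
  define lam :: "freq \<Rightarrow> complex" where
    "lam k = (case k of (a, b, c, e) \<Rightarrow> N2 * (pi * (\<i> * of_int a + of_int b)) + N5 * (pi * (\<i> * of_int a - of_int b)))" for k
  define ok :: "freq \<Rightarrow> bool" where "ok k = (case k of (a, b, c, e) \<Rightarrow> (a, b) \<noteq> (0, 0))" for k
  define m where "m k = (if ok k then 1 / lam k else 0)" for k
  define K where "K = 1 / (norm N5 - norm N2)"
  have K: "K > 0" using N by (simp add: K_def)
  have lb: "norm (lam k) \<ge> norm N5 - norm N2" if ok: "ok k" for k
  proof -
    obtain a b c e where k: "k = (a, b, c, e)" by (cases k)
    define A where "A = sqrt (of_int (a\<^sup>2 + b\<^sup>2))"
    have A: "A \<ge> 1" using norm_gauss_ge_1[of a b] ok by (simp add: ok_def k A_def)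
    have "norm (N5 * (pi * (\<i> * of_int a - of_int b))) - norm (N2 * (pi * (\<i> * of_int a + of_int b))) \<le> norm (lam k)"
      unfolding k lam_def prod.case using norm_diff_ineq[of "N5 * (pi * (\<i> * of_int a - of_int b))" "N2 * (pi * (\<i> * of_int a + of_int b))"]
      by (simp add: add.commute)
    moreover have "norm (N5 * (pi * (\<i> * of_int a - of_int b))) = norm N5 * (pi * A)"
      "norm (N2 * (pi * (\<i> * of_int a + of_int b))) = norm N2 * (pi * A)"
      unfolding norm_mult norm_gauss A_def by simp_all
    moreover have "(norm N5 - norm N2) * 1 \<le> (norm N5 - norm N2) * (pi * A)"
    proof (rule mult_left_mono)
      have "1 * 1 \<le> pi * A" using A pi_ge_two by (intro mult_mono) auto
      then show "1 \<le> pi * A" by simp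
    qed (use N in simp)
    ultimately show ?thesis by (simp add: left_diff_distrib)
  qed
  have l0: "lam k \<noteq> 0" if "ok k" for k using lb[OF that] N by auto
  have m: "\<forall>k. norm (m k) \<le> K"
  proof
    fix k show "norm (m k) \<le> K"
    proof (cases "ok k")
      case True
      have "1 / norm (lam k) \<le> 1 / (norm N5 - norm N2)" using lb[OF True] N by (intro divide_left_mono mult_pos_pos) auto
      then show ?thesis using True by (simp add: m_def K_def norm_divide)
    qed (use K in \<open>simp add: m_def\<close>)
  qed
  define m1 where "m1 k = (if ok k then 1 else 0 :: complex)" for k
  have m1: "\<forall>k. norm (m1 k) \<le> 1" by (simp add: m1_def)
  show thesis
  proof (rule that[of "S1.mult m"])
    fix f g i and c :: complex
    show "inv_fun f \<Longrightarrow> inv_fun (S1.mult m f)" by (rule S1_mult_inv[OF _ m])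
    show "inv_fun f \<Longrightarrow> S1.mult m (xi i f) = xi i (S1.mult m f)" by (rule S1_mult_xi[OF _ m])
    show "inv_fun f \<Longrightarrow> inv_fun g \<Longrightarrow> S1.mult m (\<lambda>x. f x + g x) = (\<lambda>x. S1.mult m f x + S1.mult m g x)"
      by (rule S1.mult_add[OF S1_per S1_per m])
    show "S1.mult m (\<lambda>x. c * f x) = (\<lambda>x. c * S1.mult m f x)"
      by (rule S1.mult_cmult) simp_all
    fix x assume f: "inv_fun f"
    let ?V = "\<lambda>f x. N2 * xi 2 f x + N5 * xi 5 f x"
    have cm: "S1.mult m (\<lambda>x. c * g x) = (\<lambda>x. c * S1.mult m g x)" for c g by (rule S1.mult_cmult) simp_all
    have cm4: "S1.fc4 k (\<lambda>x. c * g x) = (\<lambda>x. c * S1.fc4 k g x)" for k c g by (rule S1.fc4_cmult) simp_all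
    have i: "inv_fun (\<lambda>x. c * xi j f x)" for c j by (intro inv_cmult inv_xi f)
    have "?V (S1.mult m f) = S1.mult m (?V f)"
      unfolding S1.mult_add[OF S1_per[OF i] S1_per[OF i] m] cm S1_mult_xi[OF f m] ..
    also have "... = S1.mult m1 f"
    proof (rule S1.mult_symbol[OF _ _ m m1])
      show "S1.per (?V f)" "S1.per f" by (intro S1_per inv_add i f)+
      show "m k * S1.fc4 k (?V f) x = m1 k * S1.fc4 k f x" for k x
      proof -
        obtain a b c e where k: "k = (a, b, c, e)" by (cases k)
        have "S1.fc4 k (?V f) x = lam k * S1.fc4 k f x"
          unfolding S1.fc4_add[OF inv_smooth[OF i] inv_smooth[OF i]] cm4 k S1_symbol[OF f]
          by (simp add: lam_def algebra_simps)
        then show ?thesis using l0[of k] by (simp add: m_def m1_def)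
      qed
    qed
    finally have V: "?V (S1.mult m f) = S1.mult m1 f" .
    have "f x = S1.fc4 (0, 0, 0, 0) f x + S1.mult m1 f x"
    proof (rule S1.mult_eq_zero_freq[OF S1_per[OF f] m1])
      \<comment> \<open>The last two directions are zero vectors, so a frequency with (a, b) = (0,
        0) but another nonzero entry has a vanishing coefficient.\<close>
      show "m1 k = 1 \<or> S1.fc4 k f x = 0" if "k \<noteq> (0, 0, 0, 0)" for k x
      proof -
        obtain a b c e where k: "k = (a, b, c, e)" by (cases k)
        show ?thesis using that S1.fc4_degenerate(3)[of c a b e f x] S1.fc4_degenerate(4)[of e a b c f x]
          by (auto simp: m1_def ok_def k)
      qed
      show "m1 (0, 0, 0, 0) = 0" by (simp add: m1_def ok_def)
    qed
    then show "f x = vmean f x + (N2 * xi 2 (S1.mult m f) x + N5 * xi 5 (S1.mult m f) x)"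
      unfolding vmean_def using fun_cong[OF V, of x] by simp
  qed
qed

text \<open>Two fields are available on the base and each frequency is assigned to one of them,
  according to which of the two torus factors carries the larger frequency. Relative to that maximum
  the chosen symbol is a small perturbation of the unperturbed one.\<close>

lemma horizontal_solution:
  fixes N :: "6 \<Rightarrow> 6 \<Rightarrow> complex"
  assumes N: "\<And>i j. i \<in> {3, 4} \<Longrightarrow> j \<in> {0, 1, 3, 4} \<Longrightarrow> norm (N j i - (if i = j then 1 else 0)) \<le> 1/8"
  obtains R3 R4 where
    "\<And>f. base_fun f \<Longrightarrow> base_fun (R3 f) \<and> base_fun (R4 f)"
    "\<And>f i. base_fun f \<Longrightarrow> R3 (xi i f) = xi i (R3 f) \<and> R4 (xi i f) = xi i (R4 f)"
    "\<And>f g. base_fun f \<Longrightarrow> base_fun g \<Longrightarrow> R3 (\<lambda>x. f x + g x) = (\<lambda>x. R3 f x + R3 g x) \<and> R4 (\<lambda>x. f x + g x) = (\<lambda>x. R4 f x + R4 g x)"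
    "\<And>f c. R3 (\<lambda>x. c * f x) = (\<lambda>x. c * R3 f x) \<and> R4 (\<lambda>x. c * f x) = (\<lambda>x. c * R4 f x)"
    "\<And>f x. base_fun f \<Longrightarrow> f x = S2.fc4 (0, 0, 0, 0) f 0
       + (N 0 3 * xi 0 (R3 f) x + N 1 3 * xi 1 (R3 f) x + N 3 3 * xi 3 (R3 f) x + N 4 3 * xi 4 (R3 f) x)
       + (N 0 4 * xi 0 (R4 f) x + N 1 4 * xi 1 (R4 f) x + N 3 4 * xi 3 (R4 f) x + N 4 4 * xi 4 (R4 f) x)"
proof -
  define lam :: "6 \<Rightarrow> freq \<Rightarrow> complex" where
    "lam i k = (case k of (a, b, c, e) \<Rightarrow> N 0 i * (pi * (\<i> * of_int a + of_int b)) + N 1 i * (pi * (\<i> * of_int c + of_int e))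
      + N 3 i * (pi * (\<i> * of_int a - of_int b)) + N 4 i * (pi * (\<i> * of_int c - of_int e)))" for i k
  define A where "A k = (case k of (a, b, c, e) \<Rightarrow> pi * sqrt (of_int (a\<^sup>2 + b\<^sup>2)))" for k :: freq
  define B where "B k = (case k of (a, b, c, e) \<Rightarrow> pi * sqrt (of_int (c\<^sup>2 + e\<^sup>2)))" for k :: freq
  \<comment> \<open>The nonzero frequencies are partitioned between the indices 3 and 4, so the two
    partial inverses add up to a full one.\<close>
  define sel where "sel i k = (k \<noteq> (0, 0, 0, 0) \<and> (if A k \<ge> B k then i = 3 else i = 4))" for i :: 6 and k
  define m where "m i k = (if sel i k then 1 / lam i k else 0)" for i k
  have AB: "A k \<ge> 0" "B k \<ge> 0" for k by (auto simp: A_def B_def split: prod.splits)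
  have lb: "norm (lam i k) \<ge> 1" if s: "sel i k" for i k
  proof -
    obtain a b c e where k: "k = (a, b, c, e)" by (cases k)
    have i: "i \<in> {3, 4}" using s by (auto simp: sel_def split: if_splits)
    have n: "norm (pi * (\<i> * of_int a + of_int b)) = A k" "norm (pi * (\<i> * of_int a - of_int b)) = A k"
      "norm (pi * (\<i> * of_int c + of_int e)) = B k" "norm (pi * (\<i> * of_int c - of_int e)) = B k"
      unfolding k A_def B_def prod.case norm_mult norm_gauss by simp_all
    define M where "M j = N j i - (if i = j then 1 else 0)" for j
    have M: "norm (M j) \<le> 1/8" if "j \<in> {0, 1, 3, 4}" for j unfolding M_def by (rule N[OF i that])
    define p where "p = (if i = 3 then pi * (\<i> * of_int a - of_int b) else pi * (\<i> * of_int c - of_int e))"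
    define r where "r = M 0 * (pi * (\<i> * of_int a + of_int b)) + M 1 * (pi * (\<i> * of_int c + of_int e))
      + M 3 * (pi * (\<i> * of_int a - of_int b)) + M 4 * (pi * (\<i> * of_int c - of_int e))"
    have l: "lam i k = p + r"
      using i by (auto simp: lam_def k M_def p_def r_def algebra_simps)
    have b: "norm (M j * z) \<le> norm z / 8" if "j \<in> {0, 1, 3, 4}" for j z
      using mult_right_mono[OF M[OF that] norm_ge_zero[of z]] by (simp add: norm_mult)
    \<comment> \<open>Four perturbations of relative size 1/8 amount to at most half of max(A, B).
      That maximum is at least pi, so the symbol keeps modulus at least 1.\<close>
    have "norm r \<le> A k / 8 + B k / 8 + A k / 8 + B k / 8"
      unfolding r_def n(1)[symmetric] n(3)[symmetric] 
      by (intro norm_triangle_le add_mono b order_trans[OF b]) (simp_all only: n, simp_all)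
    moreover have "norm p = max (A k) (B k)" "max (A k) (B k) \<ge> 2"
    proof -
      show "norm p = max (A k) (B k)" using s n unfolding p_def sel_def by (auto split: if_splits)
      have "(a, b) \<noteq> (0, 0) \<or> (c, e) \<noteq> (0, 0)"
        using s by (auto simp: sel_def k)
      then have "sqrt (of_int (a\<^sup>2 + b\<^sup>2)) \<ge> 1 \<or> sqrt (of_int (c\<^sup>2 + e\<^sup>2)) \<ge> 1"
        using norm_gauss_ge_1[of a b] norm_gauss_ge_1[of c e] by blast
      then have "A k \<ge> pi * 1 \<or> B k \<ge> pi * 1" unfolding A_def B_def k prod.case
        using mult_left_mono[OF _ pi_ge_zero] by blast
      then show "max (A k) (B k) \<ge> 2" using pi_ge_two by linarith
    qed
    moreover have "norm p - norm r \<le> norm (lam i k)" unfolding l by (rule norm_diff_ineq)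
    moreover have "A k \<le> max (A k) (B k)" "B k \<le> max (A k) (B k)" by simp_all
    ultimately show ?thesis by linarith
  qed
  have m: "\<forall>k. norm (m i k) \<le> 1" for i
  proof
    fix k show "norm (m i k) \<le> 1"
      using lb[of i k] by (auto simp: m_def norm_divide divide_le_eq)
  qed
  have sel34: "(if sel 3 k then 1 else 0) + (if sel 4 k then 1 else 0) = (if k = (0, 0, 0, 0) then 0 else 1 :: complex)" for k
    by (auto simp: sel_def)
  define m1 where "m1 i k = (if sel i k then 1 else 0 :: complex)" for i k
  have m1: "\<forall>k. norm (m1 i k) \<le> 1" for i by (simp add: m1_def)
  define V where "V i f x = N 0 i * xi 0 f x + N 1 i * xi 1 f x + N 3 i * xi 3 f x + N 4 i * xi 4 f x" for i f x
  have base_inv: "inv_fun f" if "base_fun f" for f using that by (simp add: base_fun_def)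
  have p: "S2.per (\<lambda>x. c * xi j f x)" if f: "base_fun f" for c j f
  proof -
    have "S2.per (wirt j f)" for j
      unfolding wirt_eq by (intro S2.per_cmult S2.per_add S2.per_dd S2_per f)
    moreover have "xi j f = (if j = 2 \<or> j = 5 then \<lambda>x. 0 else wirt j f)"
      using xi_base[OF f] by (auto simp: fun_eq_iff)
    ultimately show ?thesis using S2.per_cmult[of "wirt j f" c] by (auto simp: S2.per_def)
  qed
  have cm: "S2.mult m (\<lambda>x. c * g x) = (\<lambda>x. c * S2.mult m g x)" for m c g by (rule S2.mult_cmult) simp_all
  have cm4: "S2.fc4 k (\<lambda>x. c * g x) = (\<lambda>x. c * S2.fc4 k g x)" for k c g by (rule S2.fc4_cmult) simp_all
  have V: "V i (S2.mult (m i) f) = S2.mult (m1 i) f" if f: "base_fun f" for i f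
  proof -
    have q: "S2.per (\<lambda>x. c * xi j f x)" for c j by (rule p[OF f])
    have Vf: "V i f = (\<lambda>x. N 0 i * xi 0 f x + N 1 i * xi 1 f x + N 3 i * xi 3 f x + N 4 i * xi 4 f x)"
      by (simp add: V_def fun_eq_iff)
    have pV: "S2.per (V i f)" unfolding Vf by (intro S2.per_add q)
    have "V i (S2.mult (m i) f) = S2.mult (m i) (V i f)"
      unfolding Vf S2.mult_add[OF S2.per_add[OF S2.per_add[OF q q] q] q m]
        S2.mult_add[OF S2.per_add[OF q q] q m] S2.mult_add[OF q q m] cm S2_mult_xi[OF f m]
      by (simp add: V_def fun_eq_iff)
    also have "... = S2.mult (m1 i) f"
    proof (rule S2.mult_symbol[OF pV S2_per[OF f] m m1])
      fix k :: freq and x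
      obtain a b c e where k: "k = (a, b, c, e)" by (cases k)
      note sm = S2.per_smooth[OF q]
      have "S2.fc4 k (V i f) x = lam i k * S2.fc4 k f x"
        unfolding Vf S2.fc4_add[OF smooth_add[OF smooth_add[OF sm sm] sm] sm]
          S2.fc4_add[OF smooth_add[OF sm sm] sm] S2.fc4_add[OF sm sm] cm4 k S2_symbol[OF f]
        by (simp add: lam_def algebra_simps)
      moreover have "lam i k \<noteq> 0" if "sel i k" using lb[OF that] by auto
      ultimately show "m i k * S2.fc4 k (V i f) x = m1 i k * S2.fc4 k f x" by (simp add: m_def m1_def)
    qed
    finally show ?thesis .
  qed
  show thesis
  proof (rule that[of "S2.mult (m 3)" "S2.mult (m 4)"])
    fix f g i and c :: complex
    show "base_fun f \<Longrightarrow> base_fun (S2.mult (m 3) f) \<and> base_fun (S2.mult (m 4) f)"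
      by (intro conjI S2_mult_base[OF _ m])
    show "base_fun f \<Longrightarrow> S2.mult (m 3) (xi i f) = xi i (S2.mult (m 3) f) \<and> S2.mult (m 4) (xi i f) = xi i (S2.mult (m 4) f)"
      by (intro conjI S2_mult_xi[OF _ m])
    show "base_fun f \<Longrightarrow> base_fun g \<Longrightarrow> S2.mult (m 3) (\<lambda>x. f x + g x) = (\<lambda>x. S2.mult (m 3) f x + S2.mult (m 3) g x)
      \<and> S2.mult (m 4) (\<lambda>x. f x + g x) = (\<lambda>x. S2.mult (m 4) f x + S2.mult (m 4) g x)"
      by (intro conjI S2.mult_add[OF S2_per S2_per m])
    show "S2.mult (m 3) (\<lambda>x. c * f x) = (\<lambda>x. c * S2.mult (m 3) f x) \<and> S2.mult (m 4) (\<lambda>x. c * f x) = (\<lambda>x. c * S2.mult (m 4) f x)"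
      by (simp only: cm simp_thms)
    fix x assume f: "base_fun f"
    define ma where "ma k = (if k = (0, 0, 0, 0) then 0 else 1 :: complex)" for k :: freq
    have ma: "\<forall>k. norm (ma k) \<le> 1" by (simp add: ma_def)
    have "f x = S2.fc4 (0, 0, 0, 0) f x + S2.mult ma f x"
      by (rule S2.mult_eq_zero_freq[OF S2_per[OF f] ma]) (simp_all add: ma_def)
    moreover have "S2.mult ma f x = S2.mult (m1 3) f x + S2.mult (m1 4) f x"
    proof -
      have "S2.mult ma f x = (\<Sum>\<^sub>\<infinity>k. m1 3 k * S2.fc4 k f x + m1 4 k * S2.fc4 k f x)"
        unfolding S2.mult_def ma_def sel34[symmetric] m1_def distrib_right ..
      also have "... = S2.mult (m1 3) f x + S2.mult (m1 4) f x"
        unfolding S2.mult_def by (intro infsum_add S2.mult_summable[OF S2_per[OF f] m1])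
      finally show ?thesis .
    qed
    ultimately show "f x = S2.fc4 (0, 0, 0, 0) f 0
       + (N 0 3 * xi 0 (S2.mult (m 3) f) x + N 1 3 * xi 1 (S2.mult (m 3) f) x + N 3 3 * xi 3 (S2.mult (m 3) f) x + N 4 3 * xi 4 (S2.mult (m 3) f) x)
       + (N 0 4 * xi 0 (S2.mult (m 4) f) x + N 1 4 * xi 1 (S2.mult (m 4) f) x + N 3 4 * xi 3 (S2.mult (m 4) f) x + N 4 4 * xi 4 (S2.mult (m 4) f) x)"
      using fun_cong[OF V[OF f, of 3], of x] fun_cong[OF V[OF f, of 4], of x] S2_mean_const[OF f, of x]
      unfolding V_def by (simp add: add.assoc)
  qed
qed

text \<open>Column i of N describes the field sum_j N j i xi_j, to be read as the i-th
  antiholomorphic field of a deformed structure. The vertical equation reduces a function to its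
  fibre average, and the horizontal one reduces this average to a constant. R commutes with all left
  invariant fields, which is what allows it inside homotopies.\<close>

theorem left_invariant_solution:
  fixes N :: "6 \<Rightarrow> 6 \<Rightarrow> complex"
  assumes N: "\<And>i j. i \<in> {3, 4} \<Longrightarrow> j \<in> {0, 1, 3, 4} \<Longrightarrow> norm (N j i - (if i = j then 1 else 0)) \<le> 1/8"
    and N5: "\<And>j. j \<in> {0, 1, 3, 4} \<Longrightarrow> N j 5 = 0" "norm (N 2 5) < norm (N 5 5)"
  obtains R :: "6 \<Rightarrow> (complex ^ 3 \<Rightarrow> complex) \<Rightarrow> complex ^ 3 \<Rightarrow> complex" where
    "\<And>i f. inv_fun f \<Longrightarrow> inv_fun (R i f)"
    "\<And>i j f. inv_fun f \<Longrightarrow> R i (xi j f) = xi j (R i f)"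
    "\<And>i f g. inv_fun f \<Longrightarrow> inv_fun g \<Longrightarrow> R i (\<lambda>x. f x + g x) = (\<lambda>x. R i f x + R i g x)"
    "\<And>i c f. inv_fun f \<Longrightarrow> R i (\<lambda>x. c * f x) = (\<lambda>x. c * R i f x)"
    "\<And>f x. inv_fun f \<Longrightarrow> f x = mean f + (\<Sum>i\<in>{3, 4, 5}. \<Sum>j\<in>UNIV. N j i * xi j (R i f) x)"
proof -
  obtain R5 where R5: "\<And>f. inv_fun f \<Longrightarrow> inv_fun (R5 f)"
    "\<And>f i. inv_fun f \<Longrightarrow> R5 (xi i f) = xi i (R5 f)"
    "\<And>f g. inv_fun f \<Longrightarrow> inv_fun g \<Longrightarrow> R5 (\<lambda>x. f x + g x) = (\<lambda>x. R5 f x + R5 g x)"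
    "\<And>f c. R5 (\<lambda>x. c * f x) = (\<lambda>x. c * R5 f x)"
    "\<And>f x. inv_fun f \<Longrightarrow> f x = vmean f x + (N 2 5 * xi 2 (R5 f) x + N 5 5 * xi 5 (R5 f) x)"
    by (rule vertical_solution[OF N5(2)], rule that; assumption)
  obtain R3 R4 where
    R: "\<And>f. base_fun f \<Longrightarrow> base_fun (R3 f) \<and> base_fun (R4 f)"
    "\<And>f i. base_fun f \<Longrightarrow> R3 (xi i f) = xi i (R3 f) \<and> R4 (xi i f) = xi i (R4 f)"
    "\<And>f g. base_fun f \<Longrightarrow> base_fun g \<Longrightarrow> R3 (\<lambda>x. f x + g x) = (\<lambda>x. R3 f x + R3 g x) \<and> R4 (\<lambda>x. f x + g x) = (\<lambda>x. R4 f x + R4 g x)"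
    "\<And>f c. R3 (\<lambda>x. c * f x) = (\<lambda>x. c * R3 f x) \<and> R4 (\<lambda>x. c * f x) = (\<lambda>x. c * R4 f x)"
    "\<And>f x. base_fun f \<Longrightarrow> f x = S2.fc4 (0, 0, 0, 0) f 0
       + (N 0 3 * xi 0 (R3 f) x + N 1 3 * xi 1 (R3 f) x + N 3 3 * xi 3 (R3 f) x + N 4 3 * xi 4 (R3 f) x)
       + (N 0 4 * xi 0 (R4 f) x + N 1 4 * xi 1 (R4 f) x + N 3 4 * xi 3 (R4 f) x + N 4 4 * xi 4 (R4 f) x)"
    by (rule horizontal_solution[of N], rule N, assumption, assumption, rule that; assumption)
  define R' where "R' i f = (if i = 3 then R3 (vmean f) else if i = 4 then R4 (vmean f) else R5 f)" for i :: 6 and f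
  note vb = vmean_base
  show thesis
  proof (rule that[of R'])
    fix i j f g and c :: complex
    show "inv_fun (R' i f)" if "inv_fun f"
      using R(1)[OF vb[OF that]] R5(1)[OF that] by (auto simp: R'_def base_fun_def)
    show "R' i (xi j f) = xi j (R' i f)" if "inv_fun f"
      using R(2)[OF vb[OF that], of j] R5(2)[OF that, of j] by (simp add: R'_def vmean_xi[OF that])
    show "R' i (\<lambda>x. f x + g x) = (\<lambda>x. R' i f x + R' i g x)" if f: "inv_fun f" and g: "inv_fun g"
      using R(3)[OF vb[OF f] vb[OF g]] R5(3)[OF f g] by (simp add: R'_def vmean_add[OF f g])
    show "R' i (\<lambda>x. c * f x) = (\<lambda>x. c * R' i f x)"
      using R(4)[of c "vmean f"] R5(4)[of c f] by (simp add: R'_def vmean_cmult)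
    fix x assume f: "inv_fun f"
    have b: "base_fun (R3 (vmean f))" "base_fun (R4 (vmean f))" using R(1)[OF vb[OF f]] by auto
    \<comment> \<open>Base functions are killed by the central fields, so the central entries of
      columns 3 and 4 contribute nothing and need no bound.\<close>
    have z: "xi 2 (R3 (vmean f)) x = 0" "xi 5 (R3 (vmean f)) x = 0" "xi 2 (R4 (vmean f)) x = 0" "xi 5 (R4 (vmean f)) x = 0"
      using xi_base[OF b(1)] xi_base[OF b(2)] by simp_all
    have n5: "N 0 5 = 0" "N 1 5 = 0" "N 3 5 = 0" "N 4 5 = 0" using N5(1) by simp_all
    have "(\<Sum>i\<in>{3, 4, 5}. \<Sum>j\<in>UNIV. N j i * xi j (R' i f) x) =
      (\<Sum>j\<in>UNIV. N j 3 * xi j (R3 (vmean f)) x) + (\<Sum>j\<in>UNIV. N j 4 * xi j (R4 (vmean f)) x) + (\<Sum>j\<in>UNIV. N j 5 * xi j (R5 f) x)"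
      by (simp add: R'_def)
    also have "mean f + ... = f x"
      unfolding sum_6 z n5 mean_def using R5(5)[OF f, of x] R(5)[OF vb[OF f], of x] by simp
    finally show "f x = mean f + (\<Sum>i\<in>{3, 4, 5}. \<Sum>j\<in>UNIV. N j i * xi j (R' i f) x)" by simp
  qed
qed

section \<open>The exterior algebra and its endomorphisms\<close>

definition clinear_map :: "(ext \<Rightarrow> ext) \<Rightarrow> bool" where
  "clinear_map L \<longleftrightarrow> (\<forall>u v. L (u + v) = L u + L v) \<and> (\<forall>c u. L (c *s u) = c *s L u)"

lemma clinear_mapI: "(\<And>u v. L (u + v) = L u + L v) \<Longrightarrow> (\<And>c u. L (c *s u) = c *s L u) \<Longrightarrow> clinear_map L"
  by (simp add: clinear_map_def)

lemma clinear_add: "clinear_map L \<Longrightarrow> L (u + v) = L u + L v"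
  and clinear_scale: "clinear_map L \<Longrightarrow> L (c *s u) = c *s L u"
  by (simp_all add: clinear_map_def)

lemma clinear_zero: "clinear_map L \<Longrightarrow> L 0 = 0"
  using clinear_scale[of L 0 0] by simp

lemma clinear_neg: "clinear_map L \<Longrightarrow> L (- u) = - L u"
  using clinear_scale[of L "-1" u] by (simp add: vector_smult_lneg)

lemma clinear_diff: "clinear_map L \<Longrightarrow> L (u - v) = L u - L v"
  using clinear_add[of L u "- v"] clinear_neg[of L v] by simp

lemma clinear_sum: "clinear_map L \<Longrightarrow> L (\<Sum>i\<in>A. f i) = (\<Sum>i\<in>A. L (f i))"
  by (induction A rule: infinite_finite_induct) (simp_all add: clinear_zero clinear_add)

lemma ext_expand: "u = (\<Sum>I\<in>UNIV. u $ I *s axis I 1)" for u :: ext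
  by (simp add: basis_expansion)

lemma clinear_ext:
  assumes "clinear_map L" "clinear_map M" "\<And>I. L (axis I 1) = M (axis I 1)"
  shows "L u = M u"
proof -
  have "L u = (\<Sum>I\<in>UNIV. u $ I *s L (axis I 1))"
    by (subst ext_expand[of u]) (simp only: clinear_sum[OF assms(1)] clinear_scale[OF assms(1)])
  also have "... = M (\<Sum>I\<in>UNIV. u $ I *s axis I 1)"
    by (simp only: clinear_sum[OF assms(2)] clinear_scale[OF assms(2)] assms(3))
  finally show ?thesis using ext_expand[of u] by simp
qed

lemma clinear_comp: "clinear_map L \<Longrightarrow> clinear_map M \<Longrightarrow> clinear_map (\<lambda>u. L (M u))"
  by (simp add: clinear_map_def)

lemma clinear_plus: "clinear_map L \<Longrightarrow> clinear_map M \<Longrightarrow> clinear_map (\<lambda>u. L u + M u)"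
  by (simp add: clinear_map_def algebra_simps vector_add_ldistrib)

lemma clinear_minus: "clinear_map L \<Longrightarrow> clinear_map M \<Longrightarrow> clinear_map (\<lambda>u. L u - M u)"
  by (simp add: clinear_map_def algebra_simps vector_ssub_ldistrib vector_add_ldistrib)

lemma clinear_smult: "clinear_map L \<Longrightarrow> clinear_map (\<lambda>u. c *s L u)"
  by (simp add: clinear_map_def algebra_simps vector_add_ldistrib vector_smult_assoc)

lemma clinear_id: "clinear_map (\<lambda>u. u)" by (simp add: clinear_map_def)

lemma clinear_const_zero: "clinear_map (\<lambda>u. 0)" by (simp add: clinear_map_def)

lemma clinear_setsum: "(\<And>i. i \<in> A \<Longrightarrow> clinear_map (L i)) \<Longrightarrow> clinear_map (\<lambda>u. \<Sum>i\<in>A. L i u)"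
  by (induction A rule: infinite_finite_induct) (auto intro: clinear_plus clinear_const_zero)

lemma wedge_add_left: "wedge (u + v) w = wedge u w + wedge v w"
  and wedge_add_right: "wedge w (u + v) = wedge w u + wedge w v"
  and wedge_scale_left: "wedge (c *s u) w = c *s wedge u w"
  and wedge_scale_right: "wedge w (c *s u) = c *s wedge w u"
  by (simp_all add: wedge_def vec_eq_iff algebra_simps sum.distrib sum_distrib_left)

lemma clinear_wedge_left: "clinear_map (\<lambda>u. wedge u w)" and clinear_wedge_right: "clinear_map (wedge w)"
  by (simp_all add: clinear_map_def wedge_add_left wedge_add_right wedge_scale_left wedge_scale_right)

lemma clinear_wedge_comp: "clinear_map L \<Longrightarrow> clinear_map (\<lambda>u. wedge w (L u))"
  and clinear_wedge_lcomp: "clinear_map L \<Longrightarrow> clinear_map (\<lambda>u. wedge (L u) w)"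
  by (simp_all add: clinear_map_def wedge_add_left wedge_add_right wedge_scale_left wedge_scale_right)

lemma clinear_uminus: "clinear_map L \<Longrightarrow> clinear_map (\<lambda>u. - L u)"
  by (simp add: clinear_map_def vec.scale_minus_right)

lemmas clinear_intros = clinear_wedge_comp clinear_wedge_lcomp clinear_id clinear_const_zero
  clinear_plus clinear_minus clinear_smult clinear_uminus

lemmas wedge_zero_left = clinear_zero[OF clinear_wedge_left]
lemmas wedge_zero_right = clinear_zero[OF clinear_wedge_right]
lemmas wedge_neg_left = clinear_neg[OF clinear_wedge_left]
lemmas wedge_neg_right = clinear_neg[OF clinear_wedge_right]
lemmas wedge_diff_left = clinear_diff[OF clinear_wedge_left]
lemmas wedge_diff_right = clinear_diff[OF clinear_wedge_right]
lemmas wedge_sum_left = clinear_sum[OF clinear_wedge_left]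
lemmas wedge_sum_right = clinear_sum[OF clinear_wedge_right]

lemma wedge_axis: "wedge (axis I 1) (axis J 1) = (if I \<inter> J = {} then shuffle_sign I J *s axis (I \<union> J) 1 else 0)"
proof -
  have "wedge (axis I 1) (axis J 1) $ K = (if I \<inter> J = {} then shuffle_sign I J *s axis (I \<union> J) 1 else 0) $ K" for K
  proof -
    have "wedge (axis I 1) (axis J 1) $ K =
      (\<Sum>I'\<in>Pow K. if I' = I then shuffle_sign I (K - I) * axis J 1 $ (K - I) else 0)"
      unfolding wedge_def vec_lambda_beta by (rule sum.cong) (auto simp: axis_def)
    also have "... = (if I \<subseteq> K then shuffle_sign I (K - I) * axis J 1 $ (K - I) else 0)"
      by (simp add: sum.delta)
    also have "... = (if I \<inter> J = {} \<and> K = I \<union> J then shuffle_sign I J else 0)"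
    proof (cases "I \<subseteq> K \<and> K - I = J")
      case True
      then have "I \<inter> J = {} \<and> K = I \<union> J" by auto
      then show ?thesis using True by (auto simp: axis_def)
    next
      case False
      then have "\<not> (I \<inter> J = {} \<and> K = I \<union> J)" by auto
      then show ?thesis using False by (auto simp: axis_def)
    qed
    finally show ?thesis by (auto simp: axis_def)
  qed
  then show ?thesis by (simp add: vec_eq_iff)
qed

text \<open>Inversions are counted additively over disjoint unions, so the sign is multiplicative in
  each argument; associativity of the product rests on this.\<close>

lemma shuffle_sign_union_left: "I \<inter> J = {} \<Longrightarrow> shuffle_sign (I \<union> J) K = shuffle_sign I K * shuffle_sign J K"
proof -
  assume d: "I \<inter> J = {}"
  have "{(i, j). i \<in> I \<union> J \<and> j \<in> K \<and> j < i} = {(i, j). i \<in> I \<and> j \<in> K \<and> j < i} \<union> {(i, j). i \<in> J \<and> j \<in> K \<and> j < i}"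
    by auto
  moreover have "{(i, j). i \<in> I \<and> j \<in> K \<and> j < i} \<inter> {(i, j). i \<in> J \<and> j \<in> K \<and> j < i} = {}" using d by auto
  ultimately show ?thesis unfolding shuffle_sign_def by (simp add: card_Un_disjoint power_add)
qed

lemma shuffle_sign_union_right: "J \<inter> K = {} \<Longrightarrow> shuffle_sign I (J \<union> K) = shuffle_sign I J * shuffle_sign I K"
proof -
  assume d: "J \<inter> K = {}"
  have "{(i, j). i \<in> I \<and> j \<in> J \<union> K \<and> j < i} = {(i, j). i \<in> I \<and> j \<in> J \<and> j < i} \<union> {(i, j). i \<in> I \<and> j \<in> K \<and> j < i}"
    by auto
  moreover have "{(i, j). i \<in> I \<and> j \<in> J \<and> j < i} \<inter> {(i, j). i \<in> I \<and> j \<in> K \<and> j < i} = {}" using d by auto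
  ultimately show ?thesis unfolding shuffle_sign_def by (simp add: card_Un_disjoint power_add)
qed

lemma wedge_assoc_axis: "wedge (wedge (axis I 1) (axis J 1)) (axis K 1) = wedge (axis I 1) (wedge (axis J 1) (axis K 1))"
proof (cases "I \<inter> J = {} \<and> (I \<union> J) \<inter> K = {}")
  case True
  then have "I \<inter> J = {}" "(I \<union> J) \<inter> K = {}" "J \<inter> K = {}" "I \<inter> (J \<union> K) = {}" "I \<inter> K = {}" by auto
  then show ?thesis
    by (simp add: wedge_axis wedge_scale_left wedge_scale_right vector_smult_assoc
        shuffle_sign_union_left shuffle_sign_union_right Un_assoc mult_ac)
next
  case False
  then have "I \<inter> J \<noteq> {} \<or> (I \<union> J) \<inter> K \<noteq> {}" "J \<inter> K \<noteq> {} \<or> I \<inter> (J \<union> K) \<noteq> {}" by auto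
  then show ?thesis
    by (auto simp: wedge_axis wedge_scale_left wedge_scale_right wedge_zero_left wedge_zero_right)
qed

text \<open>Linearity in each of the three arguments reduces the identity to monomials.\<close>

lemma wedge_assoc: "wedge (wedge u v) w = wedge u (wedge v w)"
proof -
  have 1: "wedge (wedge (axis I 1) (axis J 1)) w = wedge (axis I 1) (wedge (axis J 1) w)" for I J w
    by (rule clinear_ext[of "\<lambda>w. wedge (wedge (axis I 1) (axis J 1)) w" "\<lambda>w. wedge (axis I 1) (wedge (axis J 1) w)"])
      (intro clinear_intros wedge_assoc_axis)+
  have 2: "wedge (wedge (axis I 1) v) w = wedge (axis I 1) (wedge v w)" for I v w
    by (rule clinear_ext[of "\<lambda>v. wedge (wedge (axis I 1) v) w" "\<lambda>v. wedge (axis I 1) (wedge v w)"])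
      (intro clinear_intros 1)+
  show ?thesis
    by (rule clinear_ext[of "\<lambda>u. wedge (wedge u v) w" "\<lambda>u. wedge u (wedge v w)"])
      (intro clinear_intros 2)+
qed

definition sg :: "6 \<Rightarrow> 6 set \<Rightarrow> complex" where "sg i I = (-1) ^ card {j \<in> I. j < i}"

lemma sg_sq: "sg i I * sg i I = 1"
  by (simp add: sg_def power_mult_distrib[symmetric])

lemma sg_insert: "j \<notin> J \<Longrightarrow> sg i (insert j J) = (if j < i then - sg i J else sg i J)"
proof -
  assume j: "j \<notin> J"
  have "{k \<in> insert j J. k < i} = (if j < i then insert j {k \<in> J. k < i} else {k \<in> J. k < i})" by auto
  then show ?thesis using j by (simp add: sg_def)
qed

lemma shuffle_sign_single: "shuffle_sign {i} J = sg i J"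
proof -
  have "{(i', j). i' \<in> {i} \<and> j \<in> J \<and> j < i'} = Pair i ` {j \<in> J. j < i}" by auto
  then show ?thesis by (simp add: shuffle_sign_def sg_def card_image inj_on_def)
qed

text \<open>Interior multiplication by the vector dual to gen i.\<close>

definition contr :: "6 \<Rightarrow> ext \<Rightarrow> ext" where
  "contr i u = (\<chi> K. if i \<in> K then 0 else sg i K * u $ insert i K)"

lemma clinear_contr: "clinear_map (contr i)"
  by (auto simp: clinear_map_def contr_def vec_eq_iff algebra_simps)

lemma clinear_contr_comp: "clinear_map L \<Longrightarrow> clinear_map (\<lambda>u. contr i (L u))"
  by (rule clinear_comp[OF clinear_contr])

lemma wedge_gen_axis: "wedge (gen i) (axis I 1) = (if i \<in> I then 0 else sg i I *s axis (insert i I) 1)"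
  by (simp add: gen_def wedge_axis shuffle_sign_single)

lemma contr_axis: "contr i (axis I 1) = (if i \<in> I then sg i (I - {i}) *s axis (I - {i}) 1 else 0)"
proof -
  have "contr i (axis I 1) $ K = (if i \<in> I then sg i (I - {i}) *s axis (I - {i}) 1 else 0) $ K" for K
  proof (cases "i \<in> K")
    case True then show ?thesis by (auto simp: contr_def axis_def)
  next
    case False
    have "insert i K = I \<longleftrightarrow> i \<in> I \<and> K = I - {i}" using False by auto
    then show ?thesis using False by (auto simp: contr_def axis_def)
  qed
  then show ?thesis by (simp add: vec_eq_iff)
qed

lemma gen_anticomm: "wedge (gen i) (wedge (gen j) v) = - wedge (gen j) (wedge (gen i) v)"
proof (rule clinear_ext[of "\<lambda>v. wedge (gen i) (wedge (gen j) v)" "\<lambda>v. - wedge (gen j) (wedge (gen i) v)"])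
  show "clinear_map (\<lambda>v. wedge (gen i) (wedge (gen j) v))" "clinear_map (\<lambda>v. - wedge (gen j) (wedge (gen i) v))"
    by (intro clinear_intros)+
  fix I
  show "wedge (gen i) (wedge (gen j) (axis I 1)) = - wedge (gen j) (wedge (gen i) (axis I 1))"
    by (cases "i = j"; cases "i < j"; cases "i \<in> I"; cases "j \<in> I")
      (simp_all add: wedge_gen_axis wedge_scale_right wedge_zero_right sg_insert vector_smult_assoc
        insert_commute mult.commute vector_smult_lneg)
qed

lemma eq_neg_self: "u = - u \<Longrightarrow> u = 0" for u :: ext
proof (rule vec_eq_iff[THEN iffD2], rule allI)
  fix I assume "u = - u"
  then have "u $ I = - (u $ I)" by (metis vector_uminus_component)
  then show "u $ I = (0 :: ext) $ I" by (simp add: eq_neg_iff_add_eq_0)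
qed

lemma gen_square: "wedge (gen i) (wedge (gen i) v) = 0"
  by (rule eq_neg_self) (rule gen_anticomm)

lemma wedge_gen_nth: "wedge (gen j) v $ K = (if j \<in> K then sg j (K - {j}) * v $ (K - {j}) else 0)"
proof -
  have "wedge (gen j) v $ K = (\<Sum>I\<in>Pow K. if I = {j} then sg j (K - {j}) * v $ (K - {j}) else 0)"
    unfolding wedge_def vec_lambda_beta gen_def by (rule sum.cong) (auto simp: axis_def shuffle_sign_single)
  also have "... = (if j \<in> K then sg j (K - {j}) * v $ (K - {j}) else 0)"
    by (simp add: sum.delta)
  finally show ?thesis .
qed

lemma contr_nth: "contr i u $ K = (if i \<in> K then 0 else sg i K * u $ insert i K)"
  by (simp add: contr_def)

text \<open>The Clifford relation between creation and annihilation: every later computation with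
  contractions, in particular Cartan's formula, is a use of it.\<close>

lemma contr_wedge: "contr i (wedge (gen j) v) = (if i = j then v else 0) - wedge (gen j) (contr i v)"
proof (rule vec_eq_iff[THEN iffD2], rule allI)
  fix K
  have sq: "sg k I * (sg k I * z) = z" for k I z using sg_sq[of k I] by (simp add: mult.assoc[symmetric])
  show "contr i (wedge (gen j) v) $ K = ((if i = j then v else 0) - wedge (gen j) (contr i v)) $ K"
  proof (cases "i = j")
    case True
    show ?thesis
    proof (cases "j \<in> K")
      case k: True
      then have "insert j (K - {j}) = K" by auto
      then show ?thesis using True k by (simp add: contr_nth wedge_gen_nth sq)
    next
      case k: False
      then have "insert j K - {j} = K" by auto
      then show ?thesis using True k by (simp add: contr_nth wedge_gen_nth sq)
    qed
  next
    case False
    show ?thesis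
    proof (cases "i \<in> K \<or> j \<notin> K")
      case True then show ?thesis using False by (auto simp: contr_nth wedge_gen_nth)
    next
      case F: False
      define J where "J = K - {j}"
      have K: "K = insert j J" "j \<notin> J" "i \<notin> J" using F by (auto simp: J_def)
      have e: "insert i (insert j J) - {j} = insert i J" "insert j J - {j} = J" using K False by auto
      show ?thesis using K False by (cases "i < j") (simp_all add: contr_nth wedge_gen_nth e sg_insert)
    qed
  qed
qed

lemma contr_contr: "contr i (contr j v) = - contr j (contr i v)"
proof (rule vec_eq_iff[THEN iffD2], rule allI)
  fix K
  show "contr i (contr j v) $ K = (- contr j (contr i v)) $ K"
    by (cases "i = j"; cases "i < j"; cases "i \<in> K"; cases "j \<in> K")
      (simp_all add: contr_def sg_insert insert_commute)
qed

lemma contr_square: "contr i (contr i v) = 0"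
  by (rule eq_neg_self) (rule contr_contr)

definition one_ext :: ext where "one_ext = axis {} 1"

definition ml :: "(6 \<Rightarrow> ext) \<Rightarrow> 6 list \<Rightarrow> ext" where
  "ml \<theta> xs = foldr wedge (map \<theta> xs) one_ext"

lemma ml_simps: "ml \<theta> [] = one_ext" "ml \<theta> (x # xs) = wedge (\<theta> x) (ml \<theta> xs)"
  by (simp_all add: ml_def)

lemma monomial_ml: "monomial \<theta> I = ml \<theta> (sorted_list_of_set I)"
  by (simp add: monomial_def ml_def one_ext_def)

text \<open>Anticommutation is phrased for left multiplication operators, the form in which letters
  are moved inside a word.\<close>

definition anticomm :: "(6 \<Rightarrow> ext) \<Rightarrow> bool" where
  "anticomm \<theta> \<longleftrightarrow> (\<forall>i j v. wedge (\<theta> i) (wedge (\<theta> j) v) = - wedge (\<theta> j) (wedge (\<theta> i) v))"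

lemma anticommD: "anticomm \<theta> \<Longrightarrow> wedge (\<theta> i) (wedge (\<theta> j) v) = - wedge (\<theta> j) (wedge (\<theta> i) v)"
  unfolding anticomm_def by blast

lemma anticomm_square: "anticomm \<theta> \<Longrightarrow> wedge (\<theta> i) (wedge (\<theta> i) v) = 0"
  by (rule eq_neg_self) (rule anticommD)

text \<open>Moving the new letter to its sorted place passes exactly the smaller letters, one sign
  for each.\<close>

lemma ml_insort:
  assumes "anticomm \<theta>" "sorted xs" "distinct xs" "i \<notin> set xs"
  shows "wedge (\<theta> i) (ml \<theta> xs) = sg i (set xs) *s ml \<theta> (insort i xs)"
  using assms(2-)
proof (induction xs)
  case Nil then show ?case by (simp add: ml_simps sg_def)
next
  case (Cons x xs)
  show ?case
  proof (cases "i \<le> x")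
    case True
    have "{j \<in> set (x # xs). j < i} = {}" using True Cons.prems by auto
    then have "sg i (set (x # xs)) = 1" unfolding sg_def by (simp only: card.empty power_0)
    then show ?thesis using True by (simp add: ml_simps)
  next
    case False
    have "wedge (\<theta> i) (ml \<theta> (x # xs)) = - wedge (\<theta> x) (wedge (\<theta> i) (ml \<theta> xs))"
      unfolding ml_simps by (rule anticommD[OF assms(1)])
    also have "... = - (sg i (set xs) *s wedge (\<theta> x) (ml \<theta> (insort i xs)))"
      using Cons by (simp add: wedge_scale_right)
    finally show ?thesis using False Cons.prems by (simp add: ml_simps sg_insert vector_smult_lneg)
  qed
qed

lemma ml_member:
  assumes "anticomm \<theta>" "i \<in> set xs" shows "wedge (\<theta> i) (ml \<theta> xs) = 0"
  using assms(2)
proof (induction xs)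
  case (Cons x xs)
  show ?case
  proof (cases "i = x")
    case True then show ?thesis using anticomm_square[OF assms(1)] by (simp add: ml_simps)
  next
    case False
    then have "wedge (\<theta> i) (ml \<theta> xs) = 0" using Cons by simp
    then show ?thesis unfolding ml_simps anticommD[OF assms(1), of i x] by (simp add: wedge_zero_right)
  qed
qed simp

lemma wedge_monomial:
  assumes "anticomm \<theta>"
  shows "wedge (\<theta> i) (monomial \<theta> I) = (if i \<in> I then 0 else sg i I *s monomial \<theta> (insert i I))"
  using ml_insort[OF assms, of "sorted_list_of_set I" i] ml_member[OF assms, of i "sorted_list_of_set I"]
  by (auto simp: monomial_ml)

lemma anticomm_gen: "anticomm gen"
  unfolding anticomm_def using gen_anticomm by blast

lemma monomial_empty: "monomial \<theta> {} = one_ext"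
  by (simp add: monomial_ml ml_simps)

lemma monomial_gen: "monomial gen I = axis I 1"
proof -
  have "finite I" by simp
  then show ?thesis
  proof (induction I)
    case empty then show ?case by (simp add: monomial_empty one_ext_def)
  next
    case (insert i I)
    have "sg i I *s monomial gen (insert i I) = wedge (gen i) (monomial gen I)"
      using wedge_monomial[OF anticomm_gen, of i I] insert.hyps by simp
    also have "... = sg i I *s axis (insert i I) 1"
      using wedge_gen_axis[of i I] insert by simp
    finally have "sg i I *s monomial gen (insert i I) = sg i I *s axis (insert i I) 1" .
    moreover have "sg i I \<noteq> 0" by (simp add: sg_def)
    ultimately show ?case unfolding vector_mul_lcancel by blast
  qed
qed

text \<open>The algebra endomorphism induced by gen i \<mapsto> \<theta> i; changes of frame, the
  shear and complex conjugation are all described by it.\<close>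

definition Lam :: "(6 \<Rightarrow> ext) \<Rightarrow> ext \<Rightarrow> ext" where
  "Lam \<theta> u = (\<Sum>I\<in>UNIV. u $ I *s monomial \<theta> I)"

lemma axis_ml: "axis I 1 = ml gen (sorted_list_of_set I)"
  using monomial_gen[of I] by (simp only: monomial_ml)

lemma clinear_Lam: "clinear_map (Lam \<theta>)"
proof (rule clinear_mapI)
  show "Lam \<theta> (u + v) = Lam \<theta> u + Lam \<theta> v" for u v
    by (simp only: Lam_def vector_add_component vector_sadd_rdistrib sum.distrib)
  show "Lam \<theta> (c *s u) = c *s Lam \<theta> u" for c u
    by (simp add: Lam_def vec.scale_sum_right vector_smult_assoc)
qed

lemma clinear_Lam_comp: "clinear_map L \<Longrightarrow> clinear_map (\<lambda>u. Lam \<theta> (L u))"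
  by (rule clinear_comp[OF clinear_Lam])

lemma Lam_axis: "Lam \<theta> (axis I 1) = monomial \<theta> I"
proof -
  have "(\<Sum>J\<in>UNIV. (axis I 1 :: ext) $ J *s monomial \<theta> J) = (\<Sum>J\<in>UNIV. if J = I then monomial \<theta> J else 0)"
    by (rule sum.cong) (auto simp: axis_def)
  then show ?thesis unfolding Lam_def by (simp only: sum.delta[OF finite] UNIV_I if_True)
qed

lemma Lam_one: "Lam \<theta> one_ext = one_ext"
  unfolding one_ext_def Lam_axis by (simp add: monomial_empty one_ext_def)

lemma Lam_gen_wedge:
  assumes "anticomm \<theta>" shows "Lam \<theta> (wedge (gen i) v) = wedge (\<theta> i) (Lam \<theta> v)"
proof (rule clinear_ext[of "\<lambda>v. Lam \<theta> (wedge (gen i) v)" "\<lambda>v. wedge (\<theta> i) (Lam \<theta> v)"])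
  show "Lam \<theta> (wedge (gen i) (axis I 1)) = wedge (\<theta> i) (Lam \<theta> (axis I 1))" for I
    by (simp add: wedge_gen_axis Lam_axis wedge_monomial[OF assms] clinear_scale[OF clinear_Lam] clinear_zero[OF clinear_Lam])
qed (intro clinear_intros clinear_Lam_comp)+

lemma wedge_one: "wedge one_ext v = v"
proof (rule clinear_ext[of "wedge one_ext" "\<lambda>v. v"])
  show "wedge one_ext (axis I 1) = axis I 1" for I
    by (simp add: one_ext_def wedge_axis shuffle_sign_def)
qed (intro clinear_intros)+

lemma wedge_one_right: "wedge v one_ext = v"
proof (rule clinear_ext[of "\<lambda>v. wedge v one_ext" "\<lambda>v. v"])
  show "wedge (axis I 1) one_ext = axis I 1" for I
    by (simp add: one_ext_def wedge_axis shuffle_sign_def)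
qed (intro clinear_intros)+

lemma Lam_gen: "anticomm \<theta> \<Longrightarrow> Lam \<theta> (gen i) = \<theta> i"
  using Lam_gen_wedge[of \<theta> i one_ext] by (simp add: wedge_one_right Lam_one)

text \<open>Induction over words in the generators, suited to algebra maps and antiderivations,
  whose behaviour on a product with one generator is known.\<close>

lemma ext_gen_induct:
  assumes "P one_ext" "\<And>i v. P v \<Longrightarrow> P (wedge (gen i) v)"
    and "\<And>u v. P u \<Longrightarrow> P v \<Longrightarrow> P (u + v)" "\<And>c u. P u \<Longrightarrow> P (c *s u)"
  shows "P u"
proof -
  have ax: "P (axis I 1)" for I
  proof -
    have "P (ml gen xs)" for xs by (induction xs) (simp_all add: ml_simps assms)
    then show ?thesis by (simp only: axis_ml)
  qed
  have "P 0" using assms(4)[OF assms(1), of 0] by simp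
  then have "P (\<Sum>I\<in>A. u $ I *s axis I 1)" for A
    by (induction A rule: infinite_finite_induct) (auto intro: assms ax)
  then show ?thesis using ext_expand[of u] by metis
qed

lemma Lam_wedge:
  assumes "anticomm \<theta>" shows "Lam \<theta> (wedge u v) = wedge (Lam \<theta> u) (Lam \<theta> v)"
proof (induction u rule: ext_gen_induct)
  case 1 then show ?case by (simp add: wedge_one Lam_one)
next
  case (2 i u) then show ?case by (simp add: wedge_assoc Lam_gen_wedge[OF assms])
next
  case (3 u w) then show ?case by (simp add: wedge_add_left clinear_add[OF clinear_Lam])
next
  case (4 c u) then show ?case by (simp add: wedge_scale_left clinear_scale[OF clinear_Lam])
qed

text \<open>The universal property; identities between algebra maps are proved by comparing both
  sides on generators.\<close>

lemma Lam_unique: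
  assumes "clinear_map L" "L one_ext = one_ext" "\<And>i v. L (wedge (gen i) v) = wedge (\<theta> i) (L v)"
  shows "L u = Lam \<theta> u"
proof (rule clinear_ext[OF assms(1) clinear_Lam])
  fix I
  have "L (ml gen xs) = ml \<theta> xs" for xs by (induction xs) (simp_all add: ml_simps assms)
  then show "L (axis I 1) = Lam \<theta> (axis I 1)"
    by (simp only: Lam_axis monomial_ml) (simp only: axis_ml)
qed

lemma alghom_monomial:
  assumes "L one_ext = one_ext" "\<And>u v. L (wedge u v) = wedge (L u) (L v)"
  shows "L (monomial \<theta> I) = monomial (\<lambda>i. L (\<theta> i)) I"
proof -
  have "L (ml \<theta> xs) = ml (\<lambda>i. L (\<theta> i)) xs" for xs by (induction xs) (simp_all add: ml_simps assms)
  then show ?thesis by (simp add: monomial_ml)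
qed

definition deg1 :: "ext \<Rightarrow> bool" where "deg1 u \<longleftrightarrow> (\<exists>c. u = (\<Sum>i\<in>UNIV. c i *s gen i))"

lemma deg1_anticomm:
  assumes "deg1 p" "deg1 q" shows "wedge p (wedge q v) = - wedge q (wedge p v)"
proof -
  obtain c d where c: "p = (\<Sum>i\<in>UNIV. c i *s gen i)" and d: "q = (\<Sum>i\<in>UNIV. d i *s gen i)"
    using assms by (auto simp: deg1_def)
  define X where "X i j = wedge (gen i) (wedge (gen j) v)" for i j
  have X: "X i j = - X j i" for i j unfolding X_def by (rule gen_anticomm)
  have "wedge p (wedge q v) = (\<Sum>j\<in>UNIV. \<Sum>i\<in>UNIV. (d j * c i) *s X i j)"
    unfolding c d X_def wedge_sum_left wedge_sum_right wedge_scale_left wedge_scale_right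
    by (simp add: vec.scale_sum_right vector_smult_assoc)
  also have "... = (\<Sum>i\<in>UNIV. \<Sum>j\<in>UNIV. (d j * c i) *s X i j)" by (rule sum.swap)
  also have "... = (\<Sum>i\<in>UNIV. \<Sum>j\<in>UNIV. - ((c i * d j) *s X j i))"
    by (intro sum.cong refl, subst X) (simp add: vec.scale_minus_right mult.commute)
  also have "... = - (\<Sum>i\<in>UNIV. \<Sum>j\<in>UNIV. (c i * d j) *s X j i)" by (simp add: sum_negf)
  also have "(\<Sum>i\<in>UNIV. \<Sum>j\<in>UNIV. (c i * d j) *s X j i) = wedge q (wedge p v)"
    unfolding c d X_def wedge_sum_left wedge_sum_right wedge_scale_left wedge_scale_right
    by (simp add: vec.scale_sum_right vector_smult_assoc)
  finally show ?thesis .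
qed

lemma deg1_family_anticomm: "(\<And>i. deg1 (\<theta> i)) \<Longrightarrow> anticomm \<theta>"
  unfolding anticomm_def using deg1_anticomm by blast

lemma deg1_gen: "deg1 (gen i)"
proof -
  have "(\<Sum>j\<in>UNIV. (if j = i then 1 else 0) *s gen j) = (\<Sum>j\<in>UNIV. if j = i then gen j else 0)"
    by (rule sum.cong) auto
  also have "... = gen i" by (simp only: sum.delta[OF finite] UNIV_I if_True)
  finally show ?thesis unfolding deg1_def by (intro exI[of _ "\<lambda>j. if j = i then 1 else 0"]) (rule sym)
qed

lemma deg1_add: "deg1 u \<Longrightarrow> deg1 v \<Longrightarrow> deg1 (u + v)"
  unfolding deg1_def
proof clarify
  fix c d show "\<exists>e. (\<Sum>i\<in>UNIV. c i *s gen i) + (\<Sum>i\<in>UNIV. d i *s gen i) = (\<Sum>i\<in>UNIV. e i *s gen i)"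
    by (rule exI[of _ "\<lambda>i. c i + d i"]) (simp add: vector_sadd_rdistrib sum.distrib)
qed

lemma deg1_scale: "deg1 u \<Longrightarrow> deg1 (a *s u)"
  unfolding deg1_def
proof clarify
  fix c show "\<exists>e. a *s (\<Sum>i\<in>UNIV. c i *s gen i) = (\<Sum>i\<in>UNIV. e i *s gen i)"
    by (rule exI[of _ "\<lambda>i. a * c i"]) (simp add: vec.scale_sum_right vector_smult_assoc)
qed

lemma deg1_diff: "deg1 u \<Longrightarrow> deg1 v \<Longrightarrow> deg1 (u - v)"
  using deg1_add[of u "(-1) *s v"] deg1_scale[of v "-1"] by (simp add: vector_smult_lneg)

section \<open>The shear to the left invariant frame, and conjugation\<close>

text \<open>For i \<noteq> j the subtracted operator has square zero, so this is the exponential of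
  the derivation gen j \<mapsto> - c gen i, and therefore an algebra map.\<close>

definition elem_shear :: "complex \<Rightarrow> 6 \<Rightarrow> 6 \<Rightarrow> ext \<Rightarrow> ext" where
  "elem_shear c i j u = u - c *s wedge (gen i) (contr j u)"

text \<open>At a point x and with c = x $ 1 this carries the coordinate frame to the left invariant
  one: gen 2 becomes dz3 - z1 dz2, and likewise for the conjugates.\<close>

definition shear :: "complex \<Rightarrow> ext \<Rightarrow> ext" where
  "shear c u = elem_shear c 1 2 (elem_shear (cnj c) 4 5 u)"

definition shear_gen :: "complex \<Rightarrow> 6 \<Rightarrow> ext" where
  "shear_gen c i = (if i = 2 then gen 2 - c *s gen 1 else if i = 5 then gen 5 - cnj c *s gen 4 else gen i)"

lemma clinear_elem_shear: "clinear_map L \<Longrightarrow> clinear_map (\<lambda>u. elem_shear c i j (L u))"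
  unfolding elem_shear_def by (intro clinear_intros clinear_contr_comp)

lemma clinear_shear: "clinear_map (shear c)"
  unfolding shear_def[abs_def] by (intro clinear_elem_shear clinear_id)

lemma elem_shear_gen:
  assumes "i \<noteq> j"
  shows "elem_shear c i j (wedge (gen k) v) = wedge (if k = j then gen j - c *s gen i else gen k) (elem_shear c i j v)"
proof (cases "k = j")
  case True
  have "wedge (gen j) (wedge (gen i) (contr j v)) = - wedge (gen i) (wedge (gen j) (contr j v))" by (rule gen_anticomm)
  then show ?thesis using True
    by (simp add: elem_shear_def contr_wedge wedge_diff_right wedge_diff_left wedge_scale_left wedge_scale_right
      gen_square vec.scale_right_diff_distrib vec.scale_minus_right)
next
  case False
  have "wedge (gen i) (wedge (gen k) (contr j v)) = - wedge (gen k) (wedge (gen i) (contr j v))" by (rule gen_anticomm)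
  then show ?thesis using False
    by (simp add: elem_shear_def contr_wedge wedge_diff_right wedge_scale_right wedge_neg_right vec.scale_minus_right)
qed

lemma shear_gen_wedge: "shear c (wedge (gen k) v) = wedge (shear_gen c k) (shear c v)"
proof -
  have 1: "elem_shear (cnj c) 4 5 (wedge (gen k) v) = wedge (if k = 5 then gen 5 - cnj c *s gen 4 else gen k) (elem_shear (cnj c) 4 5 v)"
    by (rule elem_shear_gen) simp
  have 2: "elem_shear c 1 2 (wedge (gen k) v) = wedge (if k = 2 then gen 2 - c *s gen 1 else gen k) (elem_shear c 1 2 v)" for k v
    by (rule elem_shear_gen) simp
  have cl: "clinear_map (elem_shear c 1 2)" using clinear_elem_shear[OF clinear_id, of c 1 2] by simp
  show ?thesis unfolding shear_def 1
    by (simp add: 2 shear_gen_def wedge_diff_left wedge_scale_left clinear_diff[OF cl] clinear_scale[OF cl])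
qed

lemma contr_one: "contr i one_ext = 0"
  by (simp add: one_ext_def contr_axis)

lemma shear_one: "shear c one_ext = one_ext"
  by (simp add: shear_def elem_shear_def contr_one wedge_zero_right)

lemma deg1_shear_gen: "deg1 (shear_gen c i)"
  unfolding shear_gen_def by (auto intro: deg1_diff deg1_scale deg1_gen)

lemma shear_Lam: "shear c u = Lam (shear_gen c) u"
  by (rule Lam_unique[OF clinear_shear shear_one shear_gen_wedge])

lemma anticomm_shear_gen: "anticomm (shear_gen c)"
  by (rule deg1_family_anticomm[OF deg1_shear_gen])

lemma shear_wedge: "shear c (wedge u v) = wedge (shear c u) (shear c v)"
  unfolding shear_Lam by (rule Lam_wedge[OF anticomm_shear_gen])

lemma shear_on_gen: "shear c (gen i) = shear_gen c i"
  unfolding shear_Lam by (rule Lam_gen[OF anticomm_shear_gen])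

lemmas shear_add = clinear_add[OF clinear_shear]
lemmas shear_diff = clinear_diff[OF clinear_shear]
lemmas shear_scale = clinear_scale[OF clinear_shear]
lemmas shear_sum = clinear_sum[OF clinear_shear]
lemmas shear_neg = clinear_neg[OF clinear_shear]

text \<open>The one-parameter law; it supplies the inverse and encodes how the frame changes under
  multiplication in the group.\<close>

lemma shear_shear: "shear c (shear d u) = shear (c + d) u"
proof -
  have "shear c (shear d u) = Lam (shear_gen (c + d)) u"
  proof (rule Lam_unique[of "\<lambda>u. shear c (shear d u)"])
    show "clinear_map (\<lambda>u. shear c (shear d u))" by (rule clinear_comp[OF clinear_shear clinear_shear])
    have e: "shear c (shear_gen d i) = shear_gen (c + d) i" for i
      by (simp add: shear_gen_def shear_diff shear_scale shear_on_gen vec.scale_left_distrib)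
    show "shear c (shear d (wedge (gen i) v)) = wedge (shear_gen (c + d) i) (shear c (shear d v))" for i v
      by (simp only: shear_gen_wedge[of d] shear_wedge[of c] e)
  qed (simp add: shear_one)
  then show ?thesis by (simp add: shear_Lam)
qed

lemma shear_zero: "shear 0 u = u"
  by (simp add: shear_def elem_shear_def)

lemma shear_inverse: "shear (- c) (shear c u) = u" "shear c (shear (- c) u) = u"
  by (simp_all add: shear_shear shear_zero)

definition conjc :: "ext \<Rightarrow> ext" where "conjc u = (\<chi> I. cnj (u $ I))"

lemma cnj_ext_Lam: "cnj_ext u = Lam (\<lambda>i. gen (i + 3)) (conjc u)"
  by (simp add: cnj_ext_def Lam_def conjc_def)

lemma conjc_wedge: "conjc (wedge u v) = wedge (conjc u) (conjc v)"
  by (simp add: conjc_def wedge_def vec_eq_iff shuffle_sign_def)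

lemma conjc_axis: "conjc (axis I 1) = axis I 1"
  by (simp add: conjc_def axis_def vec_eq_iff)

lemma anticomm_conj_gen: "anticomm (\<lambda>i. gen (i + 3))"
  by (rule deg1_family_anticomm[OF deg1_gen])

lemma cnj_ext_add: "cnj_ext (u + v) = cnj_ext u + cnj_ext v"
  unfolding cnj_ext_Lam clinear_add[OF clinear_Lam, symmetric] by (simp add: conjc_def vec_eq_iff Lam_def) 

lemma cnj_ext_scale: "cnj_ext (c *s u) = cnj c *s cnj_ext u"
  unfolding cnj_ext_Lam clinear_scale[OF clinear_Lam, symmetric] by (rule arg_cong) (simp add: conjc_def vec_eq_iff)

lemma cnj_ext_neg: "cnj_ext (- u) = - cnj_ext u"
  using cnj_ext_scale[of "-1" u] by (simp add: vector_smult_lneg)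

lemma cnj_ext_diff: "cnj_ext (u - v) = cnj_ext u - cnj_ext v"
  using cnj_ext_add[of u "- v"] cnj_ext_neg[of v] by simp

lemma cnj_ext_wedge: "cnj_ext (wedge u v) = wedge (cnj_ext u) (cnj_ext v)"
  unfolding cnj_ext_Lam conjc_wedge by (rule Lam_wedge[OF anticomm_conj_gen])

lemma cnj_ext_gen: "cnj_ext (gen i) = gen (i + 3)"
proof -
  have "conjc (gen i) = gen i" by (simp add: gen_def conjc_axis)
  then show ?thesis unfolding cnj_ext_Lam using Lam_gen[OF anticomm_conj_gen, of i] by (simp only:)
qed

lemma cnj_ext_one: "cnj_ext one_ext = one_ext"
proof -
  have "conjc one_ext = one_ext" by (simp add: one_ext_def conjc_axis)
  then show ?thesis unfolding cnj_ext_Lam by (simp only: Lam_one)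
qed

text \<open>Cancellation excludes the five other residues; this lets the simplifier treat i + 3 as
  conjugation of the index.\<close>

lemma type6_six: "(6::6) = 0"
proof -
  have c: "(a::6) + k = b + k \<longleftrightarrow> a = b" for a b k by (rule add_right_cancel)
  have "(6::6) \<in> {0, 1, 2, 3, 4, 5}" using UNIV_6 by blast
  moreover have "(6::6) \<noteq> 1" using c[of 5 1 0] by simp
  moreover have "(6::6) \<noteq> 2" using c[of 4 2 0] by simp
  moreover have "(6::6) \<noteq> 3" using c[of 3 3 0] by simp
  moreover have "(6::6) \<noteq> 4" using c[of 2 4 0] by simp
  moreover have "(6::6) \<noteq> 5" using c[of 1 5 0] by simp
  ultimately show ?thesis by blast
qed

lemma type6_reduce [simp]: "(6::6) = 0" "(7::6) = 1" "(8::6) = 2"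
proof -
  show "(6::6) = 0" by (rule type6_six)
  have "(7::6) = 6 + 1" "(8::6) = 6 + 2" by simp_all
  then show "(7::6) = 1" "(8::6) = 2" by (simp_all only: type6_six add_0)
qed

lemma type6_add3: "(0::6) + 3 = 3" "(1::6) + 3 = 4" "(2::6) + 3 = 5" "(3::6) + 3 = 0" "(4::6) + 3 = 1" "(5::6) + 3 = 2"
  by simp_all

lemma type6_add6: "(i::6) + 3 + 3 = i"
proof -
  have "\<forall>i::6. i + 3 + 3 = i" unfolding forall_6 type6_add3 by simp
  then show ?thesis by blast
qed

lemma Lam_id: "Lam gen u = u"
  by (rule clinear_ext[OF clinear_Lam clinear_id]) (simp add: Lam_axis monomial_gen)

lemma cnj_ext_cnj_ext: "cnj_ext (cnj_ext u) = u"
proof -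
  have "cnj_ext (cnj_ext u) = Lam gen u"
  proof (rule Lam_unique[of "\<lambda>u. cnj_ext (cnj_ext u)"])
    show "clinear_map (\<lambda>u. cnj_ext (cnj_ext u))" by (rule clinear_mapI) (simp_all add: cnj_ext_add cnj_ext_scale)
  qed (simp_all add: cnj_ext_one cnj_ext_wedge cnj_ext_gen type6_add6)
  then show ?thesis by (simp add: Lam_id)
qed

lemma cnj_ext_shear: "cnj_ext (shear c u) = shear c (cnj_ext u)"
proof -
  have "cnj_ext (shear c (cnj_ext v)) = Lam (shear_gen c) v" for v
  proof (rule Lam_unique[of "\<lambda>v. cnj_ext (shear c (cnj_ext v))"])
    show "clinear_map (\<lambda>v. cnj_ext (shear c (cnj_ext v)))"
      by (rule clinear_mapI) (simp_all add: cnj_ext_add cnj_ext_scale shear_add shear_scale)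
    have "\<forall>i. cnj_ext (shear_gen c (i + 3)) = shear_gen c i"
      unfolding forall_6 type6_add3 by (simp add: shear_gen_def cnj_ext_diff cnj_ext_scale cnj_ext_gen type6_add3)
    then show "cnj_ext (shear c (cnj_ext (wedge (gen i) v))) = wedge (shear_gen c i) (cnj_ext (shear c (cnj_ext v)))" for i v
      by (simp add: cnj_ext_wedge cnj_ext_gen shear_gen_wedge)
  qed (simp add: cnj_ext_one shear_one)
  from this[of "cnj_ext u"] show ?thesis by (simp add: cnj_ext_cnj_ext shear_Lam)
qed

section \<open>Forms in the left-invariant frame\<close>

definition inv_form :: "form \<Rightarrow> bool" where "inv_form w \<longleftrightarrow> (\<forall>I. inv_fun (\<lambda>x. w x $ I))"

definition lift_op :: "((complex ^ 3 \<Rightarrow> complex) \<Rightarrow> complex ^ 3 \<Rightarrow> complex) \<Rightarrow> form \<Rightarrow> form" where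
  "lift_op X w x = (\<chi> I. X (\<lambda>x. w x $ I) x)"

text \<open>The Chevalley-Eilenberg differential of the Heisenberg algebra: d is zero on alpha and
  beta, d gamma = - alpha \<and> beta, together with the conjugate relations.\<close>

definition dlt :: "ext \<Rightarrow> ext" where
  "dlt u = - wedge (gen 0) (wedge (gen 1) (contr 2 u)) - wedge (gen 3) (wedge (gen 4) (contr 5 u))"

definition Dl :: "form \<Rightarrow> form" where
  "Dl w x = (\<Sum>i\<in>UNIV. wedge (gen i) (lift_op (xi i) w x)) + dlt (w x)"

definition Fr :: "form \<Rightarrow> form" where "Fr w x = shear (x $ 1) (w x)"

lemma clinear_nth:
  assumes "clinear_map L" shows "L u $ I = (\<Sum>J\<in>UNIV. L (axis J 1) $ I * u $ J)"
proof -
  have "L u = (\<Sum>J\<in>UNIV. u $ J *s L (axis J 1))"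
    by (subst ext_expand[of u]) (simp only: clinear_sum[OF assms] clinear_scale[OF assms])
  then show ?thesis by (simp add: mult.commute)
qed

text \<open>A scalar operator acting on components commutes with constant matrices as soon as it is
  linear. The class \<open>C\<close> makes this serve derivatives, invariant fields, solution
  operators and the mean alike.\<close>

lemma lift_op_clinear:
  assumes L: "clinear_map L" and w: "\<And>I. C (\<lambda>x. w x $ I)"
    and C: "\<And>f g. C f \<Longrightarrow> C g \<Longrightarrow> C (\<lambda>x. f x + g x)" "\<And>c f. C f \<Longrightarrow> C (\<lambda>x. c * f x)"
    and X: "\<And>f g. C f \<Longrightarrow> C g \<Longrightarrow> X (\<lambda>x. f x + g x) = (\<lambda>x. X f x + X g x)"
      "\<And>c f. C f \<Longrightarrow> X (\<lambda>x. c * f x) = (\<lambda>x. c * X f x)"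
  shows "lift_op X (\<lambda>x. L (w x)) = (\<lambda>x. L (lift_op X w x))" "C (\<lambda>x. L (w x) $ I)"
proof -
  have C0: "C (\<lambda>x. 0)" using C(2)[OF w, of 0] by simp
  have X0: "X (\<lambda>x. 0) = (\<lambda>x. 0)" using X(2)[OF C0, of 0] by simp
  have s: "C (\<lambda>x. \<Sum>J\<in>A. a J * w x $ J) \<and> X (\<lambda>x. \<Sum>J\<in>A. a J * w x $ J) = (\<lambda>x. \<Sum>J\<in>A. a J * X (\<lambda>x. w x $ J) x)"
    if "finite A" for A and a :: "6 set \<Rightarrow> complex"
    using that
  proof (induction A)
    case empty then show ?case by (simp add: C0 X0)
  next
    case (insert J A)
    have cJ: "C (\<lambda>x. a J * w x $ J)" by (intro C w)
    show ?case using insert cJ by (simp add: C(1)[OF cJ] X(1)[OF cJ] X(2)[OF w])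
  qed
  have e: "(\<lambda>x. L (w x) $ I) = (\<lambda>x. \<Sum>J\<in>UNIV. L (axis J 1) $ I * w x $ J)" for I
    by (rule ext) (rule clinear_nth[OF L])
  show "C (\<lambda>x. L (w x) $ I)" unfolding e by (rule conjunct1[OF s[OF finite]])
  show "lift_op X (\<lambda>x. L (w x)) = (\<lambda>x. L (lift_op X w x))"
  proof
    fix x
    have "lift_op X (\<lambda>x. L (w x)) x $ I = L (lift_op X w x) $ I" for I
    proof -
      have "lift_op X (\<lambda>x. L (w x)) x $ I = X (\<lambda>x. L (w x) $ I) x" by (simp only: lift_op_def vec_lambda_beta)
      also have "... = (\<Sum>J\<in>UNIV. L (axis J 1) $ I * X (\<lambda>x. w x $ J) x)"
        by (simp only: e conjunct2[OF s[OF finite, where A=UNIV and a="\<lambda>J. L (axis J 1) $ I"]])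
      also have "... = (\<Sum>J\<in>UNIV. L (axis J 1) $ I * lift_op X w x $ J)" by (simp only: lift_op_def vec_lambda_beta)
      also have "... = L (lift_op X w x) $ I" by (rule clinear_nth[OF L, symmetric])
      finally show ?thesis .
    qed
    then show "lift_op X (\<lambda>x. L (w x)) x = L (lift_op X w x)" by (simp add: vec_eq_iff)
  qed
qed

lemma inv_form_smooth: "inv_form w \<Longrightarrow> smooth w"
  unfolding inv_form_def smooth_vec_iff by (simp add: inv_smooth)

lemma smooth_nth: "smooth w \<Longrightarrow> smooth (\<lambda>x. w x $ I)" for w :: form
  by (simp add: smooth_vec_iff)

lemma wirt_lift_clinear: "clinear_map L \<Longrightarrow> smooth w \<Longrightarrow> lift_op (wirt i) (\<lambda>x. L (w x)) = (\<lambda>x. L (lift_op (wirt i) w x))"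
  by (rule lift_op_clinear(1)[where C=smooth]) (simp_all add: smooth_nth smooth_add smooth_cmult wirt_add wirt_cmult)

lemma xi_lift_clinear: "clinear_map L \<Longrightarrow> inv_form w \<Longrightarrow> lift_op (xi i) (\<lambda>x. L (w x)) = (\<lambda>x. L (lift_op (xi i) w x))"
  by (rule lift_op_clinear(1)[where C=inv_fun]) (simp_all add: inv_form_def inv_add inv_cmult xi_add xi_cmult inv_smooth)

lemma inv_form_clinear: "clinear_map L \<Longrightarrow> inv_form w \<Longrightarrow> inv_form (\<lambda>x. L (w x))"
  unfolding inv_form_def[of "\<lambda>x. L (w x)"]
  by (rule allI, rule lift_op_clinear(2)[where C=inv_fun and X="\<lambda>f. f"]) (simp_all add: inv_form_def inv_add inv_cmult)

lemma smooth_clinear: "clinear_map L \<Longrightarrow> smooth w \<Longrightarrow> smooth (\<lambda>x. L (w x))" for w :: form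
  unfolding smooth_vec_iff[of "\<lambda>x. L (w x)"]
  by (rule allI, rule lift_op_clinear(2)[where C=smooth and X="\<lambda>f. f"]) (simp_all add: smooth_nth smooth_add smooth_cmult)

lemma inv_form_add: "inv_form u \<Longrightarrow> inv_form v \<Longrightarrow> inv_form (\<lambda>x. u x + v x)"
  by (simp add: inv_form_def inv_add)

lemma inv_form_scale: "inv_form u \<Longrightarrow> inv_form (\<lambda>x. c *s u x)"
  by (simp add: inv_form_def inv_cmult)

lemma inv_form_const: "inv_form (\<lambda>x. c)"
  by (simp add: inv_form_def inv_const)

lemma inv_form_xi: "inv_form w \<Longrightarrow> inv_form (lift_op (xi i) w)"
  by (simp add: inv_form_def lift_op_def inv_xi)

lemma clinear_dlt: "clinear_map dlt"
  unfolding dlt_def[abs_def] by (intro clinear_intros clinear_contr_comp)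

lemma inv_form_sum: "(\<And>i. i \<in> A \<Longrightarrow> inv_form (u i)) \<Longrightarrow> inv_form (\<lambda>x. \<Sum>i\<in>A. u i x)"
  by (induction A rule: infinite_finite_induct) (simp_all add: inv_form_const inv_form_add)

lemma inv_form_Dl: "inv_form w \<Longrightarrow> inv_form (Dl w)"
  unfolding Dl_def[abs_def]
  by (intro inv_form_add inv_form_sum inv_form_clinear[OF clinear_wedge_right] inv_form_xi inv_form_clinear[OF clinear_dlt])

lemma wirtinger_lift: "smooth w \<Longrightarrow> wirtinger i w x = lift_op (wirt i) w x"
proof -
  assume w: "smooth w"
  have "frechet_derivative w (at x) v $ I = dd v (\<lambda>x. w x $ I) x" for v I
    using dd_vec_nth[OF w, of v x I] by (simp only: dd_def)
  then show ?thesis by (simp add: wirtinger_def lift_op_def wirt_def Let_def vec_eq_iff)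
qed

lemma ext_d_lift: "smooth w \<Longrightarrow> ext_d w x = (\<Sum>i\<in>UNIV. wedge (gen i) (lift_op (wirt i) w x))"
  by (simp add: ext_d_def wirtinger_lift)

lemma wirt_mult: "smooth f \<Longrightarrow> smooth g \<Longrightarrow> wirt i (\<lambda>x. f x * g x) x = f x * wirt i g x + wirt i f x * g x"
  unfolding wirt_eq by (simp add: dd_mult algebra_simps add_divide_distrib)

lemma lift_wirt_smult:
  assumes "smooth \<phi>" "smooth w"
  shows "lift_op (wirt i) (\<lambda>x. \<phi> x *s w x) x = \<phi> x *s lift_op (wirt i) w x + wirt i \<phi> x *s w x"
  by (simp add: lift_op_def vec_eq_iff wirt_mult[OF assms(1) smooth_nth[OF assms(2)]])

lemma smooth_smult: "smooth \<phi> \<Longrightarrow> smooth w \<Longrightarrow> smooth (\<lambda>x. \<phi> x *s w x)" for w :: form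
  unfolding smooth_vec_iff[of "\<lambda>x. \<phi> x *s w x"] by (simp add: smooth_mult smooth_nth)

lemma lift_wirt_add: "smooth u \<Longrightarrow> smooth v \<Longrightarrow> lift_op (wirt i) (\<lambda>x. u x + v x) x = lift_op (wirt i) u x + lift_op (wirt i) v x"
  by (simp add: lift_op_def vec_eq_iff wirt_add smooth_nth)

lemma coord_bl: "bounded_linear (coord i)"
  unfolding coord_def[abs_def] using bounded_linear_coord by (cases "i \<in> hol") simp_all

lemma wirt_coord: "wirt j (coord i) x = (if i = j then 1 else 0)"
proof -
  have "\<forall>j i. wirt j (coord i) x = (if i = j then 1 else 0)"
    unfolding forall_6 wirt_eq dd_bounded_linear[OF coord_bl]
    by (simp add: coord_def coord_index_def hol_def axis_def)
  then show ?thesis by blast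
qed

lemma coord_0_3: "coord 0 = (\<lambda>x. x $ 1)" "coord 3 = (\<lambda>x. cnj (x $ 1))"
  by (simp_all add: coord_def coord_index_def hol_def fun_eq_iff)

lemma shear_expand: "shear c u = u + ((- c) *s wedge (gen 1) (contr 2 u) + ((- cnj c) *s wedge (gen 4) (contr 5 u)
    + (c * cnj c) *s wedge (gen 1) (contr 2 (wedge (gen 4) (contr 5 u)))))"
  by (simp add: shear_def elem_shear_def clinear_diff[OF clinear_contr] clinear_scale[OF clinear_contr]
      wedge_diff_right wedge_scale_right vec.scale_right_diff_distrib vector_smult_assoc vector_smult_lneg algebra_simps)

text \<open>The shear depends on the point only through x $ 1 and its conjugate, so the derivatives
  with index 0 and 3 alone produce extra terms.\<close>

lemma smooth_Fr: "smooth w \<Longrightarrow> smooth (Fr w)"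
  and lift_wirt_Fr: "smooth w \<Longrightarrow> lift_op (wirt i) (Fr w) x = shear (x $ 1) (lift_op (wirt i) w x) +
    (if i = 0 then cnj (x $ 1) *s wedge (gen 1) (contr 2 (wedge (gen 4) (contr 5 (w x)))) - wedge (gen 1) (contr 2 (w x))
     else if i = 3 then (x $ 1) *s wedge (gen 1) (contr 2 (wedge (gen 4) (contr 5 (w x)))) - wedge (gen 4) (contr 5 (w x)) else 0)"
proof -
  assume w: "smooth w"
  have c1: "clinear_map (\<lambda>u. wedge (gen 1) (contr 2 u))" and c2: "clinear_map (\<lambda>u. wedge (gen 4) (contr 5 u))"
    and c3: "clinear_map (\<lambda>u. wedge (gen 1) (contr 2 (wedge (gen 4) (contr 5 u))))"
    by (intro clinear_intros clinear_contr_comp)+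
  note s1 = smooth_clinear[OF c1 w] and s2 = smooth_clinear[OF c2 w] and s3 = smooth_clinear[OF c3 w]
  have f1: "smooth (\<lambda>x::complex^3. - (x $ 1))" and f2: "smooth (\<lambda>x::complex^3. - cnj (x $ 1))"
    and f3: "smooth (\<lambda>x::complex^3. x $ 1 * cnj (x $ 1))"
    using smooth_cmult[OF smooth_coord(1), of "-1" 1] smooth_cmult[OF smooth_coord(2), of "-1" 1] smooth_mult[OF smooth_coord(1) smooth_coord(2), of 1 1]
    by simp_all
  have t1: "wirt i (\<lambda>x. - (x $ 1)) x = (if i = 0 then -1 else 0)" "wirt i (\<lambda>x. - cnj (x $ 1)) x = (if i = 3 then -1 else 0)"
    "wirt i (\<lambda>x. x $ 1 * cnj (x $ 1)) x = (if i = 0 then cnj (x $ 1) else if i = 3 then x $ 1 else 0)" for x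
    using wirt_coord[of i 0 x] wirt_coord[of i 3 x] wirt_cmult[OF smooth_coord(1), of i "-1" 1] wirt_cmult[OF smooth_coord(2), of i "-1" 1]
      wirt_mult[OF smooth_coord(1) smooth_coord(2), of i 1 1 x]
    unfolding coord_0_3 by (auto simp: fun_eq_iff)
  have Fr: "Fr w = (\<lambda>x. w x + ((- (x $ 1)) *s wedge (gen 1) (contr 2 (w x)) + ((- cnj (x $ 1)) *s wedge (gen 4) (contr 5 (w x))
    + (x $ 1 * cnj (x $ 1)) *s wedge (gen 1) (contr 2 (wedge (gen 4) (contr 5 (w x)))))))"
    by (rule ext) (simp only: Fr_def shear_expand)
  note r1 = smooth_smult[OF f1 s1] and r2 = smooth_smult[OF f2 s2] and r3 = smooth_smult[OF f3 s3]
  show "smooth (Fr w)" unfolding Fr by (intro smooth_add w r1 r2 r3)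
  show "lift_op (wirt i) (Fr w) x = shear (x $ 1) (lift_op (wirt i) w x) +
    (if i = 0 then cnj (x $ 1) *s wedge (gen 1) (contr 2 (wedge (gen 4) (contr 5 (w x)))) - wedge (gen 1) (contr 2 (w x))
     else if i = 3 then (x $ 1) *s wedge (gen 1) (contr 2 (wedge (gen 4) (contr 5 (w x)))) - wedge (gen 4) (contr 5 (w x)) else 0)"
    unfolding Fr lift_wirt_add[OF w smooth_add[OF r1 smooth_add[OF r2 r3]]] lift_wirt_add[OF r1 smooth_add[OF r2 r3]]
      lift_wirt_add[OF r2 r3] lift_wirt_smult[OF f1 s1] lift_wirt_smult[OF f2 s2] lift_wirt_smult[OF f3 s3] t1
      wirt_lift_clinear[OF c1 w] wirt_lift_clinear[OF c2 w] wirt_lift_clinear[OF c3 w]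
      shear_expand[of _ "lift_op (wirt i) w x"]
    by (cases "i = 0"; cases "i = 3") (simp_all add: vector_smult_lneg)
qed

lemma lift_xi: "lift_op (xi i) w x = lift_op (wirt i) w x +
  (if i = 1 then x $ 1 *s lift_op (wirt 2) w x else if i = 4 then cnj (x $ 1) *s lift_op (wirt 5) w x else 0)"
  by (auto simp: lift_op_def xi_def vec_eq_iff)

lemma shear_contr2: "wedge (gen 1) (shear c (contr 2 u)) = wedge (gen 1) (contr 2 u) - cnj c *s wedge (gen 1) (contr 2 (wedge (gen 4) (contr 5 u)))"
proof -
  have a: "contr 2 (wedge (gen 4) v) = - wedge (gen 4) (contr 2 v)" for v by (simp add: contr_wedge)
  have b: "contr 5 (contr 2 u) = - contr 2 (contr 5 u)" for u by (rule contr_contr)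
  show ?thesis unfolding shear_expand a b
    by (simp add: contr_square wedge_zero_right wedge_add_right wedge_scale_right wedge_neg_right gen_square
      clinear_neg[OF clinear_contr] vector_smult_lneg)
qed

lemma shear_contr5: "wedge (gen 4) (shear c (contr 5 u)) = wedge (gen 4) (contr 5 u) - c *s wedge (gen 1) (contr 2 (wedge (gen 4) (contr 5 u)))"
proof -
  have a: "contr 2 (wedge (gen 4) v) = - wedge (gen 4) (contr 2 v)" for v by (simp add: contr_wedge)
  have g: "wedge (gen 4) (wedge (gen 1) v) = - wedge (gen 1) (wedge (gen 4) v)" for v by (rule gen_anticomm)
  show ?thesis unfolding shear_expand
    by (simp add: contr_square wedge_zero_right wedge_add_right wedge_diff_right wedge_scale_right wedge_neg_right g a
      clinear_zero[OF clinear_contr] vector_smult_lneg vec.scale_minus_right)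
qed

text \<open>The extra terms from differentiating the frame are precisely those of
  \<open>dlt\<close>, while re-expressing the coordinate covectors in the invariant frame turns
  coordinate derivatives into the fields \<open>xi\<close>.\<close>

theorem ext_d_Fr: assumes "inv_form w" shows "ext_d (Fr w) = Fr (Dl w)"
proof
  fix x
  note s = inv_form_smooth[OF assms]
  define p where "p i = lift_op (wirt i) w x" for i
  show "ext_d (Fr w) x = Fr (Dl w) x"
    unfolding ext_d_lift[OF smooth_Fr[OF s]] lift_wirt_Fr[OF s] Fr_def Dl_def shear_add shear_sum lift_xi
      shear_gen_wedge p_def[symmetric] dlt_def shear_diff shear_neg shear_wedge shear_on_gen sum_6
    by (simp add: shear_gen_def wedge_add_right wedge_diff_left wedge_scale_left wedge_diff_right wedge_scale_right
      shear_add shear_scale shear_contr2 shear_contr5 clinear_zero[OF clinear_shear] wedge_zero_right algebra_simps)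
qed

text \<open>A left translation has constant differential in the coordinate frame: it adds g $ 1
  times dz2 to dz3, which is the shear with parameter - g $ 1.\<close>

lemma pullback_shear: "pullback (heis_mult g) u x = shear (- g $ 1) (u (heis_mult g x))"
proof -
  have sc: "smooth (coord i)" for i by (rule smooth_bounded_linear[OF coord_bl])
  have "ext_d (\<lambda>y. axis {} (coord i (heis_mult g y))) x = shear_gen (- g $ 1) i" for i
  proof -
    define \<phi> where "\<phi> y = coord i (heis_mult g y)" for y
    have sp: "smooth \<phi>" unfolding \<phi>_def heis_mult_affine by (rule smooth_affine[OF bounded_linear_heis_lin sc])
    have ax: "axis {} z = z *s one_ext" for z by (simp add: one_ext_def axis_def vec_eq_iff)
    have sm: "smooth (\<lambda>y. axis {} (\<phi> y) :: ext)" unfolding ax by (rule smooth_smult[OF sp smooth_const])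
    have "lift_op (wirt j) (\<lambda>y. axis {} (\<phi> y)) x = wirt j \<phi> x *s one_ext" for j
      unfolding ax lift_wirt_smult[OF sp smooth_const] by (simp add: lift_op_def wirt_const vec_eq_iff)
    then have "ext_d (\<lambda>y. axis {} (\<phi> y)) x = (\<Sum>j\<in>UNIV. wirt j \<phi> x *s gen j)"
      unfolding ext_d_lift[OF sm] by (simp add: wedge_scale_right wedge_one_right)
    also have "... = shear_gen (- g $ 1) i"
      unfolding \<phi>_def wirt_heis[OF sc] wirt_coord sum_6
    proof -
      have "\<forall>i. ((if i = 0 then 1 else 0) + (if (0::6) = 1 then g $ 1 * (if i = 2 then 1 else 0) else if (0::6) = 4 then cnj (g $ 1) * (if i = 5 then 1 else 0) else 0)) *s gen 0 +
        ((if i = 1 then 1 else 0) + (if (1::6) = 1 then g $ 1 * (if i = 2 then 1 else 0) else if (1::6) = 4 then cnj (g $ 1) * (if i = 5 then 1 else 0) else 0)) *s gen 1 +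
        ((if i = 2 then 1 else 0) + (if (2::6) = 1 then g $ 1 * (if i = 2 then 1 else 0) else if (2::6) = 4 then cnj (g $ 1) * (if i = 5 then 1 else 0) else 0)) *s gen 2 +
        ((if i = 3 then 1 else 0) + (if (3::6) = 1 then g $ 1 * (if i = 2 then 1 else 0) else if (3::6) = 4 then cnj (g $ 1) * (if i = 5 then 1 else 0) else 0)) *s gen 3 +
        ((if i = 4 then 1 else 0) + (if (4::6) = 1 then g $ 1 * (if i = 2 then 1 else 0) else if (4::6) = 4 then cnj (g $ 1) * (if i = 5 then 1 else 0) else 0)) *s gen 4 +
        ((if i = 5 then 1 else 0) + (if (5::6) = 1 then g $ 1 * (if i = 2 then 1 else 0) else if (5::6) = 4 then cnj (g $ 1) * (if i = 5 then 1 else 0) else 0)) *s gen 5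
        = shear_gen (- g $ 1) i"
        unfolding forall_6 by (simp add: shear_gen_def vector_smult_lneg add.commute)
      then show "((if i = 0 then 1 else 0) + (if (0::6) = 1 then g $ 1 * (if i = 2 then 1 else 0) else if (0::6) = 4 then cnj (g $ 1) * (if i = 5 then 1 else 0) else 0)) *s gen 0 +
        ((if i = 1 then 1 else 0) + (if (1::6) = 1 then g $ 1 * (if i = 2 then 1 else 0) else if (1::6) = 4 then cnj (g $ 1) * (if i = 5 then 1 else 0) else 0)) *s gen 1 +
        ((if i = 2 then 1 else 0) + (if (2::6) = 1 then g $ 1 * (if i = 2 then 1 else 0) else if (2::6) = 4 then cnj (g $ 1) * (if i = 5 then 1 else 0) else 0)) *s gen 2 +
        ((if i = 3 then 1 else 0) + (if (3::6) = 1 then g $ 1 * (if i = 2 then 1 else 0) else if (3::6) = 4 then cnj (g $ 1) * (if i = 5 then 1 else 0) else 0)) *s gen 3 +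
        ((if i = 4 then 1 else 0) + (if (4::6) = 1 then g $ 1 * (if i = 2 then 1 else 0) else if (4::6) = 4 then cnj (g $ 1) * (if i = 5 then 1 else 0) else 0)) *s gen 4 +
        ((if i = 5 then 1 else 0) + (if (5::6) = 1 then g $ 1 * (if i = 2 then 1 else 0) else if (5::6) = 4 then cnj (g $ 1) * (if i = 5 then 1 else 0) else 0)) *s gen 5
        = shear_gen (- g $ 1) i" by blast
    qed
    finally show ?thesis by (simp add: \<phi>_def)
  qed
  then show ?thesis by (simp add: pullback_def shear_Lam Lam_def)
qed

theorem Fr_in_forms_X: assumes "inv_form w" shows "Fr w \<in> forms_X"
proof -
  have "pullback (heis_mult g) (Fr w) x = Fr w x" if "g \<in> lattice" for g x
  proof -
    have "w (heis_mult g x) = w x" using assms that by (simp add: inv_form_def inv_fun_def vec_eq_iff)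
    moreover have "heis_mult g x $ 1 = g $ 1 + x $ 1" by (simp add: heis_mult_def)
    ultimately show ?thesis by (simp add: pullback_shear Fr_def shear_shear)
  qed
  then show ?thesis using smooth_Fr[OF inv_form_smooth[OF assms]] by (auto simp: forms_X_def)
qed

theorem forms_X_Fr: assumes "u \<in> forms_X" obtains w where "inv_form w" "u = Fr w"
proof
  define w where "w x = shear (- x $ 1) (u x)" for x
  show "u = Fr w" by (simp add: w_def Fr_def fun_eq_iff shear_inverse)
  have u: "smooth u" "\<And>g x. g \<in> lattice \<Longrightarrow> pullback (heis_mult g) u x = u x"
    using assms by (auto simp: forms_X_def)
  have bl: "bounded_linear (\<lambda>x::complex^3. - x)" by (intro bounded_linear_minus bounded_linear_ident)
  have "smooth w"
  proof -
    \<comment> \<open>The inverse shear at x is the shear at - x; smoothness comes from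
      \<open>smooth_Fr\<close> by reflecting before and after.\<close>
    have "smooth (\<lambda>x. u (- x))" using smooth_affine[OF bl u(1), of 0] by simp
    from smooth_affine[OF bl smooth_Fr[OF this], of 0] show ?thesis
      by (simp add: Fr_def w_def[abs_def])
  qed
  moreover have "w (heis_mult g x) = w x" if "g \<in> lattice" for g x
  proof -
    have h: "heis_mult g x $ 1 = g $ 1 + x $ 1" by (simp add: heis_mult_def)
    have "w x = shear (- x $ 1) (shear (- g $ 1) (u (heis_mult g x)))"
      using u(2)[OF that, of x] by (simp add: w_def pullback_shear)
    also have "... = w (heis_mult g x)" by (simp add: w_def h shear_shear add.commute)
    finally show ?thesis ..
  qed
  ultimately show "inv_form w" by (simp add: inv_form_def inv_fun_def smooth_nth)
qed

lemma fcnj_Fr: "fcnj (Fr w) = Fr (\<lambda>x. cnj_ext (w x))"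
  by (simp add: fcnj_def Fr_def cnj_ext_shear fun_eq_iff)

lemma fwedge_Fr: "Fr u \<and>\<^sub>f Fr v = Fr (\<lambda>x. wedge (u x) (v x))"
  by (simp add: fwedge_def Fr_def shear_wedge fun_eq_iff)

lemma fscale_Fr: "c \<cdot> Fr u = Fr (\<lambda>x. c *s u x)"
  by (simp add: fscale_def Fr_def shear_scale fun_eq_iff)

lemma add_Fr: "Fr u + Fr v = Fr (\<lambda>x. u x + v x)"
  by (simp add: Fr_def shear_add fun_eq_iff)

lemma diff_Fr: "Fr u - Fr v = Fr (\<lambda>x. u x - v x)"
  by (simp add: Fr_def shear_diff fun_eq_iff)

lemma Fr_inject: "Fr u = Fr v \<longleftrightarrow> u = v"
proof
  assume "Fr u = Fr v"
  then have "shear (- x $ 1) (Fr u x) = shear (- x $ 1) (Fr v x)" for x by simp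
  then show "u = v" by (simp add: Fr_def shear_inverse fun_eq_iff)
qed simp

lemma inv_form_cnj: "inv_form w \<Longrightarrow> inv_form (\<lambda>x. cnj_ext (w x))"
proof -
  assume w: "inv_form w"
  have "inv_form (\<lambda>x. conjc (w x))" unfolding inv_form_def
  proof
    fix I
    have "inv_fun (\<lambda>x. w x $ I)" using w by (simp add: inv_form_def)
    then show "inv_fun (\<lambda>x. conjc (w x) $ I)"
      unfolding inv_fun_def conjc_def vec_lambda_beta using smooth_linear_comp[OF bounded_linear_cnj, of "\<lambda>x. w x $ I"] by auto
  qed
  then show ?thesis unfolding cnj_ext_Lam by (rule inv_form_clinear[OF clinear_Lam])
qed

lemma wirt_commute: assumes f: "smooth f" shows "wirt i (wirt j f) = wirt j (wirt i f)"
proof -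
  define a b s where "a k = (axis (coord_index k) 1 :: complex^3)" and "b k = (axis (coord_index k) \<i> :: complex^3)"
    and "s k = (if k \<in> hol then - \<i> else \<i>)" for k
  have we: "wirt k g = (\<lambda>x. 1/2 * (dd (a k) g x + s k * dd (b k) g x))" for k g
    unfolding a_def b_def s_def by (rule wirt_eq)
  have sd: "smooth (dd v f)" for v by (rule smooth_dd[OF f])
  have d: "dd v (wirt k f) = (\<lambda>x. 1/2 * (dd v (dd (a k) f) x + s k * dd v (dd (b k) f) x))" for v k
    unfolding we dd_cmult[OF smooth_add[OF sd smooth_cmult[OF sd]]] dd_add[OF sd smooth_cmult[OF sd]] dd_cmult[OF sd] ..
  have w: "wirt k (wirt l f) = (\<lambda>x. 1/2 * (1/2 * (dd (a k) (dd (a l) f) x + s l * dd (a k) (dd (b l) f) x)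
      + s k * (1/2 * (dd (b k) (dd (a l) f) x + s l * dd (b k) (dd (b l) f) x))))" for k l
    by (rule trans[OF we]) (simp only: d)
  show ?thesis
    unfolding w[of i j] w[of j i] dd_commute[OF f, of "a j" "a i"] dd_commute[OF f, of "b j" "a i"]
      dd_commute[OF f, of "a j" "b i"] dd_commute[OF f, of "b j" "b i"]
    by (rule ext) (simp add: algebra_simps)
qed

text \<open>The fields \<open>xi\<close> do not commute, so d squared is computed in the coordinate
  frame, where the Wirtinger derivatives do commute, and is carried over by the injective
  \<open>Fr\<close>.\<close>

lemma Dl_Dl: assumes w: "inv_form w" shows "Dl (Dl w) = (\<lambda>x. 0)"
proof -
  let ?u = "Fr w"
  have s: "smooth ?u" by (rule smooth_Fr[OF inv_form_smooth[OF w]])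
  define q where "q i j x = lift_op (wirt i) (lift_op (wirt j) ?u) x" for i j x
  have com: "q i j x = q j i x" for i j x
  proof -
    show ?thesis by (simp add: q_def lift_op_def vec_eq_iff wirt_commute[OF smooth_nth[OF s], of i j])
  qed
  have sl: "smooth (lift_op (wirt j) ?u)" for j
    unfolding smooth_vec_iff lift_op_def using wirt_smooth[OF smooth_nth[OF s]] by simp
  have "ext_d (ext_d ?u) x = 0" for x
  proof -
    have e: "ext_d ?u = (\<lambda>x. \<Sum>j\<in>UNIV. wedge (gen j) (lift_op (wirt j) ?u x))" using ext_d_lift[OF s] by auto
    have lw: "lift_op (wirt i) (ext_d ?u) x = (\<Sum>j\<in>UNIV. wedge (gen j) (q i j x))" for i
    proof -
      have "lift_op (wirt i) (\<lambda>x. \<Sum>j\<in>A. wedge (gen j) (lift_op (wirt j) ?u x)) x = (\<Sum>j\<in>A. wedge (gen j) (q i j x))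
        \<and> smooth (\<lambda>x. \<Sum>j\<in>A. wedge (gen j) (lift_op (wirt j) ?u x))" if "finite A" for A
        using that
      proof (induction A)
        case empty then show ?case by (simp add: lift_op_def wirt_const vec_eq_iff)
      next
        case (insert j A)
        have s1: "smooth (\<lambda>x. wedge (gen j) (lift_op (wirt j) ?u x))" by (rule smooth_clinear[OF clinear_wedge_right sl])
        show ?case using insert s1
          by (simp add: lift_wirt_add smooth_add wirt_lift_clinear[OF clinear_wedge_right sl] q_def)
      qed
      from this[of UNIV] show ?thesis unfolding e by simp
    qed
    have "smooth (ext_d ?u)" unfolding e by (intro smooth_sum smooth_clinear[OF clinear_wedge_right sl])
    then have h: "ext_d (ext_d ?u) x = (\<Sum>i\<in>UNIV. \<Sum>j\<in>UNIV. wedge (gen i) (wedge (gen j) (q i j x)))"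
      by (simp add: ext_d_lift lw wedge_sum_right)
    note h
    also have "(\<Sum>i\<in>UNIV. \<Sum>j\<in>UNIV. wedge (gen i) (wedge (gen j) (q i j x))) = - (\<Sum>i\<in>UNIV. \<Sum>j\<in>UNIV. wedge (gen j) (wedge (gen i) (q j i x)))"
      by (simp only: sum_negf[symmetric]) (intro sum.cong refl, subst com, rule gen_anticomm)
    also have "(\<Sum>i\<in>UNIV. \<Sum>j\<in>UNIV. wedge (gen j) (wedge (gen i) (q j i x))) = (\<Sum>i\<in>UNIV. \<Sum>j\<in>UNIV. wedge (gen i) (wedge (gen j) (q i j x)))"
      by (rule sum.swap)
    also have "... = ext_d (ext_d ?u) x" by (rule h[symmetric])
    finally show ?thesis by (rule eq_neg_self)
  qed
  then have "Fr (Dl (Dl w)) = Fr (\<lambda>x. 0)"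
    using ext_d_Fr[OF w] ext_d_Fr[OF inv_form_Dl[OF w]] by (simp add: fun_eq_iff Fr_def clinear_zero[OF clinear_shear])
  then show ?thesis by (simp only: Fr_inject)
qed

section \<open>The frame of the deformed structure\<close>

text \<open>The coframe of X_t written in the left invariant frame of X_0, where it has constant
  coefficients.\<close>

definition th :: "param \<Rightarrow> 6 \<Rightarrow> ext" where
  "th t i = (if i = 0 then gen 0 + t $ 1 $ 1 *s gen 3 + t $ 1 $ 2 *s gen 4
    else if i = 1 then gen 1 + t $ 2 $ 1 *s gen 3 + t $ 2 $ 2 *s gen 4
    else if i = 2 then gen 2 + t $ 3 $ 1 *s gen 3 + t $ 3 $ 2 *s gen 4 - D_param t *s gen 5
    else if i = 3 then gen 3 + cnj (t $ 1 $ 1) *s gen 0 + cnj (t $ 1 $ 2) *s gen 1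
    else if i = 4 then gen 4 + cnj (t $ 2 $ 1) *s gen 0 + cnj (t $ 2 $ 2) *s gen 1
    else gen 5 + cnj (t $ 3 $ 1) *s gen 0 + cnj (t $ 3 $ 2) *s gen 1 - cnj (D_param t) *s gen 2)"

lemma deg1_th: "deg1 (th t i)"
  unfolding th_def by (auto intro!: deg1_add deg1_diff deg1_scale deg1_gen)

lemma anticomm_th: "anticomm (th t)"
  by (rule deg1_family_anticomm[OF deg1_th])

lemma th_conj: "cnj_ext (th t i) = th t (i + 3)"
proof -
  have "\<forall>i. cnj_ext (th t i) = th t (i + 3)"
    unfolding forall_6 type6_add3 
    by (simp add: th_def cnj_ext_add cnj_ext_diff cnj_ext_scale cnj_ext_gen type6_add3)
  then show ?thesis by blast
qed

lemma alpha_Fr: "alpha = Fr (\<lambda>x. gen 0)" and beta_Fr: "beta = Fr (\<lambda>x. gen 1)" and gamma_Fr: "gamma = Fr (\<lambda>x. gen 2)"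
  by (simp_all add: alpha_def beta_def gamma_def Fr_def shear_on_gen shear_gen_def fun_eq_iff)

lemma alpha_t_Fr: "alpha_t t = Fr (\<lambda>x. th t 0)"
  unfolding alpha_t_def alpha_Fr beta_Fr fcnj_Fr fscale_Fr add_Fr cnj_ext_gen type6_add3 by (simp add: th_def)

lemma beta_t_Fr: "beta_t t = Fr (\<lambda>x. th t 1)"
  unfolding beta_t_def alpha_Fr beta_Fr fcnj_Fr fscale_Fr add_Fr cnj_ext_gen type6_add3 by (simp add: th_def)

lemma gamma_t_Fr: "gamma_t t = Fr (\<lambda>x. th t 2)"
  unfolding gamma_t_def alpha_Fr beta_Fr gamma_Fr fcnj_Fr fscale_Fr add_Fr diff_Fr cnj_ext_gen type6_add3 by (simp add: th_def)

lemma coframe_Fr: "coframe t i = Fr (\<lambda>x. th t i)"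
proof -
  have "\<forall>i. coframe t i = Fr (\<lambda>x. th t i)"
    unfolding forall_6
    by (simp add: coframe_def alpha_t_Fr beta_t_Fr gamma_t_Fr fcnj_Fr th_conj type6_add3)
  then show ?thesis by blast
qed

lemma coframe_monomial_eq: "coframe_monomial t I x = shear (x $ 1) (Lam (th t) (axis I 1))"
proof -
  have "coframe_monomial t I x = monomial (\<lambda>i. shear (x $ 1) (th t i)) I"
    by (simp add: coframe_monomial_def coframe_Fr Fr_def)
  also have "... = shear (x $ 1) (monomial (th t) I)"
    by (rule alghom_monomial[symmetric]) (simp_all add: shear_one shear_wedge)
  finally show ?thesis by (simp add: Lam_axis)
qed

lemma continuous_on_vec_nth: "continuous_on S f \<Longrightarrow> continuous_on S (\<lambda>x. f x $ I)"
  by (simp add: continuous_on_def tendsto_vec_nth)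

lemma continuous_on_ext_iff: "continuous_on S f \<longleftrightarrow> (\<forall>I. continuous_on S (\<lambda>x. f x $ I))"
  for f :: "'a::topological_space \<Rightarrow> ext"
proof
  assume "continuous_on S f" then show "\<forall>I. continuous_on S (\<lambda>x. f x $ I)"
    by (auto intro: continuous_on_vec_nth)
next
  assume "\<forall>I. continuous_on S (\<lambda>x. f x $ I)"
  then have "continuous_on S (\<lambda>x. \<chi> I. f x $ I)" by (intro continuous_on_vec_lambda) simp
  then show "continuous_on S f" by simp
qed

lemma continuous_on_wedge:
  assumes "continuous_on S f" "continuous_on S g" shows "continuous_on S (\<lambda>t. wedge (f t) (g t))"
proof -
  have fg: "continuous_on S (\<lambda>t. f t $ I)" "continuous_on S (\<lambda>t. g t $ I)" for I
    using assms unfolding continuous_on_ext_iff by auto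
  show ?thesis unfolding continuous_on_ext_iff wedge_def vec_lambda_beta
    by (intro allI continuous_on_sum continuous_on_mult continuous_on_const fg)
qed

lemma continuous_on_smult:
  assumes "continuous_on S \<phi>" shows "continuous_on S (\<lambda>t. \<phi> t *s (c :: ext))"
  unfolding continuous_on_ext_iff vector_smult_component
  by (intro allI continuous_on_mult assms continuous_on_const)

lemma continuous_on_th: "continuous_on S (\<lambda>t. th t i)"
proof -
  have c: "continuous_on S (\<lambda>t::param. t $ i $ j)" for i j
    by (intro continuous_on_vec_nth continuous_on_id)
  have D: "continuous_on S (\<lambda>t. D_param t)" unfolding D_param_def
    by (intro continuous_on_diff continuous_on_mult c)
  have "\<forall>i. continuous_on S (\<lambda>t. th t i)"
    unfolding forall_6 th_def
    by (simp add: type6_distinct) (intro conjI continuous_on_add continuous_on_diff continuous_on_const continuous_on_smult continuous_on_cnj c D)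
  then show ?thesis by blast
qed

lemma th_0: "th 0 = gen"
proof -
  have "\<forall>i. th 0 i = gen i" unfolding forall_6 by (simp add: th_def D_param_def)
  then show ?thesis by auto
qed

lemma norm_axis_complex: "norm (axis I (1::complex)) = 1"
proof -
  have s: "(\<Sum>J\<in>UNIV. (norm ((axis I (1::complex)) $ J))\<^sup>2) = (\<Sum>J\<in>UNIV. if J = I then 1 else 0)"
    by (rule sum.cong) (auto simp: axis_def)
  show ?thesis unfolding norm_vec_def L2_set_def s by simp
qed

text \<open>Continuity in t of the 64 monomials at t = 0; each may deviate by a 64th of the
  tolerance.\<close>

lemma th_near:
  assumes "\<eta> > 0"
  shows "\<exists>\<epsilon>>0. \<forall>t\<in>ball 0 \<epsilon>. (\<forall>u. norm (Lam (th t) u - u) \<le> \<eta> * norm u) \<and> norm (D_param t) \<le> \<eta>"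
proof -
  have cm: "continuous_on UNIV (\<lambda>t. monomial (th t) I)" for I
  proof -
    have "continuous_on UNIV (\<lambda>t. ml (th t) xs)" for xs
      by (induction xs) (simp_all add: ml_simps continuous_on_const continuous_on_wedge continuous_on_th)
    then show ?thesis by (simp add: monomial_ml)
  qed
  have ev1: "\<forall>\<^sub>F t in nhds 0. norm (monomial (th t) I - axis I 1) < \<eta> / 64" for I
  proof -
    have "((\<lambda>t. monomial (th t) I) \<longlongrightarrow> monomial (th 0) I) (nhds 0)"
    proof -
      have "isCont (\<lambda>t. monomial (th t) I) 0" using cm[of I] by (simp add: continuous_on_eq_continuous_at)
      then show ?thesis unfolding isCont_def by (rule tendsto_at_iff_tendsto_nhds[THEN iffD1])
    qed
    then have "((\<lambda>t. monomial (th t) I) \<longlongrightarrow> axis I 1) (nhds 0)" by (simp only: th_0 monomial_gen)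
    from tendstoD[OF this, of "\<eta> / 64"] show ?thesis using assms by (simp add: dist_norm)
  qed
  have cD: "continuous_on UNIV D_param"
    unfolding D_param_def[abs_def] by (intro continuous_on_diff continuous_on_mult continuous_on_vec_nth continuous_on_id)
  have ev2: "\<forall>\<^sub>F t in nhds 0. norm (D_param t) < \<eta>"
  proof -
    have "(D_param \<longlongrightarrow> D_param 0) (nhds 0)"
      using cD by (simp add: continuous_on_eq_continuous_at isCont_def tendsto_at_iff_tendsto_nhds)
    from tendstoD[OF this assms] show ?thesis by (simp add: D_param_def)
  qed
  have "\<forall>\<^sub>F t in nhds 0. (\<forall>I\<in>UNIV. norm (monomial (th t) I - axis I 1) < \<eta> / 64) \<and> norm (D_param t) < \<eta>"
    by (intro eventually_conj eventually_ball_finite ballI ev1 ev2) simp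
  then obtain \<epsilon> where e: "\<epsilon> > 0" "\<And>t. dist t 0 < \<epsilon> \<Longrightarrow> (\<forall>I\<in>UNIV. norm (monomial (th t) I - axis I 1) < \<eta> / 64) \<and> norm (D_param t) < \<eta>"
    unfolding eventually_nhds_metric by blast
  have "norm (Lam (th t) u - u) \<le> \<eta> * norm u" if t: "t \<in> ball 0 \<epsilon>" for t u
  proof -
    have "Lam (th t) u - u = (\<Sum>I\<in>UNIV. u $ I *s (monomial (th t) I - axis I 1))"
      by (subst (2) ext_expand[of u]) (simp only: Lam_def vec.scale_right_diff_distrib sum_subtractf)
    also have "norm ... \<le> (\<Sum>I\<in>(UNIV :: 6 set set). norm u * (\<eta> / 64))"
    proof (rule sum_norm_le)
      fix I :: "6 set"
      have sc: "norm (c *s v) = norm c * norm v" for c and v :: ext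
        by (simp add: norm_vec_def L2_set_def norm_mult power_mult_distrib sum_distrib_left[symmetric] real_sqrt_mult)
      have "norm (u $ I) * norm (monomial (th t) I - axis I 1) \<le> norm u * (\<eta> / 64)"
      proof (rule mult_mono)
        show "norm (u $ I) \<le> norm u" by (rule Finite_Cartesian_Product.norm_nth_le)
        have "dist t 0 < \<epsilon>" using t by (simp add: dist_commute)
        from e(2)[OF this] show "norm (monomial (th t) I - axis I 1) \<le> \<eta> / 64" by (auto intro: less_imp_le)
      qed simp_all
      then show "norm (u $ I *s (monomial (th t) I - axis I 1)) \<le> norm u * (\<eta> / 64)" by (simp only: sc)
    qed
    also have "... = \<eta> * norm u" by (simp add: card_UNIV_set)
    finally show ?thesis .
  qed
  then show ?thesis using e by (intro exI[of _ \<epsilon>]) (auto simp: dist_commute less_imp_le)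
qed

section \<open>Gradings\<close>

text \<open>One notion for several gradings: T = \<open>UNIV\<close> counts the degree, T = {2, 5}
  the weight in gamma and its conjugate, and \<open>hol\<close>, \<open>antihol\<close> the two
  entries of the bidegree.\<close>

definition graded :: "6 set \<Rightarrow> nat \<Rightarrow> ext \<Rightarrow> bool" where
  "graded T k u \<longleftrightarrow> (\<forall>I. u $ I \<noteq> 0 \<longrightarrow> card (I \<inter> T) = k)"

lemma gradedD: "graded T k u \<Longrightarrow> card (I \<inter> T) \<noteq> k \<Longrightarrow> u $ I = 0"
  unfolding graded_def by blast

lemma graded_0: "graded T k 0" by (simp add: graded_def)

lemma graded_add: "graded T k u \<Longrightarrow> graded T k v \<Longrightarrow> graded T k (u + v)"
  unfolding graded_def by (metis add.right_neutral vector_add_component)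

lemma graded_scale: "graded T k u \<Longrightarrow> graded T k (c *s u)"
  unfolding graded_def by auto

lemma graded_neg: "graded T k u \<Longrightarrow> graded T k (- u)"
  unfolding graded_def by auto

lemma graded_diff: "graded T k u \<Longrightarrow> graded T k v \<Longrightarrow> graded T k (u - v)"
  using graded_add[OF _ graded_neg, of T k u v] by simp

lemma graded_sum: "(\<And>i. i \<in> A \<Longrightarrow> graded T k (f i)) \<Longrightarrow> graded T k (\<Sum>i\<in>A. f i)"
  by (induction A rule: infinite_finite_induct) (auto intro: graded_0 graded_add)

lemma graded_wedge:
  assumes "graded T j u" "graded T k v" shows "graded T (j + k) (wedge u v)"
  unfolding graded_def
proof (intro allI impI)
  fix K assume "wedge u v $ K \<noteq> 0"
  then have "(\<Sum>I\<in>Pow K. shuffle_sign I (K - I) * u $ I * v $ (K - I)) \<noteq> 0" by (simp add: wedge_def)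
  then obtain I where I: "I \<in> Pow K" "shuffle_sign I (K - I) * u $ I * v $ (K - I) \<noteq> 0"
    by (rule sum.not_neutral_contains_not_neutral)
  then have "card (I \<inter> T) = j" "card ((K - I) \<inter> T) = k" using assms by (auto simp: graded_def)
  moreover have "K \<inter> T = (I \<inter> T) \<union> ((K - I) \<inter> T)" "(I \<inter> T) \<inter> ((K - I) \<inter> T) = {}" using I by auto
  ultimately show "card (K \<inter> T) = j + k" by (simp add: card_Un_disjoint)
qed

lemma graded_axis: "graded T k (axis I c) \<longleftrightarrow> c = 0 \<or> card (I \<inter> T) = k"
  by (auto simp: graded_def axis_def)

lemma graded_gen: "graded T k (gen i) \<longleftrightarrow> (if i \<in> T then k = 1 else k = 0)"
  by (auto simp: gen_def graded_axis)

lemma graded_contr: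
  assumes "graded T k u" shows "i \<in> T \<Longrightarrow> graded T (k - 1) (contr i u)" "i \<notin> T \<Longrightarrow> graded T k (contr i u)"
  unfolding graded_def contr_nth
proof safe
  fix I assume i: "i \<in> T" and n: "(if i \<in> I then 0 else sg i I * u $ insert i I) \<noteq> 0"
  then have "i \<notin> I" "u $ insert i I \<noteq> 0" by (auto split: if_splits)
  then have "card (insert i I \<inter> T) = k" using assms by (auto simp: graded_def)
  moreover have "insert i I \<inter> T = insert i (I \<inter> T)" using i by auto
  ultimately show "card (I \<inter> T) = k - 1" using \<open>i \<notin> I\<close> by auto
next
  fix I assume i: "i \<notin> T" and n: "(if i \<in> I then 0 else sg i I * u $ insert i I) \<noteq> 0"
  then have "u $ insert i I \<noteq> 0" by (auto split: if_splits)
  then have "card (insert i I \<inter> T) = k" using assms by (auto simp: graded_def)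
  moreover have "insert i I \<inter> T = I \<inter> T" using i by auto
  ultimately show "card (I \<inter> T) = k" by simp
qed

lemma graded_monomial:
  assumes "anticomm \<theta>" "\<And>i. graded T (if i \<in> T then 1 else 0) (\<theta> i)"
  shows "graded T (card (I \<inter> T)) (monomial \<theta> I)"
proof -
  have "finite I" by simp
  then show ?thesis
  proof (induction I)
    case empty then show ?case by (simp add: monomial_empty one_ext_def graded_axis)
  next
    case (insert i I)
    have "graded T ((if i \<in> T then 1 else 0) + card (I \<inter> T)) (wedge (\<theta> i) (monomial \<theta> I))"
      by (rule graded_wedge[OF assms(2) insert.IH])
    moreover have "card (insert i I \<inter> T) = (if i \<in> T then 1 else 0) + card (I \<inter> T)"
      using insert.hyps by (simp add: Int_insert_left)
    moreover have "sg i I \<noteq> 0" by (simp add: sg_def)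
    ultimately show ?case using insert.hyps wedge_monomial[OF assms(1), of i I]
      by (auto simp: graded_def)
  qed
qed

lemma graded_Lam:
  assumes "anticomm \<theta>" "\<And>i. graded T (if i \<in> T then 1 else 0) (\<theta> i)" "graded T k u"
  shows "graded T k (Lam \<theta> u)"
  unfolding Lam_def
proof (rule graded_sum)
  fix I show "graded T k (u $ I *s monomial \<theta> I)"
    using assms(3) graded_monomial[OF assms(1,2), of I] by (cases "u $ I = 0") (auto simp: graded_0 graded_def)
qed

text \<open>The part v of u of a wrong weight is mapped to the part of \<open>Lam \<theta> u\<close>
  of that weight, which is zero; injectivity then removes v.\<close>

lemma graded_Lam_inverse:
  assumes "anticomm \<theta>" "\<And>i. graded T (if i \<in> T then 1 else 0) (\<theta> i)" "graded T k (Lam \<theta> u)"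
    and inj: "\<And>v. Lam \<theta> v = 0 \<Longrightarrow> v = 0"
  shows "graded T k u"
  unfolding graded_def
proof (intro allI impI, rule ccontr)
  fix I assume I: "u $ I \<noteq> 0" "card (I \<inter> T) \<noteq> k"
  define j where "j = card (I \<inter> T)"
  define v :: ext where "v = (\<chi> J. if card (J \<inter> T) = j then u $ J else 0)"
  have "Lam \<theta> v $ K = 0" for K
  proof -
    have z: "monomial \<theta> J $ K = 0" if "card (J \<inter> T) \<noteq> card (K \<inter> T)" for J
      using gradedD[OF graded_monomial[OF assms(1,2)], of K J] that by simp
    have "Lam \<theta> v $ K = (\<Sum>J\<in>UNIV. (if card (J \<inter> T) = j then u $ J else 0) * monomial \<theta> J $ K)"
      by (simp add: Lam_def v_def)
    also have "... = (\<Sum>J\<in>UNIV. (if card (K \<inter> T) = j then u $ J else 0) * monomial \<theta> J $ K)"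
      by (rule sum.cong) (use z in \<open>auto simp: z\<close>)
    also have "... = (if card (K \<inter> T) = j then Lam \<theta> u $ K else 0)"
      by (simp add: Lam_def)
    also have "... = 0" using gradedD[OF assms(3), of K] I by (auto simp: j_def)
    finally show ?thesis .
  qed
  then have "Lam \<theta> v = 0" by (simp add: vec_eq_iff)
  then have "v = 0" by (rule inj)
  then have "v $ I = 0" by simp
  then show False using I by (simp add: v_def j_def)
qed

text \<open>This is where t31 = t32 = 0 enters: without mixed terms in gamma_t the change of frame
  respects the weight.\<close>

lemma graded_th:
  assumes "t $ 3 $ 1 = 0" "t $ 3 $ 2 = 0"
  shows "graded {2, 5} (if i \<in> {2, 5} then 1 else 0) (th t i)" "graded UNIV (if i \<in> UNIV then 1 else 0) (th t i)"
proof -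
  have "\<forall>i. graded {2, 5} (if i \<in> {2, 5} then 1 else 0) (th t i)"
    unfolding forall_6 by (simp add: th_def assms graded_add graded_diff graded_scale graded_gen)
  then show "graded {2, 5} (if i \<in> {2, 5} then 1 else 0) (th t i)" by blast
  have "\<forall>i. graded UNIV 1 (th t i)"
    unfolding forall_6 by (simp add: th_def assms graded_add graded_diff graded_scale graded_gen)
  then show "graded UNIV (if i \<in> UNIV then 1 else 0) (th t i)" by simp
qed

lemma dlt_wedge: "deg1 p \<Longrightarrow> dlt (wedge p v) = wedge (dlt p) v - wedge p (dlt v)"
proof -
  have g: "dlt (wedge (gen i) v) = wedge (dlt (gen i)) v - wedge (gen i) (dlt v)" for i v
  proof -
    have gi: "contr j (gen i) = (if j = i then one_ext else 0)" for j
      using contr_wedge[of j i one_ext] by (simp add: wedge_one_right contr_one wedge_zero_right)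
    have s: "wedge (gen a) (wedge (gen b) (wedge (gen i) w)) = wedge (gen i) (wedge (gen a) (wedge (gen b) w))" for a b w
      by (simp only: gen_anticomm[of b i] wedge_neg_right gen_anticomm[of a i] minus_minus)
    show ?thesis
      unfolding dlt_def contr_wedge gi wedge_diff_right s
      by (cases "i = 2"; cases "i = 5") (simp_all add: wedge_zero_right wedge_zero_left wedge_diff_left wedge_diff_right wedge_neg_left wedge_neg_right
          wedge_assoc wedge_one wedge_one_right)
  qed
  assume "deg1 p"
  then obtain c where c: "p = (\<Sum>i\<in>UNIV. c i *s gen i)" by (auto simp: deg1_def)
  show ?thesis unfolding c
    by (simp only: wedge_sum_left wedge_scale_left clinear_sum[OF clinear_dlt] clinear_scale[OF clinear_dlt] g
        vec.scale_right_diff_distrib sum_subtractf)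
qed

text \<open>Passing two letters costs two signs. It is applied to the 2-forms d gamma_t and its
  conjugate.\<close>

lemma even_commute:
  assumes "graded UNIV 2 c" shows "wedge c (wedge (gen i) v) = wedge (gen i) (wedge c v)"
proof -
  have ax: "wedge (axis I 1) (wedge (gen i) v) = wedge (gen i) (wedge (axis I 1) v)" if I: "card I = 2" for I
  proof -
    obtain a b where ab: "I = {a, b}" "a \<noteq> b" using I by (auto simp: card_2_iff)
    have "axis I 1 = sg a {b} *s wedge (gen a) (gen b)"
      using wedge_gen_axis[of a "{b}"] ab by (simp add: gen_def vector_smult_assoc sg_sq)
    moreover have "wedge (gen a) (wedge (gen b) (wedge (gen i) v)) = wedge (gen i) (wedge (gen a) (wedge (gen b) v))"
      by (simp only: gen_anticomm[of b i] wedge_neg_right gen_anticomm[of a i] minus_minus)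
    ultimately show ?thesis by (simp add: wedge_scale_left wedge_scale_right wedge_assoc)
  qed
  have "c = (\<Sum>I\<in>UNIV. c $ I *s axis I 1)" by (rule ext_expand)
  also have "... = (\<Sum>I\<in>{I. card I = 2}. c $ I *s axis I 1)"
    using assms by (intro sum.mono_neutral_right) (auto simp: graded_def)
  finally have c: "c = (\<Sum>I\<in>{I. card I = 2}. c $ I *s axis I 1)" .
  have "wedge (\<Sum>I\<in>{I. card I = 2}. c $ I *s axis I 1) (wedge (gen i) v) = wedge (gen i) (wedge (\<Sum>I\<in>{I. card I = 2}. c $ I *s axis I 1) v)"
    by (simp add: wedge_sum_left wedge_sum_right wedge_scale_left wedge_scale_right ax)
  then show ?thesis using c by simp
qed

text \<open>The open conditions on t used below, namely that the frame map is within 1/100 of the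
  identity and that D(t) is small, together with t31 = t32 = 0.\<close>

locale tframe =
  fixes t :: param
  assumes t3: "t $ 3 $ 1 = 0" "t $ 3 $ 2 = 0"
    and near: "\<And>u. norm (Lam (th t) u - u) \<le> 1/100 * norm u"
    and Dsmall: "norm (D_param t) \<le> 1/100"
begin

definition B :: "ext \<Rightarrow> ext" where "B = Lam (th t)"

lemma clinear_B: "clinear_map B" unfolding B_def by (rule clinear_Lam)

lemma B_wedge: "B (wedge u v) = wedge (B u) (B v)" unfolding B_def by (rule Lam_wedge[OF anticomm_th])

lemma B_gen: "B (gen i) = th t i" unfolding B_def by (rule Lam_gen[OF anticomm_th])

lemma B_one: "B one_ext = one_ext" unfolding B_def by (rule Lam_one)

lemma B_zero_iff: "B u = 0 \<Longrightarrow> u = 0"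
proof -
  assume "B u = 0"
  then have "norm u \<le> 1/100 * norm u" using near[of u] by (simp add: B_def)
  then show "u = 0" by simp
qed

lemma B_inj: "B u = B v \<Longrightarrow> u = v"
  using B_zero_iff[of "u - v"] by (simp add: clinear_diff[OF clinear_B])

lemma clinear_linear: "clinear_map L \<Longrightarrow> linear L"
proof (rule linearI)
  assume L: "clinear_map L"
  show "L (u + v) = L u + L v" for u v by (rule clinear_add[OF L])
  have r: "r *\<^sub>R u = of_real r *s u" for r and u :: ext by (subst vec_eq_iff) (simp, simp add: scaleR_conv_of_real)
  show "L (r *\<^sub>R u) = r *\<^sub>R L u" for r u unfolding r by (rule clinear_scale[OF L])
qed

lemma B_surj: "\<exists>v. B v = u"
proof -
  have "inj B" using B_inj by (auto intro: injI)
  then have "surj B" by (rule linear_injective_imp_surjective[OF clinear_linear[OF clinear_B]]) (rule refl)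
  then show ?thesis by (metis surjD)
qed

definition Bi :: "ext \<Rightarrow> ext" where "Bi u = (THE v. B v = u)"

lemma B_Bi: "B (Bi u) = u"
proof -
  have "\<exists>!v. B v = u" using B_surj B_inj by blast
  then show ?thesis unfolding Bi_def by (rule theI')
qed

lemma Bi_B: "Bi (B u) = u" by (rule B_inj) (rule B_Bi)

lemma clinear_Bi: "clinear_map Bi"
  by (rule clinear_mapI; rule B_inj) (simp_all add: B_Bi clinear_add[OF clinear_B] clinear_scale[OF clinear_B])

lemma Bi_wedge: "Bi (wedge u v) = wedge (Bi u) (Bi v)"
  by (rule B_inj) (simp add: B_Bi B_wedge)

text \<open>From distance 1/100 for B one gets norm (Bi y) \<le> 2 norm y, and then 2/100 for the
  inverse.\<close>

lemma Bi_near: "norm (Bi y - y) \<le> 1/50 * norm y"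
proof -
  have 1: "norm (y - Bi y) \<le> 1/100 * norm (Bi y)" using near[of "Bi y"] by (simp add: B_def[symmetric] B_Bi)
  have "norm (Bi y) \<le> norm y + norm (y - Bi y)" using norm_triangle_sub[of "Bi y" y] by (simp add: norm_minus_commute)
  then have "norm (Bi y) \<le> 2 * norm y" using 1 norm_ge_zero[of y] by linarith
  then have "norm (y - Bi y) \<le> 1/50 * norm y" using 1 by linarith
  then show ?thesis by (simp add: norm_minus_commute)
qed

lemma B_cnj: "B (cnj_ext u) = cnj_ext (B u)"
proof -
  have "cnj_ext (B (cnj_ext v)) = Lam (th t) v" for v
  proof (rule Lam_unique[of "\<lambda>v. cnj_ext (B (cnj_ext v))"])
    show "clinear_map (\<lambda>v. cnj_ext (B (cnj_ext v)))"
      by (rule clinear_mapI) (simp_all add: cnj_ext_add cnj_ext_scale clinear_add[OF clinear_B] clinear_scale[OF clinear_B])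
  qed (simp_all add: cnj_ext_one B_one cnj_ext_wedge cnj_ext_gen B_wedge B_gen th_conj type6_add6)
  from this[of "u"] show ?thesis using cnj_ext_cnj_ext[of "B (cnj_ext u)"] by (simp add: B_def)
qed

lemma Bi_cnj: "Bi (cnj_ext u) = cnj_ext (Bi u)"
  by (rule B_inj) (simp add: B_Bi B_cnj)

lemma graded_B: "graded {2, 5} k u \<Longrightarrow> graded {2, 5} k (B u)" "graded UNIV k u \<Longrightarrow> graded UNIV k (B u)"
  unfolding B_def by (rule graded_Lam[OF anticomm_th graded_th(1)[OF t3]], assumption)
    (rule graded_Lam[OF anticomm_th graded_th(2)[OF t3]], assumption)

lemma graded_Bi: "graded {2, 5} k u \<Longrightarrow> graded {2, 5} k (Bi u)" "graded UNIV k u \<Longrightarrow> graded UNIV k (Bi u)"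
proof -
  have inj: "Lam (th t) v = 0 \<Longrightarrow> v = 0" for v using B_zero_iff by (simp add: B_def)
  show "graded {2, 5} k u \<Longrightarrow> graded {2, 5} k (Bi u)"
    by (rule graded_Lam_inverse[OF anticomm_th graded_th(1)[OF t3] _ inj]) (simp_all add: B_def[symmetric] B_Bi)
  show "graded UNIV k u \<Longrightarrow> graded UNIV k (Bi u)"
    by (rule graded_Lam_inverse[OF anticomm_th graded_th(2)[OF t3] _ inj]) (simp_all add: B_def[symmetric] B_Bi)
qed

text \<open>The old covector gen j in the coframe of X_t. Its coefficients \<open>NN j i\<close>
  therefore express the i-th field of the dual frame of X_t as sum_j NN j i xi_j.\<close>

definition nu :: "6 \<Rightarrow> ext" where "nu j = Bi (gen j)"
definition NN :: "6 \<Rightarrow> 6 \<Rightarrow> complex" where "NN j i = nu j $ {i}"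
definition c2 :: ext where "c2 = Bi (dlt (th t 2))"
definition c5 :: ext where "c5 = Bi (dlt (th t 5))"

lemma nu_expand: "nu j = (\<Sum>i\<in>UNIV. NN j i *s gen i)"
proof -
  have g: "graded UNIV 1 (nu j)" unfolding nu_def by (rule graded_Bi(2)) (simp add: graded_gen)
  have "nu j = (\<Sum>I\<in>UNIV. nu j $ I *s axis I 1)" by (rule ext_expand)
  also have "... = (\<Sum>I\<in>range (\<lambda>i. {i}). nu j $ I *s axis I 1)"
    using g by (intro sum.mono_neutral_right) (auto simp: graded_def card_1_singleton_iff image_iff)
  also have "... = (\<Sum>i\<in>UNIV. nu j $ {i} *s axis {i} 1)" by (subst sum.reindex) (auto simp: inj_on_def)
  finally show ?thesis by (simp add: NN_def gen_def)
qed

lemma NN_near: "norm (NN j i - (if i = j then 1 else 0)) \<le> 1/50"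
proof -
  have "norm ((nu j - gen j) $ {i}) \<le> norm (nu j - gen j)" by (rule Finite_Cartesian_Product.norm_nth_le)
  also have "... \<le> 1/50 * norm (gen j)" unfolding nu_def by (rule Bi_near)
  also have "norm (gen j) = 1" by (simp add: gen_def norm_axis_complex)
  finally show ?thesis by (auto simp: NN_def gen_def axis_def split: if_splits)
qed

text \<open>Horizontal covectors have weight zero, and so do their images under the inverse frame
  map. This is the hypothesis on column 5 in the solution theorem.\<close>

lemma NN_5: "j \<in> {0, 1, 3, 4} \<Longrightarrow> NN j 5 = 0"
proof -
  assume j: "j \<in> {0, 1, 3, 4}"
  then have "graded {2, 5} 0 (nu j)" unfolding nu_def by (intro graded_Bi(1)) (auto simp: graded_gen)
  then show ?thesis unfolding NN_def by (rule gradedD) simp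
qed

lemma dlt_gen: "dlt (gen i) = (if i = 2 then - wedge (gen 0) (gen 1) else if i = 5 then - wedge (gen 3) (gen 4) else 0)"
proof -
  have gi: "contr j (gen i) = (if j = i then one_ext else 0)" for j
    using contr_wedge[of j i one_ext] by (simp add: wedge_one_right contr_one wedge_zero_right)
  show ?thesis by (simp add: dlt_def gi wedge_zero_right wedge_one_right)
qed

lemma dlt_th: "dlt (th t 0) = 0" "dlt (th t 1) = 0" "dlt (th t 3) = 0" "dlt (th t 4) = 0"
  "dlt (th t 2) = D_param t *s wedge (gen 3) (gen 4) - wedge (gen 0) (gen 1)"
  by (simp_all add: th_def t3 clinear_add[OF clinear_dlt] clinear_diff[OF clinear_dlt] clinear_scale[OF clinear_dlt] dlt_gen vec.scale_minus_right)

lemma cnj_dlt: "cnj_ext (dlt (th t 2)) = dlt (th t 5)"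
proof -
  have s: "wedge (gen 0) (gen 1) = - wedge (gen 1) (gen 0)" for v using gen_anticomm[of 0 1 one_ext] by (simp add: wedge_one_right)
  have "dlt (th t 5) = cnj (D_param t) *s wedge (gen 0) (gen 1) - wedge (gen 3) (gen 4)"
    by (simp add: th_def t3 clinear_add[OF clinear_dlt] clinear_diff[OF clinear_dlt] clinear_scale[OF clinear_dlt] dlt_gen vec.scale_minus_right)
  then show ?thesis
    by (simp add: dlt_th cnj_ext_diff cnj_ext_scale cnj_ext_wedge cnj_ext_gen type6_add3)
qed

lemma c5_cnj: "c5 = cnj_ext c2"
  unfolding c5_def c2_def cnj_dlt[symmetric] by (rule Bi_cnj)

lemma graded_c2: "graded {2, 5} 0 c2" "graded UNIV 2 c2"
proof -
  have w: "graded {2, 5} 0 (wedge (gen i) (gen j))" if "i \<notin> {2, 5}" "j \<notin> {2, 5}" for i j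
  proof -
    have "graded {2, 5} (0 + 0) (wedge (gen i) (gen j))"
      by (rule graded_wedge) (use that in \<open>simp_all add: graded_gen del: insert_iff\<close>)
    then show ?thesis by simp
  qed
  have u: "graded UNIV 2 (wedge (gen i) (gen j))" for i j
  proof -
    have "graded UNIV (1 + 1) (wedge (gen i) (gen j))" by (rule graded_wedge) (simp_all add: graded_gen)
    then show ?thesis by (simp add: numeral_2_eq_2)
  qed
  show "graded {2, 5} 0 c2" unfolding c2_def dlt_th
    by (intro graded_Bi(1) graded_diff graded_scale w) (simp_all add: type6_distinct)
  show "graded UNIV 2 c2" unfolding c2_def dlt_th by (intro graded_Bi(2) graded_diff graded_scale u)
qed

text \<open>The constant part of d in the coframe of X_t; \<open>c2\<close> and \<open>c5\<close>
  are d gamma_t and its conjugate in that coframe.\<close>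

definition dT :: "ext \<Rightarrow> ext" where "dT u = wedge c2 (contr 2 u) + wedge c5 (contr 5 u)"

lemma clinear_dT: "clinear_map dT" unfolding dT_def[abs_def] by (intro clinear_intros clinear_contr_comp)

lemma graded_cnj: "graded {2, 5} k u \<Longrightarrow> graded {2, 5} k (cnj_ext u)" "graded UNIV k u \<Longrightarrow> graded UNIV k (cnj_ext u)"
proof -
  have g5: "graded {2, 5} (if i \<in> {2, 5} then 1 else 0) (gen (i + 3))" for i
  proof -
    have "\<forall>i. graded {2, 5} (if i \<in> {2, 5} then 1 else 0) (gen (i + 3))" unfolding forall_6 type6_add3 by (simp add: graded_gen)
    then show ?thesis by blast
  qed
  have cc: "graded T k (conjc u)" if "graded T k u" for T using that by (auto simp: graded_def conjc_def)
  show "graded {2, 5} k u \<Longrightarrow> graded {2, 5} k (cnj_ext u)" unfolding cnj_ext_Lam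
    by (rule graded_Lam[OF anticomm_conj_gen g5 cc])
  show "graded UNIV k u \<Longrightarrow> graded UNIV k (cnj_ext u)" unfolding cnj_ext_Lam
    by (rule graded_Lam[OF anticomm_conj_gen _ cc]) (simp_all add: graded_gen)
qed

text \<open>Both sides are antiderivations along the algebra map B, so agreement on the six
  generators suffices. That the 2-forms \<open>c2\<close> and \<open>c5\<close> commute with
  generators makes \<open>dT\<close> an antiderivation.\<close>

lemma dlt_B: "dlt (B u) = B (dT u)"
proof (induction u rule: ext_gen_induct)
  case 1 then show ?case
    by (simp add: B_one dT_def contr_one wedge_zero_right clinear_zero[OF clinear_B] dlt_def)
next
  case (2 i v)
  have g5: "graded UNIV 2 c5" unfolding c5_cnj by (rule graded_cnj(2)[OF graded_c2(2)])
  have l: "dT (wedge (gen i) v) = (if i = 2 then wedge c2 v else 0) + (if i = 5 then wedge c5 v else 0) - wedge (gen i) (dT v)"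
    by (simp add: dT_def contr_wedge wedge_diff_right wedge_zero_right even_commute[OF graded_c2(2)] even_commute[OF g5] wedge_add_right)
  have d: "dlt (th t i) = (if i = 2 then B c2 else if i = 5 then B c5 else 0)"
  proof -
    have "\<forall>i. dlt (th t i) = (if i = 2 then B c2 else if i = 5 then B c5 else 0)"
      unfolding forall_6 by (simp add: dlt_th(1-4)) (simp add: c2_def c5_def B_Bi)
    then show ?thesis by blast
  qed
  have "dlt (B (wedge (gen i) v)) = wedge (dlt (th t i)) (B v) - wedge (th t i) (B (dT v))"
    by (simp add: B_wedge B_gen dlt_wedge[OF deg1_th] 2)
  also have "... = B (dT (wedge (gen i) v))" unfolding l d
    by (simp add: clinear_add[OF clinear_B] clinear_diff[OF clinear_B] clinear_zero[OF clinear_B] B_wedge B_gen wedge_zero_left)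
  finally show ?case .
next
  case (3 u v) then show ?case
    by (simp add: clinear_add[OF clinear_B] clinear_add[OF clinear_dlt] clinear_add[OF clinear_dT])
next
  case (4 c u) then show ?case
    by (simp add: clinear_scale[OF clinear_B] clinear_scale[OF clinear_dlt] clinear_scale[OF clinear_dT])
qed

definition Dt :: "form \<Rightarrow> form" where
  "Dt w x = (\<Sum>j\<in>UNIV. wedge (nu j) (lift_op (xi j) w x)) + dT (w x)"

lemma Dl_B: "inv_form w \<Longrightarrow> Dl (\<lambda>x. B (w x)) = (\<lambda>x. B (Dt w x))"
  by (rule ext) (simp add: Dl_def Dt_def xi_lift_clinear[OF clinear_B] dlt_B clinear_add[OF clinear_B] clinear_sum[OF clinear_B]
      B_wedge nu_def B_Bi)

lemma inv_form_Dt: "inv_form w \<Longrightarrow> inv_form (Dt w)"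
  unfolding Dt_def[abs_def]
  by (intro inv_form_add inv_form_sum inv_form_clinear[OF clinear_wedge_right] inv_form_xi inv_form_clinear[OF clinear_dT])

text \<open>A form on X from its coefficient function in the coframe of X_t: change of frame by the
  constant B, then the shear to coordinates.\<close>

definition Psi :: "form \<Rightarrow> form" where "Psi w = Fr (\<lambda>x. B (w x))"

lemma ext_d_Psi: "inv_form w \<Longrightarrow> ext_d (Psi w) = Psi (Dt w)"
  unfolding Psi_def by (simp add: ext_d_Fr[OF inv_form_clinear[OF clinear_B]] Dl_B)

lemma Psi_inject: "Psi u = Psi v \<longleftrightarrow> u = v"
  unfolding Psi_def Fr_inject by (metis B_inj ext)

lemma Psi_add: "Psi u + Psi v = Psi (\<lambda>x. u x + v x)"
  unfolding Psi_def add_Fr by (simp add: clinear_add[OF clinear_B])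

lemma Psi_diff: "Psi u - Psi v = Psi (\<lambda>x. u x - v x)"
  unfolding Psi_def diff_Fr by (simp add: clinear_diff[OF clinear_B])

lemma Psi_scale: "c \<cdot> Psi u = Psi (\<lambda>x. c *s u x)"
  unfolding Psi_def fscale_Fr by (simp add: clinear_scale[OF clinear_B])

lemma Psi_wedge: "Psi u \<and>\<^sub>f Psi v = Psi (\<lambda>x. wedge (u x) (v x))"
  unfolding Psi_def fwedge_Fr by (simp add: B_wedge)

lemma Psi_cnj: "fcnj (Psi u) = Psi (\<lambda>x. cnj_ext (u x))"
  unfolding Psi_def fcnj_Fr by (simp add: B_cnj)

lemma Psi_zero: "Psi (\<lambda>x. 0) = 0"
  by (simp add: Psi_def Fr_def clinear_zero[OF clinear_B] clinear_zero[OF clinear_shear] fun_eq_iff)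

lemma forms_X_Psi: assumes "u \<in> forms_X" obtains w where "inv_form w" "u = Psi w"
proof -
  obtain v where v: "inv_form v" "u = Fr v" using forms_X_Fr[OF assms] .
  have "inv_form (\<lambda>x. Bi (v x))" by (rule inv_form_clinear[OF clinear_Bi v(1)])
  then show thesis by (rule that) (simp add: Psi_def B_Bi v(2))
qed

lemma Psi_in_forms_X: "inv_form w \<Longrightarrow> Psi w \<in> forms_X"
  unfolding Psi_def by (intro Fr_in_forms_X inv_form_clinear[OF clinear_B])

lemma frame_Psi: "alpha_t t = Psi (\<lambda>x. gen 0)" "beta_t t = Psi (\<lambda>x. gen 1)" "gamma_t t = Psi (\<lambda>x. gen 2)"
  by (simp_all add: Psi_def B_gen alpha_t_Fr beta_t_Fr gamma_t_Fr)

lemma coframe_monomial_Psi: "coframe_monomial t I x = shear (x $ 1) (B (axis I 1))"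
  by (simp add: coframe_monomial_eq B_def)

lemma Psi_expand: "Psi w x = (\<Sum>I\<in>UNIV. w x $ I *s coframe_monomial t I x)"
  unfolding Psi_def Fr_def coframe_monomial_Psi
  by (subst ext_expand[of "w x"])
    (simp only: clinear_sum[OF clinear_B] clinear_scale[OF clinear_B] shear_sum shear_scale)

lemma coframe_coeffs_Psi: "coframe_coeffs t x (Psi w x) = w x"
  unfolding coframe_coeffs_def
proof (rule the_equality)
  show "Psi w x = (\<Sum>I\<in>UNIV. w x $ I *s coframe_monomial t I x)" by (rule Psi_expand)
  fix c assume "Psi w x = (\<Sum>I\<in>UNIV. c $ I *s coframe_monomial t I x)"
  also have "... = Psi (\<lambda>x. c) x" by (rule Psi_expand[symmetric])
  finally have "shear (- x $ 1) (Psi w x) = shear (- x $ 1) (Psi (\<lambda>x. c) x)" by simp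
  then have "B (w x) = B c" by (simp add: Psi_def Fr_def shear_inverse)
  then show "c = w x" using B_inj by metis
qed

definition QQ :: "nat \<Rightarrow> nat \<Rightarrow> ext \<Rightarrow> ext" where "QQ p q u = (\<chi> I. if I \<in> bidegree p q then u $ I else 0)"

lemma clinear_QQ: "clinear_map (QQ p q)"
  by (auto simp: clinear_map_def QQ_def vec_eq_iff)

lemma pq_part_Psi: "pq_part t p q (Psi w) = Psi (\<lambda>x. QQ p q (w x))"
proof
  fix x
  have "Psi (\<lambda>x. QQ p q (w x)) x = (\<Sum>I\<in>UNIV. (if I \<in> bidegree p q then w x $ I else 0) *s coframe_monomial t I x)"
    unfolding Psi_expand by (simp add: QQ_def)
  also have "... = (\<Sum>I\<in>bidegree p q. w x $ I *s coframe_monomial t I x)"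
    by (rule sum.mono_neutral_cong_right) auto
  finally show "pq_part t p q (Psi w) x = Psi (\<lambda>x. QQ p q (w x)) x"
    unfolding pq_part_def coframe_coeffs_Psi by simp
qed

lemma delbar_Psi: "inv_form w \<Longrightarrow> delbar t p q (Psi w) = Psi (\<lambda>x. QQ p (q + 1) (Dt w x))"
  unfolding delbar_def ext_d_Psi pq_part_Psi ..

lemma pq_forms_Psi: "pq_forms t p q = {Psi w | w. inv_form w \<and> (\<forall>x. QQ p q (w x) = w x)}"
proof (rule Set.set_eqI, rule iffI)
  fix u assume u: "u \<in> pq_forms t p q"
  then have "u \<in> forms_X" by (simp add: pq_forms_def)
  then obtain w where w: "inv_form w" "u = Psi w" by (rule forms_X_Psi)
  have "QQ p q (w x) = w x" for x
  proof -
    \<comment> \<open>A subspace containing the monomials of type (p, q), hence their span; a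
      member's frame coefficients are then recovered by undoing the shear and B.\<close>
    let ?S = "{v. \<exists>c. v = shear (x $ 1) (B (QQ p q c))}"
    have "vec.span ((\<lambda>I. coframe_monomial t I x) ` bidegree p q) \<subseteq> ?S"
    proof (rule vec.span_minimal)
      show "(\<lambda>I. coframe_monomial t I x) ` bidegree p q \<subseteq> ?S"
      proof safe
        fix I assume "I \<in> bidegree p q"
        then have "QQ p q (axis I 1) = axis I 1" by (auto simp: QQ_def axis_def vec_eq_iff)
        then show "\<exists>c. coframe_monomial t I x = shear (x $ 1) (B (QQ p q c))"
          by (intro exI[of _ "axis I 1"]) (simp add: coframe_monomial_Psi)
      qed
      show "vec.subspace ?S"
      proof (rule vec.subspaceI)
        show "0 \<in> ?S" by (auto intro!: exI[of _ 0] simp: clinear_zero[OF clinear_QQ] clinear_zero[OF clinear_B] clinear_zero[OF clinear_shear])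
      next
        fix u v assume "u \<in> ?S" "v \<in> ?S"
        then obtain c d where "u = shear (x $ 1) (B (QQ p q c))" "v = shear (x $ 1) (B (QQ p q d))" by auto
        then have "u + v = shear (x $ 1) (B (QQ p q (c + d)))" by (simp add: clinear_add[OF clinear_QQ] clinear_add[OF clinear_B] shear_add)
        then show "u + v \<in> ?S" by blast
      next
        fix k u assume "u \<in> ?S"
        then obtain c where "u = shear (x $ 1) (B (QQ p q c))" by auto
        then have "k *s u = shear (x $ 1) (B (QQ p q (k *s c)))" by (simp add: clinear_scale[OF clinear_QQ] clinear_scale[OF clinear_B] shear_scale)
        then show "k *s u \<in> ?S" by blast
      qed
    qed
    moreover have "Psi w x \<in> vec.span ((\<lambda>I. coframe_monomial t I x) ` bidegree p q)" using u w by (simp add: pq_forms_def)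
    ultimately obtain c where "Psi w x = shear (x $ 1) (B (QQ p q c))" by auto
    then have "shear (- x $ 1) (shear (x $ 1) (B (w x))) = shear (- x $ 1) (shear (x $ 1) (B (QQ p q c)))" by (simp add: Psi_def Fr_def)
    then have "B (w x) = B (QQ p q c)" by (simp only: shear_inverse)
    then have "w x = QQ p q c" by (rule B_inj)
    then show ?thesis by (simp add: QQ_def vec_eq_iff)
  qed
  then show "u \<in> {Psi w | w. inv_form w \<and> (\<forall>x. QQ p q (w x) = w x)}" using w by auto
next
  fix u assume "u \<in> {Psi w | w. inv_form w \<and> (\<forall>x. QQ p q (w x) = w x)}"
  then obtain w where w: "inv_form w" "\<And>x. QQ p q (w x) = w x" "u = Psi w" by auto
  have "Psi w x \<in> vec.span ((\<lambda>I. coframe_monomial t I x) ` bidegree p q)" for x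
  proof -
    have z: "w x $ I = 0" if "I \<notin> bidegree p q" for I
      using arg_cong[OF w(2)[of x], of "\<lambda>u. u $ I"] that by (simp add: QQ_def)
    have "Psi w x = (\<Sum>I\<in>bidegree p q. w x $ I *s coframe_monomial t I x)"
      unfolding Psi_expand by (rule sum.mono_neutral_right) (auto simp: z)
    also have "... \<in> vec.span ((\<lambda>I. coframe_monomial t I x) ` bidegree p q)"
      by (intro vec.span_sum vec.span_scale vec.span_base imageI)
    finally show ?thesis .
  qed
  then show "u \<in> pq_forms t p q" using w Psi_in_forms_X by (auto simp: pq_forms_def)
qed

lemma kforms_Psi: "kforms k = {Psi w | w. inv_form w \<and> (\<forall>x. graded UNIV k (w x))}"
proof -
  have hd: "has_degree k u \<longleftrightarrow> graded UNIV k u" for u by (simp add: has_degree_def graded_def)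
  have sh: "graded UNIV k (shear c u)" if "graded UNIV k u" for c u
    unfolding shear_Lam
    by (rule graded_Lam[OF anticomm_shear_gen _ that]) (auto simp: shear_gen_def intro!: graded_diff graded_scale simp: graded_gen)
  have "graded UNIV k (Psi w x) \<longleftrightarrow> graded UNIV k (w x)" for w x
  proof
    assume "graded UNIV k (Psi w x)"
    from sh[OF this, of "- x $ 1"] have "graded UNIV k (B (w x))" by (simp add: Psi_def Fr_def shear_inverse)
    from graded_Bi(2)[OF this] show "graded UNIV k (w x)" by (simp add: Bi_B)
  next
    assume "graded UNIV k (w x)"
    then show "graded UNIV k (Psi w x)" unfolding Psi_def Fr_def by (intro sh graded_B(2))
  qed
  then show ?thesis unfolding kforms_def hd
    by (auto elim!: forms_X_Psi intro: Psi_in_forms_X)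
qed

end

section \<open>Quotients of spaces of forms\<close>

lemma cring_complex_field: "cring complex_field"
proof (rule cringI)
  show "abelian_group complex_field"
    by (rule abelian_groupI) (auto simp: complex_field_def intro: exI[of _ "- _"] add.left_inverse)
  show "Group.comm_monoid complex_field"
    by (rule comm_monoidI) (auto simp: complex_field_def)
qed (auto simp: complex_field_def algebra_simps)

lemma fscale_simps:
  "(a + b) \<cdot> u = a \<cdot> u + b \<cdot> u" "a \<cdot> (u + v) = a \<cdot> u + a \<cdot> v" "(a * b) \<cdot> u = a \<cdot> (b \<cdot> u)"
  "1 \<cdot> u = u" "0 \<cdot> u = 0" "a \<cdot> 0 = 0" "(-1) \<cdot> u = - u" "a \<cdot> (- u) = - (a \<cdot> u)" "(- a) \<cdot> u = - (a \<cdot> u)"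
  "a \<cdot> (u - v) = a \<cdot> u - a \<cdot> v"
  by (simp_all add: fscale_def fun_eq_iff vec_eq_iff algebra_simps)

definition fsub :: "form set \<Rightarrow> bool" where
  "fsub U \<longleftrightarrow> 0 \<in> U \<and> (\<forall>u\<in>U. \<forall>v\<in>U. u + v \<in> U) \<and> (\<forall>c. \<forall>u\<in>U. c \<cdot> u \<in> U)"

lemma fsub_0: "fsub U \<Longrightarrow> 0 \<in> U"
  and fsub_add: "fsub U \<Longrightarrow> u \<in> U \<Longrightarrow> v \<in> U \<Longrightarrow> u + v \<in> U"
  and fsub_scale: "fsub U \<Longrightarrow> u \<in> U \<Longrightarrow> c \<cdot> u \<in> U"
  by (auto simp: fsub_def)

lemma fsub_neg: "fsub U \<Longrightarrow> u \<in> U \<Longrightarrow> - u \<in> U"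
  using fsub_scale[of U u "-1"] by (simp add: fscale_simps)

lemma fsub_diff: "fsub U \<Longrightarrow> u \<in> U \<Longrightarrow> v \<in> U \<Longrightarrow> u - v \<in> U"
  using fsub_add[of U u "- v"] fsub_neg[of U v] by simp

lemma class_eq_iff: assumes "fsub B" shows "cohom_class B u = cohom_class B v \<longleftrightarrow> u - v \<in> B"
proof
  assume "cohom_class B u = cohom_class B v"
  moreover have "u \<in> cohom_class B u" unfolding cohom_class_def using fsub_0[OF assms] by (intro CollectI exI[of _ 0]) simp
  ultimately obtain b where "b \<in> B" "u = v + b" unfolding cohom_class_def by auto
  then show "u - v \<in> B" by simp
next
  assume d: "u - v \<in> B"
  have "cohom_class B u \<subseteq> cohom_class B v" if "u - v \<in> B" for u v
  proof
    fix x assume "x \<in> cohom_class B u"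
    then obtain b where "b \<in> B" "x = u + b" unfolding cohom_class_def by auto
    then have "(u - v) + b \<in> B" "x = v + ((u - v) + b)" using fsub_add[OF assms that] by auto
    then show "x \<in> cohom_class B v" unfolding cohom_class_def by blast
  qed
  moreover have "v - u \<in> B" using fsub_neg[OF assms d] by simp
  ultimately show "cohom_class B u = cohom_class B v" using d by blast
qed

lemma class_0: "fsub B \<Longrightarrow> cohom_class B 0 = B"
  by (auto simp: cohom_class_def)

lemma quotient_add:
  assumes "fsub B"
  shows "cohom_class B u \<oplus>\<^bsub>quotient_space Z B\<^esub> cohom_class B v = cohom_class B (u + v)"
proof -
  have "{a + a' | a a'. a \<in> cohom_class B u \<and> a' \<in> cohom_class B v} = cohom_class B (u + v)"
  proof (rule Set.set_eqI, rule iffI)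
    fix x assume "x \<in> {a + a' | a a'. a \<in> cohom_class B u \<and> a' \<in> cohom_class B v}"
    then obtain b b' where "b \<in> B" "b' \<in> B" "x = (u + b) + (v + b')" unfolding cohom_class_def by auto
    then have "b + b' \<in> B" "x = (u + v) + (b + b')" using fsub_add[OF assms] by (auto simp: algebra_simps)
    then show "x \<in> cohom_class B (u + v)" unfolding cohom_class_def by blast
  next
    fix x assume "x \<in> cohom_class B (u + v)"
    then obtain b where "b \<in> B" "x = (u + b) + (v + 0)" unfolding cohom_class_def by (auto simp: algebra_simps)
    then show "x \<in> {a + a' | a a'. a \<in> cohom_class B u \<and> a' \<in> cohom_class B v}"
      unfolding cohom_class_def using fsub_0[OF assms] by blast
  qed
  then show ?thesis by (simp add: quotient_space_def)
qed

lemma quotient_smult: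
  assumes "fsub B"
  shows "c \<odot>\<^bsub>quotient_space Z B\<^esub> cohom_class B u = cohom_class B (c \<cdot> u)"
proof -
  have "{c \<cdot> a + b | a b. a \<in> cohom_class B u \<and> b \<in> B} = cohom_class B (c \<cdot> u)"
  proof (rule Set.set_eqI, rule iffI)
    fix x assume "x \<in> {c \<cdot> a + b | a b. a \<in> cohom_class B u \<and> b \<in> B}"
    then obtain b b' where "b \<in> B" "b' \<in> B" "x = c \<cdot> (u + b) + b'" unfolding cohom_class_def by auto
    then have "c \<cdot> b + b' \<in> B" "x = c \<cdot> u + (c \<cdot> b + b')" using fsub_add[OF assms] fsub_scale[OF assms] by (auto simp: fscale_simps)
    then show "x \<in> cohom_class B (c \<cdot> u)" unfolding cohom_class_def by blast
  next
    fix x assume "x \<in> cohom_class B (c \<cdot> u)"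
    then obtain b where "b \<in> B" "x = c \<cdot> (u + 0) + b" unfolding cohom_class_def by auto
    then show "x \<in> {c \<cdot> a + b | a b. a \<in> cohom_class B u \<and> b \<in> B}"
      unfolding cohom_class_def using fsub_0[OF assms] by blast
  qed
  then show ?thesis by (simp add: quotient_space_def)
qed

lemma quotient_carrier: "carrier (quotient_space Z B) = cohom_class B ` Z"
  by (simp add: quotient_space_def)

lemma quotient_zero: "fsub B \<Longrightarrow> \<zero>\<^bsub>quotient_space Z B\<^esub> = cohom_class B 0"
  by (simp add: quotient_space_def class_0)

text \<open>The carrier may be the classes of any subspace U, which covers both the full cohomology
  spaces and the spans inside them.\<close>

lemma module_of_classes:
  assumes B: "fsub B" and U: "fsub U"
  shows "Module.module complex_field ((quotient_space Z B)\<lparr>carrier := cohom_class B ` U\<rparr>)" (is "Module.module _ ?M")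
proof (rule moduleI)
  have ad: "cohom_class B u \<oplus>\<^bsub>?M\<^esub> cohom_class B v = cohom_class B (u + v)" for u v
    using quotient_add[OF B, of Z u v] by simp
  have sm: "c \<odot>\<^bsub>?M\<^esub> cohom_class B u = cohom_class B (c \<cdot> u)" for c u
    using quotient_smult[OF B, of Z c u] by simp
  have ze: "\<zero>\<^bsub>?M\<^esub> = cohom_class B 0" using quotient_zero[OF B, of Z] by simp
  have ca: "carrier ?M = cohom_class B ` U" by simp
  show "cring complex_field" by (rule cring_complex_field)
  show "abelian_group ?M"
  proof (rule abelian_groupI, goal_cases)
    case (1 x y) then show ?case unfolding ca by (auto simp: quotient_add[OF B] intro!: imageI fsub_add[OF U])
  next
    case 2 show ?case unfolding ca ze by (intro imageI fsub_0[OF U])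
  next
    case (3 x y z) then show ?case unfolding ca by (auto simp: quotient_add[OF B] add.assoc)
  next
    case (4 x y) then show ?case unfolding ca by (auto simp: quotient_add[OF B] add.commute)
  next
    case (5 x) then show ?case unfolding ca ze by (auto simp: quotient_add[OF B])
  next
    case (6 x)
    then obtain u where u: "u \<in> U" "x = cohom_class B u" unfolding ca by auto
    have "cohom_class B (- u) \<in> cohom_class B ` U" using fsub_neg[OF U u(1)] by (rule imageI)
    moreover have "cohom_class B (- u) \<oplus>\<^bsub>?M\<^esub> x = \<zero>\<^bsub>?M\<^esub>" unfolding u(2) ad ze by simp
    ultimately show ?case unfolding ca by blast
  qed
  have U': "\<exists>u\<in>U. x = cohom_class B u" if "x \<in> carrier ?M" for x using that unfolding ca by auto
  note q = quotient_add[OF B] quotient_smult[OF B] complex_field_def fscale_simps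
  show "a \<odot>\<^bsub>?M\<^esub> x \<in> carrier ?M" if x: "x \<in> carrier ?M" for a x
    using U'[OF x] unfolding ca by (auto simp: q intro!: imageI fsub_scale[OF U])
  show "(a \<oplus>\<^bsub>complex_field\<^esub> b) \<odot>\<^bsub>?M\<^esub> x = a \<odot>\<^bsub>?M\<^esub> x \<oplus>\<^bsub>?M\<^esub> b \<odot>\<^bsub>?M\<^esub> x" if x: "x \<in> carrier ?M" for a b x
    using U'[OF x] by (auto simp: q)
  show "a \<odot>\<^bsub>?M\<^esub> (x \<oplus>\<^bsub>?M\<^esub> y) = a \<odot>\<^bsub>?M\<^esub> x \<oplus>\<^bsub>?M\<^esub> a \<odot>\<^bsub>?M\<^esub> y" if x: "x \<in> carrier ?M" and y: "y \<in> carrier ?M" for a x y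
    using U'[OF x] U'[OF y] by (auto simp: q)
  show "(a \<otimes>\<^bsub>complex_field\<^esub> b) \<odot>\<^bsub>?M\<^esub> x = a \<odot>\<^bsub>?M\<^esub> (b \<odot>\<^bsub>?M\<^esub> x)" if x: "x \<in> carrier ?M" for a b x
    using U'[OF x] by (auto simp: q)
  show "\<one>\<^bsub>complex_field\<^esub> \<odot>\<^bsub>?M\<^esub> x = x" if x: "x \<in> carrier ?M" for x
    using U'[OF x] by (auto simp: q)
qed

lemma module_quotient: assumes "fsub B" "fsub Z" shows "Module.module complex_field (quotient_space Z B)"
proof -
  have "(quotient_space Z B)\<lparr>carrier := cohom_class B ` Z\<rparr> = quotient_space Z B" by (simp add: quotient_space_def)
  with module_of_classes[OF assms, of Z] show ?thesis by (simp only:)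
qed

definition comb4 :: "form \<Rightarrow> form \<Rightarrow> form \<Rightarrow> form \<Rightarrow> form set" where
  "comb4 a b c d = {k1 \<cdot> a + k2 \<cdot> b + k3 \<cdot> c + k4 \<cdot> d | k1 k2 k3 k4. True}"

lemma comb4I: "k1 \<cdot> a + k2 \<cdot> b + k3 \<cdot> c + k4 \<cdot> d \<in> comb4 a b c d"
  unfolding comb4_def by blast

lemma fsub_comb4: "fsub (comb4 a b c d)"
  unfolding fsub_def
proof (intro conjI ballI allI)
  show "0 \<in> comb4 a b c d" using comb4I[of 0 a 0 b 0 c 0 d] by (simp add: fscale_simps)
next
  fix u v assume "u \<in> comb4 a b c d" "v \<in> comb4 a b c d"
  then obtain k1 k2 k3 k4 l1 l2 l3 l4 where
    "u = k1 \<cdot> a + k2 \<cdot> b + k3 \<cdot> c + k4 \<cdot> d" "v = l1 \<cdot> a + l2 \<cdot> b + l3 \<cdot> c + l4 \<cdot> d" unfolding comb4_def by blast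
  then have "u + v = (k1 + l1) \<cdot> a + (k2 + l2) \<cdot> b + (k3 + l3) \<cdot> c + (k4 + l4) \<cdot> d"
    by (simp add: fscale_simps algebra_simps)
  then show "u + v \<in> comb4 a b c d" by (simp only: comb4I)
next
  fix k u assume "u \<in> comb4 a b c d"
  then obtain k1 k2 k3 k4 where "u = k1 \<cdot> a + k2 \<cdot> b + k3 \<cdot> c + k4 \<cdot> d" unfolding comb4_def by blast
  then have "k \<cdot> u = (k * k1) \<cdot> a + (k * k2) \<cdot> b + (k * k3) \<cdot> c + (k * k4) \<cdot> d"
    by (simp add: fscale_simps)
  then show "k \<cdot> u \<in> comb4 a b c d" by (simp only: comb4I)
qed

lemma comb4_mem: "a \<in> comb4 a b c d" "b \<in> comb4 a b c d" "c \<in> comb4 a b c d" "d \<in> comb4 a b c d"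
  using comb4I[of 1 a 0 b 0 c 0 d] comb4I[of 0 a 1 b 0 c 0 d] comb4I[of 0 a 0 b 1 c 0 d] comb4I[of 0 a 0 b 0 c 1 d]
  by (simp_all add: fscale_simps)

lemma comb4_minimal: "fsub U \<Longrightarrow> {a, b, c, d} \<subseteq> U \<Longrightarrow> comb4 a b c d \<subseteq> U"
  unfolding comb4_def by (auto intro!: fsub_add fsub_scale)

lemma submodule_of_classes:
  assumes B: "fsub B" and U: "fsub U" and Z: "fsub Z" and UZ: "U \<subseteq> Z"
  shows "submodule (cohom_class B ` U) complex_field (quotient_space Z B)"
proof -
  show ?thesis
  proof (rule Module.module.module_incl_imp_submodule[OF module_quotient[OF B Z] _ module_of_classes[OF B U]])
    show "cohom_class B ` U \<subseteq> carrier (quotient_space Z B)" using UZ by (auto simp: quotient_carrier)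
  qed
qed

lemma lin_span_classes:
  assumes B: "fsub B" and Z: "fsub Z" and S: "{a, b, c, d} \<subseteq> Z"
  shows "lin_span (quotient_space Z B) (cohom_class B ` {a, b, c, d}) = cohom_class B ` comb4 a b c d"
proof
  have "submodule (cohom_class B ` comb4 a b c d) complex_field (quotient_space Z B)"
    by (rule submodule_of_classes[OF B fsub_comb4 Z comb4_minimal[OF Z S]])
  moreover have "cohom_class B ` {a, b, c, d} \<subseteq> cohom_class B ` comb4 a b c d"
    using comb4_mem by auto
  ultimately show "lin_span (quotient_space Z B) (cohom_class B ` {a, b, c, d}) \<subseteq> cohom_class B ` comb4 a b c d"
    unfolding lin_span_def by blast
next
  show "cohom_class B ` comb4 a b c d \<subseteq> lin_span (quotient_space Z B) (cohom_class B ` {a, b, c, d})"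
    unfolding lin_span_def
  proof (rule Inter_greatest)
    fix H assume "H \<in> {H. submodule H complex_field (quotient_space Z B) \<and> cohom_class B ` {a, b, c, d} \<subseteq> H}"
    then have H: "submodule H complex_field (quotient_space Z B)" and s: "cohom_class B ` {a, b, c, d} \<subseteq> H" by auto
    note E = Module.module.submoduleE[OF module_quotient[OF B Z] H]
    have sm: "cohom_class B (k \<cdot> u) \<in> H" if "cohom_class B u \<in> H" for k u
      using E(4)[OF _ that, of k] by (simp add: quotient_smult[OF B] complex_field_def)
    have ad: "cohom_class B (u + v) \<in> H" if "cohom_class B u \<in> H" "cohom_class B v \<in> H" for u v
      using E(5)[OF that] by (simp add: quotient_add[OF B])
    show "cohom_class B ` comb4 a b c d \<subseteq> H"
      using s unfolding comb4_def by (auto intro!: ad sm)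
  qed
qed

lemma form_space_quotient: "submodule H complex_field form_space \<longleftrightarrow> fsub H"
proof -
  have "Module.module complex_field form_space"
    by (rule moduleI; (rule cring_complex_field | rule abelian_groupI)?)
      (auto simp: form_space_def complex_field_def fscale_simps add.assoc add.commute intro: exI[of _ "- _"] left_minus)
  then interpret f: Module.module complex_field form_space .
  show ?thesis
  proof
    assume H: "submodule H complex_field form_space"
    note E = f.submoduleE[OF H]
    have sm: "c \<cdot> u \<in> H" if "u \<in> H" for c u using E(4)[OF _ that, of c] by (simp add: form_space_def complex_field_def)
    have ad: "u + v \<in> H" if "u \<in> H" "v \<in> H" for u v using E(5)[OF that] by (simp add: form_space_def)
    obtain u where "u \<in> H" using E(2) by auto
    from sm[OF this, of 0] have "0 \<in> H" by (simp add: fscale_simps)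
    then show "fsub H" using sm ad by (simp add: fsub_def)
  next
    assume H: "fsub H"
    have neg: "\<ominus>\<^bsub>form_space\<^esub> u = - u" for u
      by (rule f.minus_equality) (simp_all add: form_space_def)
    show "submodule H complex_field form_space"
      by (rule f.submoduleI) (use H fsub_neg[OF H] in \<open>auto simp: neg fsub_def\<close>, auto simp: form_space_def fsub_def)
  qed
qed

lemma lin_span_form_space: "lin_span form_space {a, b, c, d} = comb4 a b c d"
proof
  show "lin_span form_space {a, b, c, d} \<subseteq> comb4 a b c d"
    unfolding lin_span_def by (rule Inter_lower) (simp add: form_space_quotient fsub_comb4 comb4_mem)
  show "comb4 a b c d \<subseteq> lin_span form_space {a, b, c, d}"
    unfolding lin_span_def by (rule Inter_greatest) (simp add: form_space_quotient comb4_minimal)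
qed

lemma lin_span_form_single: "lin_span form_space {a} = {k \<cdot> a | k. True}"
proof -
  have "comb4 a a a a = {k \<cdot> a | k. True}"
  proof
    show "comb4 a a a a \<subseteq> {k \<cdot> a | k. True}" unfolding comb4_def by (auto simp: fscale_simps(1)[symmetric])
    show "{k \<cdot> a | k. True} \<subseteq> comb4 a a a a" using comb4I[of _ a 0 a 0 a 0 a] by (auto simp: fscale_simps)
  qed
  then show ?thesis using lin_span_form_space[of a a a a] by simp
qed

section \<open>Isomorphisms given by representatives\<close>

lemma module_direct_sum:
  assumes V: "Module.module complex_field V" and W: "Module.module complex_field W"
  shows "Module.module complex_field (V \<boxplus> W)"
proof -
  interpret V: Module.module complex_field V by (rule V)
  interpret W: Module.module complex_field W by (rule W)
  show ?thesis
  proof (rule moduleI)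
    show "cring complex_field" by (rule cring_complex_field)
    show "abelian_group (V \<boxplus> W)"
    proof (rule abelian_groupI, goal_cases)
      case (3 x y z) then show ?case by (auto simp: direct_sum_def V.a_assoc W.a_assoc)
    next
      case (4 x y) then show ?case by (auto simp: direct_sum_def V.a_comm W.a_comm)
    next
      case (6 x)
      then obtain a b where x: "x = (a, b)" "a \<in> carrier V" "b \<in> carrier W" by (auto simp: direct_sum_def)
      then show ?case by (intro bexI[of _ "(\<ominus>\<^bsub>V\<^esub> a, \<ominus>\<^bsub>W\<^esub> b)"]) (auto simp: direct_sum_def V.l_neg W.l_neg)
    qed (auto simp: direct_sum_def)
  qed (auto simp: direct_sum_def complex_field_def[symmetric] V.smult_closed W.smult_closed V.smult_l_distr W.smult_l_distr
      V.smult_r_distr W.smult_r_distr V.smult_assoc1 W.smult_assoc1 V.smult_one W.smult_one)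
qed

lemma module_conj_space:
  assumes V: "Module.module complex_field V" shows "Module.module complex_field (conj_space V)"
proof -
  interpret V: Module.module complex_field V by (rule V)
  have cf: "carrier complex_field = UNIV" "a \<oplus>\<^bsub>complex_field\<^esub> b = a + b" "a \<otimes>\<^bsub>complex_field\<^esub> b = a * b" "\<one>\<^bsub>complex_field\<^esub> = 1" for a b
    by (simp_all add: complex_field_def)
  show ?thesis
  proof (rule moduleI)
    show "cring complex_field" by (rule cring_complex_field)
    show "abelian_group (conj_space V)"
    proof (rule abelian_groupI, goal_cases)
      case (3 x y z) then show ?case by (simp add: conj_space_def V.a_assoc)
    next
      case (4 x y) then show ?case by (simp add: conj_space_def V.a_comm)
    next
      case (6 x)
      then have x: "x \<in> carrier V" by (simp add: conj_space_def)
      then show ?case by (intro bexI[of _ "\<ominus>\<^bsub>V\<^esub> x"]) (simp_all add: conj_space_def V.l_neg)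
    qed (simp_all add: conj_space_def)
  qed (use V.smult_closed V.smult_l_distr V.smult_r_distr V.smult_assoc1 V.smult_one in \<open>simp_all add: conj_space_def cf\<close>)
qed

text \<open>Both spaces are parametrised by one set S of representatives, and the isomorphism
  identifies the two parametrisations. S carries no vector space structure of its own: one
  representative need only realise both sums, or both multiples, so conjugate entries in a tuple can
  be scaled by the conjugate number.\<close>

lemma iso_from_representatives:
  assumes V: "Module.module complex_field V" and W: "Module.module complex_field W"
    and r: "bij_betw r S (carrier V)" and r': "bij_betw r' S (carrier W)"
    and add: "\<And>x y. x \<in> S \<Longrightarrow> y \<in> S \<Longrightarrow> \<exists>z\<in>S. r z = r x \<oplus>\<^bsub>V\<^esub> r y \<and> r' z = r' x \<oplus>\<^bsub>W\<^esub> r' y"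
    and smult: "\<And>c x. x \<in> S \<Longrightarrow> \<exists>z\<in>S. r z = c \<odot>\<^bsub>V\<^esub> r x \<and> r' z = c \<odot>\<^bsub>W\<^esub> r' x"
  shows "\<exists>\<Phi>. linear_iso V W \<Phi> \<and> graph_on V \<Phi> = (\<lambda>x. (r x, r' x)) ` S"
proof -
  define \<Phi> where "\<Phi> v = r' (inv_into S r v)" for v
  have \<Phi>: "\<Phi> (r x) = r' x" if "x \<in> S" for x
    using that bij_betw_imp_inj_on[OF r] by (simp add: \<Phi>_def)
  have C: "carrier V = r ` S" using bij_betw_imp_surj_on[OF r] by simp
  have "bij_betw \<Phi> (carrier V) (carrier W)"
    unfolding \<Phi>_def[abs_def] using bij_betw_trans[OF bij_betw_inv_into[OF r] r'] by (simp add: o_def)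
  moreover have "\<Phi> (x \<oplus>\<^bsub>V\<^esub> y) = \<Phi> x \<oplus>\<^bsub>W\<^esub> \<Phi> y" if xy: "x \<in> carrier V" "y \<in> carrier V" for x y
  proof -
    obtain a b where ab: "a \<in> S" "x = r a" "b \<in> S" "y = r b" using xy unfolding C by blast
    obtain z where z: "z \<in> S" "r z = r a \<oplus>\<^bsub>V\<^esub> r b" "r' z = r' a \<oplus>\<^bsub>W\<^esub> r' b" using add[OF ab(1,3)] by auto
    show ?thesis unfolding ab(2,4) z(2)[symmetric] \<Phi>[OF z(1)] \<Phi>[OF ab(1)] \<Phi>[OF ab(3)] by (rule z(3))
  qed
  moreover have "\<Phi> (c \<odot>\<^bsub>V\<^esub> x) = c \<odot>\<^bsub>W\<^esub> \<Phi> x" if xc: "x \<in> carrier V" for c x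
  proof -
    obtain a where a: "a \<in> S" "x = r a" using xc unfolding C by blast
    obtain z where z: "z \<in> S" "r z = c \<odot>\<^bsub>V\<^esub> r a" "r' z = c \<odot>\<^bsub>W\<^esub> r' a" using smult[OF a(1), of c] by auto
    show ?thesis unfolding a(2) z(2)[symmetric] \<Phi>[OF z(1)] \<Phi>[OF a(1)] by (rule z(3))
  qed
  ultimately have "linear_iso V W \<Phi>" using V W by (simp add: linear_iso_def)
  moreover have "graph_on V \<Phi> = (\<lambda>x. (r x, r' x)) ` S"
    unfolding graph_on_def C image_image by (rule image_cong) (simp_all add: \<Phi>)
  ultimately show ?thesis by blast
qed

section \<open>Components of words\<close>

lemma type6_less: "(0::6) < 1" "(0::6) < 2" "(0::6) < 3" "(0::6) < 4" "(0::6) < 5" "(1::6) < 2" "(1::6) < 3" "(1::6) < 4"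
  "(1::6) < 5" "(2::6) < 3" "(2::6) < 4" "(2::6) < 5" "(3::6) < 4" "(3::6) < 5" "(4::6) < 5"
  by (simp_all add: less_bit0_def bit0.Rep_numeral bit0.Rep_0 bit0.Rep_1)

lemma type6_not_less: "\<not> (1::6) < 0" "\<not> (2::6) < 0" "\<not> (3::6) < 0" "\<not> (4::6) < 0" "\<not> (5::6) < 0" "\<not> (2::6) < 1" "\<not> (3::6) < 1"
  "\<not> (4::6) < 1" "\<not> (5::6) < 1" "\<not> (3::6) < 2" "\<not> (4::6) < 2" "\<not> (5::6) < 2" "\<not> (4::6) < 3" "\<not> (5::6) < 3" "\<not> (5::6) < 4"
  by (simp_all add: less_bit0_def bit0.Rep_numeral bit0.Rep_0 bit0.Rep_1)

lemma type6_sort: "insert (1::6) (insert 0 S) = insert 0 (insert 1 S)" "insert (2::6) (insert 0 S) = insert 0 (insert 2 S)"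
  "insert (3::6) (insert 0 S) = insert 0 (insert 3 S)" "insert (4::6) (insert 0 S) = insert 0 (insert 4 S)"
  "insert (5::6) (insert 0 S) = insert 0 (insert 5 S)" "insert (2::6) (insert 1 S) = insert 1 (insert 2 S)"
  "insert (3::6) (insert 1 S) = insert 1 (insert 3 S)" "insert (4::6) (insert 1 S) = insert 1 (insert 4 S)"
  "insert (5::6) (insert 1 S) = insert 1 (insert 5 S)" "insert (3::6) (insert 2 S) = insert 2 (insert 3 S)"
  "insert (4::6) (insert 2 S) = insert 2 (insert 4 S)" "insert (5::6) (insert 2 S) = insert 2 (insert 5 S)"
  "insert (4::6) (insert 3 S) = insert 3 (insert 4 S)" "insert (5::6) (insert 3 S) = insert 3 (insert 5 S)"
  "insert (5::6) (insert 4 S) = insert 4 (insert 5 S)"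
  by (rule insert_commute)+

lemma axis_nth': "axis I (1::complex) $ K = (if K = I then 1 else 0)" by (simp add: axis_def)

lemma sg_empty: "sg i {} = 1" by (simp add: sg_def)

lemma gen_nth: "gen i $ K = (if K = {i} then 1 else 0)" by (simp add: gen_def axis_def)

lemmas nth_calc = wedge_gen_nth contr_nth sg_insert sg_empty gen_nth type6_less type6_not_less type6_sort type6_distinct
  insert_Diff_if set_eq_subset

lemma card3_sets:
  assumes "card (K :: 6 set) = 3"
  shows "K \<in> {{0,1,2},{0,1,3},{0,1,4},{0,1,5},{0,2,3},{0,2,4},{0,2,5},{0,3,4},{0,3,5},{0,4,5},
    {1,2,3},{1,2,4},{1,2,5},{1,3,4},{1,3,5},{1,4,5},{2,3,4},{2,3,5},{2,4,5},{3,4,5}}" (is "K \<in> ?S")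
proof -
  obtain x y z where K: "K = {x, y, z}" "x \<noteq> y" "x \<noteq> z" "y \<noteq> z" using assms by (auto simp: card_3_iff)
  have "\<forall>x y z. x \<noteq> y \<longrightarrow> x \<noteq> z \<longrightarrow> y \<noteq> z \<longrightarrow> {x, y, z} \<in> ?S"
    unfolding forall_6 by (simp only: type6_sort type6_distinct insert_iff simp_thms)
  from this[rule_format, OF K(2,3,4)] show ?thesis unfolding K(1) .
qed

text \<open>Six words of degree 2 avoid the letters 2 and 5, so six coefficients decide.\<close>

lemma weight0_degree2:
  assumes "graded {2, 5} 0 u" "graded UNIV 2 u"
    and z: "u $ {0,1} = 0" "u $ {0,3} = 0" "u $ {0,4} = 0" "u $ {1,3} = 0" "u $ {1,4} = 0" "u $ {3,4} = 0"
  shows "u = 0"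
proof -
  have "u $ K = 0" for K
  proof (rule ccontr)
    assume n: "u $ K \<noteq> 0"
    then have c: "card K = 2" "K \<inter> {2, 5} = {}" using assms(1,2) by (auto simp: graded_def)
    then obtain x y where K: "K = {x, y}" "x \<noteq> y" by (auto simp: card_2_iff)
    have "\<forall>x y::6. x \<noteq> y \<longrightarrow> x \<notin> {2,5} \<longrightarrow> y \<notin> {2, 5} \<longrightarrow> {x, y} \<in> {{0,1},{0,3},{0,4},{1,3},{1,4},{3,4}}"
      unfolding forall_6 by (simp only: type6_sort type6_distinct insert_iff empty_iff simp_thms)
    from this[rule_format, OF K(2)] have "x \<notin> {2, 5} \<Longrightarrow> y \<notin> {2, 5} \<Longrightarrow> {x, y} \<in> {{0,1},{0,3},{0,4},{1,3},{1,4},{3,4}}" .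
    moreover have "x \<notin> {2, 5}" "y \<notin> {2, 5}" using c(2) K(1) by auto
    ultimately have "K \<in> {{0,1},{0,3},{0,4},{1,3},{1,4},{3,4}}" unfolding K(1) .
    then show False using n z by auto
  qed
  then show ?thesis by (simp add: vec_eq_iff)
qed

lemma weight0_degree4:
  assumes "graded {2, 5} 0 u" "graded UNIV 4 u" "u $ {0,1,3,4} = 0"
  shows "u = 0"
proof -
  have "u $ K = 0" for K
  proof (rule ccontr)
    assume n: "u $ K \<noteq> 0"
    then have c: "card K = 4" "K \<inter> {2, 5} = {}" using assms(1,2) by (auto simp: graded_def)
    have "K \<subseteq> {0,1,3,4}" using c(2) UNIV_6 by blast
    moreover have "card {0,1,3,4::6} = 4" by (simp add: type6_distinct)
    ultimately have "K = {0,1,3,4}" using c(1) by (intro card_subset_eq) auto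
    then show False using n assms(3) by simp
  qed
  then show ?thesis by (simp add: vec_eq_iff)
qed

lemma graded_word2: "i \<notin> T \<Longrightarrow> j \<notin> T \<Longrightarrow> graded T 0 (wedge (gen i) (gen j))" "graded UNIV 2 (wedge (gen i) (gen j))"
proof -
  have "graded T (0 + 0) (wedge (gen i) (gen j))" if "i \<notin> T" "j \<notin> T"
    by (rule graded_wedge) (use that in \<open>simp_all add: graded_gen\<close>)
  then show "i \<notin> T \<Longrightarrow> j \<notin> T \<Longrightarrow> graded T 0 (wedge (gen i) (gen j))" by simp
  have "graded UNIV (1 + 1) (wedge (gen i) (gen j))" by (rule graded_wedge) (simp_all add: graded_gen)
  then show "graded UNIV 2 (wedge (gen i) (gen j))" by (simp add: numeral_2_eq_2)
qed

lemma norm_smult: "norm (c *s v) = norm c * norm v" for c and v :: ext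
  by (simp add: norm_vec_def L2_set_def norm_mult power_mult_distrib sum_distrib_left[symmetric] real_sqrt_mult)

lemma word2_axis: "i < j \<Longrightarrow> wedge (gen i) (gen j) = axis {i, j} 1"
  unfolding gen_def[of j] wedge_gen_axis by (auto simp: sg_insert sg_empty)

lemma word3_axis: "i < j \<Longrightarrow> j < k \<Longrightarrow> wedge (gen i) (wedge (gen j) (gen k)) = axis {i, j, k} 1"
  unfolding word2_axis wedge_gen_axis by (auto simp: sg_insert sg_empty)

section \<open>The coefficients of d gamma_t and the ten closed representatives\<close>

context tframe begin

definition s12 :: complex where "s12 = c2 $ {0,1}"
definition sb11 :: complex where "sb11 = c2 $ {0,3}"
definition sb12 :: complex where "sb12 = c2 $ {0,4}"
definition sb21 :: complex where "sb21 = c2 $ {1,3}"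
definition sb22 :: complex where "sb22 = c2 $ {1,4}"

text \<open>Integrability of the complex structure: d gamma_t has no (0,2) part. Multiplying by
  alpha_t \<and> beta_t isolates this part, and the result vanishes because the coefficient of the
  conjugate of gamma in gamma_t is minus the determinant D(t).\<close>

lemma c2_34: "c2 $ {3,4} = 0"
proof -
  let ?v = "wedge c2 (wedge (gen 0) (gen 1))"
  have gv: "graded {2,5} 0 ?v" "graded UNIV 4 ?v"
    using graded_wedge[OF graded_c2(1) graded_word2(1)[of 0 "{2,5}" 1]] graded_wedge[OF graded_c2(2) graded_word2(2)[of 0 1]]
    by (simp_all add: type6_distinct)
  have e: "B ?v = wedge (dlt (th t 2)) (wedge (th t 0) (th t 1))"
    by (simp add: B_wedge B_gen c2_def B_Bi)
  have "B ?v = 0"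
  proof (rule weight0_degree4[OF graded_B(1)[OF gv(1)] graded_B(2)[OF gv(2)]])
    show "B ?v $ {0,1,3,4} = 0"
      unfolding e dlt_th(5) unfolding th_def D_param_def
      by (simp add: type6_distinct wedge_add_left wedge_add_right wedge_diff_left wedge_diff_right wedge_scale_left wedge_scale_right wedge_assoc)
         (simp add: nth_calc algebra_simps)
  qed
  then have v0: "?v = 0" by (rule B_zero_iff)
  have "?v = wedge (gen 0) (wedge (gen 1) c2)"
    using even_commute[OF graded_c2(2), of 0 "gen 1"] even_commute[OF graded_c2(2), of 1 one_ext] by (simp add: wedge_one_right)
  then have "wedge (gen 0) (wedge (gen 1) c2) $ {0,1,3,4} = 0" using v0 by simp
  then show ?thesis by (simp add: nth_calc)
qed

lemma c2_expand: "c2 = s12 *s wedge (gen 0) (gen 1) + sb11 *s wedge (gen 0) (gen 3) + sb12 *s wedge (gen 0) (gen 4)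
    + sb21 *s wedge (gen 1) (gen 3) + sb22 *s wedge (gen 1) (gen 4)" (is "_ = ?r")
proof -
  have "c2 - ?r = 0"
  proof (rule weight0_degree2)
    show "graded {2, 5} 0 (c2 - ?r)"
      by (intro graded_diff graded_c2 graded_add graded_scale graded_word2) (simp_all add: type6_distinct)
    show "graded UNIV 2 (c2 - ?r)" by (intro graded_diff graded_c2 graded_add graded_scale graded_word2)
  qed (simp_all add: nth_calc s12_def sb11_def sb12_def sb21_def sb22_def c2_34)
  then show ?thesis by simp
qed

lemma c5_expand: "c5 = cnj s12 *s wedge (gen 3) (gen 4) + cnj sb11 *s wedge (gen 3) (gen 0) + cnj sb12 *s wedge (gen 3) (gen 1)
    + cnj sb21 *s wedge (gen 4) (gen 0) + cnj sb22 *s wedge (gen 4) (gen 1)"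
  unfolding c5_cnj by (subst c2_expand) (simp add: cnj_ext_add cnj_ext_scale cnj_ext_wedge cnj_ext_gen type6_add3)

lemma dT_expand: "dT u = s12 *s wedge (gen 0) (wedge (gen 1) (contr 2 u)) + sb11 *s wedge (gen 0) (wedge (gen 3) (contr 2 u))
    + sb12 *s wedge (gen 0) (wedge (gen 4) (contr 2 u)) + sb21 *s wedge (gen 1) (wedge (gen 3) (contr 2 u))
    + sb22 *s wedge (gen 1) (wedge (gen 4) (contr 2 u))
    + (cnj s12 *s wedge (gen 3) (wedge (gen 4) (contr 5 u)) + cnj sb11 *s wedge (gen 3) (wedge (gen 0) (contr 5 u))
    + cnj sb12 *s wedge (gen 3) (wedge (gen 1) (contr 5 u)) + cnj sb21 *s wedge (gen 4) (wedge (gen 0) (contr 5 u))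
    + cnj sb22 *s wedge (gen 4) (wedge (gen 1) (contr 5 u)))"
  unfolding dT_def by (subst c2_expand, subst c5_expand) (simp add: wedge_add_left wedge_scale_left wedge_assoc)

text \<open>In the old frame d gamma_t is - alpha \<and> beta up to D(t) and has norm at most
  101/100. Passing to the frame of X_t moves a coefficient by at most 202/10000, and D(t) accounts
  for another 1/100.\<close>

lemma c2_near: "norm (c2 $ I + (if I = {0,1} then 1 else 0)) \<le> 1/25"
proof -
  let ?y = "dlt (th t 2)"
  have y: "?y = D_param t *s axis {3,4} 1 - axis {0,1} 1" by (simp add: dlt_th word2_axis type6_less)
  have "norm ?y \<le> norm (D_param t *s (axis {3,4} 1 :: ext)) + norm (axis {0,1} 1 :: ext)" unfolding y by (rule norm_triangle_ineq4)
  also have "... \<le> 1/100 + 1" using Dsmall by (simp add: norm_smult norm_axis_complex)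
  finally have ny: "norm ?y \<le> 101/100" by simp
  have "norm ((c2 - ?y) $ I) \<le> norm (c2 - ?y)" by (rule Finite_Cartesian_Product.norm_nth_le)
  also have "... \<le> 1/50 * norm ?y" unfolding c2_def by (rule Bi_near)
  finally have 1: "norm (c2 $ I - ?y $ I) \<le> 202/10000" using ny by simp
  have 2: "norm (?y $ I + (if I = {0,1} then 1 else 0)) \<le> 1/100" using Dsmall by (auto simp: y axis_def set_eq_subset type6_distinct)
  have "c2 $ I + (if I = {0,1} then 1 else 0) = (c2 $ I - ?y $ I) + (?y $ I + (if I = {0,1} then 1 else 0))" by simp
  then have "norm (c2 $ I + (if I = {0,1} then 1 else 0)) \<le> norm (c2 $ I - ?y $ I) + norm (?y $ I + (if I = {0,1} then 1 else 0))"
    by (simp only: norm_triangle_ineq)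
  then show ?thesis using 1 2 by linarith
qed

lemma sb_small: "norm sb11 \<le> 1/25" "norm sb12 \<le> 1/25" "norm sb21 \<le> 1/25" "norm sb22 \<le> 1/25"
  using c2_near[of "{0,3}"] c2_near[of "{0,4}"] c2_near[of "{1,3}"] c2_near[of "{1,4}"]
  by (simp_all add: sb11_def sb12_def sb21_def sb22_def set_eq_subset type6_distinct)

lemma s12_large: "norm s12 \<ge> 24/25"
proof -
  have "norm (s12 + 1) \<le> 1/25" using c2_near[of "{0,1}"] by (simp add: s12_def)
  then show ?thesis using norm_triangle_ineq2[of 1 "- s12"] by (simp add: add.commute)
qed

lemma s12_nonzero: "s12 \<noteq> 0" using s12_large by auto

text \<open>The leading term has modulus at least 576/625, the perturbation at most 4/625.\<close>

lemma nondegenerate: assumes "norm E \<le> 4 * (1/25 * (1/25))" shows "s12 * cnj s12 + E \<noteq> 0"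
proof
  assume "s12 * cnj s12 + E = 0"
  then have "norm (s12 * cnj s12) = norm E" by (metis add_eq_0_iff norm_minus_cancel)
  moreover have "24/25 * (24/25) \<le> norm s12 * norm s12" using s12_large by (intro mult_mono) auto
  ultimately show False using assms by (simp add: norm_mult)
qed

lemma sb_products:
  fixes a b :: complex
  assumes "norm a \<le> 1/25" "norm b \<le> 1/25" shows "norm (a * cnj b) \<le> 1/25 * (1/25)"
  using assms by (simp only: norm_mult complex_mod_cnj) (intro mult_mono; simp)

lemma sum4_le: "norm a \<le> r \<Longrightarrow> norm b \<le> r \<Longrightarrow> norm c \<le> r \<Longrightarrow> norm d \<le> r \<Longrightarrow> norm (a + b + c + d) \<le> 4 * r" for a b c d :: complex
  using norm_triangle_ineq[of "a + b + c" d] norm_triangle_ineq[of "a + b" c] norm_triangle_ineq[of a b] by linarith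

text \<open>Determinants of rank one problems: the former for independence of the conjugates of the
  Gammas and for passing to them from the star images, the latter for the way back.\<close>

lemma Q_nonzero:
  "s12 * cnj s12 + (sb21 * cnj sb21 + sb12 * cnj sb12 + (- sb11) * cnj sb22 + (- sb22) * cnj sb11) \<noteq> 0"
  "s12 * cnj s12 + (sb21 * cnj sb21 + sb12 * cnj sb12 + sb11 * cnj sb11 + sb22 * cnj sb22) \<noteq> 0"
proof -
  have n: "norm (- sb11) \<le> 1/25" "norm (- sb22) \<le> 1/25" unfolding norm_minus_cancel by (rule sb_small)+
  show "s12 * cnj s12 + (sb21 * cnj sb21 + sb12 * cnj sb12 + (- sb11) * cnj sb22 + (- sb22) * cnj sb11) \<noteq> 0"
    by (intro nondegenerate sum4_le sb_products sb_small n)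
  show "s12 * cnj s12 + (sb21 * cnj sb21 + sb12 * cnj sb12 + sb11 * cnj sb11 + sb22 * cnj sb22) \<noteq> 0"
    by (intro nondegenerate sum4_le sb_products sb_small)
qed

text \<open>These words have weight one and \<open>dT\<close> lowers the weight by one, so only the
  coefficient at gamma \<and> conj gamma enters. At {0,1,2} and {3,4,5} even this drops out, since d
  gamma_t has no (0,2) part.\<close>

lemma dT_weight1:
  "dT m $ {0,1,2} = 0" "dT m $ {3,4,5} = 0"
  "dT m $ {0,2,3} = - cnj sb11 * m $ {2,5}" "dT m $ {1,2,3} = - cnj sb12 * m $ {2,5}"
  "dT m $ {0,2,4} = - cnj sb21 * m $ {2,5}" "dT m $ {1,2,4} = - cnj sb22 * m $ {2,5}"
  "dT m $ {2,3,4} = - cnj s12 * m $ {2,5}" "dT m $ {0,1,5} = s12 * m $ {2,5}"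
  "dT m $ {0,3,5} = sb11 * m $ {2,5}" "dT m $ {0,4,5} = sb12 * m $ {2,5}"
  "dT m $ {1,3,5} = sb21 * m $ {2,5}" "dT m $ {1,4,5} = sb22 * m $ {2,5}"
  by (simp_all add: dT_expand nth_calc)

lemma graded_dT: "graded {2,5} (Suc k) u \<Longrightarrow> graded {2,5} k (dT u)" "graded UNIV (Suc k) u \<Longrightarrow> graded UNIV (k + 2) (dT u)"
proof -
  have g5: "graded UNIV 2 c5" "graded {2,5} 0 c5" unfolding c5_cnj by (rule graded_cnj graded_c2)+
  show "graded {2,5} (Suc k) u \<Longrightarrow> graded {2,5} k (dT u)"
    using graded_wedge[OF graded_c2(1) graded_contr(1)[of "{2,5}" "Suc k" u 2]] graded_wedge[OF g5(2) graded_contr(1)[of "{2,5}" "Suc k" u 5]]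
    unfolding dT_def by (intro graded_add) simp_all
  show "graded UNIV (Suc k) u \<Longrightarrow> graded UNIV (k + 2) (dT u)"
    using graded_wedge[OF graded_c2(2) graded_contr(1)[of UNIV "Suc k" u 2]] graded_wedge[OF g5(1) graded_contr(1)[of UNIV "Suc k" u 5]]
    unfolding dT_def by (intro graded_add) (simp_all add: add.commute)
qed

text \<open>The combination of Gamma1 to Gamma4 with coefficients k1 to k4, their corrections
  collected at the word alpha, beta, conj gamma. \<open>cmb'\<close> is the conjugate
  family.\<close>

definition cmb :: "complex \<Rightarrow> complex \<Rightarrow> complex \<Rightarrow> complex \<Rightarrow> ext" where
  "cmb k1 k2 k3 k4 = k1 *s axis {0,2,3} 1 + k2 *s axis {0,2,4} 1 + k3 *s axis {1,2,3} 1 + k4 *s axis {1,2,4} 1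
     + ((- k1 * sb22 + k2 * sb21 + k3 * sb12 - k4 * sb11) / cnj s12) *s axis {0,1,5} 1"

definition cmb' :: "complex \<Rightarrow> complex \<Rightarrow> complex \<Rightarrow> complex \<Rightarrow> ext" where
  "cmb' k1 k2 k3 k4 = k1 *s axis {0,3,5} 1 + k2 *s axis {1,3,5} 1 + k3 *s axis {0,4,5} 1 + k4 *s axis {1,4,5} 1
     + ((- k1 * cnj sb22 + k2 * cnj sb21 + k3 * cnj sb12 - k4 * cnj sb11) / s12) *s axis {2,3,4} 1"

lemma cnj_axis3: "cnj_ext (axis {i, j, k} 1) = wedge (gen (i + 3)) (wedge (gen (j + 3)) (gen (k + 3)))" if "i < j" "j < k"
  using that by (simp add: word3_axis[symmetric] cnj_ext_wedge cnj_ext_gen)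

lemma word3_eq: assumes "card {i, j, k} = 3" "wedge (gen i) (wedge (gen j) (gen k)) $ {i, j, k} = 1"
  shows "wedge (gen i) (wedge (gen j) (gen k)) = axis {i, j, k} 1"
proof -
  have "wedge (gen i) (wedge (gen j) (gen k)) $ K = (if K = {i, j, k} then 1 else 0)" for K
  proof (cases "K = {i, j, k}")
    case False
    have "i \<noteq> j" "i \<noteq> k" "j \<noteq> k" using assms(1) by (auto simp: card_insert_if split: if_splits)
    then have "wedge (gen i) (wedge (gen j) (gen k)) $ K = 0"
    proof -
      have "\<not> (i \<in> K \<and> j \<in> K - {i} \<and> K - {i} - {j} = {k})" using False by blast
      then show ?thesis unfolding wedge_gen_nth gen_nth by auto
    qed
    then show ?thesis using False by simp
  qed (use assms in simp)
  then show ?thesis by (simp add: vec_eq_iff axis_nth')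
qed

lemma cnj_words: "cnj_ext (axis {0,2,3} 1) = axis {0,3,5} 1" "cnj_ext (axis {0,2,4} 1) = axis {1,3,5} 1"
  "cnj_ext (axis {1,2,3} 1) = axis {0,4,5} 1" "cnj_ext (axis {1,2,4} 1) = axis {1,4,5} 1"
  "cnj_ext (axis {0,1,5} 1) = axis {2,3,4} 1" "cnj_ext (axis {0,1,2} 1) = axis {3,4,5} 1"
proof -
  have "wedge (gen 3) (wedge (gen 5) (gen 0)) = axis {0,3,5} 1" using word3_eq[of 3 5 0] by (simp add: nth_calc)
  then show "cnj_ext (axis {0,2,3} 1) = axis {0,3,5} 1" by (simp add: cnj_axis3 type6_less type6_add3)
  have "wedge (gen 3) (wedge (gen 5) (gen 1)) = axis {1,3,5} 1" using word3_eq[of 3 5 1] by (simp add: nth_calc)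
  then show "cnj_ext (axis {0,2,4} 1) = axis {1,3,5} 1" by (simp add: cnj_axis3 type6_less type6_add3)
  have "wedge (gen 4) (wedge (gen 5) (gen 0)) = axis {0,4,5} 1" using word3_eq[of 4 5 0] by (simp add: nth_calc)
  then show "cnj_ext (axis {1,2,3} 1) = axis {0,4,5} 1" by (simp add: cnj_axis3 type6_less type6_add3)
  have "wedge (gen 4) (wedge (gen 5) (gen 1)) = axis {1,4,5} 1" using word3_eq[of 4 5 1] by (simp add: nth_calc)
  then show "cnj_ext (axis {1,2,4} 1) = axis {1,4,5} 1" by (simp add: cnj_axis3 type6_less type6_add3)
  have "wedge (gen 3) (wedge (gen 4) (gen 2)) = axis {2,3,4} 1" using word3_eq[of 3 4 2] by (simp add: nth_calc)
  then show "cnj_ext (axis {0,1,5} 1) = axis {2,3,4} 1" by (simp add: cnj_axis3 type6_less type6_add3)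
  have "wedge (gen 3) (wedge (gen 4) (gen 5)) = axis {3,4,5} 1" using word3_eq[of 3 4 5] by (simp add: nth_calc)
  then show "cnj_ext (axis {0,1,2} 1) = axis {3,4,5} 1" by (simp add: cnj_axis3 type6_less type6_add3)
qed

lemma cnj_cmb: "cnj_ext (cmb k1 k2 k3 k4) = cmb' (cnj k1) (cnj k2) (cnj k3) (cnj k4)"
  by (simp add: cmb_def cmb'_def cnj_ext_add cnj_ext_scale cnj_words)

lemma graded_axis3: "card {i, j, k} = 3 \<Longrightarrow> card ({i, j, k} \<inter> {2,5}) = n \<Longrightarrow> graded {2,5} n (axis {i, j, k} 1) \<and> graded UNIV 3 (axis {i, j, k} 1)"
  by (simp add: graded_axis)

lemma graded_cmb: "graded {2,5} 1 (cmb k1 k2 k3 k4)" "graded UNIV 3 (cmb k1 k2 k3 k4)"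
  "graded {2,5} 1 (cmb' k1 k2 k3 k4)" "graded UNIV 3 (cmb' k1 k2 k3 k4)"
  "graded hol 2 (cmb k1 k2 k3 k4)" "graded antihol 1 (cmb k1 k2 k3 k4)"
  "graded hol 1 (cmb' k1 k2 k3 k4)" "graded antihol 2 (cmb' k1 k2 k3 k4)"
  unfolding cmb_def cmb'_def by (intro graded_add graded_scale; simp add: graded_axis hol_def antihol_def type6_distinct Int_insert_left)+

lemma cmb_nth: "cmb k1 k2 k3 k4 $ {0,2,3} = k1" "cmb k1 k2 k3 k4 $ {0,2,4} = k2" "cmb k1 k2 k3 k4 $ {1,2,3} = k3" "cmb k1 k2 k3 k4 $ {1,2,4} = k4"
  "cmb' k1 k2 k3 k4 $ {0,3,5} = k1" "cmb' k1 k2 k3 k4 $ {1,3,5} = k2" "cmb' k1 k2 k3 k4 $ {0,4,5} = k3" "cmb' k1 k2 k3 k4 $ {1,4,5} = k4"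
  "cmb' k1 k2 k3 k4 $ {2,3,4} = (- k1 * cnj sb22 + k2 * cnj sb21 + k3 * cnj sb12 - k4 * cnj sb11) / s12"
  "cmb k1 k2 k3 k4 $ {0,1,5} = (- k1 * sb22 + k2 * sb21 + k3 * sb12 - k4 * sb11) / cnj s12" "cmb' k1 k2 k3 k4 $ {0,1,5} = 0"
  "cmb' k1 k2 k3 k4 $ {0,2,3} = 0" "cmb' k1 k2 k3 k4 $ {0,2,4} = 0" "cmb' k1 k2 k3 k4 $ {1,2,3} = 0" "cmb' k1 k2 k3 k4 $ {1,2,4} = 0"
  "cmb k1 k2 k3 k4 $ {0,3,5} = 0" "cmb k1 k2 k3 k4 $ {1,3,5} = 0" "cmb k1 k2 k3 k4 $ {0,4,5} = 0" "cmb k1 k2 k3 k4 $ {1,4,5} = 0" "cmb k1 k2 k3 k4 $ {2,3,4} = 0"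
  "cmb k1 k2 k3 k4 $ {0,1,2} = 0" "cmb' k1 k2 k3 k4 $ {0,1,2} = 0" "cmb k1 k2 k3 k4 $ {3,4,5} = 0" "cmb' k1 k2 k3 k4 $ {3,4,5} = 0"
  unfolding cmb_def cmb'_def by (simp_all add: axis_nth' set_eq_subset type6_distinct)

lemma dT_0134: "dT u $ {0,1,3,4} = s12 * u $ {2,3,4} + sb11 * u $ {1,2,4} - sb12 * u $ {1,2,3} - sb21 * u $ {0,2,4} + sb22 * u $ {0,2,3}
    + cnj s12 * u $ {0,1,5} + cnj sb11 * u $ {1,4,5} - cnj sb12 * u $ {0,4,5} - cnj sb21 * u $ {1,3,5} + cnj sb22 * u $ {0,3,5}"
  by (simp add: dT_expand nth_calc)

text \<open>In weight zero and degree 4 there is only one word, so closedness of a weight one 3-form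
  is a single scalar equation.\<close>

lemma dT_closed: assumes "graded {2,5} 1 u" "graded UNIV 3 u" "dT u $ {0,1,3,4} = 0" shows "dT u = 0"
proof (rule weight0_degree4[OF _ _ assms(3)])
  show "graded {2,5} 0 (dT u)" by (rule graded_dT(1)) (use assms(1) in simp)
  have "graded UNIV (2 + 2) (dT u)" by (rule graded_dT(2)) (use assms(2) in \<open>simp add: numeral_3_eq_3 numeral_2_eq_2\<close>)
  then show "graded UNIV 4 (dT u)" by simp
qed

text \<open>The correction term in the definition of each Gamma is the solution of that scalar
  equation; this is why the representatives are d-closed and not merely closed for the Dolbeault
  operator.\<close>

lemma dT_cmb: "dT (cmb k1 k2 k3 k4) = 0" "dT (cmb' k1 k2 k3 k4) = 0"
proof -
  show "dT (cmb k1 k2 k3 k4) = 0"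
    by (rule dT_closed[OF graded_cmb(1,2)]) (simp add: dT_0134 cmb_nth s12_nonzero; (simp add: algebra_simps)?)
  show "dT (cmb' k1 k2 k3 k4) = 0"
    by (rule dT_closed[OF graded_cmb(3,4)]) (simp add: dT_0134 cmb_nth s12_nonzero; (simp add: algebra_simps)?)
qed

lemma dT_012: "dT (axis {0,1,2} 1) = 0" "dT (axis {3,4,5} 1) = 0"
proof -
  show "dT (axis {0,1,2} 1) = 0"
    by (rule dT_closed) (simp_all add: graded_axis type6_distinct Int_insert_left dT_0134 axis_nth' set_eq_subset)
  show "dT (axis {3,4,5} 1) = 0"
    by (rule dT_closed) (simp_all add: graded_axis type6_distinct Int_insert_left dT_0134 axis_nth' set_eq_subset)
qed

text \<open>The five equations compare a combination of conjugate Gammas with x times the image of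
  gamma \<and> conj gamma. Eliminating the four coefficients leaves a nonzero determinant times
  x.\<close>

lemma key_zero:
  assumes "k1 = sb11 * x" "k2 = sb21 * x" "k3 = sb12 * x" "k4 = sb22 * x"
    "(- k1 * cnj sb22 + k2 * cnj sb21 + k3 * cnj sb12 - k4 * cnj sb11) / s12 = - cnj s12 * x"
  shows "x = 0"
proof -
  have "- k1 * cnj sb22 + k2 * cnj sb21 + k3 * cnj sb12 - k4 * cnj sb11 = - cnj s12 * x * s12"
    using assms(5) s12_nonzero by (simp add: divide_eq_eq)
  then have "(s12 * cnj s12 + (sb21 * cnj sb21 + sb12 * cnj sb12 + (- sb11) * cnj sb22 + (- sb22) * cnj sb11)) * x = 0"
    unfolding assms(1-4) by (simp add: algebra_simps)
  then show ?thesis using Q_nonzero(1) by simp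
qed

text \<open>All ten words have weight one, so they see m only through its coefficient at {2, 5}; the
  conjugate Gammas force this coefficient to vanish, and then every other coefficient vanishes
  too.\<close>

lemma exact_zero:
  assumes e: "a *s axis {0,1,2} 1 + cmb k1 k2 k3 k4 + cmb' l1 l2 l3 l4 + b *s axis {3,4,5} 1 = dT m"
  shows "a = 0" "b = 0" "k1 = 0" "k2 = 0" "k3 = 0" "k4 = 0" "l1 = 0" "l2 = 0" "l3 = 0" "l4 = 0"
proof -
  have c: "(a *s axis {0,1,2} 1 + cmb k1 k2 k3 k4 + cmb' l1 l2 l3 l4 + b *s axis {3,4,5} 1) $ K = dT m $ K" for K
    using e by simp
  note s = cmb_nth dT_weight1 axis_nth' set_eq_subset type6_distinct
  have l: "l1 = sb11 * m ${2,5}" "l2 = sb21 * m ${2,5}" "l3 = sb12 * m ${2,5}" "l4 = sb22 * m ${2,5}"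
    "(- l1 * cnj sb22 + l2 * cnj sb21 + l3 * cnj sb12 - l4 * cnj sb11) / s12 = - cnj s12 * m ${2,5}"
    using c[of "{0,3,5}"] c[of "{1,3,5}"] c[of "{0,4,5}"] c[of "{1,4,5}"] c[of "{2,3,4}"] by (simp_all add: s)
  have x: "m ${2,5} = 0" by (rule key_zero[OF l])
  show "l1 = 0" "l2 = 0" "l3 = 0" "l4 = 0" using l x by simp_all
  show "a = 0" "b = 0" "k1 = 0" "k2 = 0" "k3 = 0" "k4 = 0"
    using c[of "{0,1,2}"] c[of "{3,4,5}"] c[of "{0,2,3}"] c[of "{0,2,4}"] c[of "{1,2,3}"] c[of "{1,2,4}"] x
    by (simp_all add: s)
qed

end

section \<open>Means and closed forms\<close>

definition mn :: "form \<Rightarrow> ext" where "mn w = (\<chi> I. mean (\<lambda>x. w x $ I))"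

text \<open>The mean is regarded as an operator with constant functions as values, so that
  \<open>lift_op_clinear\<close> applies.\<close>

lemma mn_clinear: assumes L: "clinear_map L" and w: "inv_form w" shows "mn (\<lambda>x. L (w x)) = L (mn w)"
proof -
  have "lift_op (\<lambda>f x. mean f) (\<lambda>x. L (w x)) = (\<lambda>x. L (lift_op (\<lambda>f x. mean f) w x))"
    by (rule lift_op_clinear(1)[where C=inv_fun, OF L])
      (use w in \<open>simp_all add: inv_form_def inv_add inv_cmult mean_add mean_cmult\<close>)
  from fun_cong[OF this, of 0] show ?thesis by (simp add: lift_op_def mn_def)
qed

lemma mn_add: "inv_form u \<Longrightarrow> inv_form v \<Longrightarrow> mn (\<lambda>x. u x + v x) = mn u + mn v"
  by (simp add: mn_def vec_eq_iff mean_add inv_form_def)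

lemma mn_xi: "inv_form w \<Longrightarrow> mn (lift_op (xi i) w) = 0"
  by (simp add: mn_def lift_op_def vec_eq_iff mean_xi inv_form_def)

lemma mean_zero: "mean (\<lambda>x. 0) = 0"
  using mean_cmult[of 0 "\<lambda>x. 0"] by simp

lemma mn_zero: "mn (\<lambda>x. 0) = 0"
  by (simp add: mn_def vec_eq_iff mean_zero)

lemma mn_sum: "finite A \<Longrightarrow> (\<And>i. i \<in> A \<Longrightarrow> inv_form (u i)) \<Longrightarrow> mn (\<lambda>x. \<Sum>i\<in>A. u i x) = (\<Sum>i\<in>A. mn (u i))"
  by (induction A rule: finite_induct) (simp_all add: mn_zero mn_add inv_form_sum)

lemma graded_mn: "(\<And>x. graded T k (w x)) \<Longrightarrow> graded T k (mn w)"
  unfolding graded_def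
proof (intro allI impI, rule ccontr)
  fix I assume w: "\<And>x. \<forall>I. w x $ I \<noteq> 0 \<longrightarrow> card (I \<inter> T) = k" and n: "mn w $ I \<noteq> 0" and c: "card (I \<inter> T) \<noteq> k"
  have "w x $ I = 0" for x using w c by blast
  then have "mn w $ I = 0" by (simp add: mn_def mean_zero)
  then show False using n by simp
qed

text \<open>The properties of the operators from the solution theorem that the homotopies use:
  invariance, linearity and commutation with all left invariant fields.\<close>

definition sol_op :: "((complex ^ 3 \<Rightarrow> complex) \<Rightarrow> complex ^ 3 \<Rightarrow> complex) \<Rightarrow> bool" where
  "sol_op T \<longleftrightarrow> (\<forall>f. inv_fun f \<longrightarrow> inv_fun (T f)) \<and> (\<forall>j f. inv_fun f \<longrightarrow> T (xi j f) = xi j (T f)) \<and>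
    (\<forall>f g. inv_fun f \<longrightarrow> inv_fun g \<longrightarrow> T (\<lambda>x. f x + g x) = (\<lambda>x. T f x + T g x)) \<and>
    (\<forall>c f. inv_fun f \<longrightarrow> T (\<lambda>x. c * f x) = (\<lambda>x. c * T f x))"

lemma sol_zero: assumes "sol_op T" shows "T (\<lambda>x. 0) = (\<lambda>x. 0)"
proof -
  have "T (\<lambda>x. 0 * 0) = (\<lambda>x. 0 * T (\<lambda>x. 0) x)" using assms inv_const[of 0] unfolding sol_op_def by blast
  then show ?thesis by simp
qed

lemma sol_inv: "sol_op T \<Longrightarrow> inv_form w \<Longrightarrow> inv_form (lift_op T w)"
  by (simp add: sol_op_def inv_form_def lift_op_def)

lemma sol_clinear: "sol_op T \<Longrightarrow> clinear_map L \<Longrightarrow> inv_form w \<Longrightarrow> lift_op T (\<lambda>x. L (w x)) = (\<lambda>x. L (lift_op T w x))"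
  by (rule lift_op_clinear(1)[where C=inv_fun]) (simp_all add: inv_form_def inv_add inv_cmult sol_op_def)

lemma sol_xi: "sol_op T \<Longrightarrow> inv_form w \<Longrightarrow> lift_op T (lift_op (xi j) w) = lift_op (xi j) (lift_op T w)"
  by (rule ext) (simp add: sol_op_def inv_form_def lift_op_def vec_eq_iff)

lemma sol_add: "sol_op T \<Longrightarrow> inv_form u \<Longrightarrow> inv_form v \<Longrightarrow> lift_op T (\<lambda>x. u x + v x) = (\<lambda>x. lift_op T u x + lift_op T v x)"
  by (simp add: sol_op_def inv_form_def lift_op_def fun_eq_iff vec_eq_iff)

lemma sol_lift_zero: "sol_op T \<Longrightarrow> lift_op T (\<lambda>x. 0) = (\<lambda>x. 0)"
  by (simp add: lift_op_def sol_zero fun_eq_iff vec_eq_iff)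

lemma sol_sum:
  assumes T: "sol_op T" and "finite A" and "\<And>i. i \<in> A \<Longrightarrow> inv_form (u i)"
  shows "lift_op T (\<lambda>x. \<Sum>i\<in>A. u i x) = (\<lambda>x. \<Sum>i\<in>A. lift_op T (u i) x)"
  using assms(2,3) by (induction A rule: finite_induct) (simp_all add: sol_lift_zero[OF T] sol_add[OF T] inv_form_sum)

lemma graded_sol: assumes "sol_op T" "\<And>x. graded S k (w x)" shows "graded S k (lift_op T w x)"
  unfolding graded_def
proof (intro allI impI, rule ccontr)
  fix I assume n: "lift_op T w x $ I \<noteq> 0" and c: "card (I \<inter> S) \<noteq> k"
  have "w x $ I = 0" for x using assms(2)[of x] c by (rule gradedD)
  then have "lift_op T w x $ I = 0" by (simp add: lift_op_def sol_zero[OF assms(1)])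
  then show False using n by simp
qed

lemma xi_lift_add: "inv_form u \<Longrightarrow> inv_form v \<Longrightarrow> lift_op (xi j) (\<lambda>x. u x + v x) = (\<lambda>x. lift_op (xi j) u x + lift_op (xi j) v x)"
  by (simp add: lift_op_def fun_eq_iff vec_eq_iff xi_add inv_form_def inv_smooth)

lemma xi_lift_const: "lift_op (xi j) (\<lambda>x. c) = (\<lambda>x. 0)"
  by (simp add: lift_op_def fun_eq_iff vec_eq_iff xi_const)

lemma xi_lift_sum: "finite A \<Longrightarrow> (\<And>i. i \<in> A \<Longrightarrow> inv_form (u i)) \<Longrightarrow> lift_op (xi j) (\<lambda>x. \<Sum>i\<in>A. u i x) = (\<lambda>x. \<Sum>i\<in>A. lift_op (xi j) (u i) x)"
  by (induction A rule: finite_induct) (simp_all add: xi_lift_const xi_lift_add inv_form_sum)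

lemma clinear_scalar: "clinear_map (\<lambda>u. k *s u)" using clinear_smult[OF clinear_id] .

lemma Dl_comb: assumes a: "inv_form a" and b: "inv_form b" shows "Dl (\<lambda>x. a x + k *s b x) = (\<lambda>x. Dl a x + k *s Dl b x)"
proof
  fix x
  have "lift_op (xi j) (\<lambda>x. a x + k *s b x) x = lift_op (xi j) a x + k *s lift_op (xi j) b x" for j
    by (simp add: xi_lift_add[OF a inv_form_scale[OF b]] xi_lift_clinear[OF clinear_scalar b])
  then show "Dl (\<lambda>x. a x + k *s b x) x = Dl a x + k *s Dl b x"
    by (simp add: Dl_def wedge_add_right wedge_scale_right clinear_add[OF clinear_dlt] clinear_scale[OF clinear_dlt]
        sum.distrib vec.scale_sum_right vec.scale_right_distrib)
qed

lemma Dl_const: "Dl (\<lambda>x. c) = (\<lambda>x. dlt c)"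
  by (rule ext) (simp add: Dl_def xi_lift_const wedge_zero_right)

lemma Dl_zero: "Dl (\<lambda>x. 0) = (\<lambda>x. 0)"
  by (simp add: Dl_const clinear_zero[OF clinear_dlt])

lemma mn_Dl: assumes w: "inv_form w" shows "mn (Dl w) = dlt (mn w)"
proof -
  have x: "inv_form (lift_op (xi i) w)" for i by (rule inv_form_xi[OF w])
  have "mn (Dl w) = mn (\<lambda>x. \<Sum>i\<in>UNIV. wedge (gen i) (lift_op (xi i) w x)) + mn (\<lambda>x. dlt (w x))"
    unfolding Dl_def[abs_def] by (intro mn_add inv_form_sum inv_form_clinear[OF clinear_wedge_right] x inv_form_clinear[OF clinear_dlt] w)
  also have "mn (\<lambda>x. \<Sum>i\<in>UNIV. wedge (gen i) (lift_op (xi i) w x)) = (\<Sum>i\<in>UNIV. wedge (gen i) (mn (lift_op (xi i) w)))"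
    by (simp add: mn_sum inv_form_clinear[OF clinear_wedge_right] x mn_clinear[OF clinear_wedge_right])
  also have "... = 0" by (simp add: mn_xi[OF w] wedge_zero_right)
  finally show ?thesis by (simp add: mn_clinear[OF clinear_dlt w])
qed

lemma solution_id:
  obtains R :: "6 \<Rightarrow> (complex ^ 3 \<Rightarrow> complex) \<Rightarrow> complex ^ 3 \<Rightarrow> complex" where
    "\<And>i. sol_op (R i)" "\<And>f x. inv_fun f \<Longrightarrow> f x = mean f + (\<Sum>i\<in>{3, 4, 5}. xi i (R i f) x)"
proof -
  have N1: "\<And>i j :: 6. i \<in> {3, 4} \<Longrightarrow> j \<in> {0, 1, 3, 4} \<Longrightarrow> norm ((if i = j then 1 else 0) - (if i = j then 1 else 0) :: complex) \<le> 1/8" by simp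
  have N2: "\<And>j::6. j \<in> {0, 1, 3, 4} \<Longrightarrow> (if 5 = j then 1 else 0) = (0::complex)" by (auto simp: type6_distinct)
  have N3: "norm (if (5::6) = 2 then 1 else 0 :: complex) < norm (if (5::6) = 5 then 1 else 0 :: complex)" by (simp add: type6_distinct)
  obtain R :: "6 \<Rightarrow> (complex ^ 3 \<Rightarrow> complex) \<Rightarrow> complex ^ 3 \<Rightarrow> complex" where R: "\<And>i f. inv_fun f \<Longrightarrow> inv_fun (R i f)"
    "\<And>i j f. inv_fun f \<Longrightarrow> R i (xi j f) = xi j (R i f)"
    "\<And>i f g. inv_fun f \<Longrightarrow> inv_fun g \<Longrightarrow> R i (\<lambda>x. f x + g x) = (\<lambda>x. R i f x + R i g x)"
    "\<And>i c f. inv_fun f \<Longrightarrow> R i (\<lambda>x. c * f x) = (\<lambda>x. c * R i f x)"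
    "\<And>f x. inv_fun f \<Longrightarrow> f x = mean f + (\<Sum>i\<in>{3, 4, 5}. \<Sum>j\<in>UNIV. (if i = j then 1 else 0) * xi j (R i f) x)"
    by (rule left_invariant_solution[where N="\<lambda>j i. if i = j then 1 else 0", OF N1 N2 N3], assumption, assumption, assumption, rule that; assumption)
  have inner: "(\<Sum>j\<in>UNIV. (if i = j then 1 else 0) * g j) = g i" for i :: 6 and g :: "6 \<Rightarrow> complex"
    by (subst sum.mono_neutral_right[of UNIV "{i}"]) auto
  show thesis
  proof (rule that[of R])
    show "sol_op (R i)" for i using R(1-4) by (simp add: sol_op_def)
    show "f x = mean f + (\<Sum>i\<in>{3, 4, 5}. xi i (R i f) x)" if "inv_fun f" for f x
      using R(5)[OF that, of x] by (simp only: inner)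
  qed
qed

text \<open>R commutes with the fields, so every field kills the image of a constant under R; the
  solution identity then reads c = mean c.\<close>

lemma mean_const: "mean (\<lambda>x. c) = c"
proof -
  obtain R :: "6 \<Rightarrow> (complex ^ 3 \<Rightarrow> complex) \<Rightarrow> complex ^ 3 \<Rightarrow> complex" where
    R: "\<And>i. sol_op (R i)" "\<And>f x. inv_fun f \<Longrightarrow> f x = mean f + (\<Sum>i\<in>{3, 4, 5}. xi i (R i f) x)"
    by (rule solution_id, rule that; assumption)
  have "xi i (R i (\<lambda>x. c)) = R i (xi i (\<lambda>x. c))" for i
    using R(1)[of i] inv_const[of c] unfolding sol_op_def by metis
  then have "xi i (R i (\<lambda>x. c)) = (\<lambda>x. 0)" for i by (simp add: xi_const sol_zero[OF R(1)])
  then show ?thesis using R(2)[OF inv_const[of c], of 0] by simp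
qed

lemma mn_const: "mn (\<lambda>x. c) = c"
  by (simp add: mn_def mean_const)

text \<open>Cartan's formula on constant forms: the anticommutator is the Lie derivative along the
  field dual to the given letter, nilpotent for the letters 3 and 4 and zero for the central letter
  5.\<close>

lemma dlt_contr: "dlt (contr 3 v) + contr 3 (dlt v) = - wedge (gen 4) (contr 5 v)"
  "dlt (contr 4 v) + contr 4 (dlt v) = wedge (gen 3) (contr 5 v)"
  "dlt (contr 5 v) + contr 5 (dlt v) = 0"
  unfolding dlt_def clinear_diff[OF clinear_contr] clinear_neg[OF clinear_contr] contr_wedge
    contr_contr[of 2 3] contr_contr[of 5 3] contr_contr[of 2 4] contr_contr[of 5 4] contr_contr[of 2 5] contr_square
  by (simp_all add: type6_distinct contr_wedge wedge_diff_right wedge_neg_right wedge_zero_right contr_square)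

text \<open>Contracting with the fields 3, 4, 5 after applying R gives a homotopy from the identity
  to the mean, up to the Lie derivative term N. For closed u the form N u is closed again and N
  annihilates it, so a second use of the homotopy finishes.\<close>

theorem closed_form_decomposition:
  assumes u: "inv_form u" "Dl u = (\<lambda>x. 0)" "\<And>x. graded UNIV 3 (u x)"
  obtains c y where "graded UNIV 3 c" "inv_form y" "\<And>x. graded UNIV 2 (y x)" "u = (\<lambda>x. c + Dl y x)"
proof -
  obtain R :: "6 \<Rightarrow> (complex ^ 3 \<Rightarrow> complex) \<Rightarrow> complex ^ 3 \<Rightarrow> complex" where
    R: "\<And>i. sol_op (R i)" "\<And>f x. inv_fun f \<Longrightarrow> f x = mean f + (\<Sum>i\<in>{3, 4, 5}. xi i (R i f) x)"
    by (rule solution_id, rule that; assumption)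
  let ?J = "{3, 4, 5} :: 6 set"
  define H where "H w x = (\<Sum>i\<in>?J. contr i (lift_op (R i) w x))" for w x
  \<comment> \<open>The sum of the Lie derivative terms of \<open>dlt_contr\<close>, each applied
    after the matching R.\<close>
  define N where "N w x = wedge (gen 3) (contr 5 (lift_op (R 4) w x)) - wedge (gen 4) (contr 5 (lift_op (R 3) w x))" for w x
  have clc: "clinear_map (contr i)" for i by (rule clinear_contr)
  have hi: "inv_form (H w)" if w: "inv_form w" for w
    unfolding H_def[abs_def] by (intro inv_form_sum inv_form_clinear[OF clc] sol_inv[OF R(1)] w)
  have main: "Dl (H w) x + H (Dl w) x = w x - mn w + N w x" if w: "inv_form w" for w x
  proof -
    define a where "a i = lift_op (R i) w x" for i
    define q where "q i j = lift_op (xi j) (lift_op (R i) w) x" for i j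
    have ri: "inv_form (lift_op (R i) w)" for i by (rule sol_inv[OF R(1) w])
    have xw: "inv_form (lift_op (xi j) w)" for j by (rule inv_form_xi[OF w])
    have "lift_op (xi j) (H w) x = (\<Sum>i\<in>?J. contr i (q i j))" for j
    proof -
      have "lift_op (xi j) (H w) = (\<lambda>x. \<Sum>i\<in>?J. lift_op (xi j) (\<lambda>x. contr i (lift_op (R i) w x)) x)"
        unfolding H_def[abs_def] by (rule xi_lift_sum) (simp_all add: inv_form_clinear[OF clc ri])
      then show ?thesis by (simp only: xi_lift_clinear[OF clc ri] q_def)
    qed
    then have d1: "Dl (H w) x = (\<Sum>j\<in>UNIV. wedge (gen j) (\<Sum>i\<in>?J. contr i (q i j))) + dlt (\<Sum>i\<in>?J. contr i (a i))"
      by (simp only: Dl_def H_def a_def)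
    have "lift_op (R i) (Dl w) x = (\<Sum>j\<in>UNIV. wedge (gen j) (q i j)) + dlt (a i)" for i
    proof -
      have "lift_op (R i) (Dl w) = (\<lambda>x. lift_op (R i) (\<lambda>x. \<Sum>j\<in>UNIV. wedge (gen j) (lift_op (xi j) w x)) x + lift_op (R i) (\<lambda>x. dlt (w x)) x)"
        unfolding Dl_def[abs_def]
        by (rule sol_add[OF R(1)]) (intro inv_form_sum inv_form_clinear[OF clinear_wedge_right] inv_form_clinear[OF clinear_dlt] xw w)+
      moreover have "lift_op (R i) (\<lambda>x. \<Sum>j\<in>UNIV. wedge (gen j) (lift_op (xi j) w x)) = (\<lambda>x. \<Sum>j\<in>UNIV. lift_op (R i) (\<lambda>x. wedge (gen j) (lift_op (xi j) w x)) x)"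
        by (rule sol_sum[OF R(1)]) (simp_all add: inv_form_clinear[OF clinear_wedge_right xw])
      ultimately show ?thesis
        by (simp only: sol_clinear[OF R(1) clinear_wedge_right xw] sol_clinear[OF R(1) clinear_dlt w] sol_xi[OF R(1) w] q_def a_def)
    qed
    then have d2: "H (Dl w) x = (\<Sum>i\<in>?J. contr i ((\<Sum>j\<in>UNIV. wedge (gen j) (q i j)) + dlt (a i)))"
      by (simp only: H_def)
    have e1: "(\<Sum>j\<in>UNIV. wedge (gen j) (\<Sum>i\<in>?J. contr i (q i j))) = (\<Sum>i\<in>?J. \<Sum>j\<in>UNIV. wedge (gen j) (contr i (q i j)))"
      unfolding wedge_sum_right by (rule sum.swap)
    \<comment> \<open>The subtracted double sum cancels the derivative terms of
      \<open>Dl (H w)\<close>; this uses that R commutes with the fields. Only the diagonal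
      survives, and the solution identity evaluates it.\<close>
    have e2: "contr i (\<Sum>j\<in>UNIV. wedge (gen j) (q i j)) = q i i - (\<Sum>j\<in>UNIV. wedge (gen j) (contr i (q i j)))" for i
    proof -
      have "(\<Sum>j\<in>UNIV. if i = j then q i j else 0) = q i i" by (simp add: sum.delta')
      then show ?thesis by (simp only: clinear_sum[OF clc] contr_wedge sum_subtractf)
    qed
    have e3: "(\<Sum>i\<in>?J. q i i) = w x - mn w"
    proof -
      have "(\<Sum>i\<in>?J. q i i) $ I = (w x - mn w) $ I" for I
      proof -
        have "inv_fun (\<lambda>x. w x $ I)" using w by (simp add: inv_form_def)
        from R(2)[OF this, of x] have "w x $ I - mean (\<lambda>x. w x $ I) = (\<Sum>i\<in>?J. xi i (R i (\<lambda>x. w x $ I)) x)" by simp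
        then show ?thesis by (simp add: q_def lift_op_def mn_def)
      qed
      then show ?thesis by (simp only: vec_eq_iff) simp
    qed
    have "Dl (H w) x + H (Dl w) x = (\<Sum>i\<in>?J. q i i) + (\<Sum>i\<in>?J. dlt (contr i (a i)) + contr i (dlt (a i)))"
      unfolding d1 d2 e1 clinear_add[OF clc] e2 clinear_sum[OF clinear_dlt] by (simp only: sum.distrib sum_subtractf) (simp only: algebra_simps)
    also have "(\<Sum>i\<in>?J. dlt (contr i (a i)) + contr i (dlt (a i))) = N w x"
      by (simp add: type6_distinct dlt_contr N_def a_def)
    finally show ?thesis unfolding e3 .
  qed
  have H0: "H (\<lambda>x. 0) x = 0" for x unfolding H_def by (simp add: sol_lift_zero[OF R(1)] clinear_zero[OF clc])
  have split: "w x = mn w + Dl (H w) x - N w x" if "inv_form w" "Dl w = (\<lambda>x. 0)" for w x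
    using main[OF that(1), of x] H0[of x] that(2) by (simp add: algebra_simps)
  have ni: "inv_form (N u)"
  proof -
    have "inv_form (\<lambda>x. wedge (gen i) (contr 5 (lift_op (R j) u x)))" for i j
      by (intro inv_form_clinear[OF clinear_wedge_right] inv_form_clinear[OF clc] sol_inv[OF R(1)] u(1))
    from inv_form_add[OF this inv_form_scale[OF this], of 3 4 "-1" 4 3] show ?thesis
      by (simp add: N_def[abs_def] vector_smult_lneg)
  qed
  \<comment> \<open>N produces no letter 5 but consumes one, hence N squared is zero.\<close>
  have N5: "contr 5 (N u x) = 0" for x
    by (simp add: N_def clinear_diff[OF clc] contr_wedge contr_square wedge_zero_right type6_distinct)
  have NN: "N (N u) x = 0" for x
  proof -
    have "contr 5 (lift_op (R j) (N u) x) = 0" for j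
      using fun_cong[OF sol_clinear[OF R(1) clc ni, of j 5], of x] by (simp add: N5 sol_lift_zero[OF R(1)])
    then show ?thesis by (simp add: N_def wedge_zero_right)
  qed
  have dm: "dlt (mn u) = 0" using mn_Dl[OF u(1)] by (simp add: u(2) mn_zero)
  have Dn: "Dl (N u) = (\<lambda>x. 0)"
  proof -
    have "N u = (\<lambda>x. (mn u + 1 *s Dl (H u) x) + (-1) *s u x)" using split[OF u(1,2)] by (simp add: fun_eq_iff vector_smult_lneg)
    moreover have "Dl (\<lambda>x. (mn u + 1 *s Dl (H u) x) + (-1) *s u x) = (\<lambda>x. 0)"
    proof -
      have i: "inv_form (Dl (H u))" by (rule inv_form_Dl[OF hi[OF u(1)]])
      show ?thesis
        by (simp only: Dl_comb[OF inv_form_add[OF inv_form_const inv_form_scale[OF i]] u(1)] Dl_comb[OF inv_form_const i] u(2) Dl_const dm Dl_Dl[OF hi[OF u(1)]]) simp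
    qed
    ultimately show ?thesis by simp
  qed
  have gN: "graded UNIV 3 (N u x)" for x
  proof -
    have "graded UNIV (1 + (3 - 1)) (wedge (gen i) (contr 5 (lift_op (R j) u x)))" for i j
      by (intro graded_wedge graded_contr(1) graded_sol[OF R(1)] u(3)) (simp_all add: graded_gen)
    then show ?thesis unfolding N_def by (intro graded_diff) (simp_all add: numeral_3_eq_3)
  qed
  have gH: "graded UNIV 2 (H w x)" if "\<And>x. graded UNIV 3 (w x)" for w x
  proof -
    have "graded UNIV (3 - 1) (contr i (lift_op (R i) w x))" for i
      by (intro graded_contr(1) graded_sol[OF R(1)] that) simp
    then show ?thesis unfolding H_def by (intro graded_sum) simp
  qed
  \<comment> \<open>Substituting the decomposition of \<open>N u\<close> into that of u; both
    homotopy terms together give the primitive.\<close>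
  show thesis
  proof (rule that[of "mn u - mn (N u)" "\<lambda>x. H u x + (-1) *s H (N u) x"])
    show "graded UNIV 3 (mn u - mn (N u))" by (intro graded_diff graded_mn u(3) gN)
    show "inv_form (\<lambda>x. H u x + (-1) *s H (N u) x)" by (intro inv_form_add inv_form_scale hi u(1) ni)
    show "graded UNIV 2 (H u x + (-1) *s H (N u) x)" for x by (intro graded_add graded_scale gH u(3) gN)
    have "u x = mn u - mn (N u) + (Dl (H u) x - Dl (H (N u)) x)" for x
      using split[OF u(1,2), of x] split[OF ni Dn, of x] NN[of x] by (simp add: algebra_simps)
    then show "u = (\<lambda>x. mn u - mn (N u) + Dl (\<lambda>x. H u x + (-1) *s H (N u) x) x)"
      by (simp only: Dl_comb[OF hi[OF u(1)] hi[OF ni]]) (simp add: fun_eq_iff vector_smult_lneg)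
  qed
qed

section \<open>Closed constant 3-forms\<close>

lemma card3_induct:
  assumes "card (K :: 6 set) = 3" and "P {0,1,2}" "P {0,1,3}" "P {0,1,4}" "P {0,1,5}" "P {0,2,3}" "P {0,2,4}" "P {0,2,5}" "P {0,3,4}" "P {0,3,5}" "P {0,4,5}" "P {1,2,3}" "P {1,2,4}" "P {1,2,5}" "P {1,3,4}" "P {1,3,5}" "P {1,4,5}" "P {2,3,4}" "P {2,3,5}" "P {2,4,5}" "P {3,4,5}"
  shows "P K"
  using card3_sets[OF assms(1)] assms(2-) by (elim insertE emptyE) (simp_all only:)

lemma graded_dlt: "graded UNIV (Suc k) u \<Longrightarrow> graded UNIV (k + 2) (dlt u)"
proof -
  assume u: "graded UNIV (Suc k) u"
  have "graded UNIV (1 + (1 + (Suc k - 1))) (wedge (gen i) (wedge (gen j) (contr l u)))" for i j l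
    by (intro graded_wedge graded_contr(1) u) (simp_all add: graded_gen)
  then show ?thesis unfolding dlt_def by (intro graded_diff graded_neg) simp_all
qed

text \<open>Leading words of the ten representatives. On closed constant 3-forms these coefficients
  determine the class modulo images of \<open>dlt\<close>.\<close>

definition P10 :: "6 set set" where
  "P10 = {{0,1,2},{0,2,3},{0,2,4},{1,2,3},{1,2,4},{0,3,5},{1,3,5},{0,4,5},{1,4,5},{3,4,5}}"

text \<open>Of the ten remaining coefficients, closedness kills four and ties a fifth to the one at
  {0,1,5}. The five left over are matched by the images of five words of degree 2, from which y is
  read off.\<close>

lemma const_exact:
  assumes z: "graded UNIV 3 z" "dlt z = 0" "\<And>K. K \<in> P10 \<Longrightarrow> z $ K = 0"
  obtains y where "graded UNIV 2 y" "z = dlt y"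
proof -
  define y :: ext where "y = - (z $ {0,1,3}) *s axis {2,3} 1 - z $ {0,1,4} *s axis {2,4} 1 + z $ {0,3,4} *s axis {0,5} 1
    + z $ {1,3,4} *s axis {1,5} 1 - z $ {0,1,5} *s axis {2,5} (1::complex)"
  have gy: "graded UNIV 2 y" unfolding y_def
    by (intro graded_add graded_diff graded_scale) (simp_all add: graded_axis type6_distinct)
  have d: "dlt z $ K = 0" for K by (simp add: z(2))
  have c: "z $ {2,3,5} = 0" "z $ {2,4,5} = 0" "z $ {0,2,5} = 0" "z $ {1,2,5} = 0" "z $ {2,3,4} = - z $ {0,1,5}"
    using d[of "{0,1,3,5}"] d[of "{0,1,4,5}"] d[of "{0,2,3,4}"] d[of "{1,2,3,4}"] d[of "{0,1,3,4}"]
    by (simp_all add: dlt_def nth_calc add_eq_0_iff eq_neg_iff_add_eq_0)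
  have p: "z $ {0,1,2} = 0" "z $ {0,2,3} = 0" "z $ {0,2,4} = 0" "z $ {1,2,3} = 0" "z $ {1,2,4} = 0" "z $ {0,3,5} = 0"
    "z $ {1,3,5} = 0" "z $ {0,4,5} = 0" "z $ {1,4,5} = 0" "z $ {3,4,5} = 0"
    by (simp_all add: z(3) P10_def)
  have "z $ K = dlt y $ K" for K
  proof (cases "card K = 3")
    case True
    show ?thesis
      by (rule card3_induct[where P="\<lambda>K. z $ K = dlt y $ K", OF True]) (simp_all add: c p y_def dlt_def nth_calc axis_nth')
  next
    case False
    then show ?thesis using gradedD[OF z(1), of K] gradedD[OF graded_dlt[of 1 y], of K] gy by (simp add: numeral_2_eq_2 numeral_3_eq_3)
  qed
  then have "z = dlt y" by (simp add: vec_eq_iff)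
  then show thesis using that gy by blast
qed

context tframe begin

definition rep :: "complex \<Rightarrow> complex \<Rightarrow> complex \<Rightarrow> complex \<Rightarrow> complex \<Rightarrow> complex \<Rightarrow> complex \<Rightarrow> complex \<Rightarrow> complex \<Rightarrow> complex \<Rightarrow> ext" where
  "rep a k1 k2 k3 k4 l1 l2 l3 l4 b = a *s axis {0,1,2} 1 + cmb k1 k2 k3 k4 + cmb' l1 l2 l3 l4 + b *s axis {3,4,5} 1"

lemma cmb_linear: "cmb (k1 + l1) (k2 + l2) (k3 + l3) (k4 + l4) = cmb k1 k2 k3 k4 + cmb l1 l2 l3 l4"
  "cmb' (k1 + l1) (k2 + l2) (k3 + l3) (k4 + l4) = cmb' k1 k2 k3 k4 + cmb' l1 l2 l3 l4"
  "cmb (c * k1) (c * k2) (c * k3) (c * k4) = c *s cmb k1 k2 k3 k4"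
  "cmb' (c * k1) (c * k2) (c * k3) (c * k4) = c *s cmb' k1 k2 k3 k4"
  by (simp_all add: cmb_def cmb'_def vec_eq_iff add_divide_distrib diff_divide_distrib algebra_simps)

lemma graded_rep: "graded UNIV 3 (rep a k1 k2 k3 k4 l1 l2 l3 l4 b)"
  unfolding rep_def by (intro graded_add graded_scale graded_cmb) (simp_all add: graded_axis type6_distinct)

lemma dT_rep: "dT (rep a k1 k2 k3 k4 l1 l2 l3 l4 b) = 0"
  by (simp add: rep_def clinear_add[OF clinear_dT] clinear_scale[OF clinear_dT] dT_cmb dT_012)

text \<open>A dimension count in disguise: the map from ten parameters to the ten coordinates
  \<open>P10\<close> of the representative is injective, by \<open>const_exact\<close> and
  \<open>exact_zero\<close>, hence onto. What remains of c then has vanishing \<open>P10\<close>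
  coordinates and is exact.\<close>

lemma const_representation:
  assumes c: "graded UNIV 3 c" "dlt c = 0"
  obtains a k1 k2 k3 k4 l1 l2 l3 l4 b y where "graded UNIV 2 y" "c = B (rep a k1 k2 k3 k4 l1 l2 l3 l4 b) + dlt y"
proof -
  define pr where "pr u = (\<chi> I. if I \<in> P10 then u $ I else 0)" for u :: ext
  define G where "G u = rep (u $ {0,1,2}) (u $ {0,2,3}) (u $ {0,2,4}) (u $ {1,2,3}) (u $ {1,2,4}) (u $ {0,3,5}) (u $ {1,3,5})
    (u $ {0,4,5}) (u $ {1,4,5}) (u $ {3,4,5})" for u :: ext
  \<comment> \<open>The identity on the other coordinates turns the map into an endomorphism of
    \<open>ext\<close>, for which injectivity gives surjectivity.\<close>
  define L where "L u = pr (B (G u)) + (u - pr u)" for u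
  have lp: "clinear_map pr" by (rule clinear_mapI) (simp_all add: pr_def vec_eq_iff)
  have lG: "clinear_map G"
    by (rule clinear_mapI) (simp_all add: G_def rep_def cmb_linear vec.scale_left_distrib vec.scale_right_distrib add_ac)
  have lL: "clinear_map L"
    by (rule clinear_mapI) (simp_all add: L_def clinear_add[OF lp] clinear_add[OF lG] clinear_add[OF clinear_B]
        clinear_scale[OF lp] clinear_scale[OF lG] clinear_scale[OF clinear_B] vec.scale_right_distrib vec.scale_right_diff_distrib algebra_simps)
  have pp: "pr (pr u) = pr u" for u by (simp add: pr_def vec_eq_iff)
  have prL: "pr (L u) = pr (B (G u))" for u
    by (simp add: L_def clinear_add[OF lp] clinear_diff[OF lp] pp)
  have pz: "u $ K = 0" if "pr u = 0" "K \<in> P10" for u K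
    using arg_cong[OF that(1), of "\<lambda>v. v $ K"] that(2) by (simp add: pr_def)
  have dG: "dlt (B (G u)) = 0" for u by (simp add: dlt_B G_def dT_rep clinear_zero[OF clinear_B])
  have gG: "graded UNIV 3 (B (G u))" for u unfolding G_def by (intro graded_B(2) graded_rep)
  \<comment> \<open>If the ten coordinates vanish, the closed form \<open>B (G u)\<close> is exact,
    so \<open>G u\<close> lies in the range of \<open>dT\<close>, which forces its parameters to be
    zero.\<close>
  have inj0: "u = 0" if u: "L u = 0" for u
  proof -
    have p0: "pr (B (G u)) = 0" using prL[of u] u by (simp add: clinear_zero[OF lp])
    obtain y where y: "B (G u) = dlt y"
      by (rule const_exact[OF gG dG, of u], rule pz[OF p0], assumption, rule that)
    have "B (G u) = B (dT (Bi y))" using y by (simp add: dlt_B[symmetric] B_Bi)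
    then have "G u = dT (Bi y)" by (rule B_inj)
    then have "u $ K = 0" if "K \<in> P10" for K
      using exact_zero[of "u $ {0,1,2}" "u $ {0,2,3}" "u $ {0,2,4}" "u $ {1,2,3}" "u $ {1,2,4}" "u $ {0,3,5}" "u $ {1,3,5}" "u $ {0,4,5}" "u $ {1,4,5}" "u $ {3,4,5}" "Bi y"] that
      unfolding G_def rep_def P10_def by (elim insertE emptyE) simp_all
    then have "pr u = 0" by (simp add: pr_def vec_eq_iff)
    then show "u = 0" using u p0 by (simp add: L_def)
  qed
  have "inj L"
  proof (rule injI)
    fix u v assume "L u = L v"
    then have "L (u - v) = 0" by (simp add: clinear_diff[OF lL])
    then show "u = v" using inj0 by fastforce
  qed
  then have "surj L" by (rule linear_injective_imp_surjective[OF clinear_linear[OF lL]]) (rule refl)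
  then obtain u where u: "L u = pr c" by (metis surjD)
  have e: "pr (c - B (G u)) = 0" using prL[of u] u by (simp add: clinear_diff[OF lp] pp)
  have z: "graded UNIV 3 (c - B (G u))" "dlt (c - B (G u)) = 0"
    by (intro graded_diff c gG) (simp add: clinear_diff[OF clinear_dlt] dG c(2))
  obtain y where y: "graded UNIV 2 y" "c - B (G u) = dlt y"
    by (rule const_exact[OF z], rule pz[OF e], assumption, rule that)
  then have "c = B (G u) + dlt y" by (simp add: algebra_simps)
  then show thesis unfolding G_def by (rule that[OF y(1)])
qed

end

section \<open>Dolbeault cohomology\<close>

lemma fsub_image:
  assumes U: "fsub U" and ad: "\<And>u v. u \<in> U \<Longrightarrow> v \<in> U \<Longrightarrow> F (u + v) = F u + F v" and sc: "\<And>c u. u \<in> U \<Longrightarrow> F (c \<cdot> u) = c \<cdot> F u"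
  shows "fsub (F ` U)" "fsub {u \<in> U. F u = 0}"
proof -
  have z: "F 0 = 0" using sc[OF fsub_0[OF U], of 0] by (simp add: fscale_simps)
  show "fsub (F ` U)" unfolding fsub_def
  proof (intro conjI ballI allI)
    show "0 \<in> F ` U" using imageI[OF fsub_0[OF U], of F] by (simp add: z)
  next
    fix u v assume "u \<in> F ` U" "v \<in> F ` U"
    then obtain a b where ab: "a \<in> U" "u = F a" "b \<in> U" "v = F b" by blast
    show "u + v \<in> F ` U" unfolding ab(2,4) ad[OF ab(1,3), symmetric] by (rule imageI[OF fsub_add[OF U ab(1,3)]])
  next
    fix c u assume "u \<in> F ` U"
    then obtain a where a: "a \<in> U" "u = F a" by blast
    show "c \<cdot> u \<in> F ` U" unfolding a(2) sc[OF a(1), symmetric] by (rule imageI[OF fsub_scale[OF U a(1)]])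
  qed
  show "fsub {u \<in> U. F u = 0}" unfolding fsub_def
    using fsub_0[OF U] by (auto simp: z ad sc fscale_simps fsub_add[OF U] fsub_scale[OF U])
qed

lemma hol_union: "I = (I \<inter> hol) \<union> (I \<inter> antihol)"
proof -
  have "x \<in> hol \<union> antihol" for x using UNIV_6 by (auto simp: hol_def antihol_def)
  then show ?thesis by blast
qed

lemma bidegree_iff: "I \<in> bidegree p q \<longleftrightarrow> card (I \<inter> hol) = p \<and> card (I \<inter> antihol) = q"
  by (simp add: bidegree_def)

lemmas bid_calc = bidegree_iff hol_def antihol_def Int_insert_left type6_distinct

lemma bidegree_30: "I \<in> bidegree 3 0 \<longleftrightarrow> I = {0,1,2}"
proof
  assume "I \<in> bidegree 3 0"
  then have c: "card (I \<inter> hol) = 3" "I \<inter> antihol = {}" by (simp_all add: bidegree_iff)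
  have "I \<inter> hol = hol" by (rule card_subset_eq) (simp_all add: c, simp add: hol_def type6_distinct)
  then show "I = {0,1,2}" using hol_union[of I] c(2) by (simp add: hol_def)
qed (simp add: bid_calc)

lemma bidegree_03: "I \<in> bidegree 0 3 \<longleftrightarrow> I = {3,4,5}"
proof
  assume "I \<in> bidegree 0 3"
  then have c: "card (I \<inter> antihol) = 3" "I \<inter> hol = {}" by (simp_all add: bidegree_iff)
  have "I \<inter> antihol = antihol" by (rule card_subset_eq) (simp_all add: c, simp add: antihol_def type6_distinct)
  then show "I = {3,4,5}" using hol_union[of I] c(2) by (simp add: antihol_def)
qed (simp add: bid_calc)

lemma contr_gen: "contr j (gen i) = (if j = i then one_ext else 0)"
  using contr_wedge[of j i one_ext] by (simp add: wedge_one_right contr_one wedge_zero_right)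

lemma sol_fsum:
  assumes T: "sol_op T" and "finite A" and g: "\<And>j. j \<in> A \<Longrightarrow> inv_fun (g j)"
  shows "T (\<lambda>x. \<Sum>j\<in>A. c j * g j x) = (\<lambda>x. \<Sum>j\<in>A. c j * T (g j) x)"
  using assms(2) g
proof (induction A)
  case empty then show ?case by (simp add: sol_zero[OF T])
next
  case (insert j A)
  have i: "inv_fun (\<lambda>x. c j * g j x)" "inv_fun (\<lambda>x. \<Sum>j\<in>A. c j * g j x)"
    using insert.prems by (auto intro!: inv_cmult inv_sum)
  have "T (\<lambda>x. c j * g j x + (\<Sum>j\<in>A. c j * g j x)) = (\<lambda>x. T (\<lambda>x. c j * g j x) x + T (\<lambda>x. \<Sum>j\<in>A. c j * g j x) x)"
    using T i unfolding sol_op_def by blast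
  moreover have "T (\<lambda>x. c j * g j x) = (\<lambda>x. c j * T (g j) x)"
    using T insert.prems unfolding sol_op_def by blast
  ultimately show ?case using insert by simp
qed

context tframe begin

lemma QQ_axis: "QQ p q (axis I 1) = (if I \<in> bidegree p q then axis I 1 else 0)"
  by (auto simp: QQ_def vec_eq_iff axis_def)

lemma QQ_graded: "graded hol a u \<Longrightarrow> graded antihol b u \<Longrightarrow> QQ p q u = (if p = a \<and> q = b then u else 0)"
  by (auto simp: QQ_def vec_eq_iff graded_def bidegree_iff)

text \<open>Forms with constant coefficients in the coframe of X_t.\<close>

definition cst :: "ext \<Rightarrow> form" where "cst c = Psi (\<lambda>x. c)"

lemma cst_add: "cst a + cst b = cst (a + b)" by (simp add: cst_def Psi_add)
lemma cst_diff: "cst a - cst b = cst (a - b)" by (simp add: cst_def Psi_diff)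
lemma cst_scale: "k \<cdot> cst a = cst (k *s a)" by (simp add: cst_def Psi_scale)
lemma cst_wedge: "cst a \<and>\<^sub>f cst b = cst (wedge a b)" by (simp add: cst_def Psi_wedge)
lemma cst_cnj: "fcnj (cst a) = cst (cnj_ext a)" by (simp add: cst_def Psi_cnj)
lemma cst_zero: "cst 0 = 0" by (simp add: cst_def Psi_zero)
lemma cst_inject: "cst a = cst b \<longleftrightarrow> a = b" unfolding cst_def Psi_inject by (simp add: fun_eq_iff)

lemma frame_cst: "alpha_t t = cst (gen 0)" "beta_t t = cst (gen 1)" "gamma_t t = cst (gen 2)"
  by (simp_all add: cst_def frame_Psi)

lemma Dt_const: "Dt (\<lambda>x. c) = (\<lambda>x. dT c)"
  by (rule ext) (simp add: Dt_def xi_lift_const wedge_zero_right)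

lemma ext_d_cst: "ext_d (cst c) = cst (dT c)"
  by (simp add: cst_def ext_d_Psi[OF inv_form_const] Dt_const)

lemma delbar_cst: "delbar t p q (cst c) = cst (QQ p (q + 1) (dT c))"
  by (simp add: cst_def delbar_Psi[OF inv_form_const] Dt_const)

lemma del_cst: "del t p q (cst c) = cst (QQ (p + 1) q (dT c))"
  by (simp add: del_def ext_d_cst) (simp add: cst_def pq_part_Psi)

lemma cst_pq: "QQ p q c = c \<Longrightarrow> cst c \<in> pq_forms t p q"
  unfolding pq_forms_Psi cst_def using inv_form_const by blast

lemma dT_gen2: "dT (gen 2) = c2"
  by (simp add: dT_def contr_gen wedge_one_right wedge_zero_right type6_distinct)

lemma c2_axis: "c2 = s12 *s axis {0,1} 1 + sb11 *s axis {0,3} 1 + sb12 *s axis {0,4} 1 + sb21 *s axis {1,3} 1 + sb22 *s axis {1,4} 1"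
  by (rule trans[OF c2_expand]) (simp add: word2_axis type6_less)

lemma QQ_c2: "QQ 2 0 c2 = s12 *s axis {0,1} 1"
  "QQ 1 1 c2 = sb11 *s axis {0,3} 1 + sb12 *s axis {0,4} 1 + sb21 *s axis {1,3} 1 + sb22 *s axis {1,4} 1"
  by (subst c2_axis, simp add: clinear_add[OF clinear_QQ] clinear_scale[OF clinear_QQ] QQ_axis bid_calc)+

text \<open>Since d gamma_t is \<open>c2\<close> in the coframe of X_t, the abstractly defined
  constant is the (2,0) coefficient of \<open>c2\<close>.\<close>

lemma sigma12_eq: "sigma12 t = s12"
proof -
  have l: "del t 1 0 (gamma_t t) = cst (s12 *s axis {0,1} 1)"
    by (simp only: frame_cst del_cst dT_gen2 one_add_one QQ_c2)
  have r: "s \<cdot> alpha_t t \<and>\<^sub>f beta_t t = cst (s *s axis {0,1} 1)" for s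
    by (simp add: frame_cst cst_wedge cst_scale word2_axis type6_less)
  show ?thesis unfolding sigma12_def l r cst_inject
  proof (rule the_equality)
    fix s assume "s12 *s axis {0,1} 1 = s *s (axis {0,1} 1 :: ext)"
    from arg_cong[OF this, of "\<lambda>u. u $ {0,1}"] show "s = s12" by simp
  qed simp
qed

lemma sigma_bar_eq: "sigma_bar t $ 1 $ 1 = sb11" "sigma_bar t $ 1 $ 2 = sb12" "sigma_bar t $ 2 $ 1 = sb21" "sigma_bar t $ 2 $ 2 = sb22"
proof -
  let ?S = "(\<chi> i j. if i = 1 then if j = 1 then sb11 else sb12 else if j = 1 then sb21 else sb22) :: complex ^ 2 ^ 2"
  have l: "delbar t 1 0 (gamma_t t) = cst (sb11 *s axis {0,3} 1 + sb12 *s axis {0,4} 1 + sb21 *s axis {1,3} 1 + sb22 *s axis {1,4} 1)"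
    by (simp only: frame_cst delbar_cst dT_gen2 add_0 QQ_c2)
  have r: "s $ 1 $ 1 \<cdot> alpha_t t \<and>\<^sub>f fcnj (alpha_t t) + s $ 1 $ 2 \<cdot> alpha_t t \<and>\<^sub>f fcnj (beta_t t)
     + s $ 2 $ 1 \<cdot> beta_t t \<and>\<^sub>f fcnj (alpha_t t) + s $ 2 $ 2 \<cdot> beta_t t \<and>\<^sub>f fcnj (beta_t t)
     = cst (s $ 1 $ 1 *s axis {0,3} 1 + s $ 1 $ 2 *s axis {0,4} 1 + s $ 2 $ 1 *s axis {1,3} 1 + s $ 2 $ 2 *s axis {1,4} 1)" for s :: "complex ^ 2 ^ 2"
    by (simp add: frame_cst cst_cnj cnj_ext_gen type6_add3 cst_wedge cst_scale cst_add word2_axis type6_less)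
  have "sigma_bar t = ?S" unfolding sigma_bar_def l r cst_inject
  proof (rule the_equality)
    fix s :: "complex ^ 2 ^ 2"
    assume a: "sb11 *s axis {0,3} 1 + sb12 *s axis {0,4} 1 + sb21 *s axis {1,3} 1 + sb22 *s axis {1,4} 1
      = s $ 1 $ 1 *s axis {0,3} 1 + s $ 1 $ 2 *s axis {0,4} 1 + s $ 2 $ 1 *s axis {1,3} 1 + s $ 2 $ 2 *s (axis {1,4} 1 :: ext)"
    have "s $ 1 $ 1 = sb11" using arg_cong[OF a, of "\<lambda>u. u $ {0,3}"] by (simp add: axis_nth' set_eq_subset type6_distinct)
    moreover have "s $ 1 $ 2 = sb12" using arg_cong[OF a, of "\<lambda>u. u $ {0,4}"] by (simp add: axis_nth' set_eq_subset type6_distinct)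
    moreover have "s $ 2 $ 1 = sb21" using arg_cong[OF a, of "\<lambda>u. u $ {1,3}"] by (simp add: axis_nth' set_eq_subset type6_distinct)
    moreover have "s $ 2 $ 2 = sb22" using arg_cong[OF a, of "\<lambda>u. u $ {1,4}"] by (simp add: axis_nth' set_eq_subset type6_distinct)
    ultimately show "s = ?S" by (simp add: vec_eq_iff forall_2)
  qed simp
  then show "sigma_bar t $ 1 $ 1 = sb11" "sigma_bar t $ 1 $ 2 = sb12" "sigma_bar t $ 2 $ 1 = sb21" "sigma_bar t $ 2 $ 2 = sb22"
    by simp_all
qed

lemma Gamma_cst: "Gamma1 t = cst (cmb 1 0 0 0)" "Gamma2 t = cst (cmb 0 1 0 0)" "Gamma3 t = cst (cmb 0 0 1 0)" "Gamma4 t = cst (cmb 0 0 0 1)"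
  by (simp_all add: Gamma1_def Gamma2_def Gamma3_def Gamma4_def frame_cst cst_cnj cnj_ext_gen type6_add3 cst_wedge cst_scale cst_diff cst_add
      word3_axis type6_less sigma12_eq sigma_bar_eq cmb_def cst_inject)

lemma span21_eq: "span21 t = {cst (cmb k1 k2 k3 k4) | k1 k2 k3 k4. True}"
proof -
  have "k1 \<cdot> cst (cmb 1 0 0 0) + k2 \<cdot> cst (cmb 0 1 0 0) + k3 \<cdot> cst (cmb 0 0 1 0) + k4 \<cdot> cst (cmb 0 0 0 1) = cst (cmb k1 k2 k3 k4)" for k1 k2 k3 k4
    by (simp add: cst_scale cst_add cmb_linear(1,3)[symmetric])
  then show ?thesis unfolding span21_def Gammas_def Gamma_cst lin_span_form_space comb4_def by simp
qed

lemma span30_eq: "span30 t = {cst (a *s axis {0,1,2} 1) | a. True}"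
proof -
  have "alpha_t t \<and>\<^sub>f beta_t t \<and>\<^sub>f gamma_t t = cst (axis {0,1,2} 1)"
    by (simp add: frame_cst cst_wedge word3_axis type6_less)
  then show ?thesis unfolding span30_def lin_span_form_single by (simp add: cst_scale)
qed

lemma Dt_comb: assumes a: "inv_form a" and b: "inv_form b" shows "Dt (\<lambda>x. a x + k *s b x) = (\<lambda>x. Dt a x + k *s Dt b x)"
proof
  fix x
  have "lift_op (xi j) (\<lambda>x. a x + k *s b x) x = lift_op (xi j) a x + k *s lift_op (xi j) b x" for j
    by (simp add: xi_lift_add[OF a inv_form_scale[OF b]] xi_lift_clinear[OF clinear_scalar b])
  then show "Dt (\<lambda>x. a x + k *s b x) x = Dt a x + k *s Dt b x"
    by (simp add: Dt_def wedge_add_right wedge_scale_right clinear_add[OF clinear_dT] clinear_scale[OF clinear_dT]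
        sum.distrib vec.scale_sum_right vec.scale_right_distrib)
qed

lemma ext_d_comb: assumes "u \<in> forms_X" "v \<in> forms_X" shows "ext_d (u + k \<cdot> v) = ext_d u + k \<cdot> ext_d v" "u + k \<cdot> v \<in> forms_X"
    "pq_part t p q (u + k \<cdot> v) = pq_part t p q u + k \<cdot> pq_part t p q v"
proof -
  obtain a where a: "inv_form a" "u = Psi a" by (rule forms_X_Psi[OF assms(1)])
  obtain b where b: "inv_form b" "v = Psi b" by (rule forms_X_Psi[OF assms(2)])
  have s: "u + k \<cdot> v = Psi (\<lambda>x. a x + k *s b x)" by (simp add: a(2) b(2) Psi_scale Psi_add)
  have i: "inv_form (\<lambda>x. a x + k *s b x)" by (intro inv_form_add inv_form_scale a b)
  show "ext_d (u + k \<cdot> v) = ext_d u + k \<cdot> ext_d v"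
    unfolding s ext_d_Psi[OF i] Dt_comb[OF a(1) b(1)] by (simp add: a b ext_d_Psi Psi_scale Psi_add)
  show "u + k \<cdot> v \<in> forms_X" unfolding s by (rule Psi_in_forms_X[OF i])
  show "pq_part t p q (u + k \<cdot> v) = pq_part t p q u + k \<cdot> pq_part t p q v"
    unfolding s pq_part_Psi by (simp add: a b pq_part_Psi Psi_scale Psi_add clinear_add[OF clinear_QQ] clinear_scale[OF clinear_QQ])
qed

lemma zero_forms_X: "0 \<in> forms_X"
  using Psi_in_forms_X[OF inv_form_const[of 0]] by (simp add: Psi_zero)

lemma ext_d_zero: "ext_d 0 = 0"
  using ext_d_cst[of 0] by (simp add: cst_zero clinear_zero[OF clinear_dT])

lemma ext_d_forms_X: "u \<in> forms_X \<Longrightarrow> ext_d u \<in> forms_X"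
  by (erule forms_X_Psi) (simp add: ext_d_Psi Psi_in_forms_X inv_form_Dt)

lemma pq_part_zero: "pq_part t p q 0 = 0"
  using pq_part_Psi[of p q "\<lambda>x. 0"] by (simp add: Psi_zero clinear_zero[OF clinear_QQ])

lemma linear_on_forms:
  assumes "u \<in> forms_X" "v \<in> forms_X"
  shows "ext_d (u + v) = ext_d u + ext_d v" "ext_d (k \<cdot> v) = k \<cdot> ext_d v"
    "delbar t p q (u + v) = delbar t p q u + delbar t p q v" "delbar t p q (k \<cdot> v) = k \<cdot> delbar t p q v"
proof -
  show e1: "ext_d (u + v) = ext_d u + ext_d v" using ext_d_comb(1)[OF assms, of 1] by (simp add: fscale_simps)
  show e2: "ext_d (k \<cdot> v) = k \<cdot> ext_d v" using ext_d_comb(1)[OF zero_forms_X assms(2), of k] by (simp add: ext_d_zero)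
  show "delbar t p q (u + v) = delbar t p q u + delbar t p q v"
    unfolding delbar_def e1 using ext_d_comb(3)[OF ext_d_forms_X[OF assms(1)] ext_d_forms_X[OF assms(2)], of p "q + 1" 1] by (simp add: fscale_simps)
  show "delbar t p q (k \<cdot> v) = k \<cdot> delbar t p q v"
    unfolding delbar_def e2 using ext_d_comb(3)[OF zero_forms_X ext_d_forms_X[OF assms(2)], of p "q + 1" k] by (simp add: pq_part_zero)
qed

lemma fsub_pq: "fsub (pq_forms t p q)"
  unfolding fsub_def pq_forms_Psi
proof (intro conjI ballI allI)
  show "0 \<in> {Psi w | w. inv_form w \<and> (\<forall>x. QQ p q (w x) = w x)}"
    using inv_form_const[of 0] by (intro CollectI exI[of _ "\<lambda>x. 0"]) (simp add: Psi_zero clinear_zero[OF clinear_QQ])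
next
  fix u v assume "u \<in> {Psi w | w. inv_form w \<and> (\<forall>x. QQ p q (w x) = w x)}" "v \<in> {Psi w | w. inv_form w \<and> (\<forall>x. QQ p q (w x) = w x)}"
  then obtain a b where "inv_form a" "\<forall>x. QQ p q (a x) = a x" "u = Psi a" "inv_form b" "\<forall>x. QQ p q (b x) = b x" "v = Psi b" by blast
  then show "u + v \<in> {Psi w | w. inv_form w \<and> (\<forall>x. QQ p q (w x) = w x)}"
    by (intro CollectI exI[of _ "\<lambda>x. a x + b x"]) (simp add: Psi_add inv_form_add clinear_add[OF clinear_QQ])
next
  fix c u assume "u \<in> {Psi w | w. inv_form w \<and> (\<forall>x. QQ p q (w x) = w x)}"
  then obtain a where "inv_form a" "\<forall>x. QQ p q (a x) = a x" "u = Psi a" by blast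
  then show "c \<cdot> u \<in> {Psi w | w. inv_form w \<and> (\<forall>x. QQ p q (w x) = w x)}"
    by (intro CollectI exI[of _ "\<lambda>x. c *s a x"]) (simp add: Psi_scale inv_form_scale clinear_scale[OF clinear_QQ])
qed

lemma fsub_kforms: "fsub (kforms k)"
  unfolding fsub_def kforms_Psi
proof (intro conjI ballI allI)
  show "0 \<in> {Psi w | w. inv_form w \<and> (\<forall>x. graded UNIV k (w x))}"
    using inv_form_const[of 0] by (intro CollectI exI[of _ "\<lambda>x. 0"]) (simp add: Psi_zero graded_0)
next
  fix u v assume "u \<in> {Psi w | w. inv_form w \<and> (\<forall>x. graded UNIV k (w x))}" "v \<in> {Psi w | w. inv_form w \<and> (\<forall>x. graded UNIV k (w x))}"
  then obtain a b where "inv_form a" "\<forall>x. graded UNIV k (a x)" "u = Psi a" "inv_form b" "\<forall>x. graded UNIV k (b x)" "v = Psi b" by blast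
  then show "u + v \<in> {Psi w | w. inv_form w \<and> (\<forall>x. graded UNIV k (w x))}"
    by (intro CollectI exI[of _ "\<lambda>x. a x + b x"]) (simp add: Psi_add inv_form_add graded_add)
next
  fix c u assume "u \<in> {Psi w | w. inv_form w \<and> (\<forall>x. graded UNIV k (w x))}"
  then obtain a where "inv_form a" "\<forall>x. graded UNIV k (a x)" "u = Psi a" by blast
  then show "c \<cdot> u \<in> {Psi w | w. inv_form w \<and> (\<forall>x. graded UNIV k (w x))}"
    by (intro CollectI exI[of _ "\<lambda>x. c *s a x"]) (simp add: Psi_scale inv_form_scale graded_scale)
qed

lemma pq_in_forms_X: "u \<in> pq_forms t p q \<Longrightarrow> u \<in> forms_X" "u \<in> kforms k \<Longrightarrow> u \<in> forms_X"
  by (simp_all add: pq_forms_def kforms_def)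

lemma fsub_zero: "fsub {0}"
  by (simp add: fsub_def fscale_simps)

lemma fsub_Dolb: "fsub {u \<in> pq_forms t p q. delbar t p q u = 0}" "fsub (delbar_boundaries t p q)"
proof -
  have a: "delbar t p q (u + v) = delbar t p q u + delbar t p q v" "delbar t p q (c \<cdot> v) = c \<cdot> delbar t p q v"
    if "u \<in> pq_forms t p q" "v \<in> pq_forms t p q" for p q u v c
    using linear_on_forms[OF pq_in_forms_X(1)[OF that(1)] pq_in_forms_X(1)[OF that(2)]] by simp_all
  have f: "fsub (delbar t p q ` pq_forms t p q)" "fsub {u \<in> pq_forms t p q. delbar t p q u = 0}" for p q
    by (rule fsub_image[OF fsub_pq]; simp add: a)+
  show "fsub {u \<in> pq_forms t p q. delbar t p q u = 0}" by (rule f)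
  show "fsub (delbar_boundaries t p q)" unfolding delbar_boundaries_def using f(1) fsub_zero by simp
qed

lemma fsub_dR: "fsub {u \<in> kforms k. ext_d u = 0}" "fsub (dR_boundaries k)"
proof -
  have a: "ext_d (u + v) = ext_d u + ext_d v" "ext_d (c \<cdot> v) = c \<cdot> ext_d v" if "u \<in> kforms k" "v \<in> kforms k" for k u v c
    using linear_on_forms[OF pq_in_forms_X(2)[OF that(1)] pq_in_forms_X(2)[OF that(2)]] by simp_all
  have f: "fsub (ext_d ` kforms k)" "fsub {u \<in> kforms k. ext_d u = 0}" for k
    by (rule fsub_image[OF fsub_kforms]; simp add: a)+
  show "fsub {u \<in> kforms k. ext_d u = 0}" by (rule f)
  show "fsub (dR_boundaries k)" unfolding dR_boundaries_def using f(1) fsub_zero by simp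
qed

lemma mn_Dt: assumes w: "inv_form w" shows "mn (Dt w) = dT (mn w)"
proof -
  have x: "inv_form (lift_op (xi i) w)" for i by (rule inv_form_xi[OF w])
  have "mn (Dt w) = mn (\<lambda>x. \<Sum>i\<in>UNIV. wedge (nu i) (lift_op (xi i) w x)) + mn (\<lambda>x. dT (w x))"
    unfolding Dt_def[abs_def] by (intro mn_add inv_form_sum inv_form_clinear[OF clinear_wedge_right] x inv_form_clinear[OF clinear_dT] w)
  also have "mn (\<lambda>x. \<Sum>i\<in>UNIV. wedge (nu i) (lift_op (xi i) w x)) = (\<Sum>i\<in>UNIV. wedge (nu i) (mn (lift_op (xi i) w)))"
    by (simp add: mn_sum inv_form_clinear[OF clinear_wedge_right] x mn_clinear[OF clinear_wedge_right])
  also have "... = 0" by (simp add: mn_xi[OF w] wedge_zero_right)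
  finally show ?thesis by (simp add: mn_clinear[OF clinear_dT w])
qed

text \<open>Averaging a primitive: the mean fixes constants, kills the derivative part of d and
  preserves types, so a constant exact form has a constant primitive.\<close>

lemma delbar_exact_const:
  assumes "cst c \<in> delbar_boundaries t p (Suc q)"
  obtains m where "QQ p q m = m" "c = QQ p (Suc q) (dT m)"
proof -
  obtain w where w: "inv_form w" "\<And>x. QQ p q (w x) = w x" "cst c = delbar t p q (Psi w)"
    using assms unfolding delbar_boundaries_def pq_forms_Psi by auto
  have "(\<lambda>x. c) = (\<lambda>x. QQ p (Suc q) (Dt w x))" using w(3) by (simp add: delbar_Psi[OF w(1)] cst_def Psi_inject)
  from arg_cong[OF this, of mn] have "c = QQ p (Suc q) (dT (mn w))"
    by (simp only: mn_const mn_clinear[OF clinear_QQ inv_form_Dt[OF w(1)]] mn_Dt[OF w(1)])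
  moreover have "QQ p q (mn w) = mn w"
  proof -
    have "mn w = mn (\<lambda>x. QQ p q (w x))" by (rule arg_cong[where f=mn]) (rule ext, rule w(2)[symmetric])
    also have "\<dots> = QQ p q (mn w)" by (rule mn_clinear[OF clinear_QQ w(1)])
    finally show ?thesis by (rule sym)
  qed
  ultimately show thesis by (rule that[rotated])
qed

lemma d_exact_const: assumes "cst c \<in> dR_boundaries 3" shows "\<exists>m. c = dT m"
proof -
  obtain w where w: "inv_form w" "cst c = ext_d (Psi w)" using assms unfolding dR_boundaries_def kforms_Psi by auto
  have "(\<lambda>x. c) = Dt w" using w(2) by (simp add: ext_d_Psi[OF w(1)] cst_def Psi_inject)
  from arg_cong[OF this, of mn] show ?thesis by (auto simp: mn_const mn_Dt[OF w(1)])
qed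

text \<open>The derivative of the coefficients along the i-th field of the frame dual to the coframe
  of X_t.\<close>

definition pw :: "6 \<Rightarrow> form \<Rightarrow> form" where "pw i w x = (\<Sum>j\<in>UNIV. NN j i *s lift_op (xi j) w x)"

lemma Dt_pw: "Dt w x = (\<Sum>i\<in>UNIV. wedge (gen i) (pw i w x)) + dT (w x)"
proof -
  have "(\<Sum>j\<in>UNIV. wedge (nu j) (lift_op (xi j) w x)) = (\<Sum>j\<in>UNIV. \<Sum>i\<in>UNIV. wedge (gen i) (NN j i *s lift_op (xi j) w x))"
    by (rule sum.cong[OF refl], subst nu_expand) (simp add: wedge_sum_left wedge_scale_left wedge_scale_right)
  also have "... = (\<Sum>i\<in>UNIV. \<Sum>j\<in>UNIV. wedge (gen i) (NN j i *s lift_op (xi j) w x))" by (rule sum.swap)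
  finally show ?thesis by (simp add: Dt_def pw_def wedge_sum_right)
qed

lemma pw_nth: "pw i w x $ J = (\<Sum>j\<in>UNIV. NN j i * xi j (\<lambda>x. w x $ J) x)"
  by (simp add: pw_def lift_op_def)

text \<open>The deviation 1/50 is below the required 1/8, and |NN 2 5| \<le> 1/50 < 49/50 \<le> |NN
  5 5| is the dominance needed vertically.\<close>

lemma solution_NN:
  obtains R :: "6 \<Rightarrow> (complex ^ 3 \<Rightarrow> complex) \<Rightarrow> complex ^ 3 \<Rightarrow> complex" where
    "\<And>i. sol_op (R i)" "\<And>f x. inv_fun f \<Longrightarrow> f x = mean f + (\<Sum>i\<in>{3, 4, 5}. \<Sum>j\<in>UNIV. NN j i * xi j (R i f) x)"
proof -
  have N1: "norm (NN j i - (if i = j then 1 else 0)) \<le> 1/8" if "i \<in> {3, 4}" "j \<in> {0, 1, 3, 4}" for i j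
    by (rule order_trans[OF NN_near]) simp
  have N3: "norm (NN 2 5) < norm (NN 5 5)"
  proof -
    have "norm (NN 2 5) \<le> 1/50" using NN_near[of 2 5] by (simp add: type6_distinct)
    moreover have "norm (NN 5 5 - 1) \<le> 1/50" using NN_near[of 5 5] by simp
    ultimately show ?thesis using norm_triangle_ineq2[of 1 "1 - NN 5 5"] by (simp add: norm_minus_commute)
  qed
  obtain R :: "6 \<Rightarrow> (complex ^ 3 \<Rightarrow> complex) \<Rightarrow> complex ^ 3 \<Rightarrow> complex" where R: "\<And>i f. inv_fun f \<Longrightarrow> inv_fun (R i f)"
    "\<And>i j f. inv_fun f \<Longrightarrow> R i (xi j f) = xi j (R i f)"
    "\<And>i f g. inv_fun f \<Longrightarrow> inv_fun g \<Longrightarrow> R i (\<lambda>x. f x + g x) = (\<lambda>x. R i f x + R i g x)"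
    "\<And>i c f. inv_fun f \<Longrightarrow> R i (\<lambda>x. c * f x) = (\<lambda>x. c * R i f x)"
    "\<And>f x. inv_fun f \<Longrightarrow> f x = mean f + (\<Sum>i\<in>{3, 4, 5}. \<Sum>j\<in>UNIV. NN j i * xi j (R i f) x)"
    by (rule left_invariant_solution[where N=NN, OF N1 NN_5 N3], assumption, assumption, assumption, rule that; assumption)
  show thesis
  proof (rule that[of R])
    show "sol_op (R i)" for i using R(1-4) by (simp add: sol_op_def)
  qed (rule R(5))
qed

text \<open>A Liouville theorem: R commutes with the fields, so the three antiholomorphic
  derivatives of its values vanish as well, and the solution identity leaves only the mean.\<close>

lemma constant_of_antihol:
  assumes f: "inv_fun f" and z: "\<And>i x. i \<in> {3,4,5} \<Longrightarrow> (\<Sum>j\<in>UNIV. NN j i * xi j f x) = 0"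
  shows "f x = mean f"
proof -
  obtain R :: "6 \<Rightarrow> (complex ^ 3 \<Rightarrow> complex) \<Rightarrow> complex ^ 3 \<Rightarrow> complex" where
    R: "\<And>i. sol_op (R i)" "\<And>f x. inv_fun f \<Longrightarrow> f x = mean f + (\<Sum>i\<in>{3, 4, 5}. \<Sum>j\<in>UNIV. NN j i * xi j (R i f) x)"
    by (rule solution_NN, rule that; assumption)
  have "(\<Sum>j\<in>UNIV. NN j i * xi j (R i f) x) = 0" if i: "i \<in> {3,4,5}" for i
  proof -
    have c: "xi j (R i f) = R i (xi j f)" for j using R(1)[of i] f unfolding sol_op_def by simp
    have "(\<lambda>x. \<Sum>j\<in>UNIV. NN j i * R i (xi j f) x) = R i (\<lambda>x. \<Sum>j\<in>UNIV. NN j i * xi j f x)"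
      by (rule sol_fsum[OF R(1), symmetric]) (simp_all add: inv_xi[OF f])
    also have "... = (\<lambda>x. 0)" by (simp only: z[OF i] sol_zero[OF R(1)])
    finally show ?thesis unfolding c by (rule fun_cong)
  qed
  then have "(\<Sum>i\<in>{3, 4, 5}. \<Sum>j\<in>UNIV. NN j i * xi j (R i f) x) = 0" by (intro sum.neutral) blast
  then show ?thesis using R(2)[OF f, of x] by simp
qed

text \<open>The coefficient of the single (3,0) word has vanishing antiholomorphic derivatives, read
  off at the three words of type (3,1); the constant part of d does not contribute there.\<close>

lemma closed_30:
  assumes "u \<in> pq_forms t 3 0" "delbar t 3 0 u = 0"
  shows "\<exists>a. u = cst (a *s axis {0,1,2} 1)"
proof -
  obtain w where w: "inv_form w" "\<And>x. QQ 3 0 (w x) = w x" "u = Psi w" using assms(1) unfolding pq_forms_Psi by blast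
  define f where "f x = w x $ {0,1,2}" for x
  have wn: "w x $ J = (if J = {0,1,2} then f x else 0)" for x J
    using arg_cong[OF w(2)[of x], of "\<lambda>u. u $ J"] by (auto simp: QQ_def bidegree_30 f_def split: if_splits)
  have wf: "w x = f x *s axis {0,1,2} 1" for x by (simp add: vec_eq_iff wn axis_nth')
  have fi: "inv_fun f" using w(1) by (simp add: inv_form_def f_def[abs_def])
  have "(\<lambda>x. QQ 3 1 (Dt w x)) = (\<lambda>x. 0)" using assms(2) unfolding w(3) delbar_Psi[OF w(1)] Psi_zero[symmetric] Psi_inject by simp
  then have z: "QQ 3 1 (Dt w x) $ K = 0" for x K by (simp add: fun_eq_iff)
  have d0: "dT (w x) = 0" for x by (simp add: wf clinear_scale[OF clinear_dT] dT_012)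
  have p: "pw i w x $ J = (if J = {0,1,2} then \<Sum>j\<in>UNIV. NN j i * xi j f x else 0)" for i x J
  proof (cases "J = {0,1,2}")
    case True
    have "(\<lambda>x. w x $ {0,1,2}) = f" by (rule ext) (simp add: f_def)
    then show ?thesis unfolding pw_nth True by (simp only: if_True refl)
  next
    case False then show ?thesis unfolding pw_nth wn by (simp add: xi_const)
  qed
  have D: "Dt w x $ K = wedge (gen 0) (pw 0 w x) $ K + wedge (gen 1) (pw 1 w x) $ K + wedge (gen 2) (pw 2 w x) $ K
      + wedge (gen 3) (pw 3 w x) $ K + wedge (gen 4) (pw 4 w x) $ K + wedge (gen 5) (pw 5 w x) $ K" for x K
    by (simp add: Dt_pw d0 sum_6)
  have "(\<Sum>j\<in>UNIV. NN j i * xi j f x) = 0" if i: "i \<in> {3,4,5}" for i x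
  proof -
    have e: "Dt w x $ {0,1,2,3} = 0" "Dt w x $ {0,1,2,4} = 0" "Dt w x $ {0,1,2,5} = 0"
      using z[of x "{0,1,2,3}"] z[of x "{0,1,2,4}"] z[of x "{0,1,2,5}"] by (simp_all add: QQ_def bid_calc)
    have s: "sg 3 {0,1,2} \<noteq> 0" "sg 4 {0,1,2} \<noteq> 0" "sg 5 {0,1,2} \<noteq> 0" by (simp_all add: sg_def)
    have "Dt w x $ {0,1,2,3} = sg 3 {0,1,2} * (\<Sum>j\<in>UNIV. NN j 3 * xi j f x)"
      "Dt w x $ {0,1,2,4} = sg 4 {0,1,2} * (\<Sum>j\<in>UNIV. NN j 4 * xi j f x)"
      "Dt w x $ {0,1,2,5} = sg 5 {0,1,2} * (\<Sum>j\<in>UNIV. NN j 5 * xi j f x)"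
      unfolding D wedge_gen_nth p by (simp_all add: insert_Diff_if type6_distinct set_eq_subset)
    then show ?thesis using e s i by auto
  qed
  then have "f x = mean f" for x by (rule constant_of_antihol[OF fi])
  then have "w = (\<lambda>x. mean f *s axis {0,1,2} 1)" using wf by auto
  then show ?thesis using w(3) by (auto simp: cst_def)
qed

text \<open>The solution identity for the coefficient is the statement that it differs from its mean
  by the divergence of the R i f, and that divergence is exact.\<close>

lemma class_03:
  assumes "u \<in> pq_forms t 0 3"
  shows "\<exists>a. u - cst (a *s axis {3,4,5} 1) \<in> delbar_boundaries t 0 3"
proof -
  obtain w where w: "inv_form w" "\<And>x. QQ 0 3 (w x) = w x" "u = Psi w" using assms unfolding pq_forms_Psi by blast
  define f where "f x = w x $ {3,4,5}" for x
  have fi: "inv_fun f" using w(1) by (simp add: inv_form_def f_def[abs_def])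
  obtain R :: "6 \<Rightarrow> (complex ^ 3 \<Rightarrow> complex) \<Rightarrow> complex ^ 3 \<Rightarrow> complex" where
    R: "\<And>i. sol_op (R i)" "\<And>f x. inv_fun f \<Longrightarrow> f x = mean f + (\<Sum>i\<in>{3, 4, 5}. \<Sum>j\<in>UNIV. NN j i * xi j (R i f) x)"
    by (rule solution_NN, rule that; assumption)
  have Ri: "inv_fun (R i f)" for i using R(1)[of i] fi by (simp add: sol_op_def)
  \<comment> \<open>The values R i f placed on the words complementary to the letter i in {3,4,5};
    the minus sign at {3,5} is the sign of inserting 4 there.\<close>
  define y :: form where "y x = R 3 f x *s axis {4,5} 1 + (-1 * R 4 f x) *s axis {3,5} 1 + R 5 f x *s axis {3,4} 1" for x
  have yi: "inv_form y" unfolding inv_form_def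
  proof
    fix I
    have "(\<lambda>x. y x $ I) = (\<lambda>x. (axis {4,5} 1 :: ext) $ I * R 3 f x + (- (axis {3,5} 1 :: ext) $ I) * R 4 f x + (axis {3,4} 1 :: ext) $ I * R 5 f x)"
      by (simp add: y_def fun_eq_iff mult.commute)
    then show "inv_fun (\<lambda>x. y x $ I)" by (simp only:) (intro inv_add inv_cmult Ri)
  qed
  have yq: "QQ 0 2 (y x) = y x" for x
    by (simp add: y_def clinear_add[OF clinear_QQ] clinear_scale[OF clinear_QQ] QQ_axis bid_calc clinear_diff[OF clinear_QQ])
  have yn: "(\<lambda>x. y x $ {4,5}) = R 3 f" "(\<lambda>x. y x $ {3,5}) = (\<lambda>x. -1 * R 4 f x)" "(\<lambda>x. y x $ {3,4}) = R 5 f"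
    by (rule ext, simp add: y_def axis_nth' set_eq_subset type6_distinct)+
  have p: "pw 3 y x $ {4,5} = (\<Sum>j\<in>UNIV. NN j 3 * xi j (R 3 f) x)" "pw 4 y x $ {3,5} = - (\<Sum>j\<in>UNIV. NN j 4 * xi j (R 4 f) x)"
    "pw 5 y x $ {3,4} = (\<Sum>j\<in>UNIV. NN j 5 * xi j (R 5 f) x)" for x
    unfolding pw_nth yn xi_cmult[OF inv_smooth[OF Ri]] by (simp_all add: sum_negf)
  have e: "QQ 0 3 (Dt y x) = w x - mean f *s axis {3,4,5} 1" for x
  proof -
    have "QQ 0 3 (Dt y x) $ K = (w x - mean f *s axis {3,4,5} 1) $ K" for K
    proof (cases "K = {3,4,5}")
      case False
      then show ?thesis using arg_cong[OF w(2)[of x], of "\<lambda>u. u $ K"] by (simp add: QQ_def bidegree_03 axis_nth')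
    next
      case True
      have "Dt y x $ {3,4,5} = wedge (gen 0) (pw 0 y x) $ {3,4,5} + wedge (gen 1) (pw 1 y x) $ {3,4,5} + wedge (gen 2) (pw 2 y x) $ {3,4,5}
          + wedge (gen 3) (pw 3 y x) $ {3,4,5} + wedge (gen 4) (pw 4 y x) $ {3,4,5} + wedge (gen 5) (pw 5 y x) $ {3,4,5}"
        by (simp add: Dt_pw dT_weight1 sum_6)
      also have "... = (\<Sum>j\<in>UNIV. NN j 3 * xi j (R 3 f) x) + ((\<Sum>j\<in>UNIV. NN j 4 * xi j (R 4 f) x) + (\<Sum>j\<in>UNIV. NN j 5 * xi j (R 5 f) x))"
        unfolding wedge_gen_nth by (simp add: insert_Diff_if type6_distinct sg_insert sg_empty type6_less type6_not_less p)
      also have "... = f x - mean f"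
        using R(2)[OF fi, of x] by (simp add: type6_distinct)
      finally show ?thesis unfolding True by (simp add: QQ_def bidegree_03 axis_nth' f_def)
    qed
    then show ?thesis by (simp add: vec_eq_iff)
  qed
  have "delbar t 0 2 (Psi y) = u - cst (mean f *s axis {3,4,5} 1)"
    using delbar_Psi[OF yi, of 0 2] by (simp add: e w(3) cst_def Psi_diff)
  moreover have "Psi y \<in> pq_forms t 0 2" unfolding pq_forms_Psi using yi yq by blast
  ultimately have "u - cst (mean f *s axis {3,4,5} 1) \<in> delbar_boundaries t 0 3"
    unfolding delbar_boundaries_def by (auto intro: rev_image_eqI)
  then show ?thesis ..
qed

lemma exact_03: "cst (a *s axis {3,4,5} 1) \<in> delbar_boundaries t 0 3 \<Longrightarrow> a = 0"
proof -
  assume a: "cst (a *s axis {3,4,5} 1) \<in> delbar_boundaries t 0 3"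
  then have "cst (a *s axis {3,4,5} 1) \<in> delbar_boundaries t 0 (Suc 2)" by (simp add: numeral_3_eq_3)
  then obtain m where "QQ 0 2 m = m" and e: "a *s axis {3,4,5} 1 = QQ 0 (Suc 2) (dT m)" by (rule delbar_exact_const)
  from arg_cong[OF e, of "\<lambda>u. u $ {3,4,5}"] show "a = 0" by (simp add: QQ_def dT_weight1)
qed

text \<open>A primitive has type (2,0), hence no coefficient at the mixed word {2, 5}, and the
  leading words of the Gammas see nothing else.\<close>

lemma exact_21: "cst (cmb k1 k2 k3 k4) \<in> delbar_boundaries t 2 1 \<Longrightarrow> k1 = 0 \<and> k2 = 0 \<and> k3 = 0 \<and> k4 = 0"
proof -
  assume "cst (cmb k1 k2 k3 k4) \<in> delbar_boundaries t 2 1"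
  then have "cst (cmb k1 k2 k3 k4) \<in> delbar_boundaries t 2 (Suc 0)" by simp
  then obtain m where m: "QQ 2 0 m = m" "cmb k1 k2 k3 k4 = QQ 2 (Suc 0) (dT m)" by (rule delbar_exact_const)
  have x: "m $ {2,5} = 0" using arg_cong[OF m(1), of "\<lambda>u. u $ {2,5}"] by (simp add: QQ_def bid_calc)
  have c: "cmb k1 k2 k3 k4 $ K = QQ 2 (Suc 0) (dT m) $ K" for K using m(2) by simp
  show ?thesis using c[of "{0,2,3}"] c[of "{0,2,4}"] c[of "{1,2,3}"] c[of "{1,2,4}"]
    by (simp add: cmb_nth QQ_def dT_weight1 x)
qed

text \<open>Here a primitive of type (1,1) may contain gamma \<and> conj gamma; the smallness of the
  coefficients of d gamma_t, through \<open>key_zero\<close>, excludes it.\<close>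

lemma exact_12: "cst (cmb' k1 k2 k3 k4) \<in> delbar_boundaries t 1 2 \<Longrightarrow> k1 = 0 \<and> k2 = 0 \<and> k3 = 0 \<and> k4 = 0"
proof -
  assume "cst (cmb' k1 k2 k3 k4) \<in> delbar_boundaries t 1 2"
  then have "cst (cmb' k1 k2 k3 k4) \<in> delbar_boundaries t 1 (Suc 1)" by (simp add: numeral_2_eq_2)
  then obtain m where "QQ 1 1 m = m" and m: "cmb' k1 k2 k3 k4 = QQ 1 (Suc 1) (dT m)" by (rule delbar_exact_const)
  have c: "cmb' k1 k2 k3 k4 $ K = QQ 1 (Suc 1) (dT m) $ K" for K using m by simp
  have q: "QQ 1 (Suc 1) u $ K = u $ K" if "K \<in> bidegree 1 (Suc 1)" for u K
    using that by (simp add: QQ_def)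
  have b: "{0,3,5} \<in> bidegree 1 (Suc 1)" "{1,3,5} \<in> bidegree 1 (Suc 1)" "{0,4,5} \<in> bidegree 1 (Suc 1)"
    "{1,4,5} \<in> bidegree 1 (Suc 1)" "{2,3,4} \<in> bidegree 1 (Suc 1)" by (simp_all add: bid_calc)
  have l1: "k1 = sb11 * m ${2,5}" using c[of "{0,3,5}"] by (simp only: q[OF b(1)] cmb_nth dT_weight1)
  have l2: "k2 = sb21 * m ${2,5}" using c[of "{1,3,5}"] by (simp only: q[OF b(2)] cmb_nth dT_weight1)
  have l3: "k3 = sb12 * m ${2,5}" using c[of "{0,4,5}"] by (simp only: q[OF b(3)] cmb_nth dT_weight1)
  have l4: "k4 = sb22 * m ${2,5}" using c[of "{1,4,5}"] by (simp only: q[OF b(4)] cmb_nth dT_weight1)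
  have l5: "(- k1 * cnj sb22 + k2 * cnj sb21 + k3 * cnj sb12 - k4 * cnj sb11) / s12 = - cnj s12 * m ${2,5}"
    using c[of "{2,3,4}"] by (simp only: q[OF b(5)] cmb_nth dT_weight1)
  note l = l1 l2 l3 l4 l5
  have "m ${2,5} = 0" by (rule key_zero[OF l])
  then show ?thesis using l1 l2 l3 l4 by simp
qed

lemma closed_cmb:
  "cst (cmb k1 k2 k3 k4) \<in> {u \<in> pq_forms t 2 1. delbar t 2 1 u = 0}"
  "cst (cmb' k1 k2 k3 k4) \<in> {u \<in> pq_forms t 1 2. delbar t 1 2 u = 0}"
proof -
  have q: "QQ 2 1 (cmb k1 k2 k3 k4) = cmb k1 k2 k3 k4" "QQ 1 2 (cmb' k1 k2 k3 k4) = cmb' k1 k2 k3 k4"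
    using QQ_graded[OF graded_cmb(5,6), where p=2 and q=1] QQ_graded[OF graded_cmb(7,8), where p=1 and q=2] by simp_all
  show "cst (cmb k1 k2 k3 k4) \<in> {u \<in> pq_forms t 2 1. delbar t 2 1 u = 0}"
    using cst_pq[OF q(1)] by (simp add: delbar_cst dT_cmb clinear_zero[OF clinear_QQ] cst_zero)
  show "cst (cmb' k1 k2 k3 k4) \<in> {u \<in> pq_forms t 1 2. delbar t 1 2 u = 0}"
    using cst_pq[OF q(2)] by (simp add: delbar_cst dT_cmb clinear_zero[OF clinear_QQ] cst_zero)
qed

end

section \<open>The star operator\<close>

lemma wedge_axis_top: "wedge (axis I 1) d $ UNIV = shuffle_sign I (- I) * d $ (- I)"
proof -
  have "wedge (axis I 1) d $ UNIV = (\<Sum>J\<in>UNIV. if J = I then shuffle_sign J (- J) * d $ (- J) else 0)"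
    unfolding wedge_def vec_lambda_beta by (rule sum.cong) (auto simp: axis_def Compl_eq_Diff_UNIV)
  then show ?thesis by simp
qed

text \<open>The signs of the complementary pairs of words, that is, the table of the star operator
  on 3-forms.\<close>

lemma wedge_top: "wedge (axis {0,1,2} 1) s $ UNIV = s $ {3,4,5}"
  "wedge (axis {0,1,3} 1) s $ UNIV = - s $ {2,4,5}"
  "wedge (axis {0,1,4} 1) s $ UNIV = s $ {2,3,5}"
  "wedge (axis {0,1,5} 1) s $ UNIV = - s $ {2,3,4}"
  "wedge (axis {0,2,3} 1) s $ UNIV = s $ {1,4,5}"
  "wedge (axis {0,2,4} 1) s $ UNIV = - s $ {1,3,5}"
  "wedge (axis {0,2,5} 1) s $ UNIV = s $ {1,3,4}"
  "wedge (axis {0,3,4} 1) s $ UNIV = s $ {1,2,5}"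
  "wedge (axis {0,3,5} 1) s $ UNIV = - s $ {1,2,4}"
  "wedge (axis {0,4,5} 1) s $ UNIV = s $ {1,2,3}"
  "wedge (axis {1,2,3} 1) s $ UNIV = - s $ {0,4,5}"
  "wedge (axis {1,2,4} 1) s $ UNIV = s $ {0,3,5}"
  "wedge (axis {1,2,5} 1) s $ UNIV = - s $ {0,3,4}"
  "wedge (axis {1,3,4} 1) s $ UNIV = - s $ {0,2,5}"
  "wedge (axis {1,3,5} 1) s $ UNIV = s $ {0,2,4}"
  "wedge (axis {1,4,5} 1) s $ UNIV = - s $ {0,2,3}"
  "wedge (axis {2,3,4} 1) s $ UNIV = s $ {0,1,5}"
  "wedge (axis {2,3,5} 1) s $ UNIV = - s $ {0,1,4}"
  "wedge (axis {2,4,5} 1) s $ UNIV = s $ {0,1,3}"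
  "wedge (axis {3,4,5} 1) s $ UNIV = - s $ {0,1,2}"
proof -
  have w: "wedge (axis {i, j, k} 1) s = wedge (gen i) (wedge (gen j) (wedge (gen k) s))" if "i < j" "j < k" for i j k
    using that by (simp add: word3_axis[symmetric] wedge_assoc)
  show "wedge (axis {0,1,2} 1) s $ UNIV = s $ {3,4,5}"
    unfolding UNIV_6 w[OF type6_less(1) type6_less(6)] by (simp add: nth_calc)
  show "wedge (axis {0,1,3} 1) s $ UNIV = - s $ {2,4,5}"
    unfolding UNIV_6 w[OF type6_less(1) type6_less(7)] by (simp add: nth_calc)
  show "wedge (axis {0,1,4} 1) s $ UNIV = s $ {2,3,5}"
    unfolding UNIV_6 w[OF type6_less(1) type6_less(8)] by (simp add: nth_calc)
  show "wedge (axis {0,1,5} 1) s $ UNIV = - s $ {2,3,4}"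
    unfolding UNIV_6 w[OF type6_less(1) type6_less(9)] by (simp add: nth_calc)
  show "wedge (axis {0,2,3} 1) s $ UNIV = s $ {1,4,5}"
    unfolding UNIV_6 w[OF type6_less(2) type6_less(10)] by (simp add: nth_calc)
  show "wedge (axis {0,2,4} 1) s $ UNIV = - s $ {1,3,5}"
    unfolding UNIV_6 w[OF type6_less(2) type6_less(11)] by (simp add: nth_calc)
  show "wedge (axis {0,2,5} 1) s $ UNIV = s $ {1,3,4}"
    unfolding UNIV_6 w[OF type6_less(2) type6_less(12)] by (simp add: nth_calc)
  show "wedge (axis {0,3,4} 1) s $ UNIV = s $ {1,2,5}"
    unfolding UNIV_6 w[OF type6_less(3) type6_less(13)] by (simp add: nth_calc)
  show "wedge (axis {0,3,5} 1) s $ UNIV = - s $ {1,2,4}"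
    unfolding UNIV_6 w[OF type6_less(3) type6_less(14)] by (simp add: nth_calc)
  show "wedge (axis {0,4,5} 1) s $ UNIV = s $ {1,2,3}"
    unfolding UNIV_6 w[OF type6_less(4) type6_less(15)] by (simp add: nth_calc)
  show "wedge (axis {1,2,3} 1) s $ UNIV = - s $ {0,4,5}"
    unfolding UNIV_6 w[OF type6_less(6) type6_less(10)] by (simp add: nth_calc)
  show "wedge (axis {1,2,4} 1) s $ UNIV = s $ {0,3,5}"
    unfolding UNIV_6 w[OF type6_less(6) type6_less(11)] by (simp add: nth_calc)
  show "wedge (axis {1,2,5} 1) s $ UNIV = - s $ {0,3,4}"
    unfolding UNIV_6 w[OF type6_less(6) type6_less(12)] by (simp add: nth_calc)
  show "wedge (axis {1,3,4} 1) s $ UNIV = - s $ {0,2,5}"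
    unfolding UNIV_6 w[OF type6_less(7) type6_less(13)] by (simp add: nth_calc)
  show "wedge (axis {1,3,5} 1) s $ UNIV = s $ {0,2,4}"
    unfolding UNIV_6 w[OF type6_less(7) type6_less(14)] by (simp add: nth_calc)
  show "wedge (axis {1,4,5} 1) s $ UNIV = - s $ {0,2,3}"
    unfolding UNIV_6 w[OF type6_less(8) type6_less(15)] by (simp add: nth_calc)
  show "wedge (axis {2,3,4} 1) s $ UNIV = s $ {0,1,5}"
    unfolding UNIV_6 w[OF type6_less(10) type6_less(13)] by (simp add: nth_calc)
  show "wedge (axis {2,3,5} 1) s $ UNIV = - s $ {0,1,4}"
    unfolding UNIV_6 w[OF type6_less(10) type6_less(14)] by (simp add: nth_calc)
  show "wedge (axis {2,4,5} 1) s $ UNIV = s $ {0,1,3}"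
    unfolding UNIV_6 w[OF type6_less(11) type6_less(15)] by (simp add: nth_calc)
  show "wedge (axis {3,4,5} 1) s $ UNIV = - s $ {0,1,2}"
    unfolding UNIV_6 w[OF type6_less(13) type6_less(15)] by (simp add: nth_calc)
qed

lemma graded_6: assumes "graded UNIV 6 u" shows "u = u $ UNIV *s axis UNIV 1"
proof -
  have h: "u $ K = (u $ UNIV *s axis UNIV 1) $ K" for K
  proof (cases "K = UNIV")
    case True
    show ?thesis unfolding True by (simp add: axis_nth')
  next
    case False
    have "card K \<noteq> 6"
    proof
      assume "card K = 6"
      then have "card K = card (UNIV :: 6 set)" by simp
      then have "K = UNIV" by (intro card_subset_eq) simp_all
      then show False using False by simp
    qed
    then have "u $ K = 0" by (intro gradedD[OF assms]) simp
    then show ?thesis using False by (simp add: axis_nth')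
  qed
  show ?thesis unfolding vec_eq_iff by (rule allI, rule h)
qed

context tframe begin

definition om :: ext where "om = \<i> *s wedge (gen 0) (gen 3) + \<i> *s wedge (gen 1) (gen 4) + \<i> *s wedge (gen 2) (gen 5)"
definition vol :: ext where "vol = (1/6) *s wedge om (wedge om om)"

lemma volume_cst: "volume t = cst vol"
proof -
  have "omega t = cst om"
    by (simp add: omega_def frame_cst cst_cnj cnj_ext_gen type6_add3 cst_wedge cst_scale cst_add om_def)
  then show ?thesis by (simp add: volume_def cst_wedge cst_scale vol_def)
qed

lemma vol_top: "vol $ {0,1,2,3,4,5} = \<i>"
  unfolding vol_def om_def
  by (simp add: wedge_add_left wedge_add_right wedge_scale_left wedge_scale_right wedge_assoc) (simp add: nth_calc)

text \<open>Three factors i give - i, and sorting the letters into holomorphic before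
  antiholomorphic ones changes the sign once more.\<close>

lemma vol_eq: "vol = \<i> *s axis UNIV 1"
proof -
  have g: "graded UNIV 2 om" unfolding om_def by (intro graded_add graded_scale graded_word2)
  have "graded UNIV (2 + (2 + 2)) vol" unfolding vol_def by (intro graded_scale graded_wedge g)
  then have "graded UNIV 6 vol" by simp
  from graded_6[OF this] show ?thesis using vol_top by (simp only: UNIV_6)
qed

text \<open>The defining condition is linear in u and lives in top degree, so it may be checked on
  words of length 3. Uniqueness holds because each coefficient of s is detected by the complementary
  word.\<close>

lemma hodge_star_cst:
  assumes v: "graded UNIV 3 v" and s: "graded UNIV 3 s"
    and e: "\<And>I. card I = 3 \<Longrightarrow> wedge (axis I 1) s $ UNIV = cnj (v $ I) * \<i>"
  shows "hodge_star t 3 (fcnj (cst v)) = cst s"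
proof
  fix x
  have cs: "cst u x = shear (x $ 1) (B u)" for u by (simp add: cst_def Psi_def Fr_def)
  have onto: "\<exists>u'. u = cst u' x" for u
    by (rule exI[of _ "Bi (shear (- x $ 1) u)"]) (simp add: cs B_Bi shear_inverse)
  have deg: "has_degree k (cst u x) \<longleftrightarrow> graded UNIV k u" for k u
  proof -
    have sh: "graded UNIV k (shear c u)" if "graded UNIV k u" for c u
      unfolding shear_Lam
      by (rule graded_Lam[OF anticomm_shear_gen _ that]) (auto simp: shear_gen_def intro!: graded_diff graded_scale simp: graded_gen)
    have "graded UNIV k (cst u x) \<longleftrightarrow> graded UNIV k u"
    proof
      assume "graded UNIV k (cst u x)"
      from sh[OF this, of "- x $ 1"] have "graded UNIV k (B u)" by (simp add: cs shear_inverse)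
      from graded_Bi(2)[OF this] show "graded UNIV k u" by (simp add: Bi_B)
    next
      assume "graded UNIV k u"
      then show "graded UNIV k (cst u x)" unfolding cs by (intro sh graded_B(2))
    qed
    then show ?thesis by (simp add: has_degree_def graded_def)
  qed
  have wd: "wedge (cst a x) (cst b x) = cst (wedge a b) x" for a b by (simp add: cs B_wedge shear_wedge)
  have inj: "cst a x = cst b x \<longleftrightarrow> a = b" for a b
  proof
    assume "cst a x = cst b x"
    then have "shear (- x $ 1) (shear (x $ 1) (B a)) = shear (- x $ 1) (shear (x $ 1) (B b))" by (simp add: cs)
    then have "B a = B b" by (simp only: shear_inverse)
    then show "a = b" by (rule B_inj)
  qed simp
  have sc: "k *s cst a x = cst (k *s a) x" for k a by (simp add: cs clinear_scale[OF clinear_B] shear_scale)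
  have co: "coframe_coeffs t x (cst u x) = u" for u unfolding cst_def by (rule coframe_coeffs_Psi)
  define pr where "pr u = (\<Sum>I\<in>UNIV. u $ I * cnj (v $ I))" for u :: ext
  have he: "herm t x (cst u x) (cnj_ext (fcnj (cst v) x)) = pr u" for u
    by (simp add: herm_def fcnj_def cnj_ext_cnj_ext co pr_def)
  have eqn: "(\<forall>u. has_degree 3 u \<longrightarrow> wedge u (cst s' x) = herm t x u (cnj_ext (fcnj (cst v) x)) *s volume t x)
    \<longleftrightarrow> (\<forall>u. graded UNIV 3 u \<longrightarrow> wedge u s' = (pr u * \<i>) *s axis UNIV 1)" for s'
  proof -
    have "(\<forall>u. has_degree 3 u \<longrightarrow> wedge u (cst s' x) = herm t x u (cnj_ext (fcnj (cst v) x)) *s volume t x)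
      \<longleftrightarrow> (\<forall>u. has_degree 3 (cst u x) \<longrightarrow> wedge (cst u x) (cst s' x) = herm t x (cst u x) (cnj_ext (fcnj (cst v) x)) *s volume t x)"
      using onto by metis
    also have "\<dots> \<longleftrightarrow> (\<forall>u. graded UNIV 3 u \<longrightarrow> wedge u s' = (pr u * \<i>) *s axis UNIV 1)"
      by (simp only: deg wd he volume_cst sc inj vol_eq vector_smult_assoc)
    finally show ?thesis .
  qed
  have sat: "wedge u s = (pr u * \<i>) *s axis UNIV 1" if u: "graded UNIV 3 u" for u
  proof -
    have "graded UNIV (3 + 3) (wedge u s)" by (rule graded_wedge[OF u s])
    then have "wedge u s = wedge u s $ UNIV *s axis UNIV 1" by (intro graded_6) simp
    also have "wedge u s = (\<Sum>I\<in>UNIV. u $ I *s wedge (axis I 1) s)"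
      by (subst (1) ext_expand[of u]) (simp only: wedge_sum_left wedge_scale_left)
    then have "wedge u s $ UNIV = (\<Sum>I\<in>UNIV. u $ I * wedge (axis I 1) s $ UNIV)" by simp
    also have "\<dots> = (\<Sum>I\<in>UNIV. u $ I * cnj (v $ I) * \<i>)"
    proof (rule sum.cong[OF refl])
      fix I show "u $ I * wedge (axis I 1) s $ UNIV = u $ I * cnj (v $ I) * \<i>"
        using e[of I] gradedD[OF u, of I] by (cases "card I = 3") simp_all
    qed
    also have "\<dots> = pr u * \<i>" by (simp add: pr_def sum_distrib_right)
    finally show ?thesis .
  qed
  show "hodge_star t 3 (fcnj (cst v)) x = cst s x"
    unfolding hodge_star_def
  proof (rule the_equality)
    show "has_degree (6 - 3) (cst s x) \<and> (\<forall>u. has_degree 3 u \<longrightarrow> wedge u (cst s x) = herm t x u (cnj_ext (fcnj (cst v) x)) *s volume t x)"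
      unfolding eqn using sat s by (simp add: deg)
  next
    fix z assume z: "has_degree (6 - 3) z \<and> (\<forall>u. has_degree 3 u \<longrightarrow> wedge u z = herm t x u (cnj_ext (fcnj (cst v) x)) *s volume t x)"
    obtain s' where s': "z = cst s' x" using onto by blast
    have g: "graded UNIV 3 s'" and w: "\<And>u. graded UNIV 3 u \<Longrightarrow> wedge u s' = (pr u * \<i>) *s axis UNIV 1"
      using z unfolding s' eqn by (simp_all add: deg)
    have "s' $ J = s $ J" for J
    proof (cases "card J = 3")
      case True
      have "card (- J) = 3" by (simp add: Compl_eq_Diff_UNIV card_Diff_subset True)
      then have "graded UNIV 3 (axis (- J) 1)" by (simp add: graded_axis)
      then have "wedge (axis (- J) 1) s' = wedge (axis (- J) 1) s" using w sat by metis
      from arg_cong[OF this, of "\<lambda>u. u $ UNIV"] show ?thesis by (simp add: wedge_axis_top shuffle_sign_def)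
    qed (use gradedD[OF g, of J] gradedD[OF s, of J] in simp)
    then have "s' = s" by (simp add: vec_eq_iff)
    then show "z = cst s x" using s' by simp
  qed
qed

text \<open>The same four leading words as in \<open>cmb'\<close>, but with the correction
  coefficient that the star operator produces; the two differ in how the coefficients of d gamma_t
  enter.\<close>

definition cms :: "complex \<Rightarrow> complex \<Rightarrow> complex \<Rightarrow> complex \<Rightarrow> ext" where
  "cms m1 m2 m3 m4 = m1 *s axis {0,3,5} 1 + m2 *s axis {1,3,5} 1 + m3 *s axis {0,4,5} 1 + m4 *s axis {1,4,5} 1
     + ((m1 * cnj sb11 + m2 * cnj sb21 + m3 * cnj sb12 + m4 * cnj sb22) / s12) *s axis {2,3,4} 1"

lemma graded_cms: "graded {2,5} 1 (cms k1 k2 k3 k4)" "graded UNIV 3 (cms k1 k2 k3 k4)"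
  "graded hol 1 (cms k1 k2 k3 k4)" "graded antihol 2 (cms k1 k2 k3 k4)"
  unfolding cms_def by (intro graded_add graded_scale; simp add: graded_axis hol_def antihol_def type6_distinct Int_insert_left)+

text \<open>Complementation permutes the leading words up to signs and sends alpha, beta, conj gamma
  to the word {2,3,4}; the factor i comes from the volume form.\<close>

lemma star_cmb: "hodge_star t 3 (fcnj (cst (cmb k1 k2 k3 k4))) = cst (cms (\<i> * cnj k4) (- \<i> * cnj k2) (- \<i> * cnj k3) (\<i> * cnj k1))"
proof (rule hodge_star_cst[OF graded_cmb(2) graded_cms(2)])
  fix I :: "6 set" assume I: "card I = 3"
  let ?s = "cms (\<i> * cnj k4) (- \<i> * cnj k2) (- \<i> * cnj k3) (\<i> * cnj k1)"
  let ?M = "\<i> * cnj k4 * cnj sb11 + - \<i> * cnj k2 * cnj sb21 + - \<i> * cnj k3 * cnj sb12 + \<i> * cnj k1 * cnj sb22"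
  let ?K = "- cnj k1 * cnj sb22 + cnj k2 * cnj sb21 + cnj k3 * cnj sb12 - cnj k4 * cnj sb11"
  have "- ?M = ?K * \<i>" by (simp add: algebra_simps)
  then have h: "- (?M / s12) = ?K / s12 * \<i>" by (simp only: minus_divide_left times_divide_eq_left)
  note z = axis_nth' set_eq_subset type6_distinct
  have a: "?s $ {2,3,4} = ?M / s12" by (simp add: cms_def z)
  have b: "cnj (cmb k1 k2 k3 k4 $ {0,1,5}) = ?K / s12" by (simp add: cmb_def z)
  have c: "wedge (axis {0,1,5} 1) ?s $ UNIV = cnj (cmb k1 k2 k3 k4 $ {0,1,5}) * \<i>"
    unfolding wedge_top a b by (rule h)
  have n: "?s $ {0,3,5} = \<i> * cnj k4" "?s $ {1,3,5} = - \<i> * cnj k2" "?s $ {0,4,5} = - \<i> * cnj k3" "?s $ {1,4,5} = \<i> * cnj k1"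
    by (simp_all add: cms_def z)
  have n0: "?s $ {0,1,2} = 0" "?s $ {0,1,3} = 0" "?s $ {0,1,4} = 0" "?s $ {0,1,5} = 0" "?s $ {0,2,3} = 0" "?s $ {0,2,4} = 0"
    "?s $ {0,2,5} = 0" "?s $ {0,3,4} = 0" "?s $ {1,2,3} = 0" "?s $ {1,2,4} = 0" "?s $ {1,2,5} = 0" "?s $ {1,3,4} = 0"
    "?s $ {2,3,5} = 0" "?s $ {2,4,5} = 0" "?s $ {3,4,5} = 0"
    by (simp_all add: cms_def z)
  have m: "cmb k1 k2 k3 k4 $ {0,2,3} = k1" "cmb k1 k2 k3 k4 $ {0,2,4} = k2" "cmb k1 k2 k3 k4 $ {1,2,3} = k3" "cmb k1 k2 k3 k4 $ {1,2,4} = k4"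
    by (simp_all add: cmb_def z)
  have m0: "cmb k1 k2 k3 k4 $ {0,1,2} = 0" "cmb k1 k2 k3 k4 $ {0,1,3} = 0" "cmb k1 k2 k3 k4 $ {0,1,4} = 0" "cmb k1 k2 k3 k4 $ {0,2,5} = 0"
    "cmb k1 k2 k3 k4 $ {0,3,4} = 0" "cmb k1 k2 k3 k4 $ {0,3,5} = 0" "cmb k1 k2 k3 k4 $ {0,4,5} = 0" "cmb k1 k2 k3 k4 $ {1,2,5} = 0"
    "cmb k1 k2 k3 k4 $ {1,3,4} = 0" "cmb k1 k2 k3 k4 $ {1,3,5} = 0" "cmb k1 k2 k3 k4 $ {1,4,5} = 0" "cmb k1 k2 k3 k4 $ {2,3,4} = 0"
    "cmb k1 k2 k3 k4 $ {2,3,5} = 0" "cmb k1 k2 k3 k4 $ {2,4,5} = 0" "cmb k1 k2 k3 k4 $ {3,4,5} = 0"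
    by (simp_all add: cmb_def z)
  show "wedge (axis I 1) ?s $ UNIV = cnj (cmb k1 k2 k3 k4 $ I) * \<i>"
  proof (rule card3_induct[where P="\<lambda>I. wedge (axis I 1) ?s $ UNIV = cnj (cmb k1 k2 k3 k4 $ I) * \<i>", OF I])
    show "wedge (axis {0,1,5} 1) ?s $ UNIV = cnj (cmb k1 k2 k3 k4 $ {0,1,5}) * \<i>" by (rule c)
  qed (simp_all only: wedge_top n n0 m m0, simp_all)
qed

text \<open>The (1,2) part of d(gamma_t \<and> conj gamma_t), the exact form by which star images
  and conjugates differ.\<close>

definition rel :: ext where
  "rel = sb11 *s axis {0,3,5} 1 + sb21 *s axis {1,3,5} 1 + sb12 *s axis {0,4,5} 1 + sb22 *s axis {1,4,5} 1 - cnj s12 *s axis {2,3,4} 1"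

lemma rel_exact: "cst (x *s rel) \<in> delbar_boundaries t 1 2"
proof -
  have g: "graded UNIV (1 + 2) (dT (axis {2,5} 1))" using graded_dT(2)[of 1 "axis {2,5} 1"] by (simp add: graded_axis type6_distinct numeral_2_eq_2)
  have "QQ 1 2 (dT (axis {2,5} 1)) $ K = rel $ K" for K
  proof (cases "card K = 3")
    case True
    have z: "dT (axis {2,5} 1) $ {0,3,4} = 0" "dT (axis {2,5} 1) $ {1,3,4} = 0" "dT (axis {2,5} 1) $ {2,3,5} = 0" "dT (axis {2,5} 1) $ {2,4,5} = 0"
      by (simp_all add: dT_expand nth_calc axis_nth')
    show ?thesis
      by (rule card3_induct[where P="\<lambda>K. QQ 1 2 (dT (axis {2,5} 1)) $ K = rel $ K", OF True])
        (simp_all add: QQ_def bid_calc rel_def axis_nth' set_eq_subset dT_weight1 z)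
  next
    case False
    have "dT (axis {2,5} 1) $ K = 0" by (rule gradedD[OF g]) (use False in simp)
    moreover have "rel $ K = 0"
    proof -
      have ne: "K \<noteq> {i, j, k}" if "card {i, j, k} = 3" for i j k using False that by auto
      show ?thesis using ne[of 0 3 5] ne[of 1 3 5] ne[of 0 4 5] ne[of 1 4 5] ne[of 2 3 4] by (simp add: rel_def axis_nth' type6_distinct)
    qed
    ultimately show ?thesis by (simp add: QQ_def)
  qed
  then have "QQ 1 2 (dT (axis {2,5} 1)) = rel" by (simp add: vec_eq_iff)
  then have "delbar t 1 1 (cst (axis {2,5} 1)) = cst rel" by (simp add: delbar_cst numeral_2_eq_2)
  moreover have "cst (axis {2,5} 1) \<in> pq_forms t 1 1" by (rule cst_pq) (simp add: QQ_axis bid_calc)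
  ultimately have "cst rel \<in> delbar_boundaries t 1 2" unfolding delbar_boundaries_def by (auto intro: rev_image_eqI)
  from fsub_scale[OF fsub_Dolb(2) this, of x] show ?thesis by (simp add: cst_scale)
qed

text \<open>Subtracting x times \<open>rel\<close> changes the leading coefficients as well as the
  last one; the requirement that the last one become that of \<open>cmb'\<close> is a linear
  equation for x with the former determinant of \<open>Q_nonzero\<close>.\<close>

lemma cms_cmb': "\<exists>l1 l2 l3 l4. cst (cms m1 m2 m3 m4) - cst (cmb' l1 l2 l3 l4) \<in> delbar_boundaries t 1 2"
proof -
  let ?Q = "s12 * cnj s12 + (sb21 * cnj sb21 + sb12 * cnj sb12 + (- sb11) * cnj sb22 + (- sb22) * cnj sb11)"
  let ?N = "- m1 * cnj sb22 + m2 * cnj sb21 + m3 * cnj sb12 - m4 * cnj sb11"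
  let ?N' = "m1 * cnj sb11 + m2 * cnj sb21 + m3 * cnj sb12 + m4 * cnj sb22"
  define x where "x = (?N - ?N') / ?Q"
  have x: "x * ?Q = ?N - ?N'" using Q_nonzero(1) by (simp add: x_def)
  have "?N' / s12 - (- (m1 - x * sb11) * cnj sb22 + (m2 - x * sb21) * cnj sb21 + (m3 - x * sb12) * cnj sb12 - (m4 - x * sb22) * cnj sb11) / s12
    = (- x * cnj s12 * s12) / s12"
    unfolding diff_divide_distrib[symmetric] using x by (intro arg_cong[where f="\<lambda>z. z / s12"]) (simp add: algebra_simps)
  then have h: "?N' / s12 - (- (m1 - x * sb11) * cnj sb22 + (m2 - x * sb21) * cnj sb21 + (m3 - x * sb12) * cnj sb12 - (m4 - x * sb22) * cnj sb11) / s12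
    = - x * cnj s12" using s12_nonzero by simp
  have "cms m1 m2 m3 m4 - cmb' (m1 - x * sb11) (m2 - x * sb21) (m3 - x * sb12) (m4 - x * sb22)
    = (x * sb11) *s axis {0,3,5} 1 + (x * sb21) *s axis {1,3,5} 1 + (x * sb12) *s axis {0,4,5} 1 + (x * sb22) *s axis {1,4,5} 1
     + (?N' / s12 - (- (m1 - x * sb11) * cnj sb22 + (m2 - x * sb21) * cnj sb21 + (m3 - x * sb12) * cnj sb12 - (m4 - x * sb22) * cnj sb11) / s12) *s axis {2,3,4} 1"
    unfolding cms_def cmb'_def vec.scale_left_diff_distrib by simp
  also have "\<dots> = x *s rel" unfolding h rel_def
    by (simp add: vec.scale_right_distrib vec.scale_right_diff_distrib)
  finally have e: "cms m1 m2 m3 m4 - cmb' (m1 - x * sb11) (m2 - x * sb21) (m3 - x * sb12) (m4 - x * sb22) = x *s rel" .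
  have "cst (cms m1 m2 m3 m4) - cst (cmb' (m1 - x * sb11) (m2 - x * sb21) (m3 - x * sb12) (m4 - x * sb22)) \<in> delbar_boundaries t 1 2"
    unfolding cst_diff e by (rule rel_exact)
  then show ?thesis by blast
qed

text \<open>The same elimination in the other direction; the latter determinant of
  \<open>Q_nonzero\<close> occurs because the correction of \<open>cms\<close> pairs each
  coefficient with its own conjugate.\<close>

lemma cmb'_cms: "\<exists>m1 m2 m3 m4. cst (cmb' l1 l2 l3 l4) - cst (cms m1 m2 m3 m4) \<in> delbar_boundaries t 1 2"
proof -
  let ?Q = "s12 * cnj s12 + (sb21 * cnj sb21 + sb12 * cnj sb12 + sb11 * cnj sb11 + sb22 * cnj sb22)"
  let ?N = "- l1 * cnj sb22 + l2 * cnj sb21 + l3 * cnj sb12 - l4 * cnj sb11"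
  let ?N' = "l1 * cnj sb11 + l2 * cnj sb21 + l3 * cnj sb12 + l4 * cnj sb22"
  define x where "x = (?N' - ?N) / ?Q"
  have x: "x * ?Q = ?N' - ?N" using Q_nonzero(2) by (simp add: x_def)
  have "?N / s12 - ((l1 - x * sb11) * cnj sb11 + (l2 - x * sb21) * cnj sb21 + (l3 - x * sb12) * cnj sb12 + (l4 - x * sb22) * cnj sb22) / s12
    = (- x * cnj s12 * s12) / s12"
    unfolding diff_divide_distrib[symmetric] using x by (intro arg_cong[where f="\<lambda>z. z / s12"]) (simp add: algebra_simps)
  then have h: "?N / s12 - ((l1 - x * sb11) * cnj sb11 + (l2 - x * sb21) * cnj sb21 + (l3 - x * sb12) * cnj sb12 + (l4 - x * sb22) * cnj sb22) / s12
    = - x * cnj s12" using s12_nonzero by simp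
  have "cmb' l1 l2 l3 l4 - cms (l1 - x * sb11) (l2 - x * sb21) (l3 - x * sb12) (l4 - x * sb22)
    = (x * sb11) *s axis {0,3,5} 1 + (x * sb21) *s axis {1,3,5} 1 + (x * sb12) *s axis {0,4,5} 1 + (x * sb22) *s axis {1,4,5} 1
     + (?N / s12 - ((l1 - x * sb11) * cnj sb11 + (l2 - x * sb21) * cnj sb21 + (l3 - x * sb12) * cnj sb12 + (l4 - x * sb22) * cnj sb22) / s12) *s axis {2,3,4} 1"
    unfolding cms_def cmb'_def vec.scale_left_diff_distrib by simp
  also have "\<dots> = x *s rel" unfolding h rel_def
    by (simp add: vec.scale_right_distrib vec.scale_right_diff_distrib)
  finally have e: "cmb' l1 l2 l3 l4 - cms (l1 - x * sb11) (l2 - x * sb21) (l3 - x * sb12) (l4 - x * sb22) = x *s rel" .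
  have "cst (cmb' l1 l2 l3 l4) - cst (cms (l1 - x * sb11) (l2 - x * sb21) (l3 - x * sb12) (l4 - x * sb22)) \<in> delbar_boundaries t 1 2"
    unfolding cst_diff e by (rule rel_exact)
  then show ?thesis by blast
qed

text \<open>The form need not be d-closed, but its differential is a multiple of the only weight
  zero word of degree 4, which has type (2,2) and so no (1,3) part.\<close>

lemma closed_cms: "cst (cms k1 k2 k3 k4) \<in> {u \<in> pq_forms t 1 2. delbar t 1 2 u = 0}"
proof -
  have q: "QQ 1 2 (cms k1 k2 k3 k4) = cms k1 k2 k3 k4" using QQ_graded[OF graded_cms(3,4), where p=1 and q=2] by simp
  have "QQ 1 (2 + 1) (dT (cms k1 k2 k3 k4)) $ K = 0" for K
  proof (cases "K = {0,1,3,4}")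
    case True then show ?thesis by (simp add: QQ_def bid_calc)
  next
    case False
    let ?u = "dT (cms k1 k2 k3 k4)"
    have "graded UNIV (2 + 2) ?u" by (rule graded_dT(2)) (use graded_cms(2)[of k1 k2 k3 k4] in \<open>simp add: numeral_3_eq_3 numeral_2_eq_2\<close>)
    then have g: "graded {2,5} 0 ?u" "graded UNIV 4 ?u" using graded_dT(1)[of 0 "cms k1 k2 k3 k4"] graded_cms(1)[of k1 k2 k3 k4] by simp_all
    have "?u - ?u $ {0,1,3,4} *s axis {0,1,3,4} 1 = 0"
    proof -
      have ga: "graded {2,5} 0 (axis {0,1,3,4} 1)" "graded UNIV 4 (axis {0,1,3,4} 1)" by (simp_all add: graded_axis type6_distinct)
      show ?thesis
        by (rule weight0_degree4[OF graded_diff[OF g(1) graded_scale[OF ga(1)]] graded_diff[OF g(2) graded_scale[OF ga(2)]]]) simp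
    qed
    then have "?u $ K = (?u $ {0,1,3,4} *s axis {0,1,3,4} 1) $ K" by simp
    then show ?thesis using False by (simp add: QQ_def axis_nth')
  qed
  then have "QQ 1 (2 + 1) (dT (cms k1 k2 k3 k4)) = 0" by (simp only: vec_eq_iff zero_index) simp
  then show ?thesis using cst_pq[OF q] by (simp add: delbar_cst cst_zero)
qed

section \<open>The isomorphisms\<close>

text \<open>The space defined through the star operator is described by conjugates of the Gammas;
  this makes the Hodge symmetry plain conjugation of representatives.\<close>

lemma H12_carrier: "lin_span (H_Dolb t 1 2) ((\<lambda>u. Dolb_class t 1 2 (hodge_star t 3 (fcnj u))) ` Gammas t)
    = Dolb_class t 1 2 ` {cst (cmb' l1 l2 l3 l4) | l1 l2 l3 l4. True}"
proof -
  let ?B = "delbar_boundaries t 1 2" and ?Z = "{u \<in> pq_forms t 1 2. delbar t 1 2 u = 0}"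
  let ?G = "{cst (cms 0 0 0 \<i>), cst (cms 0 (- \<i>) 0 0), cst (cms 0 0 (- \<i>) 0), cst (cms \<i> 0 0 0)}"
  have s: "(\<lambda>u. Dolb_class t 1 2 (hodge_star t 3 (fcnj u))) ` Gammas t = cohom_class ?B ` ?G"
    by (simp add: Gammas_def Gamma_cst star_cmb Dolb_class_def)
  have "lin_span (H_Dolb t 1 2) (cohom_class ?B ` ?G) = cohom_class ?B ` comb4 (cst (cms 0 0 0 \<i>)) (cst (cms 0 (- \<i>) 0 0)) (cst (cms 0 0 (- \<i>) 0)) (cst (cms \<i> 0 0 0))"
    unfolding H_Dolb_def by (rule lin_span_classes[OF fsub_Dolb(2) fsub_Dolb(1)]) (simp only: insert_subset closed_cms empty_subsetI simp_thms)
  also have "comb4 (cst (cms 0 0 0 \<i>)) (cst (cms 0 (- \<i>) 0 0)) (cst (cms 0 0 (- \<i>) 0)) (cst (cms \<i> 0 0 0)) = {cst (cms m1 m2 m3 m4) | m1 m2 m3 m4. True}"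
  proof -
    have e: "k1 \<cdot> cst (cms 0 0 0 \<i>) + k2 \<cdot> cst (cms 0 (- \<i>) 0 0) + k3 \<cdot> cst (cms 0 0 (- \<i>) 0) + k4 \<cdot> cst (cms \<i> 0 0 0)
      = cst (cms (k4 * \<i>) (- k2 * \<i>) (- k3 * \<i>) (k1 * \<i>))" for k1 k2 k3 k4
      unfolding cst_scale cst_add cst_inject cms_def
      by (simp add: vec_eq_iff algebra_simps add_divide_distrib diff_divide_distrib)
    have "cst (cms m1 m2 m3 m4) \<in> comb4 (cst (cms 0 0 0 \<i>)) (cst (cms 0 (- \<i>) 0 0)) (cst (cms 0 0 (- \<i>) 0)) (cst (cms \<i> 0 0 0))" for m1 m2 m3 m4
      using comb4I[of "- \<i> * m4" "cst (cms 0 0 0 \<i>)" "\<i> * m2" "cst (cms 0 (- \<i>) 0 0)" "\<i> * m3" "cst (cms 0 0 (- \<i>) 0)" "- \<i> * m1" "cst (cms \<i> 0 0 0)"]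
      unfolding e by (simp add: algebra_simps mult.assoc[symmetric])
    then show ?thesis unfolding comb4_def e by blast
  qed
  also have "cohom_class ?B ` {cst (cms m1 m2 m3 m4) | m1 m2 m3 m4. True} = cohom_class ?B ` {cst (cmb' l1 l2 l3 l4) | l1 l2 l3 l4. True}"
  proof (intro equalityI subsetI)
    fix X assume "X \<in> cohom_class ?B ` {cst (cms m1 m2 m3 m4) | m1 m2 m3 m4. True}"
    then obtain m1 m2 m3 m4 where X: "X = cohom_class ?B (cst (cms m1 m2 m3 m4))" by blast
    obtain l1 l2 l3 l4 where "cst (cms m1 m2 m3 m4) - cst (cmb' l1 l2 l3 l4) \<in> ?B" using cms_cmb' by blast
    then have "X = cohom_class ?B (cst (cmb' l1 l2 l3 l4))" unfolding X class_eq_iff[OF fsub_Dolb(2)] .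
    then show "X \<in> cohom_class ?B ` {cst (cmb' l1 l2 l3 l4) | l1 l2 l3 l4. True}" by blast
  next
    fix X assume "X \<in> cohom_class ?B ` {cst (cmb' l1 l2 l3 l4) | l1 l2 l3 l4. True}"
    then obtain l1 l2 l3 l4 where X: "X = cohom_class ?B (cst (cmb' l1 l2 l3 l4))" by blast
    obtain m1 m2 m3 m4 where "cst (cmb' l1 l2 l3 l4) - cst (cms m1 m2 m3 m4) \<in> ?B" using cmb'_cms by blast
    then have "X = cohom_class ?B (cst (cms m1 m2 m3 m4))" unfolding X class_eq_iff[OF fsub_Dolb(2)] .
    then show "X \<in> cohom_class ?B ` {cst (cms m1 m2 m3 m4) | m1 m2 m3 m4. True}" by blast
  qed
  finally show ?thesis unfolding s unfolding Dolb_class_def[abs_def] .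
qed

lemma fcnj_cmb: "fcnj (cst (cmb k1 k2 k3 k4)) = cst (cmb' (cnj k1) (cnj k2) (cnj k3) (cnj k4))"
  by (simp add: cst_cnj cnj_cmb)

lemma fcnj_012: "fcnj (cst (a *s axis {0,1,2} 1)) = cst (cnj a *s axis {3,4,5} 1)"
  by (simp add: cst_cnj cnj_ext_scale cnj_words)

text \<open>There are no boundaries in type (3,0), so the classes are the closed forms themselves,
  and these are the constant ones.\<close>

lemma bij_30: "bij_betw (Dolb_class t 3 0) (span30 t) (carrier (H_Dolb t 3 0))"
  unfolding bij_betw_def
proof
  have b: "delbar_boundaries t 3 0 = {0}" by (simp add: delbar_boundaries_def)
  show "inj_on (Dolb_class t 3 0) (span30 t)"
    by (rule inj_onI) (simp add: Dolb_class_def b class_eq_iff[OF fsub_zero])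
  have "cst (a *s axis {0,1,2} 1) \<in> {u \<in> pq_forms t 3 0. delbar t 3 0 u = 0}" for a
  proof -
    have "QQ 3 0 (a *s axis {0,1,2} 1) = a *s axis {0,1,2} 1" by (simp add: clinear_scale[OF clinear_QQ] QQ_axis bidegree_30)
    from cst_pq[OF this] show ?thesis
      by (simp add: delbar_cst clinear_scale[OF clinear_dT] dT_012 clinear_zero[OF clinear_QQ] cst_zero)
  qed
  then have "span30 t = {u \<in> pq_forms t 3 0. delbar t 3 0 u = 0}" unfolding span30_eq using closed_30 by auto
  then show "Dolb_class t 3 0 ` span30 t = carrier (H_Dolb t 3 0)"
    by (simp add: H_Dolb_def quotient_carrier Dolb_class_def)
qed

lemma bij_03: "bij_betw (\<lambda>s. Dolb_class t 0 3 (fcnj s)) (span30 t) (carrier (H_Dolb t 0 3))"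
  unfolding bij_betw_def
proof
  show "inj_on (\<lambda>s. Dolb_class t 0 3 (fcnj s)) (span30 t)"
  proof (rule inj_onI)
    fix u v assume uv: "u \<in> span30 t" "v \<in> span30 t" "Dolb_class t 0 3 (fcnj u) = Dolb_class t 0 3 (fcnj v)"
    obtain a b where ab: "u = cst (a *s axis {0,1,2} 1)" "v = cst (b *s axis {0,1,2} 1)" using uv unfolding span30_eq by blast
    have "cst ((cnj a - cnj b) *s axis {3,4,5} 1) \<in> delbar_boundaries t 0 3"
      using uv(3) unfolding ab fcnj_012 Dolb_class_def class_eq_iff[OF fsub_Dolb(2)] by (simp add: cst_diff vec.scale_left_diff_distrib)
    from exact_03[OF this] show "u = v" by (simp add: ab)
  qed
  let ?Z = "{u \<in> pq_forms t 0 3. delbar t 0 3 u = 0}"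
  have z: "cst (cnj a *s axis {3,4,5} 1) \<in> ?Z" for a
  proof -
    have "QQ 0 3 (cnj a *s axis {3,4,5} 1) = cnj a *s axis {3,4,5} 1" by (simp add: clinear_scale[OF clinear_QQ] QQ_axis bidegree_03)
    from cst_pq[OF this] show ?thesis
      by (simp add: delbar_cst clinear_scale[OF clinear_dT] dT_012 clinear_zero[OF clinear_QQ] cst_zero)
  qed
  show "(\<lambda>s. Dolb_class t 0 3 (fcnj s)) ` span30 t = carrier (H_Dolb t 0 3)"
    unfolding H_Dolb_def quotient_carrier Dolb_class_def[abs_def]
  proof (intro equalityI subsetI)
    fix X assume "X \<in> (\<lambda>s. cohom_class (delbar_boundaries t 0 3) (fcnj s)) ` span30 t"
    then show "X \<in> cohom_class (delbar_boundaries t 0 3) ` ?Z" using z unfolding span30_eq by (auto simp: fcnj_012 intro!: imageI)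
  next
    fix X assume "X \<in> cohom_class (delbar_boundaries t 0 3) ` ?Z"
    then obtain u where u: "u \<in> pq_forms t 0 3" "X = cohom_class (delbar_boundaries t 0 3) u" by blast
    obtain a where "u - cst (a *s axis {3,4,5} 1) \<in> delbar_boundaries t 0 3" using class_03[OF u(1)] by blast
    then have "X = cohom_class (delbar_boundaries t 0 3) (fcnj (cst (cnj a *s axis {0,1,2} 1)))"
      unfolding u(2) fcnj_012 class_eq_iff[OF fsub_Dolb(2)] by simp
    then show "X \<in> (\<lambda>s. cohom_class (delbar_boundaries t 0 3) (fcnj s)) ` span30 t" unfolding span30_eq by blast
  qed
qed

lemma H21_carrier: "carrier (H21_gamma t) = Dolb_class t 2 1 ` span21 t"
proof -
  have "lin_span (H_Dolb t 2 1) (Dolb_class t 2 1 ` Gammas t) = Dolb_class t 2 1 ` span21 t"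
    unfolding span21_def Gammas_def lin_span_form_space H_Dolb_def Dolb_class_def[abs_def]
    by (rule lin_span_classes[OF fsub_Dolb(2) fsub_Dolb(1)]) (simp only: Gamma_cst insert_subset closed_cmb empty_subsetI simp_thms)
  then show ?thesis by (simp add: H21_gamma_def)
qed

lemma bij_21: "bij_betw (Dolb_class t 2 1) (span21 t) (carrier (H21_gamma t))"
  unfolding bij_betw_def H21_carrier
proof (intro conjI refl inj_onI)
  fix u v assume uv: "u \<in> span21 t" "v \<in> span21 t" "Dolb_class t 2 1 u = Dolb_class t 2 1 v"
  obtain k1 k2 k3 k4 where u: "u = cst (cmb k1 k2 k3 k4)" using uv(1) unfolding span21_eq by blast
  obtain l1 l2 l3 l4 where v: "v = cst (cmb l1 l2 l3 l4)" using uv(2) unfolding span21_eq by blast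
  have d: "cmb k1 k2 k3 k4 - cmb l1 l2 l3 l4 = cmb (k1 - l1) (k2 - l2) (k3 - l3) (k4 - l4)"
    using cmb_linear(1)[of "k1 - l1" l1 "k2 - l2" l2 "k3 - l3" l3 "k4 - l4" l4] by simp
  have "cst (cmb (k1 - l1) (k2 - l2) (k3 - l3) (k4 - l4)) \<in> delbar_boundaries t 2 1"
    using uv(3) unfolding u v Dolb_class_def class_eq_iff[OF fsub_Dolb(2)] cst_diff d .
  from exact_21[OF this] show "u = v" by (simp add: u v)
qed

lemma cmb'_conj_set: "{cst (cmb' l1 l2 l3 l4) | l1 l2 l3 l4. True} = fcnj ` span21 t"
proof (intro equalityI subsetI)
  fix X assume "X \<in> {cst (cmb' l1 l2 l3 l4) | l1 l2 l3 l4. True}"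
  then obtain l1 l2 l3 l4 where "X = cst (cmb' l1 l2 l3 l4)" by blast
  then have "X = fcnj (cst (cmb (cnj l1) (cnj l2) (cnj l3) (cnj l4)))" by (simp add: fcnj_cmb)
  then show "X \<in> fcnj ` span21 t" unfolding span21_eq by blast
next
  fix X assume "X \<in> fcnj ` span21 t"
  then obtain k1 k2 k3 k4 where "X = fcnj (cst (cmb k1 k2 k3 k4))" unfolding span21_eq by blast
  then have "X = cst (cmb' (cnj k1) (cnj k2) (cnj k3) (cnj k4))" by (simp only: fcnj_cmb)
  then show "X \<in> {cst (cmb' l1 l2 l3 l4) | l1 l2 l3 l4. True}" by blast
qed

lemma H12_carrier': "carrier (H12_gamma t) = (\<lambda>w. Dolb_class t 1 2 (fcnj w)) ` span21 t"
proof -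
  have "carrier (H12_gamma t) = lin_span (H_Dolb t 1 2) ((\<lambda>u. Dolb_class t 1 2 (hodge_star t 3 (fcnj u))) ` Gammas t)"
    unfolding H12_gamma_def by simp
  also have "\<dots> = Dolb_class t 1 2 ` (fcnj ` span21 t)" unfolding H12_carrier cmb'_conj_set ..
  finally show ?thesis by (simp only: image_image)
qed

lemma bij_12: "bij_betw (\<lambda>w. Dolb_class t 1 2 (fcnj w)) (span21 t) (carrier (H12_gamma t))"
  unfolding bij_betw_def H12_carrier'
proof (intro conjI refl inj_onI)
  fix u v assume uv: "u \<in> span21 t" "v \<in> span21 t" "Dolb_class t 1 2 (fcnj u) = Dolb_class t 1 2 (fcnj v)"
  obtain k1 k2 k3 k4 where u: "u = cst (cmb k1 k2 k3 k4)" using uv(1) unfolding span21_eq by blast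
  obtain l1 l2 l3 l4 where v: "v = cst (cmb l1 l2 l3 l4)" using uv(2) unfolding span21_eq by blast
  have d: "cmb' a1 a2 a3 a4 - cmb' b1 b2 b3 b4 = cmb' (a1 - b1) (a2 - b2) (a3 - b3) (a4 - b4)" for a1 a2 a3 a4 b1 b2 b3 b4
    using cmb_linear(2)[of "a1 - b1" b1 "a2 - b2" b2 "a3 - b3" b3 "a4 - b4" b4] by simp
  have "cst (cmb' (cnj k1 - cnj l1) (cnj k2 - cnj l2) (cnj k3 - cnj l3) (cnj k4 - cnj l4)) \<in> delbar_boundaries t 1 2"
    using uv(3) unfolding u v fcnj_cmb Dolb_class_def class_eq_iff[OF fsub_Dolb(2)] cst_diff d .
  from exact_12[OF this] show "u = v" by (simp add: u v)
qed

lemma rep_cst: "cst (a *s axis {0,1,2} 1) + cst (cmb k1 k2 k3 k4) + fcnj (cst (cmb l1 l2 l3 l4)) + fcnj (cst (b *s axis {0,1,2} 1))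
    = cst (rep a k1 k2 k3 k4 (cnj l1) (cnj l2) (cnj l3) (cnj l4) (cnj b))"
  by (simp add: fcnj_cmb fcnj_012 cst_add rep_def)

text \<open>The form is moved to the frame of X_0, reduced there to a constant closed form by the
  homotopy, and that constant form is replaced by a representative in the frame of X_t.\<close>

lemma dR_surjective:
  assumes "u \<in> kforms 3" "ext_d u = 0"
  shows "\<exists>a k1 k2 k3 k4 l1 l2 l3 l4 b. u - cst (rep a k1 k2 k3 k4 l1 l2 l3 l4 b) \<in> dR_boundaries 3"
proof -
  obtain w where w: "inv_form w" "\<And>x. graded UNIV 3 (w x)" "u = Psi w" using assms(1) unfolding kforms_Psi by blast
  define v where "v x = B (w x)" for x
  have v: "inv_form v" "\<And>x. graded UNIV 3 (v x)" "u = Fr v"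
    unfolding v_def[abs_def] using inv_form_clinear[OF clinear_B w(1)] graded_B(2)[OF w(2)] w(3) by (simp_all add: Psi_def)
  have "Fr (Dl v) = Fr (\<lambda>x. 0)"
    using assms(2) unfolding v(3) ext_d_Fr[OF v(1)] by (simp add: Fr_def fun_eq_iff clinear_zero[OF clinear_shear])
  then have Dv: "Dl v = (\<lambda>x. 0)" by (simp only: Fr_inject)
  obtain c y where cy: "graded UNIV 3 c" "inv_form y" "\<And>x. graded UNIV 2 (y x)" "v = (\<lambda>x. c + Dl y x)"
    by (rule closed_form_decomposition[OF v(1) Dv v(2)], rule that)
  have "Dl (\<lambda>x. c + 1 *s Dl y x) = (\<lambda>x. dlt c)"
    by (simp only: Dl_comb[OF inv_form_const inv_form_Dl[OF cy(2)]] Dl_const Dl_Dl[OF cy(2)]) simp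
  moreover have "(\<lambda>x. c + 1 *s Dl y x) = v" by (simp add: cy(4))
  ultimately have "dlt c = 0" using Dv by (simp add: fun_eq_iff)
  then obtain a k1 k2 k3 k4 l1 l2 l3 l4 b z where z: "graded UNIV 2 z" "c = B (rep a k1 k2 k3 k4 l1 l2 l3 l4 b) + dlt z"
    by (rule const_representation[OF cy(1)])
  let ?r = "rep a k1 k2 k3 k4 l1 l2 l3 l4 b" and ?y = "\<lambda>x. z + 1 *s y x"
  have iy: "inv_form ?y" by (intro inv_form_add inv_form_const inv_form_scale cy(2))
  have "u - cst ?r = Fr (\<lambda>x. v x - B ?r)" by (simp add: v(3) cst_def Psi_def diff_Fr)
  also have "(\<lambda>x. v x - B ?r) = Dl ?y"
    by (simp only: Dl_comb[OF inv_form_const cy(2)] Dl_const) (simp add: cy(4) z(2))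
  also have "Fr (Dl ?y) = ext_d (Fr ?y)" by (rule ext_d_Fr[OF iy, symmetric])
  also have "Fr ?y = Psi (\<lambda>x. Bi (?y x))" by (simp add: Psi_def B_Bi)
  finally have e: "u - cst ?r = ext_d (Psi (\<lambda>x. Bi (?y x)))" .
  have "Psi (\<lambda>x. Bi (?y x)) \<in> kforms 2" unfolding kforms_Psi
    using inv_form_clinear[OF clinear_Bi iy] graded_Bi(2)[OF graded_add[OF z(1) graded_scale[OF cy(3)]]] by blast
  then have "u - cst ?r \<in> dR_boundaries 3" unfolding e dR_boundaries_def by simp
  then show ?thesis by blast
qed

text \<open>The last two entries are stored before conjugation, so all four lie in the spans of
  (3,0) and (2,1) representatives.\<close>

definition SS :: "(form \<times> form \<times> form \<times> form) set" where
  "SS = span30 t \<times> span21 t \<times> span21 t \<times> span30 t"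

definition rdR :: "form \<times> form \<times> form \<times> form \<Rightarrow> form set" where
  "rdR = (\<lambda>(u, v, w, s). dR_class 3 (u + v + fcnj w + fcnj s))"

definition rD :: "form \<times> form \<times> form \<times> form \<Rightarrow> form set \<times> form set \<times> form set \<times> form set" where
  "rD = (\<lambda>(u, v, w, s). (Dolb_class t 3 0 u, Dolb_class t 2 1 v, Dolb_class t 1 2 (fcnj w), Dolb_class t 0 3 (fcnj s)))"

lemma SS_E:
  assumes "x \<in> SS"
  obtains a k1 k2 k3 k4 l1 l2 l3 l4 b where
    "x = (cst (a *s axis {0,1,2} 1), cst (cmb k1 k2 k3 k4), cst (cmb l1 l2 l3 l4), cst (b *s axis {0,1,2} 1))"
  using assms unfolding SS_def span21_eq span30_eq by blast

lemma SS_I: "(cst (a *s axis {0,1,2} 1), cst (cmb k1 k2 k3 k4), cst (cmb l1 l2 l3 l4), cst (b *s axis {0,1,2} 1)) \<in> SS"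
  unfolding SS_def span21_eq span30_eq by blast

text \<open>Injectivity comes from averaging primitives and \<open>exact_zero\<close>, surjectivity
  from \<open>dR_surjective\<close>.\<close>

lemma bij_dR: "bij_betw rdR SS (carrier (H_dR 3))"
  unfolding bij_betw_def
proof
  show "inj_on rdR SS"
  proof (rule inj_onI)
    fix x y assume xy: "x \<in> SS" "y \<in> SS" "rdR x = rdR y"
    obtain a k1 k2 k3 k4 l1 l2 l3 l4 b where x: "x = (cst (a *s axis {0,1,2} 1), cst (cmb k1 k2 k3 k4), cst (cmb l1 l2 l3 l4), cst (b *s axis {0,1,2} 1))"
      by (rule SS_E[OF xy(1)])
    obtain a' k1' k2' k3' k4' l1' l2' l3' l4' b' where y: "y = (cst (a' *s axis {0,1,2} 1), cst (cmb k1' k2' k3' k4'), cst (cmb l1' l2' l3' l4'), cst (b' *s axis {0,1,2} 1))"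
      by (rule SS_E[OF xy(2)])
    have "cst (rep a k1 k2 k3 k4 (cnj l1) (cnj l2) (cnj l3) (cnj l4) (cnj b)) - cst (rep a' k1' k2' k3' k4' (cnj l1') (cnj l2') (cnj l3') (cnj l4') (cnj b')) \<in> dR_boundaries 3"
      using xy(3) unfolding x y rdR_def prod.case rep_cst dR_class_def class_eq_iff[OF fsub_dR(2)] .
    then obtain m where "rep a k1 k2 k3 k4 (cnj l1) (cnj l2) (cnj l3) (cnj l4) (cnj b) - rep a' k1' k2' k3' k4' (cnj l1') (cnj l2') (cnj l3') (cnj l4') (cnj b') = dT m"
      unfolding cst_diff using d_exact_const by blast
    moreover have "rep a k1 k2 k3 k4 (cnj l1) (cnj l2) (cnj l3) (cnj l4) (cnj b) - rep a' k1' k2' k3' k4' (cnj l1') (cnj l2') (cnj l3') (cnj l4') (cnj b')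
      = (a - a') *s axis {0,1,2} 1 + cmb (k1 - k1') (k2 - k2') (k3 - k3') (k4 - k4') + cmb' (cnj l1 - cnj l1') (cnj l2 - cnj l2') (cnj l3 - cnj l3') (cnj l4 - cnj l4') + (cnj b - cnj b') *s axis {3,4,5} 1"
    proof -
      have d1: "cmb (k1 - k1') (k2 - k2') (k3 - k3') (k4 - k4') = cmb k1 k2 k3 k4 - cmb k1' k2' k3' k4'"
        using cmb_linear(1)[of "k1 - k1'" k1' "k2 - k2'" k2' "k3 - k3'" k3' "k4 - k4'" k4'] by simp
      have d2: "cmb' (a1 - b1) (a2 - b2) (a3 - b3) (a4 - b4) = cmb' a1 a2 a3 a4 - cmb' b1 b2 b3 b4" for a1 a2 a3 a4 b1 b2 b3 b4
        using cmb_linear(2)[of "a1 - b1" b1 "a2 - b2" b2 "a3 - b3" b3 "a4 - b4" b4] by simp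
      show ?thesis unfolding rep_def d1 d2 vec.scale_left_diff_distrib by (simp add: algebra_simps)
    qed
    ultimately have "(a - a') *s axis {0,1,2} 1 + cmb (k1 - k1') (k2 - k2') (k3 - k3') (k4 - k4') + cmb' (cnj l1 - cnj l1') (cnj l2 - cnj l2') (cnj l3 - cnj l3') (cnj l4 - cnj l4') + (cnj b - cnj b') *s axis {3,4,5} 1 = dT m"
      by (simp only:)
    from exact_zero[OF this] show "x = y" by (simp add: x y)
  qed
  have k: "cst (rep a k1 k2 k3 k4 l1 l2 l3 l4 b) \<in> {u \<in> kforms 3. ext_d u = 0}" for a k1 k2 k3 k4 l1 l2 l3 l4 b
    unfolding kforms_Psi using graded_rep[of a k1 k2 k3 k4 l1 l2 l3 l4 b] inv_form_const
    by (auto simp: ext_d_cst dT_rep cst_zero) (auto simp: cst_def)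
  show "rdR ` SS = carrier (H_dR 3)" unfolding H_dR_def quotient_carrier
  proof (intro equalityI subsetI)
    fix X assume "X \<in> rdR ` SS"
    then obtain x where x: "x \<in> SS" "X = rdR x" by blast
    obtain a k1 k2 k3 k4 l1 l2 l3 l4 b where "x = (cst (a *s axis {0,1,2} 1), cst (cmb k1 k2 k3 k4), cst (cmb l1 l2 l3 l4), cst (b *s axis {0,1,2} 1))"
      by (rule SS_E[OF x(1)])
    then have "X = cohom_class (dR_boundaries 3) (cst (rep a k1 k2 k3 k4 (cnj l1) (cnj l2) (cnj l3) (cnj l4) (cnj b)))"
      unfolding x(2) by (simp only: rdR_def prod.case rep_cst dR_class_def)
    then show "X \<in> cohom_class (dR_boundaries 3) ` {u \<in> kforms 3. ext_d u = 0}" using k by blast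
  next
    fix X assume "X \<in> cohom_class (dR_boundaries 3) ` {u \<in> kforms 3. ext_d u = 0}"
    then obtain u where u: "u \<in> kforms 3" "ext_d u = 0" "X = cohom_class (dR_boundaries 3) u" by blast
    obtain a k1 k2 k3 k4 l1 l2 l3 l4 b where "u - cst (rep a k1 k2 k3 k4 l1 l2 l3 l4 b) \<in> dR_boundaries 3"
      using dR_surjective[OF u(1,2)] by blast
    then have "X = cohom_class (dR_boundaries 3) (cst (rep a k1 k2 k3 k4 l1 l2 l3 l4 b))"
      unfolding u(3) class_eq_iff[OF fsub_dR(2)] .
    also have "\<dots> = rdR (cst (a *s axis {0,1,2} 1), cst (cmb k1 k2 k3 k4), cst (cmb (cnj l1) (cnj l2) (cnj l3) (cnj l4)), cst (cnj b *s axis {0,1,2} 1))"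
      by (simp only: rdR_def prod.case rep_cst dR_class_def complex_cnj_cnj)
    finally show "X \<in> rdR ` SS" using SS_I by blast
  qed
qed

lemma fsub_span: "fsub (span30 t)" "fsub (span21 t)"
proof -
  show "fsub (span21 t)" unfolding span21_def Gammas_def lin_span_form_space by (rule fsub_comb4)
  have "lin_span form_space {X} = comb4 X X X X" for X using lin_span_form_space[of X X X X] by simp
  then show "fsub (span30 t)" unfolding span30_def by (simp add: fsub_comb4)
qed

lemma modules:
  "Module.module complex_field (H_dR 3)" "Module.module complex_field (H_Dolb t p q)"
  "Module.module complex_field (H21_gamma t)" "Module.module complex_field (H12_gamma t)"
proof -
  show "Module.module complex_field (H_dR 3)" unfolding H_dR_def by (rule module_quotient[OF fsub_dR(2,1)])
  show "Module.module complex_field (H_Dolb t p q)" unfolding H_Dolb_def by (rule module_quotient[OF fsub_Dolb(2,1)])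
  have "H21_gamma t = (quotient_space {u \<in> pq_forms t 2 1. delbar t 2 1 u = 0} (delbar_boundaries t 2 1))\<lparr>carrier := cohom_class (delbar_boundaries t 2 1) ` span21 t\<rparr>"
    using H21_carrier by (simp add: H21_gamma_def H_Dolb_def Dolb_class_def[abs_def])
  then show "Module.module complex_field (H21_gamma t)" using module_of_classes[OF fsub_Dolb(2) fsub_span(2)] by simp
  have f: "fsub (fcnj ` span21 t)"
  proof -
    have c: "fcnj (u + v) = fcnj u + fcnj v" "cnj c \<cdot> fcnj u = fcnj (c \<cdot> u)" for u v c
      by (simp_all add: fcnj_def fscale_def fun_eq_iff cnj_ext_add cnj_ext_scale)
    show ?thesis unfolding fsub_def
    proof (intro conjI ballI allI)
      have "fcnj 0 = 0" using c(2)[of 0 0] by (simp add: fscale_simps)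
      then show "0 \<in> fcnj ` span21 t" using imageI[OF fsub_0[OF fsub_span(2)], of fcnj] by simp
    next
      fix u v assume "u \<in> fcnj ` span21 t" "v \<in> fcnj ` span21 t"
      then obtain a b where ab: "a \<in> span21 t" "u = fcnj a" "b \<in> span21 t" "v = fcnj b" by blast
      show "u + v \<in> fcnj ` span21 t" unfolding ab c(1)[symmetric] by (rule imageI[OF fsub_add[OF fsub_span(2) ab(1,3)]])
    next
      fix k u assume "u \<in> fcnj ` span21 t"
      then obtain a where a: "a \<in> span21 t" "u = fcnj a" by blast
      have "k \<cdot> u = fcnj (cnj k \<cdot> a)" unfolding a(2) c(2)[symmetric] by simp
      then show "k \<cdot> u \<in> fcnj ` span21 t" using fsub_scale[OF fsub_span(2) a(1)] by blast
    qed
  qed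
  have "H12_gamma t = (quotient_space {u \<in> pq_forms t 1 2. delbar t 1 2 u = 0} (delbar_boundaries t 1 2))\<lparr>carrier := cohom_class (delbar_boundaries t 1 2) ` (fcnj ` span21 t)\<rparr>"
    using H12_carrier' by (simp add: H12_gamma_def H_Dolb_def Dolb_class_def[abs_def] image_image)
  then show "Module.module complex_field (H12_gamma t)" using module_of_classes[OF fsub_Dolb(2) f] by simp
qed

lemma class_ops:
  "dR_class 3 a \<oplus>\<^bsub>H_dR 3\<^esub> dR_class 3 b = dR_class 3 (a + b)" "c \<odot>\<^bsub>H_dR 3\<^esub> dR_class 3 a = dR_class 3 (c \<cdot> a)"
  "Dolb_class t p q a \<oplus>\<^bsub>H_Dolb t p q\<^esub> Dolb_class t p q b = Dolb_class t p q (a + b)"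
  "c \<odot>\<^bsub>H_Dolb t p q\<^esub> Dolb_class t p q a = Dolb_class t p q (c \<cdot> a)"
  "Dolb_class t 2 1 a \<oplus>\<^bsub>H21_gamma t\<^esub> Dolb_class t 2 1 b = Dolb_class t 2 1 (a + b)"
  "c \<odot>\<^bsub>H21_gamma t\<^esub> Dolb_class t 2 1 a = Dolb_class t 2 1 (c \<cdot> a)"
  "Dolb_class t 1 2 a \<oplus>\<^bsub>H12_gamma t\<^esub> Dolb_class t 1 2 b = Dolb_class t 1 2 (a + b)"
  "c \<odot>\<^bsub>H12_gamma t\<^esub> Dolb_class t 1 2 a = Dolb_class t 1 2 (c \<cdot> a)"
  by (simp_all add: H_dR_def dR_class_def H_Dolb_def Dolb_class_def H21_gamma_def H12_gamma_def
      quotient_add[OF fsub_dR(2)] quotient_smult[OF fsub_dR(2)] quotient_add[OF fsub_Dolb(2)] quotient_smult[OF fsub_Dolb(2)])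

text \<open>The second copy is phrased with \<open>Suc 0\<close>, the form to which the simplifier
  rewrites the natural number 1.\<close>

lemmas class_simps = class_ops class_ops[unfolded One_nat_def]

lemma fcnj_add: "fcnj (u + v) = fcnj u + fcnj v"
  by (simp add: fcnj_def fun_eq_iff cnj_ext_add)

lemma fcnj_scale: "fcnj (c \<cdot> u) = cnj c \<cdot> fcnj u"
  by (simp add: fcnj_def fscale_def fun_eq_iff cnj_ext_scale)

lemma bij_product:
  assumes "bij_betw f A A'" "bij_betw g C C'" "bij_betw h D D'" "bij_betw k E E'"
  shows "bij_betw (\<lambda>(u, v, w, s). (f u, g v, h w, k s)) (A \<times> C \<times> D \<times> E) (A' \<times> C' \<times> D' \<times> E')"
proof -
  have "(\<lambda>(u, v, w, s). (f u, g v, h w, k s)) = map_prod f (map_prod g (map_prod h k))"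
    by (auto simp: fun_eq_iff)
  then show ?thesis using assms by (simp add: bij_betw_map_prod)
qed

theorem Hodge_decomposition:
  "\<exists>\<Phi>. linear_iso (H_dR 3) (H_Dolb t 3 0 \<boxplus> H21_gamma t \<boxplus> H12_gamma t \<boxplus> H_Dolb t 0 3) \<Phi> \<and> canonical_Hodge_decomposition t \<Phi>"
proof -
  let ?W = "H_Dolb t 3 0 \<boxplus> H21_gamma t \<boxplus> H12_gamma t \<boxplus> H_Dolb t 0 3"
  have "\<exists>\<Phi>. linear_iso (H_dR 3) ?W \<Phi> \<and> graph_on (H_dR 3) \<Phi> = (\<lambda>x. (rdR x, rD x)) ` SS"
  proof (rule iso_from_representatives)
    show "Module.module complex_field (H_dR 3)" by (rule modules)
    show "Module.module complex_field ?W" by (intro module_direct_sum modules)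
    show "bij_betw rdR SS (carrier (H_dR 3))" by (rule bij_dR)
    show "bij_betw rD SS (carrier ?W)"
      using bij_product[OF bij_30 bij_21 bij_12 bij_03] by (simp add: rD_def SS_def direct_sum_def)
  next
    fix x y assume "x \<in> SS" "y \<in> SS"
    then obtain u v w s u' v' w' s' where x: "x = (u, v, w, s)" "u \<in> span30 t" "v \<in> span21 t" "w \<in> span21 t" "s \<in> span30 t"
      and y: "y = (u', v', w', s')" "u' \<in> span30 t" "v' \<in> span21 t" "w' \<in> span21 t" "s' \<in> span30 t"
      unfolding SS_def by blast
    show "\<exists>z\<in>SS. rdR z = rdR x \<oplus>\<^bsub>H_dR 3\<^esub> rdR y \<and> rD z = rD x \<oplus>\<^bsub>?W\<^esub> rD y"
    proof (intro bexI conjI)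
      show "(u + u', v + v', w + w', s + s') \<in> SS"
        unfolding SS_def by (intro SigmaI fsub_add fsub_span x y)
      show "rdR (u + u', v + v', w + w', s + s') = rdR x \<oplus>\<^bsub>H_dR 3\<^esub> rdR y"
        by (simp add: rdR_def x(1) y(1) class_simps fcnj_add add_ac)
      show "rD (u + u', v + v', w + w', s + s') = rD x \<oplus>\<^bsub>?W\<^esub> rD y"
        by (simp add: rD_def x(1) y(1) direct_sum_def class_simps fcnj_add)
    qed
  next
    fix c x assume "x \<in> SS"
    then obtain u v w s where x: "x = (u, v, w, s)" "u \<in> span30 t" "v \<in> span21 t" "w \<in> span21 t" "s \<in> span30 t"
      unfolding SS_def by blast
    show "\<exists>z\<in>SS. rdR z = c \<odot>\<^bsub>H_dR 3\<^esub> rdR x \<and> rD z = c \<odot>\<^bsub>?W\<^esub> rD x"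
    proof (intro bexI conjI)
      \<comment> \<open>The entries that are conjugated afterwards are scaled by the conjugate of c,
        so that all four components of both images are scaled by c.\<close>
      show "(c \<cdot> u, c \<cdot> v, cnj c \<cdot> w, cnj c \<cdot> s) \<in> SS"
        unfolding SS_def by (intro SigmaI fsub_scale fsub_span x)
      show "rdR (c \<cdot> u, c \<cdot> v, cnj c \<cdot> w, cnj c \<cdot> s) = c \<odot>\<^bsub>H_dR 3\<^esub> rdR x"
        by (simp add: rdR_def x(1) class_simps fcnj_scale fscale_simps)
      show "rD (c \<cdot> u, c \<cdot> v, cnj c \<cdot> w, cnj c \<cdot> s) = c \<odot>\<^bsub>?W\<^esub> rD x"
        by (simp add: rD_def x(1) direct_sum_def class_simps fcnj_scale)
    qed
  qed
  moreover have "(\<lambda>x. (rdR x, rD x)) ` SS = {(dR_class 3 (u + v + fcnj w + fcnj s),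
         (Dolb_class t 3 0 u, Dolb_class t 2 1 v, Dolb_class t 1 2 (fcnj w), Dolb_class t 0 3 (fcnj s))) | u v w s.
          u \<in> span30 t \<and> v \<in> span21 t \<and> w \<in> span21 t \<and> s \<in> span30 t}"
    unfolding SS_def rdR_def rD_def by force
  ultimately show ?thesis unfolding canonical_Hodge_decomposition_def by simp
qed

text \<open>The second parametrisation g is conjugate linear, so it becomes linear once the target
  is replaced by its conjugate space.\<close>

lemma symmetry:
  assumes V: "Module.module complex_field V" and W: "Module.module complex_field W" and S: "fsub S"
    and f: "bij_betw f S (carrier V)" and g: "bij_betw g S (carrier W)"
    and fo: "\<And>a b. f a \<oplus>\<^bsub>V\<^esub> f b = f (a + b)" "\<And>c a. c \<odot>\<^bsub>V\<^esub> f a = f (c \<cdot> a)"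
    and go: "\<And>a b. g a \<oplus>\<^bsub>W\<^esub> g b = g (a + b)" "\<And>c a. cnj c \<odot>\<^bsub>W\<^esub> g a = g (c \<cdot> a)"
  shows "\<exists>\<Psi>. linear_iso V (conj_space W) \<Psi> \<and> graph_on V \<Psi> = {(f u, g u) | u. u \<in> S}"
proof -
  have "\<exists>\<Psi>. linear_iso V (conj_space W) \<Psi> \<and> graph_on V \<Psi> = (\<lambda>x. (f x, g x)) ` S"
  proof (rule iso_from_representatives[OF V module_conj_space[OF W] f])
    show "bij_betw g S (carrier (conj_space W))" using g by (simp add: conj_space_def)
    show "\<exists>z\<in>S. f z = f x \<oplus>\<^bsub>V\<^esub> f y \<and> g z = g x \<oplus>\<^bsub>conj_space W\<^esub> g y" if "x \<in> S" "y \<in> S" for x y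
      using fsub_add[OF S that] by (intro bexI[of _ "x + y"]) (simp_all add: conj_space_def fo go)
    show "\<exists>z\<in>S. f z = c \<odot>\<^bsub>V\<^esub> f x \<and> g z = c \<odot>\<^bsub>conj_space W\<^esub> g x" if "x \<in> S" for c x
      using fsub_scale[OF S that, of c] by (intro bexI[of _ "c \<cdot> x"]) (simp_all add: conj_space_def fo go)
  qed
  moreover have "(\<lambda>x. (f x, g x)) ` S = {(f u, g u) | u. u \<in> S}" by blast
  ultimately show ?thesis by simp
qed

theorem Hodge_symmetries:
  "\<exists>\<Psi>. linear_iso (H_Dolb t 3 0) (conj_space (H_Dolb t 0 3)) \<Psi> \<and> canonical_symmetry_30 t \<Psi>"
  "\<exists>\<Psi>. linear_iso (H21_gamma t) (conj_space (H12_gamma t)) \<Psi> \<and> canonical_symmetry_21 t \<Psi>"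
proof -
  show "\<exists>\<Psi>. linear_iso (H_Dolb t 3 0) (conj_space (H_Dolb t 0 3)) \<Psi> \<and> canonical_symmetry_30 t \<Psi>"
    unfolding canonical_symmetry_30_def
    by (rule symmetry[OF modules(2) modules(2) fsub_span(1) bij_30 bij_03]) (simp_all add: class_simps fcnj_add fcnj_scale)
  show "\<exists>\<Psi>. linear_iso (H21_gamma t) (conj_space (H12_gamma t)) \<Psi> \<and> canonical_symmetry_21 t \<Psi>"
    unfolding canonical_symmetry_21_def
    by (rule symmetry[OF modules(3) modules(4) fsub_span(2) bij_21 bij_12]) (simp_all add: class_simps fcnj_add fcnj_scale)
qed

end

theorem proposition1p3:
  shows "\<exists>\<epsilon>>0. \<forall>t\<in>Delta_gamma \<epsilon>.
    (\<exists>\<Phi>. linear_iso (H_dR 3) (H_Dolb t 3 0 \<boxplus> H21_gamma t \<boxplus> H12_gamma t \<boxplus> H_Dolb t 0 3) \<Phi> \<and>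
         canonical_Hodge_decomposition t \<Phi>) \<and>
    (\<exists>\<Psi>. linear_iso (H_Dolb t 3 0) (conj_space (H_Dolb t 0 3)) \<Psi> \<and>
         canonical_symmetry_30 t \<Psi>) \<and>
    (\<exists>\<Psi>. linear_iso (H21_gamma t) (conj_space (H12_gamma t)) \<Psi> \<and>
         canonical_symmetry_21 t \<Psi>)"
proof -
  \<comment> \<open>The closeness 1/100 is the one required by \<open>tframe\<close>; by continuity
    at t = 0 it holds on a ball.\<close>
  obtain \<epsilon> where e: "\<epsilon> > 0" "\<forall>t\<in>ball 0 \<epsilon>. (\<forall>u. norm (Lam (th t) u - u) \<le> 1/100 * norm u) \<and> norm (D_param t) \<le> 1/100"
    using th_near[of "1/100"] by auto
  have "tframe t" if "t \<in> Delta_gamma \<epsilon>" for t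
    using e(2) that by (auto simp: Delta_gamma_def tframe_def)
  then show ?thesis using e(1) tframe.Hodge_decomposition tframe.Hodge_symmetries by blast
qed

end
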